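(* Assume $R\in\mathbb S^m_{++}$, $Q-S^\top R^{-1}S\in\mathbb S^n_{++}$, $Q+\bar Q-S^\top R^{-1}S\in\mathbb S^n_{++}$; that the systems $[A+\bar A,\Gamma+\bar\Gamma;B]$ and $[A,C,\Gamma;B,D]$ are $L^2$-stabilizable (defined in the context); and that $\boldsymbol\xi=(\xi^1,\dots,\xi^N)$ are i.i.d. $\mathbb R^n$-valued random variables with common law $\mu_0\in\mathcal P_4(\mathbb R^n)$, independent of $(W^0,W^1,\dots,W^N)$. Let $\mathbf u_T=(u_T^{1,N},\dots,u_T^{N,N})$ be the optimal control of the $N$-agent social optimization problem on $[0,T]$. Let $\tilde{\mathbf u}_T=(\tilde u_T^1,\dots,\tilde u_T^N)$ be given by the finite-horizon mean field feedback $$\tilde u_T^i(t)=\Theta_T^*(t)\tilde X_T^i(t)+\big(\bar\Theta_T^*(t)-\Theta_T^*(t)\big)\tilde X_T^{(N)}(t)+\theta_T^*(t),\quad t\in[0,T],$$ where $(\tilde X_T^1,\dots,\tilde X_T^N)$ is the solution of the corresponding closed-loop $N$-agent system with $\tilde X_T^i(0)=\xi^i$, and $\tilde X_T^{(N)}=\frac1N\sum_{i=1}^N\tilde X_T^i$, and where $(\Theta_T^*,\bar\Theta_T^*,\theta_T^* )$ are defined in the context. Then there exist constants $N^*>0$ and $K>0$, independent of $T$ and $N$, such that for all $T>0$ and all $N>N^*$, $$\Big|\frac1N\sum_{i=1}^NJ_T^i(\boldsymbol\xi;\mathbf u_T(\cdot))-\frac1N\sum_{i=1}^NJ_T^i(\boldsymbol\xi;\tilde{\mathbf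 u}_T(\cdot))\Big|\le\frac{KT}N.$$
   Context: Notation. $\mathbb S^k,\mathbb S^k_+,\mathbb S^k_{++}$: real symmetric, positive semidefinite, positive definite $k\times k$ matrices; $\mathcal P_4(\mathbb R^n)$: probability measures with finite fourth moment. Fix $n,m\in\mathbb N^+$, $A,\bar A,C,\bar C,\Gamma,\bar\Gamma\in\mathbb R^{n\times n}$, $B,D\in\mathbb R^{n\times m}$, $Q,\bar Q\in\mathbb S^n$, $S\in\mathbb R^{m\times n}$, $R\in\mathbb S^m$, $b,\sigma,\gamma,q\in\mathbb R^n$, $r\in\mathbb R^m$. $N$-agent social optimization problem. $(\tilde\Omega,\tilde{\mathcal F},\tilde{\mathbb P})$ is a complete probability space carrying independent one-dimensional standard Brownian motions $W^0,W^1,\dots,W^N$ and an initial $\sigma$-algebra $\tilde{\mathcal F}_0$, independent of them, on which $\tilde{\mathbb P}$ is atomless; $\tilde{\mathbb F}$ is the complete right-continuous augmentation of the filtration generated by $W^0,\dots,W^N,\tilde{\mathcal F}_0$; the $\xi^i$ are $\tilde{\mathcal F}_0$-measurable. $\mathscr U_c[0,T]$: $\tilde{\mathbb F}$-progressively measurable $\mathbb R^m$-valued $u$ with $\tilde{\mathbb E}\int_0^T|u|^2dt<\infty$. State equations: $X^{i,N}(0)=\xi^i$, $$dX^{i,N}=\{AX^{i,N}+\bar AX^{(N)}+Bu^{i,N}+b\}dt+\{CX^{i,N}+\bar CX^{(N)}+Du^{i,N}+\sigma\}dW^i+\{\Gamma X^{i,N}+\bar\Gamma X^{(N)}+\gamma\}dW^0,$$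 $X^{(N)}=\frac1N\sum_iX^{i,N}$. Costs: $J_T^i(\boldsymbol\xi;\mathbf u)=\tilde{\mathbb E}\int_0^Tf(X^{i,N},X^{(N)},u^{i,N})dt$, $f(x,\bar x,u)=\langle Qx,x\rangle+2\langle Sx,u\rangle+\langle Ru,u\rangle+2\langle q,x\rangle+2\langle r,u\rangle+\langle\bar Q\bar x,\bar x\rangle$. The problem is to minimize $\frac1N\sum_iJ_T^i(\boldsymbol\xi;\mathbf u)$ over $\mathbf u\in(\mathscr U_c[0,T])^N$; under the hypotheses there is a unique minimizer $\mathbf u_T$. The closed-loop $N$-agent system for $\tilde{\mathbf u}_T$ is the state equations above with $u^{i,N}$ replaced by $\tilde u_T^i$. $L^2$-stabilizability ($W,W^0$ independent standard Brownian motions). $[A+\bar A,\Gamma+\bar\Gamma;B]$ is $L^2$-stabilizable if there is $\bar\Theta\in\mathbb R^{m\times n}$ such that for every $y\in\mathbb R^n$ the solution of $dY=(A+\bar A+B\bar\Theta)Y\,dt+(\Gamma+\bar\Gamma)Y\,dW^0$, $Y(0)=y$, satisfies $\mathbb E\int_0^\infty|Y|^2dt<\infty$. $[A,C,\Gamma;B,D]$ is $L^2$-stabilizable if there is $\Theta\in\mathbb R^{m\times n}$ such that for every initial state $\xi$ independent of $(W,W^0)$ with $\mathbb E|\xi|^4<\infty$ the solution of $dX=(A+B\Theta)X\,dt+(C+D\Theta)X\,dW+\Gamma X\,dW^0$, $X(0)=\xi$, satisfies $\mathbb E\int_0^\infty|X|^2dt<\infty$. Mean field feedback coefficients. $\hat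 A=A+\bar A$, $\hat C=C+\bar C$, $\hat\Gamma=\Gamma+\bar\Gamma$, $\hat Q=Q+\bar Q$; $\mathcal Q(P)=PA+A^\top P+C^\top PC+\Gamma^\top P\Gamma+Q$; $\hat{\mathcal Q}(P,\bar\Pi)=\bar\Pi\hat A+\hat A^\top\bar\Pi+\hat C^\top P\hat C+\hat\Gamma^\top\bar\Pi\hat\Gamma+\hat Q$; $\mathcal S(P)=B^\top P+D^\top PC+S$; $\hat{\mathcal S}(P,\bar\Pi)=B^\top\bar\Pi+D^\top P\hat C+S$; $\mathcal R(P)=R+D^\top PD$. $(P_T,\bar\Pi_T,p_T)$ is the unique solution on $[0,T]$ with $P_T,\bar\Pi_T\in\mathbb S^n_+$ and zero terminal values at $T$ of $\dot P_T+\mathcal Q(P_T)-\mathcal S(P_T)^\top\mathcal R(P_T)^{-1}\mathcal S(P_T)=0$, $\dot{\bar\Pi}_T+\hat{\mathcal Q}(P_T,\bar\Pi_T)-\hat{\mathcal S}(P_T,\bar\Pi_T)^\top\mathcal R(P_T)^{-1}\hat{\mathcal S}(P_T,\bar\Pi_T)=0$, $\dot p_T+(\hat A+B\bar\Theta_T^* )^\top p_T+(\hat C+D\bar\Theta_T^* )^\top P_T\sigma+(\bar\Theta_T^* )^\top r+\bar\Pi_Tb+\hat\Gamma^\top\bar\Pi_T\gamma+q=0$, where $\Theta_T^*=-\mathcal R(P_T)^{-1}\mathcal S(P_T)$, $\bar\Theta_T^*=-\mathcal R(P_T)^{-1}\hat{\mathcal S}(P_T,\bar\Pi_T)$, $\theta_T^*=-\mathcal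 R(P_T)^{-1}(B^\top p_T+D^\top P_T\sigma+r)$. *)

theory Defs
  imports "HOL-Probability.Probability"
begin

section \<open>Matrices\<close>

definition symmetric_matrix :: "real^'k^'k \<Rightarrow> bool" where
  "symmetric_matrix M \<longleftrightarrow> transpose M = M"

definition psd_matrix :: "real^'k^'k \<Rightarrow> bool" where
  "psd_matrix M \<longleftrightarrow> symmetric_matrix M \<and> (\<forall>x. 0 \<le> x \<bullet> (M *v x))"

definition pd_matrix :: "real^'k^'k \<Rightarrow> bool" where
  "pd_matrix M \<longleftrightarrow> symmetric_matrix M \<and> (\<forall>x. x \<noteq> 0 \<longrightarrow> 0 < x \<bullet> (M *v x))"


section \<open>Brownian motions and filtrations\<close>

text \<open>Time is of type \<^typ>\<open>real\<close>; only nonnegative times are ever constrained.\<close>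

definition standard_brownian_motion :: "'w measure \<Rightarrow> (real \<Rightarrow> 'w \<Rightarrow> real) \<Rightarrow> bool" where
  "standard_brownian_motion M W \<longleftrightarrow>
     (\<forall>t\<ge>0. W t \<in> borel_measurable M) \<and>
     (AE \<omega> in M. W 0 \<omega> = 0) \<and>
     (AE \<omega> in M. continuous_on {0..} (\<lambda>t. W t \<omega>)) \<and>
     (\<forall>s t. 0 \<le> s \<longrightarrow> s < t \<longrightarrow>
        distributed M lborel (\<lambda>\<omega>. W t \<omega> - W s \<omega>) (normal_density 0 (sqrt (t - s)))) \<and>
     (\<forall>\<tau>::nat \<Rightarrow> real. 0 \<le> \<tau> 0 \<longrightarrow> mono \<tau> \<longrightarrow>
        (\<forall>k. prob_space.indep_vars M (\<lambda>_. borel)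
               (\<lambda>l \<omega>. W (\<tau> (Suc l)) \<omega> - W (\<tau> l) \<omega>) {..<k}))"

text \<open>A complete probability space with Brownian motions \<open>W j\<close>, \<open>j \<in> J\<close>, and an initial
  sigma-algebra \<open>F0\<close>, all of them jointly independent. Sigma-algebras are represented by
  measures of which only the space and the measurable sets matter.\<close>

definition brownian_basis ::
    "'w measure \<Rightarrow> 'w measure \<Rightarrow> (nat \<Rightarrow> real \<Rightarrow> 'w \<Rightarrow> real) \<Rightarrow> nat set \<Rightarrow> bool" where
  "brownian_basis M F0 W J \<longleftrightarrow>
     prob_space M \<and> complete_measure M \<and>
     subalgebra M F0 \<and>
     (\<forall>j\<in>J. standard_brownian_motion M (W j)) \<and>
     prob_space.indep_sets M
       (case_option (sets F0)
          (\<lambda>j. sigma_sets (space M) (\<Union>t\<in>{0..}. sets (vimage_algebra (space M) (W j t) borel))))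
       (insert None (Some ` J))"

definition raw_filtration ::
    "'w measure \<Rightarrow> 'w measure \<Rightarrow> (nat \<Rightarrow> real \<Rightarrow> 'w \<Rightarrow> real) \<Rightarrow> nat set \<Rightarrow> real \<Rightarrow> 'w measure" where
  "raw_filtration M F0 W J t =
     sigma (space M)
       (sets F0 \<union> null_sets M \<union>
        (\<Union>j\<in>J. \<Union>s\<in>{0..t}. sets (vimage_algebra (space M) (W j s) borel)))"

text \<open>The complete right-continuous augmentation.\<close>

definition usual_filtration ::
    "'w measure \<Rightarrow> 'w measure \<Rightarrow> (nat \<Rightarrow> real \<Rightarrow> 'w \<Rightarrow> real) \<Rightarrow> nat set \<Rightarrow> real \<Rightarrow> 'w measure" where
  "usual_filtration M F0 W J t = sigma (space M) (\<Inter>s\<in>{t<..}. sets (raw_filtration M F0 W J s))"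

definition prog_measurable ::
    "(real \<Rightarrow> 'w measure) \<Rightarrow> real \<Rightarrow> (real \<Rightarrow> 'w \<Rightarrow> 'v::topological_space) \<Rightarrow> bool" where
  "prog_measurable F T u \<longleftrightarrow>
     (\<forall>t\<in>{0..T}. (\<lambda>(s, \<omega>). u s \<omega>) \<in> borel_measurable (restrict_space borel {0..t} \<Otimes>\<^sub>M F t))"

definition energy ::
    "'w measure \<Rightarrow> real set \<Rightarrow> (real \<Rightarrow> 'w \<Rightarrow> 'v::real_normed_vector) \<Rightarrow> ennreal" where
  "energy M I u = (\<integral>\<^sup>+\<omega>. (\<integral>\<^sup>+t\<in>I. ennreal ((norm (u t \<omega>))\<^sup>2) \<partial>lborel) \<partial>M)"


section \<open>Ito integral and stochastic differential equations\<close>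

text \<open>Simple processes $\sum_{l<k} \eta_l 1_{(\tau_l, \tau_{l+1}]}$ with bounded
  $\mathcal F_{\tau_l}$-measurable $\eta_l$.\<close>

definition simple_process ::
    "'w measure \<Rightarrow> (real \<Rightarrow> 'w measure) \<Rightarrow> nat \<Rightarrow> (nat \<Rightarrow> real) \<Rightarrow>
     (nat \<Rightarrow> 'w \<Rightarrow> 'v::real_normed_vector) \<Rightarrow> bool" where
  "simple_process M F k \<tau> \<eta> \<longleftrightarrow>
     0 \<le> \<tau> 0 \<and> mono \<tau> \<and>
     (\<forall>l<k. \<eta> l \<in> borel_measurable (F (\<tau> l)) \<and> bounded (\<eta> l ` space M))"

definition simple_value ::
    "nat \<Rightarrow> (nat \<Rightarrow> real) \<Rightarrow> (nat \<Rightarrow> 'w \<Rightarrow> 'v::real_normed_vector) \<Rightarrow> real \<Rightarrow> 'w \<Rightarrow> 'v" where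
  "simple_value k \<tau> \<eta> s \<omega> = (\<Sum>l<k. indicator {\<tau> l<..\<tau> (Suc l)} s *\<^sub>R \<eta> l \<omega>)"

definition simple_integral ::
    "(real \<Rightarrow> 'w \<Rightarrow> real) \<Rightarrow> nat \<Rightarrow> (nat \<Rightarrow> real) \<Rightarrow> (nat \<Rightarrow> 'w \<Rightarrow> 'v::real_normed_vector) \<Rightarrow>
     real \<Rightarrow> 'w \<Rightarrow> 'v" where
  "simple_integral W k \<tau> \<eta> t \<omega> =
     (\<Sum>l<k. (W (min (\<tau> (Suc l)) t) \<omega> - W (min (\<tau> l) t) \<omega>) *\<^sub>R \<eta> l \<omega>)"

text \<open>\<open>Z\<close> is a version of $\int_0^t H\,dW$: the $L^2$-limit of the integrals of simple processes
  converging to \<open>H\<close> in $L^2([0,t]\times\Omega)$. By the Ito isometry \<open>Z\<close> is determined up to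
  almost sure equality.\<close>

definition has_ito_integral ::
    "'w measure \<Rightarrow> (real \<Rightarrow> 'w measure) \<Rightarrow> (real \<Rightarrow> 'w \<Rightarrow> real) \<Rightarrow> real \<Rightarrow>
     (real \<Rightarrow> 'w \<Rightarrow> 'v::real_normed_vector) \<Rightarrow> ('w \<Rightarrow> 'v) \<Rightarrow> bool" where
  "has_ito_integral M F W t H Z \<longleftrightarrow>
     Z \<in> borel_measurable M \<and>
     (\<exists>k \<tau> \<eta>. (\<forall>j. simple_process M F (k j) (\<tau> j) (\<eta> j)) \<and>
        ((\<lambda>j. energy M {0..t} (\<lambda>s \<omega>. H s \<omega> - simple_value (k j) (\<tau> j) (\<eta> j) s \<omega>))
           \<longlonglongrightarrow> 0) \<and>
        ((\<lambda>j. \<integral>\<^sup>+\<omega>. ennreal ((norm (Z \<omega> - simple_integral W (k j) (\<tau> j) (\<eta> j) t \<omega>))\<^sup>2) \<partial>M)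
           \<longlonglongrightarrow> 0))"

text \<open>\<open>X\<close> solves $dX = \beta\,dt + \sum_{j\in J} \sigma_j\,dW^j$, $X(0)=\xi$ on $[0,T]$, in the
  usual square-integrable class in which linear equations are uniquely solvable. The processes
  \<open>\<beta>\<close> and \<open>\<sigma> j\<close> will depend on \<open>X\<close>.\<close>

definition solves_sde ::
    "'w measure \<Rightarrow> (real \<Rightarrow> 'w measure) \<Rightarrow> (nat \<Rightarrow> real \<Rightarrow> 'w \<Rightarrow> real) \<Rightarrow> nat set \<Rightarrow> real \<Rightarrow>
     ('w \<Rightarrow> real^'n) \<Rightarrow> (real \<Rightarrow> 'w \<Rightarrow> real^'n) \<Rightarrow> (nat \<Rightarrow> real \<Rightarrow> 'w \<Rightarrow> real^'n) \<Rightarrow>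
     (real \<Rightarrow> 'w \<Rightarrow> real^'n) \<Rightarrow> bool" where
  "solves_sde M F W J T \<xi> \<beta> \<sigma> X \<longleftrightarrow>
     prog_measurable F T X \<and> energy M {0..T} X < \<infinity> \<and>
     (AE \<omega> in M. continuous_on {0..T} (\<lambda>t. X t \<omega>)) \<and>
     (\<forall>t\<in>{0..T}. \<exists>Z. (\<forall>j\<in>J. has_ito_integral M F (W j) t (\<sigma> j) (Z j)) \<and>
        (AE \<omega> in M. X t \<omega> = \<xi> \<omega> + (LINT s:{0..t}|lborel. \<beta> s \<omega>) + (\<Sum>j\<in>J. Z j \<omega>)))"


section \<open>\<open>L\<^sup>2\<close>-stabilizability\<close>

text \<open>The argument of type \<^typ>\<open>'w itself\<close> only fixes the type on which the probability
  spaces live. \<open>W 0\<close> is the common noise $W^0$ and \<open>W 1\<close> is $W$. The filtration is generated by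
  the initial state and the Brownian motions; \<^const>\<open>brownian_basis\<close> contains the independence
  of the initial state from the noise.\<close>

definition L2_stabilizable_common ::
    "'w itself \<Rightarrow> real^'n^'n \<Rightarrow> real^'n^'n \<Rightarrow> real^'m^'n \<Rightarrow> bool" where
  "L2_stabilizable_common _ A \<Gamma> B \<longleftrightarrow>
     (\<exists>\<Theta> :: real^'n^'m. \<forall>(M :: 'w measure) W y Y.
        (let F0 = vimage_algebra (space M) (\<lambda>_. y) (borel :: (real^'n) measure);
             F = usual_filtration M F0 W {0, 1} in
         brownian_basis M F0 W {0, 1} \<longrightarrow>
         (\<forall>T>0. solves_sde M F W {0} T (\<lambda>_. y)
                  (\<lambda>t \<omega>. (A + B ** \<Theta>) *v Y t \<omega>) (\<lambda>_ t \<omega>. \<Gamma> *v Y t \<omega>) Y) \<longrightarrow>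
         energy M {0..} Y < \<infinity>))"

definition L2_stabilizable ::
    "'w itself \<Rightarrow> real^'n^'n \<Rightarrow> real^'n^'n \<Rightarrow> real^'n^'n \<Rightarrow> real^'m^'n \<Rightarrow> real^'m^'n \<Rightarrow> bool" where
  "L2_stabilizable _ A C \<Gamma> B D \<longleftrightarrow>
     (\<exists>\<Theta> :: real^'n^'m. \<forall>(M :: 'w measure) W \<xi> X.
        (let F0 = vimage_algebra (space M) \<xi> (borel :: (real^'n) measure);
             F = usual_filtration M F0 W {0, 1} in
         brownian_basis M F0 W {0, 1} \<longrightarrow>
         (\<integral>\<^sup>+\<omega>. ennreal ((norm (\<xi> \<omega>)) ^ 4) \<partial>M) < \<infinity> \<longrightarrow>
         (\<forall>T>0. solves_sde M F W {0, 1} T \<xi>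
                  (\<lambda>t \<omega>. (A + B ** \<Theta>) *v X t \<omega>)
                  (\<lambda>j t \<omega>. (if j = 0 then \<Gamma> else C + D ** \<Theta>) *v X t \<omega>) X) \<longrightarrow>
         energy M {0..} X < \<infinity>))"


section \<open>The \<open>N\<close>-agent social optimization problem\<close>

record ('n, 'm) lq_data =
  mA :: "real^'n^'n"
  mAbar :: "real^'n^'n"
  mC :: "real^'n^'n"
  mCbar :: "real^'n^'n"
  mG :: "real^'n^'n"
  mGbar :: "real^'n^'n"
  mB :: "real^'m^'n"
  mD :: "real^'m^'n"
  mQ :: "real^'n^'n"
  mQbar :: "real^'n^'n"
  mS :: "real^'n^'m"
  mR :: "real^'m^'m"
  vb :: "real^'n"
  vsig :: "real^'n"
  vgam :: "real^'n"
  vq :: "real^'n"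
  vr :: "real^'m"

text \<open>\<open>mG\<close>, \<open>mGbar\<close>, \<open>vsig\<close>, \<open>vgam\<close> are $\Gamma$, $\bar\Gamma$, $\sigma$, $\gamma$. Agents are numbered
  $1,\dots,N$, and \<open>W 0\<close> is the common noise.\<close>

definition agent_setup ::
    "'w measure \<Rightarrow> 'w measure \<Rightarrow> (nat \<Rightarrow> real \<Rightarrow> 'w \<Rightarrow> real) \<Rightarrow> nat \<Rightarrow> (real^'n) measure \<Rightarrow>
     (nat \<Rightarrow> 'w \<Rightarrow> real^'n) \<Rightarrow> bool" where
  "agent_setup M F0 W N \<mu>\<^sub>0 \<xi> \<longleftrightarrow>
     brownian_basis M F0 W {0..N} \<and>
     (\<forall>E\<in>sets F0. 0 < measure M E \<longrightarrow>
        (\<exists>E'\<in>sets F0. E' \<subseteq> E \<and> 0 < measure M E' \<and> measure M E' < measure M E)) \<and>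
     (\<forall>i\<in>{1..N}. \<xi> i \<in> borel_measurable F0 \<and> distr M borel (\<xi> i) = \<mu>\<^sub>0) \<and>
     prob_space.indep_vars M (\<lambda>_. borel) \<xi> {1..N}"

abbreviation agent_filtration ::
    "'w measure \<Rightarrow> 'w measure \<Rightarrow> (nat \<Rightarrow> real \<Rightarrow> 'w \<Rightarrow> real) \<Rightarrow> nat \<Rightarrow> real \<Rightarrow> 'w measure" where
  "agent_filtration M F0 W N \<equiv> usual_filtration M F0 W {0..N}"

definition agent_mean ::
    "nat \<Rightarrow> (nat \<Rightarrow> real \<Rightarrow> 'w \<Rightarrow> real^'n) \<Rightarrow> real \<Rightarrow> 'w \<Rightarrow> real^'n" where
  "agent_mean N X t \<omega> = (1 / real N) *\<^sub>R (\<Sum>i=1..N. X i t \<omega>)"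

definition admissible ::
    "'w measure \<Rightarrow> (real \<Rightarrow> 'w measure) \<Rightarrow> real \<Rightarrow> nat \<Rightarrow> (nat \<Rightarrow> real \<Rightarrow> 'w \<Rightarrow> real^'m) \<Rightarrow> bool" where
  "admissible M F T N u \<longleftrightarrow>
     (\<forall>i\<in>{1..N}. prog_measurable F T (u i) \<and> energy M {0..T} (u i) < \<infinity>)"

definition state_system ::
    "('n::finite, 'm::finite) lq_data \<Rightarrow> 'w measure \<Rightarrow> (real \<Rightarrow> 'w measure) \<Rightarrow> (nat \<Rightarrow> real \<Rightarrow> 'w \<Rightarrow> real) \<Rightarrow>
     real \<Rightarrow> nat \<Rightarrow> (nat \<Rightarrow> 'w \<Rightarrow> real^'n) \<Rightarrow> (nat \<Rightarrow> real \<Rightarrow> 'w \<Rightarrow> real^'m) \<Rightarrow>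
     (nat \<Rightarrow> real \<Rightarrow> 'w \<Rightarrow> real^'n) \<Rightarrow> bool" where
  "state_system d M F W T N \<xi> u X \<longleftrightarrow>
     (\<forall>i\<in>{1..N}. solves_sde M F W {0, i} T (\<xi> i)
        (\<lambda>t \<omega>. mA d *v X i t \<omega> + mAbar d *v agent_mean N X t \<omega> + mB d *v u i t \<omega> + vb d)
        (\<lambda>j t \<omega>. if j = 0
           then mG d *v X i t \<omega> + mGbar d *v agent_mean N X t \<omega> + vgam d
           else mC d *v X i t \<omega> + mCbar d *v agent_mean N X t \<omega> + mD d *v u i t \<omega> + vsig d)
        (X i))"

definition running_cost ::
    "('n::finite, 'm::finite) lq_data \<Rightarrow> real^'n \<Rightarrow> real^'n \<Rightarrow> real^'m \<Rightarrow> real" where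
  "running_cost d x xbar u =
     (mQ d *v x) \<bullet> x + 2 * ((mS d *v x) \<bullet> u) + (mR d *v u) \<bullet> u
     + 2 * (vq d \<bullet> x) + 2 * (vr d \<bullet> u) + (mQbar d *v xbar) \<bullet> xbar"

text \<open>The costs $J_T^i(\xi;u)$ take both the controls and the corresponding states as arguments;
  the latter are determined by the former up to indistinguishability.\<close>

definition agent_cost ::
    "('n::finite, 'm::finite) lq_data \<Rightarrow> 'w measure \<Rightarrow> real \<Rightarrow> nat \<Rightarrow> (nat \<Rightarrow> real \<Rightarrow> 'w \<Rightarrow> real^'n) \<Rightarrow>
     (nat \<Rightarrow> real \<Rightarrow> 'w \<Rightarrow> real^'m) \<Rightarrow> nat \<Rightarrow> real" where
  "agent_cost d M T N X u i =
     (LINT \<omega>|M. (LINT t:{0..T}|lborel. running_cost d (X i t \<omega>) (agent_mean N X t \<omega>) (u i t \<omega>)))"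

definition social_cost ::
    "('n::finite, 'm::finite) lq_data \<Rightarrow> 'w measure \<Rightarrow> real \<Rightarrow> nat \<Rightarrow> (nat \<Rightarrow> real \<Rightarrow> 'w \<Rightarrow> real^'n) \<Rightarrow>
     (nat \<Rightarrow> real \<Rightarrow> 'w \<Rightarrow> real^'m) \<Rightarrow> real" where
  "social_cost d M T N X u = (1 / real N) * (\<Sum>i=1..N. agent_cost d M T N X u i)"

definition optimal_control ::
    "('n::finite, 'm::finite) lq_data \<Rightarrow> 'w measure \<Rightarrow> (real \<Rightarrow> 'w measure) \<Rightarrow> (nat \<Rightarrow> real \<Rightarrow> 'w \<Rightarrow> real) \<Rightarrow>
     real \<Rightarrow> nat \<Rightarrow> (nat \<Rightarrow> 'w \<Rightarrow> real^'n) \<Rightarrow> (nat \<Rightarrow> real \<Rightarrow> 'w \<Rightarrow> real^'m) \<Rightarrow> bool" where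
  "optimal_control d M F W T N \<xi> u \<longleftrightarrow>
     admissible M F T N u \<and>
     (\<forall>X v Y. state_system d M F W T N \<xi> u X \<longrightarrow>
        admissible M F T N v \<longrightarrow> state_system d M F W T N \<xi> v Y \<longrightarrow>
        social_cost d M T N X u \<le> social_cost d M T N Y v)"


section \<open>Mean field feedback coefficients\<close>

abbreviation "hA d \<equiv> mA d + mAbar d"
abbreviation "hC d \<equiv> mC d + mCbar d"
abbreviation "hG d \<equiv> mG d + mGbar d"
abbreviation "hQ d \<equiv> mQ d + mQbar d"

definition opQ :: "('n::finite, 'm::finite) lq_data \<Rightarrow> real^'n^'n \<Rightarrow> real^'n^'n" where
  "opQ d P = P ** mA d + transpose (mA d) ** P + transpose (mC d) ** P ** mC d
     + transpose (mG d) ** P ** mG d + mQ d"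

definition op_hatQ :: "('n::finite, 'm::finite) lq_data \<Rightarrow> real^'n^'n \<Rightarrow> real^'n^'n \<Rightarrow> real^'n^'n" where
  "op_hatQ d P \<Pi>b = \<Pi>b ** hA d + transpose (hA d) ** \<Pi>b + transpose (hC d) ** P ** hC d
     + transpose (hG d) ** \<Pi>b ** hG d + hQ d"

definition opS :: "('n::finite, 'm::finite) lq_data \<Rightarrow> real^'n^'n \<Rightarrow> real^'n^'m" where
  "opS d P = transpose (mB d) ** P + transpose (mD d) ** P ** mC d + mS d"

definition op_hatS :: "('n::finite, 'm::finite) lq_data \<Rightarrow> real^'n^'n \<Rightarrow> real^'n^'n \<Rightarrow> real^'n^'m" where
  "op_hatS d P \<Pi>b = transpose (mB d) ** \<Pi>b + transpose (mD d) ** P ** hC d + mS d"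

definition opR :: "('n::finite, 'm::finite) lq_data \<Rightarrow> real^'n^'n \<Rightarrow> real^'m^'m" where
  "opR d P = mR d + transpose (mD d) ** P ** mD d"

definition fb_Theta :: "('n::finite, 'm::finite) lq_data \<Rightarrow> real^'n^'n \<Rightarrow> real^'n^'m" where
  "fb_Theta d P = - (matrix_inv (opR d P) ** opS d P)"

definition fb_Theta_bar :: "('n::finite, 'm::finite) lq_data \<Rightarrow> real^'n^'n \<Rightarrow> real^'n^'n \<Rightarrow> real^'n^'m" where
  "fb_Theta_bar d P \<Pi>b = - (matrix_inv (opR d P) ** op_hatS d P \<Pi>b)"

definition fb_theta :: "('n::finite, 'm::finite) lq_data \<Rightarrow> real^'n^'n \<Rightarrow> real^'n \<Rightarrow> real^'m" where
  "fb_theta d P p =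
     - (matrix_inv (opR d P) *v (transpose (mB d) *v p + transpose (mD d) *v (P *v vsig d) + vr d))"

definition riccati_system ::
    "('n::finite, 'm::finite) lq_data \<Rightarrow> real \<Rightarrow> (real \<Rightarrow> real^'n^'n) \<Rightarrow> (real \<Rightarrow> real^'n^'n) \<Rightarrow> (real \<Rightarrow> real^'n) \<Rightarrow> bool"
  where
  "riccati_system d T P \<Pi>b p \<longleftrightarrow>
     P T = 0 \<and> \<Pi>b T = 0 \<and> p T = 0 \<and>
     (\<forall>t\<in>{0..T}. psd_matrix (P t) \<and> psd_matrix (\<Pi>b t) \<and>
       (\<exists>P' \<Pi>b' p'.
          (P has_vector_derivative P') (at t within {0..T}) \<and>
          (\<Pi>b has_vector_derivative \<Pi>b') (at t within {0..T}) \<and>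
          (p has_vector_derivative p') (at t within {0..T}) \<and>
          P' + opQ d (P t)
             - transpose (opS d (P t)) ** matrix_inv (opR d (P t)) ** opS d (P t) = 0 \<and>
          \<Pi>b' + op_hatQ d (P t) (\<Pi>b t)
             - transpose (op_hatS d (P t) (\<Pi>b t)) ** matrix_inv (opR d (P t))
               ** op_hatS d (P t) (\<Pi>b t) = 0 \<and>
          p' + transpose (hA d + mB d ** fb_Theta_bar d (P t) (\<Pi>b t)) *v p t
             + transpose (hC d + mD d ** fb_Theta_bar d (P t) (\<Pi>b t)) *v (P t *v vsig d)
             + transpose (fb_Theta_bar d (P t) (\<Pi>b t)) *v vr d
             + \<Pi>b t *v vb d + transpose (hG d) *v (\<Pi>b t *v vgam d) + vq d = 0))"

definition mean_field_feedback ::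
    "('n::finite, 'm::finite) lq_data \<Rightarrow> nat \<Rightarrow> (real \<Rightarrow> real^'n^'n) \<Rightarrow> (real \<Rightarrow> real^'n^'n) \<Rightarrow> (real \<Rightarrow> real^'n) \<Rightarrow>
     (nat \<Rightarrow> real \<Rightarrow> 'w \<Rightarrow> real^'n) \<Rightarrow> nat \<Rightarrow> real \<Rightarrow> 'w \<Rightarrow> real^'m" where
  "mean_field_feedback d N P \<Pi>b p X i t \<omega> =
     fb_Theta d (P t) *v X i t \<omega>
     + (fb_Theta_bar d (P t) (\<Pi>b t) - fb_Theta d (P t)) *v agent_mean N X t \<omega>
     + fb_theta d (P t) (p t)"

end

theory Submission
  imports Defs
begin

text \<open>Take the expectation of
  \<open>V(t) = 1/N \<Sum>\<^sub>i \<langle>P X\<^sub>i, X\<^sub>i\<rangle> + \<langle>(L - P) X\<^sub>m, X\<^sub>m\<rangle> + 2 \<langle>p, X\<^sub>m\<rangle>\<close> along the agents, where \<open>X\<^sub>m\<close> is their mean and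
  \<open>L\<close> is $\bar\Pi_T$. The Riccati equations complete the squares: the social cost of a control \<open>u\<close> is \<open>V(0)\<close>, plus an integral
  not depending on \<open>u\<close>, plus the expected integral of the average of \<open>\<langle>R(P) w\<^sub>i, w\<^sub>i\<rangle> + 1/N \<langle>(L - P) h\<^sub>i, h\<^sub>i\<rangle>\<close>, where
  \<open>w\<^sub>i\<close> is the gap between \<open>u\<^sub>i\<close> and the mean field feedback and \<open>h\<^sub>i\<close> is the coefficient of \<open>W\<^sup>i\<close>. For the feedback
  the squares vanish, so by optimality the two costs differ only by the terms with \<open>h\<^sub>i\<close>; coercivity bounds these by
  \<open>1/N\<close> times the cost, hence by \<open>O(T/N)\<close>, as soon as \<open>(P, L, p)\<close> is bounded independently of \<open>T\<close>. The bounds on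
  \<open>P\<close> and \<open>L\<close> come from the energy of the states stabilized by a constant feedback, which exist by Picard iteration, and
  the bound on \<open>p\<close> from a Lyapunov function.\<close>

section \<open>Square-integrable functions\<close>

text \<open>Stabilizability only says that every process solving the stabilized equation has finite
  energy; it does not produce a process. Solutions with continuous adapted paths must therefore be
  constructed, which is why Ito integrals and a maximal inequality are developed. The Riccati
  functions are deterministic, so the energies can be read off one fixed space, and the bounds then
  hold for all \<open>T\<close>, \<open>N\<close> and all other spaces. Only expectations of
  products of Ito processes are differentiated; no localization and no pathwise Ito formula occur.
  The factor 1/N stems from the independence of the \<open>W i\<close>: in the quadratic variation
  of the mean the own noises survive only on the diagonal, N of N^2 pairs. The factor T, for small T
  as well, stems from the zero terminal values: with bounded right-hand sides, \<open>P\<close>,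
  \<open>L\<close>, \<open>p\<close> are O(T) at time 0. The lower bound on N serves to absorb: the
  terms with h are at most D/N times the cost shifted by a multiple of T, and D/N \<le> 1/2 turns
  this into an a priori O(T) bound on that cost, which is then inserted a second time.\<close>

abbreviation sqn :: "'a measure => ('a => 'v::real_normed_vector) => ennreal" where
 "sqn M f \<equiv> \<integral>\<^sup>+x. ennreal ((norm (f x))^2) \<partial>M"

definition L2_fun :: "'a measure => ('a => 'v::euclidean_space) => bool" where
 "L2_fun M f \<longleftrightarrow> f : borel_measurable M \<and> integrable M (%x. (norm (f x))\<^sup>2)"

lemma L2_fun_measurable[measurable_dest]: "L2_fun M f ==> f : borel_measurable M"
 by (simp add: L2_fun_def)

lemma L2_fun_integrable: "L2_fun M f ==> integrable M (%x. (norm (f x))\<^sup>2)"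
 by (simp add: L2_fun_def)

lemma L2_fun_iff:
 "L2_fun M f \<longleftrightarrow> f : borel_measurable M \<and> sqn M f < \<infinity>"
 unfolding L2_fun_def integrable_iff_bounded by (auto simp: power_abs)

lemma L2_fun_nn_integral:
 "L2_fun M f ==> sqn M f = ennreal (\<integral>x. (norm (f x))\<^sup>2 \<partial>M)"
 by (rule nn_integral_eq_integral) (auto simp: L2_fun_integrable)

lemma norm_add_square_le:
 fixes a b :: "'v::real_normed_vector"
 shows "(norm (a + b))^2 <= 2 * (norm a)^2 + 2 * (norm b)^2"
proof -
 have "(norm (a + b))^2 <= (norm a + norm b)^2"
  by (intro power_mono norm_triangle_ineq) auto
 also have "... <= 2 * (norm a)^2 + 2 * (norm b)^2"
  using sum_squares_bound[of "norm a" "norm b"] by (simp add: power2_sum)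
 finally show ?thesis .
qed

lemma L2_fun_bound:
 assumes "L2_fun M g" "f : borel_measurable M" "!!x. x : space M ==> norm (f x) <= c * norm (g x)"
 shows "L2_fun M f"
 unfolding L2_fun_def
proof (intro conjI assms)
 have "integrable M (%x. c\<^sup>2 * (norm (g x))^2)" using L2_fun_integrable[OF assms(1)] by auto
 then show "integrable M (%x. (norm (f x))\<^sup>2)"
 proof (rule Bochner_Integration.integrable_bound)
  show "(%x. (norm (f x))\<^sup>2) : borel_measurable M" using assms(2) by measurable
  show "AE x in M. norm ((norm (f x))^2) <= norm (c\<^sup>2 * (norm (g x))^2)"
  proof (rule AE_I2)
   fix x assume "x : space M"
   then have "(norm (f x))^2 <= (c * norm (g x))^2" by (intro power_mono assms) auto
   then show "norm ((norm (f x))^2) <= norm (c\<^sup>2 * (norm (g x))^2)"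
    by (simp add: power_mult_distrib)
  qed
 qed
qed

lemma L2_fun_add: "L2_fun M f ==> L2_fun M g ==> L2_fun M (%x. f x + g x)"
 unfolding L2_fun_def
proof (intro conjI)
 assume a: "f : borel_measurable M \<and> integrable M (%x. (norm (f x))\<^sup>2)"
   "g : borel_measurable M \<and> integrable M (%x. (norm (g x))\<^sup>2)"
 then show m: "(%x. f x + g x) : borel_measurable M" by auto
 have "integrable M (%x. 2 * (norm (f x))^2 + 2 * (norm (g x))^2)" using a by auto
 then show "integrable M (%x. (norm (f x + g x))\<^sup>2)"
  by (rule Bochner_Integration.integrable_bound) (use m in \<open>auto intro!: AE_I2 order_trans[OF norm_add_square_le]\<close>)
qed

lemma L2_fun_zero: "L2_fun M (%x. 0)"
 by (simp add: L2_fun_def)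

lemma L2_fun_scaleR: "L2_fun M f ==> L2_fun M (%x. c *\<^sub>R f x)"
 by (rule L2_fun_bound[where c="\<bar>c\<bar>"]) (auto dest: L2_fun_measurable)

lemma L2_fun_diff: "L2_fun M f ==> L2_fun M g ==> L2_fun M (%x. f x - g x)"
 using L2_fun_add[of M f "%x. (-1) *\<^sub>R g x"] L2_fun_scaleR[of M g "-1"] by simp

lemma L2_fun_sum: "(!!i. i : I ==> L2_fun M (f i)) ==> L2_fun M (%x. \<Sum>i\<in>I. f i x)"
 by (induction I rule: infinite_finite_induct) (auto intro: L2_fun_add L2_fun_zero)

lemma L2_fun_linear:
 assumes "bounded_linear h" "L2_fun M f"
 shows "L2_fun M (%x. h (f x))"
proof -
 obtain K where K: "!!x. norm (h x) <= norm x * K" using bounded_linear.bounded[OF assms(1)] by blast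
 have [measurable]: "h : borel_measurable borel"
  by (intro borel_measurable_continuous_onI linear_continuous_on assms(1))
 show ?thesis
  by (rule L2_fun_bound[OF assms(2), where c=K]) (use K L2_fun_measurable[OF assms(2)] in \<open>auto simp: mult.commute\<close>)
qed

lemma L2_fun_const: "finite_measure M ==> L2_fun M (%x. c)"
 by (simp add: L2_fun_def finite_measure.integrable_const)

lemma L2_fun_bounded:
 assumes "finite_measure M" "f : borel_measurable M" "!!x. x : space M ==> norm (f x) <= c"
 shows "L2_fun M f"
 by (rule L2_fun_bound[OF L2_fun_const[OF assms(1), where c="1::real"], where c=c]) (use assms in auto)

lemma L2_fun_bounded_scaleR:
 fixes f :: "'a => 'v::euclidean_space"
 assumes "L2_fun M f" "g : borel_measurable M" "!!x. x : space M ==> \<bar>g x\<bar> <= c"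
 shows "L2_fun M (%x. g x *\<^sub>R f x)"
 by (rule L2_fun_bound[OF assms(1), where c=c])
  (use assms L2_fun_measurable[OF assms(1)] in \<open>auto intro!: mult_right_mono\<close>)

lemma L2_fun_AE_cong:
 assumes "L2_fun M f" "g : borel_measurable M" "AE x in M. f x = g x"
 shows "L2_fun M g"
 using assms unfolding L2_fun_def
 by (auto elim!: integrable_cong_AE_imp)

lemma L2_inner_integrable:
 assumes "L2_fun M f" "L2_fun M g"
 shows "integrable M (%x. f x \<bullet> g x)"
proof (rule Bochner_Integration.integrable_bound)
 show "integrable M (%x. (norm (f x))\<^sup>2 + (norm (g x))^2)" using assms by (auto simp: L2_fun_def)
 show "(%x. f x \<bullet> g x) : borel_measurable M" using assms by (auto simp: L2_fun_def)
 show "AE x in M. norm (f x \<bullet> g x) <= norm ((norm (f x))^2 + (norm (g x))^2)"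
 proof (rule AE_I2)
  fix x
  have "\<bar>f x \<bullet> g x\<bar> <= norm (f x) * norm (g x)" by (rule Cauchy_Schwarz_ineq2)
  also have "... <= (norm (f x))^2 + (norm (g x))^2"
   using sum_squares_bound[of "norm (f x)" "norm (g x)"]
    mult_nonneg_nonneg[OF norm_ge_zero[of "f x"] norm_ge_zero[of "g x"]]
   by linarith
  finally show "norm (f x \<bullet> g x) <= norm ((norm (f x))^2 + (norm (g x))^2)" by simp
 qed
qed

lemma L2_mult_integrable:
 fixes f g :: "'a => real"
 assumes "L2_fun M f" "L2_fun M g"
 shows "integrable M (%x. f x * g x)"
 using L2_inner_integrable[OF assms] by simp

lemma L2_integrable:
 fixes f :: "'a => real"
 assumes "finite_measure M" "L2_fun M f"
 shows "integrable M f"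
 using L2_mult_integrable[OF assms(2) L2_fun_const[OF assms(1), of 1]] by simp

lemma L2_Cauchy_Schwarz:
 assumes "L2_fun M f" "L2_fun M g"
 shows "\<bar>\<integral>x. f x \<bullet> g x \<partial>M\<bar> <= sqrt (\<integral>x. (norm (f x))\<^sup>2 \<partial>M) * sqrt (\<integral>x. (norm (g x))\<^sup>2 \<partial>M)"
proof -
 have m[measurable]: "f : borel_measurable M" "g : borel_measurable M"
  using assms by (auto simp: L2_fun_def)
 have int: "integrable M (%x. norm (f x) * norm (g x))"
  by (rule L2_mult_integrable)
   (use assms in \<open>auto simp: L2_fun_def\<close>)
 have n2: "ennreal (norm x) ^ 2 = ennreal ((norm x)^2)" for x :: 'b by (simp add: ennreal_power)
 have "(\<integral>\<^sup>+x. ennreal (norm (f x)) * ennreal (norm (g x)) \<partial>M)^2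
   <= (\<integral>\<^sup>+x. (ennreal (norm (f x)))\<^sup>2 \<partial>M) * (\<integral>\<^sup>+x. (ennreal (norm (g x)))\<^sup>2 \<partial>M)"
  by (rule Cauchy_Schwarz_nn_integral) auto
 also have "(\<integral>\<^sup>+x. ennreal (norm (f x)) * ennreal (norm (g x)) \<partial>M)
   = ennreal (\<integral>x. norm (f x) * norm (g x) \<partial>M)"
  using nn_integral_eq_integral[OF int] by (simp add: ennreal_mult'[symmetric])
 finally have "ennreal ((\<integral>x. norm (f x) * norm (g x) \<partial>M)^2)
   <= ennreal ((\<integral>x. (norm (f x))\<^sup>2 \<partial>M) * (\<integral>x. (norm (g x))\<^sup>2 \<partial>M))"
  by (simp add: n2 L2_fun_nn_integral[OF assms(1)] L2_fun_nn_integral[OF assms(2)]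
    ennreal_power ennreal_mult'[symmetric])
 then have 1: "(\<integral>x. norm (f x) * norm (g x) \<partial>M)^2 <= (\<integral>x. (norm (f x))\<^sup>2 \<partial>M) * (\<integral>x. (norm (g x))\<^sup>2 \<partial>M)"
  by (subst (asm) ennreal_le_iff) auto
 have "\<bar>\<integral>x. f x \<bullet> g x \<partial>M\<bar> <= (\<integral>x. \<bar>f x \<bullet> g x\<bar> \<partial>M)" by (rule integral_abs_bound)
 also have "... <= (\<integral>x. norm (f x) * norm (g x) \<partial>M)"
  by (intro integral_mono int integrable_abs L2_inner_integrable assms Cauchy_Schwarz_ineq2)
 also have "... <= sqrt ((\<integral>x. (norm (f x))\<^sup>2 \<partial>M) * (\<integral>x. (norm (g x))\<^sup>2 \<partial>M))"
  by (rule real_le_rsqrt) (rule 1)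
 finally show ?thesis by (simp add: real_sqrt_mult)
qed

text \<open>Written with \<open>sqn\<close> and as limit minus approximant, so that it unfolds to
  the second convergence clause of \<open>has_ito_integral\<close>; integrability of the limit need
  not be known beforehand.\<close>

definition L2_tendsto :: "'a measure => (nat => 'a => 'v::euclidean_space) => ('a => 'v) => bool" where
 "L2_tendsto M f l \<longleftrightarrow> (%n. sqn M (%x. l x - f n x)) \<longlonglongrightarrow> 0"

lemma nn_integral_square_add_le:
 assumes [measurable]: "f : borel_measurable M" "g : borel_measurable M"
 shows "sqn M (%x. f x + g x)
  <= 2 * sqn M f + 2 * sqn M (%x. g x :: 'v::euclidean_space)"
proof -
 have "sqn M (%x. f x + g x)
   <= (\<integral>\<^sup>+x. 2 * ennreal ((norm (f x))^2) + 2 * ennreal ((norm (g x))^2) \<partial>M)"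
 proof (rule nn_integral_mono)
  fix x
  have "ennreal ((norm (f x + g x))^2) <= ennreal (2 * (norm (f x))^2 + 2 * (norm (g x))^2)"
   by (intro ennreal_leI norm_add_square_le)
  then show "ennreal ((norm (f x + g x))^2) <= 2 * ennreal ((norm (f x))^2) + 2 * ennreal ((norm (g x))^2)"
   by (simp add: ennreal_mult'')
 qed
 also have "... = 2 * sqn M f + 2 * sqn M g"
  by (subst nn_integral_add) (auto simp: nn_integral_cmult)
 finally show ?thesis .
qed

text \<open>Finiteness is inherited from a single approximant: some \<open>f n\<close> has squared
  distance below 1 from \<open>l\<close>.\<close>

lemma L2_tendsto_L2:
 assumes lim: "L2_tendsto M f l" and f: "!!n. L2_fun M (f n)" and [measurable]: "l : borel_measurable M"
 shows "L2_fun M l"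
proof -
 have [measurable]: "f n : borel_measurable M" for n using f L2_fun_measurable by auto
 have "\<forall>\<^sub>F n in sequentially. sqn M (%x. l x - f n x) < 1"
  using lim unfolding L2_tendsto_def by (rule order_tendstoD) simp
 then obtain n where n: "sqn M (%x. l x - f n x) < 1"
  by (auto simp: eventually_sequentially)
 have "sqn M (%x. l x - f n x + f n x)
  <= 2 * sqn M (%x. l x - f n x) + 2 * sqn M (f n)"
  by (rule nn_integral_square_add_le) auto
 also have "... < \<infinity>"
  using f[of n] less_trans[OF n ennreal_one_less_top]
  by (simp add: ennreal_mult_less_top ennreal_mult_eq_top_iff L2_fun_iff less_top[symmetric])
 finally show ?thesis by (simp add: L2_fun_iff)
qed

lemma L2_tendsto_real:
 assumes lim: "L2_tendsto M f l" and f: "!!n. L2_fun M (f n)" and l: "L2_fun M l"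
 shows "(%n. \<integral>x. (norm (f n x - l x))\<^sup>2 \<partial>M) \<longlonglongrightarrow> 0"
proof -
 have "sqn M (%x. l x - f n x) = ennreal (\<integral>x. (norm (f n x - l x))\<^sup>2 \<partial>M)" for n
  by (subst norm_minus_commute) (rule L2_fun_nn_integral[OF L2_fun_diff[OF f l]])
 then have "(%n. ennreal (\<integral>x. (norm (f n x - l x))\<^sup>2 \<partial>M)) \<longlonglongrightarrow> ennreal 0"
  using lim unfolding L2_tendsto_def by simp
 then show ?thesis by (subst (asm) tendsto_ennreal_iff) auto
qed

text \<open>The error splits as (f - l)(g - k) + (f - l) k + l (g - k), and Cauchy-Schwarz handles
  each piece. Isometry and orthogonality pass from simple integrands to general ones through this
  continuity.\<close>

lemma L2_tendsto_inner:
 assumes lf: "L2_tendsto M f l" and f: "!!n. L2_fun M (f n)" and l: "L2_fun M l"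
 assumes lg: "L2_tendsto M g k" and g: "!!n. L2_fun M (g n)" and k: "L2_fun M k"
 shows "(%n. \<integral>x. f n x \<bullet> g n x \<partial>M) \<longlonglongrightarrow> (\<integral>x. l x \<bullet> k x \<partial>M)"
proof -
 define a where "a n = sqrt (\<integral>x. (norm (f n x - l x))\<^sup>2 \<partial>M)" for n
 define b where "b n = sqrt (\<integral>x. (norm (g n x - k x))\<^sup>2 \<partial>M)" for n
 have a0: "a \<longlonglongrightarrow> 0" and b0: "b \<longlonglongrightarrow> 0"
  using tendsto_real_sqrt[OF L2_tendsto_real[OF lf f l]] tendsto_real_sqrt[OF L2_tendsto_real[OF lg g k]]
  by (auto simp: a_def[abs_def] b_def[abs_def])
 define A where "A = sqrt (\<integral>x. (norm (l x))\<^sup>2 \<partial>M)"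
 define B where "B = sqrt (\<integral>x. (norm (k x))\<^sup>2 \<partial>M)"
 have bd: "\<bar>(\<integral>x. f n x \<bullet> g n x \<partial>M) - (\<integral>x. l x \<bullet> k x \<partial>M)\<bar> <= a n * b n + a n * B + A * b n" for n
 proof -
  have d1: "L2_fun M (%x. f n x - l x)" and d2: "L2_fun M (%x. g n x - k x)"
   by (auto intro: L2_fun_diff f l g k)
  have "(\<integral>x. f n x \<bullet> g n x \<partial>M) - (\<integral>x. l x \<bullet> k x \<partial>M) = (\<integral>x. f n x \<bullet> g n x - l x \<bullet> k x \<partial>M)"
   by (rule Bochner_Integration.integral_diff[symmetric]) (auto intro: L2_inner_integrable f l g k)
  also have "... = (\<integral>x. (f n x - l x) \<bullet> (g n x - k x) + (f n x - l x) \<bullet> k x + l x \<bullet> (g n x - k x) \<partial>M)"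
   by (rule Bochner_Integration.integral_cong) (auto simp: algebra_simps)
  also have "... = (\<integral>x. (f n x - l x) \<bullet> (g n x - k x) \<partial>M) + (\<integral>x. (f n x - l x) \<bullet> k x \<partial>M)
    + (\<integral>x. l x \<bullet> (g n x - k x) \<partial>M)"
   by (subst Bochner_Integration.integral_add;
     (intro Bochner_Integration.integrable_add L2_inner_integrable d1 d2 l k)?)+ simp
  finally have eq: "(\<integral>x. f n x \<bullet> g n x \<partial>M) - (\<integral>x. l x \<bullet> k x \<partial>M) = ..." .
  show ?thesis unfolding eq
   using L2_Cauchy_Schwarz[OF d1 d2] L2_Cauchy_Schwarz[OF d1 k] L2_Cauchy_Schwarz[OF l d2]
   unfolding a_def b_def A_def B_def by linarith
 qed
 have "(%n. a n * b n + a n * B + A * b n) \<longlonglongrightarrow> 0 * 0 + 0 * B + A * 0"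
  by (intro tendsto_add tendsto_mult tendsto_const a0 b0)
 then have lim: "(%n. a n * b n + a n * B + A * b n) \<longlonglongrightarrow> 0" by simp
 have "(%n. (\<integral>x. f n x \<bullet> g n x \<partial>M) - (\<integral>x. l x \<bullet> k x \<partial>M)) \<longlonglongrightarrow> 0"
  by (rule Lim_null_comparison[OF _ lim]) (use bd in simp)
 then show ?thesis by (simp add: LIM_zero_iff)
qed

lemma L2_tendsto_const: "L2_tendsto M (%n. f) f"
 by (simp add: L2_tendsto_def)

section \<open>Brownian filtrations\<close>

locale brownian_space =
 fixes M :: "'w measure" and F0 :: "'w measure" and W :: "nat => real => 'w => real" and J :: "nat set"
 assumes basis: "brownian_basis M F0 W J" and finite_J: "finite J"
begin

sublocale prob_space M
 using basis by (simp add: brownian_basis_def)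

abbreviation "raw \<equiv> raw_filtration M F0 W J"
abbreviation "Fl \<equiv> usual_filtration M F0 W J"

lemma sets_F0: "sets F0 \<subseteq> sets M" "space F0 = space M"
 using basis by (auto simp: brownian_basis_def subalgebra_def)

lemma bm: "j : J ==> standard_brownian_motion M (W j)"
 using basis by (simp add: brownian_basis_def)

lemma W_measurable: "j : J ==> 0 <= t ==> W j t : borel_measurable M"
 using bm unfolding standard_brownian_motion_def by blast

lemma W_zero: "j : J ==> AE w in M. W j 0 w = 0"
 using bm unfolding standard_brownian_motion_def by blast

lemma W_continuous: "j : J ==> AE w in M. continuous_on {0..} (%t. W j t w)"
 using bm unfolding standard_brownian_motion_def by blast

lemma W_vimage_sets:
 assumes "j : J" "0 <= t"
 shows "sets (vimage_algebra (space M) (W j t) borel) \<subseteq> sets M"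
 using measurable_sets[OF W_measurable[OF assms]] by (auto simp: sets_vimage_algebra2)

lemma raw_generator_subset:
 "sets F0 \<union> null_sets M \<union> (\<Union>j\<in>J. \<Union>s\<in>{0..t}. sets (vimage_algebra (space M) (W j s) borel)) \<subseteq> sets M"
 using sets_F0 W_vimage_sets by fastforce

lemma space_raw[simp]: "space (raw t) = space M"
 by (simp add: raw_filtration_def space_measure_of_conv)

lemma sets_raw:
 "sets (raw t) = sigma_sets (space M) (sets F0 \<union> null_sets M \<union>
  (\<Union>j\<in>J. \<Union>s\<in>{0..t}. sets (vimage_algebra (space M) (W j s) borel)))"
 unfolding raw_filtration_def
 by (rule sets_measure_of) (use raw_generator_subset[of t] sets.space_closed in blast)

lemma sets_raw_subset: "sets (raw t) \<subseteq> sets M"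
 unfolding sets_raw by (rule sets.sigma_sets_subset[OF raw_generator_subset])

lemma sets_raw_mono: "s <= t ==> sets (raw s) \<subseteq> sets (raw t)"
 unfolding sets_raw by (rule sigma_sets_mono') fastforce

lemma space_usual[simp]: "space (Fl t) = space M"
 by (simp add: usual_filtration_def space_measure_of_conv)

lemma usual_generator_subset: "(\<Inter>s\<in>{t<..}. sets (raw s)) \<subseteq> sets M"
 using sets_raw_subset[of "t+1"] by (auto intro!: bexI[of _ "t+1"])

lemma sets_usual: "sets (Fl t) = sigma_sets (space M) (\<Inter>s\<in>{t<..}. sets (raw s))"
 unfolding usual_filtration_def
 by (rule sets_measure_of) (use usual_generator_subset[of t] sets.space_closed in blast)

lemma sets_usual_subset: "sets (Fl t) \<subseteq> sets M"
 unfolding sets_usual by (rule sets.sigma_sets_subset[OF usual_generator_subset])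

text \<open>Right continuity costs an arbitrarily small delay: events of \<open>Fl t\<close> are
  available in the raw filtration only strictly after \<open>t\<close>. Independence of increments
  is proved for \<open>raw\<close>, so the moment lemmas for \<open>Fl\<close> move from
  \<open>s\<close> to \<open>s + h\<close> and let \<open>h\<close> tend to 0.\<close>

lemma sets_usual_raw: "t < s ==> sets (Fl t) \<subseteq> sets (raw s)"
 unfolding sets_usual
 using sets.sigma_sets_subset[of "(\<Inter>s\<in>{t<..}. sets (raw s))" "raw s"] by auto

lemma sets_raw_usual: "sets (raw t) \<subseteq> sets (Fl t)"
 unfolding sets_usual using sets_raw_mono[of t] by (auto intro!: sigma_sets.Basic dest: less_imp_le)

lemma sets_usual_mono: "s <= t ==> sets (Fl s) \<subseteq> sets (Fl t)"
 unfolding sets_usual by (rule sigma_sets_mono') auto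

lemma null_sets_usual: "null_sets M \<subseteq> sets (Fl t)"
 using sets_raw_usual[of t] sets_raw[of t] by (auto intro: sigma_sets.Basic)

lemma F0_usual: "sets F0 \<subseteq> sets (Fl t)"
 using sets_raw_usual[of t] sets_raw[of t] by (auto intro: sigma_sets.Basic)

lemma usual_subalgebra: "subalgebra M (Fl t)"
 by (simp add: subalgebra_def sets_usual_subset)

lemma usual_measurable_M: "f : measurable (Fl t) N ==> f : measurable M N"
 by (rule measurable_from_subalg[OF usual_subalgebra])

lemma usual_measurable_mono: "f : measurable (Fl s) N ==> s <= t ==> f : measurable (Fl t) N"
 by (rule measurable_from_subalg[of "Fl t" "Fl s"]) (auto simp: subalgebra_def sets_usual_mono)

lemma usual_measurable_raw: "f : measurable (Fl s) N ==> s < t ==> f : measurable (raw t) N"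
 by (rule measurable_from_subalg[of "raw t" "Fl s"]) (auto simp: subalgebra_def dest: sets_usual_raw)

lemma F0_measurable_usual: "f : measurable F0 N ==> f : measurable (Fl t) N"
 by (rule measurable_from_subalg[of "Fl t" F0]) (use F0_usual sets_F0 in \<open>auto simp: subalgebra_def\<close>)

lemma W_adapted:
 assumes "j : J" "0 <= s" "s <= t"
 shows "W j s : borel_measurable (Fl t)"
proof (rule measurableI)
 fix A :: "real set" assume "A : sets borel"
 then have "W j s -` A \<inter> space M : sets (vimage_algebra (space M) (W j s) borel)"
  by (rule in_vimage_algebra)
 then have "W j s -` A \<inter> space M : sets (raw t)"
  unfolding sets_raw using assms by (intro sigma_sets.Basic) auto
 then show "W j s -` A \<inter> space (Fl t) : sets (Fl t)" using sets_raw_usual by auto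
qed simp

subsection \<open>Independence of increments\<close>

definition past :: "nat => real => 'w set set" where
 "past j s = sigma_sets (space M) (\<Union>r\<in>{0..s}. sets (vimage_algebra (space M) (W j r) borel))"

text \<open>The pi-system of finite-dimensional events behind \<open>past\<close>; independence is
  verified on it and extended by \<open>indep_set_sigma_sets\<close>.\<close>

definition cylinders :: "nat => real => 'w set set" where
 "cylinders j s = {{w\<in>space M. \<forall>r\<in>R. W j r w : A r} | R A. finite R \<and> R \<subseteq> {0..s} \<and> (\<forall>r. A r : sets borel)}"

definition increment_events :: "nat => real => real => 'w set set" where
 "increment_events j s t = {(%w. W j t w - W j s w) -` A \<inter> space M | A. A : sets borel}"

lemma cylinder_event:
 assumes "j : J" "finite R" "R \<subseteq> {0..}" "!!r. A r : sets borel"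
 shows "{w\<in>space M. \<forall>r\<in>R. W j r w : A r} : events"
proof -
 have "{w\<in>space M. W j r w : A r} : events" if "r : R" for r
  using measurable_sets[OF W_measurable[of j r] assms(4)[of r]] assms that
  by (auto simp: vimage_def Int_def conj_commute)
 then show ?thesis using assms(2) by (intro sets.sets_Collect_finite_All) auto
qed

lemma Int_stable_cylinders: "Int_stable (cylinders j s)"
proof (rule Int_stableI)
 fix a b assume "a : cylinders j s" "b : cylinders j s"
 then obtain R A R' A' where
  a: "a = {w\<in>space M. \<forall>r\<in>R. W j r w : A r}" "finite R" "R \<subseteq> {0..s}" "!!r. A r : sets borel" and
  b: "b = {w\<in>space M. \<forall>r\<in>R'. W j r w : A' r}" "finite R'" "R' \<subseteq> {0..s}" "!!r. A' r : sets borel"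
  unfolding cylinders_def by auto
 define C where "C r = (if r : R then A r else UNIV) \<inter> (if r : R' then A' r else UNIV)" for r
 have "a \<inter> b = {w\<in>space M. \<forall>r\<in>R \<union> R'. W j r w : C r}"
  unfolding a b C_def by auto
 moreover have "C r : sets borel" for r using a b by (auto simp: C_def)
 ultimately show "a \<inter> b : cylinders j s"
  unfolding cylinders_def using a(2,3) b(2,3)
  by (intro CollectI exI[of _ "R \<union> R'"] exI[of _ C] conjI) auto
qed

lemma past_cylinders: "past j s \<subseteq> sigma_sets (space M) (cylinders j s)"
 unfolding past_def
proof (rule sigma_sets_mono)
 show "(\<Union>r\<in>{0..s}. sets (vimage_algebra (space M) (W j r) borel)) \<subseteq> sigma_sets (space M) (cylinders j s)"
 proof
  fix B assume "B : (\<Union>r\<in>{0..s}. sets (vimage_algebra (space M) (W j r) borel))"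
  then obtain r A where r: "r : {0..s}" "A : sets borel" "B = W j r -` A \<inter> space M"
   by (auto simp: sets_vimage_algebra2)
  have "B = {w\<in>space M. \<forall>r'\<in>{r}. W j r' w : A}" using r by auto
  moreover have "{w\<in>space M. \<forall>r'\<in>{r}. W j r' w : A} : cylinders j s"
   unfolding cylinders_def using r by (intro CollectI exI[of _ "{r}"] exI[of _ "%_. A"]) auto
  ultimately have "B : cylinders j s" by (simp only:)
  then show "B : sigma_sets (space M) (cylinders j s)" by auto
 qed
qed

lemma increment_measurable: "j : J ==> 0 <= s ==> 0 <= t ==> (%w. W j t w - W j s w) : borel_measurable M"
 using W_measurable by (auto intro: borel_measurable_diff)

lemma Int_stable_increment_events: "Int_stable (increment_events j s t)"
proof (rule Int_stableI)
 fix a b assume "a : increment_events j s t" "b : increment_events j s t"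
 then obtain A B where "A : sets borel" "B : sets borel" "a = (%w. W j t w - W j s w) -` A \<inter> space M"
   "b = (%w. W j t w - W j s w) -` B \<inter> space M"
  unfolding increment_events_def by auto
 then show "a \<inter> b : increment_events j s t"
  unfolding increment_events_def by (intro CollectI exI[of _ "A \<inter> B"]) auto
qed

text \<open>A Brownian motion has, by definition, independent increments along nondecreasing
  sequences of times. Sorting \<open>R\<close> together with 0 and appending \<open>s\<close> and
  \<open>t\<close> makes the values at \<open>R\<close> partial sums of the first increments, while
  the last increment is the one from \<open>s\<close> to \<open>t\<close>.\<close>

lemma cylinder_increment_indep:
 assumes j: "j : J" and st: "0 <= s" "s < t" and R: "finite R" "R \<subseteq> {0..s}" and A: "!!r. A r : sets borel"
  and B: "B : sets borel"
 defines "E \<equiv> {w\<in>space M. \<forall>r\<in>R. W j r w : A r}" and "D \<equiv> (%w. W j t w - W j s w) -` B \<inter> space M"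
 shows "prob (E \<inter> D) = prob E * prob D"
proof -
 define xs where "xs = sorted_list_of_set (insert 0 R)"
 define n where "n = length xs"
 \<comment> \<open>Position \<open>n\<close> is \<open>s\<close> and every later position is
   \<open>t\<close>: increments 0 to n - 1 end no later than \<open>s\<close>, and increment
   \<open>n\<close> runs from \<open>s\<close> to \<open>t\<close>.\<close>
 define \<tau> where "\<tau> l = (if l < n then xs ! l else if l = n then s else t)" for l
 have fR: "finite (insert 0 R)" using R by simp
 have set_xs: "set xs = insert 0 R" and srt: "sorted xs"
  using fR by (auto simp: xs_def simp del: sorted_list_of_set_insert_remove)
 have le_s: "x : {0..s}" if "x : set xs" for x using that R st set_xs by auto
 have n0: "n > 0" using set_xs by (auto simp: n_def)
 have xs0: "xs ! 0 = 0"
 proof -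
  obtain i where "i < n" "xs ! i = 0" using set_xs by (metis in_set_conv_nth insertI1 n_def)
  moreover have "xs ! 0 <= xs ! i" using srt \<open>i < n\<close> by (auto simp: n_def intro: sorted_nth_mono)
  moreover have "xs ! 0 >= 0" using le_s[of "xs ! 0"] n0 by (auto simp: n_def)
  ultimately show ?thesis by simp
 qed
 have nth_s: "xs ! l <= s" if "l < n" for l using le_s[of "xs ! l"] that by (auto simp: n_def)
 have mono: "mono \<tau>"
 proof (rule monoI)
  fix a b :: nat assume "a <= b"
  then show "\<tau> a <= \<tau> b"
   using nth_s[of a] st srt by (auto simp: \<tau>_def n_def intro: sorted_nth_mono)
 qed
 define U where "U l = (%w. W j (\<tau> (Suc l)) w - W j (\<tau> l) w)" for l
 have "indep_vars (%_. borel) U {..<Suc n}"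
 proof -
  have "0 <= \<tau> 0" using n0 xs0 by (simp add: \<tau>_def)
  then show ?thesis
   using bm[OF j] mono unfolding standard_brownian_motion_def U_def by blast
 qed
 then have ind: "indep_var (PiM {..<n} (%_. borel)) (%w. restrict (%i. U i w) {..<n})
   (PiM {n} (%_. borel)) (%w. restrict (%i. U i w) {n})"
  by (rule indep_var_restrict) auto
 have "\<exists>i<n. xs ! i = r" if "r : R" for r
  using that set_xs by (metis in_set_conv_nth insertCI n_def)
 then obtain idx where idx: "!!r. r : R ==> idx r < n \<and> xs ! idx r = r" by metis
 define XA where "XA = {f\<in>space (PiM {..<n} (%_. borel :: real measure)). \<forall>r\<in>R. (\<Sum>l<idx r. f l) : A r}"
 define XB where "XB = {f\<in>space (PiM {n} (%_. borel :: real measure)). f n : B}"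
 have XA: "XA : sets (PiM {..<n} (%_. borel))"
  unfolding XA_def
 proof (rule sets.sets_Collect_finite_All[OF _ R(1)])
  fix r assume r: "r : R"
  have "(%f. \<Sum>l<idx r. f l) : borel_measurable (PiM {..<n} (%_. borel :: real measure))"
   by (rule borel_measurable_sum) (use idx[OF r] in \<open>auto intro!: measurable_component_singleton\<close>)
  from measurable_sets[OF this A[of r]]
  show "{f : space (PiM {..<n} (%_. borel)). (\<Sum>l<idx r. f l) : A r} : sets (PiM {..<n} (%_. borel))"
   by (simp add: vimage_def Int_def conj_commute)
 qed
 have XB: "XB : sets (PiM {n} (%_. borel))"
 proof -
  have "(%f. f n) : borel_measurable (PiM {n} (%_. borel :: real measure))"
   by (rule measurable_component_singleton) auto
  from measurable_sets[OF this B] show ?thesis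
   by (simp add: vimage_def Int_def conj_commute XB_def)
 qed
 \<comment> \<open>Partial sums recover \<open>W j r - W j 0\<close>, whereas \<open>E\<close>
   speaks of \<open>W j r\<close>. The two events differ by a null set, because \<open>W j 0\<close>
   vanishes almost surely.\<close>
 define E' where "E' = (%w. restrict (%i. U i w) {..<n}) -` XA \<inter> space M"
 have E': "E' = {w\<in>space M. \<forall>r\<in>R. W j r w - W j 0 w : A r}"
 proof -
  have "(\<Sum>l<idx r. U l w) = W j r w - W j 0 w" if "r : R" for r w
   using sum_lessThan_telescope[of "%l. W j (\<tau> l) w" "idx r"] idx[OF that] n0 xs0
   unfolding U_def by (simp add: \<tau>_def)
  moreover have "(\<Sum>l<idx r. restrict (%i. U i w) {..<n} l) = (\<Sum>l<idx r. U l w)" if "r : R" for r w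
   by (rule sum.cong) (use idx[OF that] in auto)
  ultimately show ?thesis
   by (auto simp: E'_def XA_def space_PiM PiE_def)
 qed
 have D: "D = (%w. restrict (%i. U i w) {n}) -` XB \<inter> space M"
  by (auto simp: D_def XB_def space_PiM PiE_def U_def \<tau>_def)
 have "prob (E' \<inter> D) = prob E' * prob D"
  using indep_varD[OF ind XA XB] unfolding E'_def D
  by (simp add: vimage_Int[symmetric] vimage_Times Int_ac Int_left_absorb comp_def)
 moreover have ev: "E : events" "E' : events" "D : events"
 proof -
  show "E : events" unfolding E_def by (rule cylinder_event) (use j R A in auto)
  show "E' : events" "D : events"
   using ind XA XB unfolding E'_def D indep_var_eq by (auto dest: measurable_sets)
 qed
 moreover have AE0: "AE w in M. w : E \<longleftrightarrow> w : E'"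
  using W_zero[OF j] by eventually_elim (auto simp: E_def E')
 moreover have "prob E = prob E'"
  by (rule measure_eq_AE) (use AE0 ev in auto)
 moreover have "prob (E \<inter> D) = prob (E' \<inter> D)"
  by (rule measure_eq_AE) (use AE0 ev in auto)
 ultimately show ?thesis by simp
qed

lemma past_events: "j : J ==> past j s \<subseteq> events"
 unfolding past_def using W_vimage_sets by (intro sets.sigma_sets_subset) fastforce

lemma past_increment_indep:
 assumes j: "j : J" and st: "0 <= s" "s < t" and E: "E : past j s" and D: "D : increment_events j s t"
 shows "prob (E \<inter> D) = prob E * prob D"
proof -
 have "indep_set (cylinders j s) (increment_events j s t)"
 proof (rule indep_setI)
  show "cylinders j s \<subseteq> events"
   unfolding cylinders_def using cylinder_event[OF j] by (fastforce simp: subset_iff)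
  show "increment_events j s t \<subseteq> events"
   unfolding increment_events_def using increment_measurable[OF j, of s t] st
   by (auto intro: measurable_sets)
 next
  fix a b assume "a : cylinders j s" "b : increment_events j s t"
  then show "prob (a \<inter> b) = prob a * prob b"
   unfolding cylinders_def increment_events_def using cylinder_increment_indep[OF j st] by auto
 qed
 then have "indep_set (sigma_sets (space M) (cylinders j s)) (sigma_sets (space M) (increment_events j s t))"
  by (intro indep_set_sigma_sets Int_stable_cylinders Int_stable_increment_events)
 then show ?thesis
  by (rule indep_setD) (use E D past_cylinders in auto)
qed

text \<open>One initial event and one past event of each Brownian motion. Such rectangles are stable
  under intersection, and the sigma-algebra they generate with the null sets contains
  \<open>raw s\<close>.\<close>

definition past_rectangles :: "real => 'w set set" where
 "past_rectangles s = {A \<inter> (\<Inter>j\<in>J. B j) | A B. A : sets F0 \<and> (\<forall>j\<in>J. B j : past j s)}"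

text \<open>The intersection with \<open>space M\<close> matters for empty \<open>J\<close>, where
  the inner intersection would be \<open>UNIV\<close>.\<close>

definition joint_increment_events :: "real => real => 'w set set" where
 "joint_increment_events s t = {space M \<inter> (\<Inter>j\<in>J. D j) | D. \<forall>j\<in>J. D j : increment_events j s t}"

lemma increment_events_events: "j : J ==> 0 <= s ==> s < t ==> increment_events j s t \<subseteq> events"
 unfolding increment_events_def using increment_measurable[of j s t] by (auto intro: measurable_sets)

lemma Inter_events: "(!!j. j : J ==> B j : events) ==> A : events ==> A \<inter> (\<Inter>j\<in>J. B j) : events"
 using finite_J by (cases "J = {}") auto

lemma space_increment_events: "space M : increment_events j s t"
 unfolding increment_events_def by (intro CollectI exI[of _ UNIV]) auto

text \<open>The joint independence in \<open>brownian_basis\<close> is indexed by options: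
  \<open>None\<close> stands for the initial sigma-algebra and \<open>Some j\<close> for
  \<open>W j\<close>. Putting the whole space into a slot removes it from the product.\<close>

lemma prob_F0_bm:
 assumes "A : sets F0" and "!!j. j : J ==>
   B j : sigma_sets (space M) (\<Union>t\<in>{0..}. sets (vimage_algebra (space M) (W j t) borel))"
 shows "prob (A \<inter> (\<Inter>j\<in>J. B j)) = prob A * (\<Prod>j\<in>J. prob (B j))"
proof -
 let ?C = "case_option A B"
 have "prob (\<Inter>x\<in>insert None (Some ` J). ?C x) = (\<Prod>x\<in>insert None (Some ` J). prob (?C x))"
  by (rule indep_setsD[of "case_option (sets F0)
     (%j. sigma_sets (space M) (\<Union>t\<in>{0..}. sets (vimage_algebra (space M) (W j t) borel)))"])
   (use basis finite_J assms in \<open>auto simp: brownian_basis_def\<close>)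
 also have "(\<Prod>x\<in>insert None (Some ` J). prob (?C x)) = prob A * (\<Prod>j\<in>J. prob (B j))"
  using finite_J by (subst prod.insert) (auto simp: prod.reindex)
 finally show ?thesis by simp
qed

lemma past_future:
 assumes "0 <= s" "s < t" "j : J"
 shows "past j s \<subseteq> sigma_sets (space M) (\<Union>t\<in>{0..}. sets (vimage_algebra (space M) (W j t) borel))"
  and "increment_events j s t \<subseteq> sigma_sets (space M) (\<Union>t\<in>{0..}. sets (vimage_algebra (space M) (W j t) borel))"
proof -
 let ?G = "\<Union>t\<in>{0..}. sets (vimage_algebra (space M) (W j t) borel)"
 show "past j s \<subseteq> sigma_sets (space M) ?G"
  unfolding past_def by (rule sigma_sets_mono') auto
 have G: "?G \<subseteq> Pow (space M)" using sets.space_closed[of "vimage_algebra (space M) (W j _) borel"] by auto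
 have "W j r : borel_measurable (sigma (space M) ?G)" if "0 <= r" for r
 proof (rule measurableI)
  fix A :: "real set" assume "A : sets borel"
  then have "W j r -` A \<inter> space M : ?G" using in_vimage_algebra[of A borel "W j r" "space M"] that by auto
  then show "W j r -` A \<inter> space (sigma (space M) ?G) : sets (sigma (space M) ?G)"
   using G by (auto simp: sets_measure_of)
 qed simp
 then have "(%w. W j t w - W j s w) : borel_measurable (sigma (space M) ?G)"
  using assms by auto
 from measurable_sets[OF this] show "increment_events j s t \<subseteq> sigma_sets (space M) ?G"
  unfolding increment_events_def using G by (auto simp: sets_measure_of)
qed

lemma sigma_sets_Int:
 assumes "A : sigma_sets S G" "B : sigma_sets S G" "G \<subseteq> Pow S"
 shows "A \<inter> B : sigma_sets S G"
proof -
 interpret sigma_algebra S "sigma_sets S G" by (rule sigma_algebra_sigma_sets) (rule assms)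
 show ?thesis using assms by auto
qed

text \<open>For each \<open>j\<close> the intersection regroups into a past event and an increment
  event, which \<open>past_increment_indep\<close> separates; joint independence is used for the
  intersection and for each side. Null sets, which \<open>raw\<close> contains, are independent of
  everything.\<close>

lemma rectangle_increment_indep:
 assumes st: "0 <= s" "s < t"
 shows "indep_set (past_rectangles s \<union> null_sets M) (joint_increment_events s t)"
proof (rule indep_setI)
 show "past_rectangles s \<union> null_sets M \<subseteq> events"
  unfolding past_rectangles_def using sets_F0 past_events by (auto intro!: Inter_events) (meson subsetD)
 show ev: "joint_increment_events s t \<subseteq> events"
  unfolding joint_increment_events_def using increment_events_events st
  by (auto intro!: Inter_events) (meson subsetD)
 fix a b assume a: "a : past_rectangles s \<union> null_sets M" and b: "b : joint_increment_events s t"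
 show "prob (a \<inter> b) = prob a * prob b"
 proof (cases "a : null_sets M")
  case True
  then have "a \<inter> b : null_sets M" using ev b by (intro null_set_Int2) auto
  with True show ?thesis by (simp add: null_setsD1 measure_def)
 next
  case False
  then obtain A B where a': "a = A \<inter> (\<Inter>j\<in>J. B j)" "A : sets F0" "!!j. j : J ==> B j : past j s"
   using a unfolding past_rectangles_def by auto
  obtain D where b': "b = space M \<inter> (\<Inter>j\<in>J. D j)" "!!j. j : J ==> D j : increment_events j s t"
   using b unfolding joint_increment_events_def by auto
  have G: "(\<Union>t\<in>{0..}. sets (vimage_algebra (space M) (W j t) borel)) \<subseteq> Pow (space M)" for j
   using sets.space_closed[of "vimage_algebra (space M) (W j _) borel"] by auto
  have "a \<inter> b = A \<inter> (\<Inter>j\<in>J. B j \<inter> D j)" unfolding a' b' using sets_F0 sets.sets_into_space[OF a'(2)] by auto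
  also have "prob ... = prob A * (\<Prod>j\<in>J. prob (B j \<inter> D j))"
   using past_future[OF st] a'(3) b'(2) G
   by (intro prob_F0_bm[OF a'(2)] sigma_sets_Int) blast+
  also have "... = prob A * (\<Prod>j\<in>J. prob (B j) * prob (D j))"
   by (simp add: past_increment_indep[OF _ st a'(3) b'(2)])
  also have "... = (prob A * (\<Prod>j\<in>J. prob (B j))) * (prob (space M) * (\<Prod>j\<in>J. prob (D j)))"
   by (simp add: prod.distrib prob_space)
  also have "prob A * (\<Prod>j\<in>J. prob (B j)) = prob a"
   unfolding a' by (rule prob_F0_bm[symmetric, OF a'(2)]) (use a'(3) past_future(1)[OF st] in blast)
  also have "prob (space M) * (\<Prod>j\<in>J. prob (D j)) = prob b"
   unfolding b' sets_F0(2)[symmetric]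
   by (rule prob_F0_bm[symmetric, OF sets.top]) (use b'(2) past_future(2)[OF st] in blast)
  finally show ?thesis .
 qed
qed

lemma Int_stable_past: "Int_stable (past_rectangles s \<union> null_sets M)"
proof (rule Int_stableI)
 have ev: "past_rectangles s \<subseteq> events"
  unfolding past_rectangles_def using sets_F0 past_events by (auto intro!: Inter_events) (meson subsetD)
 fix a b assume ab: "a : past_rectangles s \<union> null_sets M" "b : past_rectangles s \<union> null_sets M"
 show "a \<inter> b : past_rectangles s \<union> null_sets M"
 proof (cases "a : null_sets M \<or> b : null_sets M")
  case True then show ?thesis using ab ev by (auto intro: null_set_Int1 null_set_Int2)
 next
  case False
  then obtain A B A' B' where a': "a = A \<inter> (\<Inter>j\<in>J. B j)" "A : sets F0" "!!j. j : J ==> B j : past j s"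
   and b': "b = A' \<inter> (\<Inter>j\<in>J. B' j)" "A' : sets F0" "!!j. j : J ==> B' j : past j s"
   using ab unfolding past_rectangles_def by auto
  have "B j \<inter> B' j : past j s" if "j : J" for j
   unfolding past_def
  proof (rule sigma_sets_Int)
   show "(\<Union>r\<in>{0..s}. sets (vimage_algebra (space M) (W j r) borel)) \<subseteq> Pow (space M)"
    using sets.sets_into_space[of _ "vimage_algebra (space M) (W j _) borel"] by fastforce
  qed (use a' b' that in \<open>auto simp: past_def\<close>)
  then have "a \<inter> b : past_rectangles s"
   unfolding past_rectangles_def a' b' using a'(2) b'(2)
   by (intro CollectI exI[of _ "A \<inter> A'"] exI[of _ "%j. B j \<inter> B' j"]) auto
  then show ?thesis by simp
 qed
qed

lemma Int_stable_joint: "Int_stable (joint_increment_events s t)"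
proof (rule Int_stableI)
 fix a b assume "a : joint_increment_events s t" "b : joint_increment_events s t"
 then obtain D D' where "a = space M \<inter> (\<Inter>j\<in>J. D j)" "!!j. j : J ==> D j : increment_events j s t"
   "b = space M \<inter> (\<Inter>j\<in>J. D' j)" "!!j. j : J ==> D' j : increment_events j s t"
  unfolding joint_increment_events_def by auto
 then show "a \<inter> b : joint_increment_events s t"
  unfolding joint_increment_events_def
  by (intro CollectI exI[of _ "%j. D j \<inter> D' j"])
    (auto intro!: Int_stableD[OF Int_stable_increment_events])
qed

lemma raw_past: "sets (raw s) \<subseteq> sigma_sets (space M) (past_rectangles s \<union> null_sets M)"
 unfolding sets_raw
proof (rule sigma_sets_mono, safe)
 have sp: "space M : past j s" for j unfolding past_def by (rule sigma_sets_top)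
 fix x
 { assume "x : sets F0"
  then have "x : past_rectangles s"
   unfolding past_rectangles_def
   using sp sets.sets_into_space[of x F0] sets_F0 by (intro CollectI exI[of _ x] exI[of _ "%j. space M"]) auto
  then show "x : sigma_sets (space M) (past_rectangles s \<union> null_sets M)" by auto }
 { assume "x : null_sets M" then show "x : sigma_sets (space M) (past_rectangles s \<union> null_sets M)" by auto }
 fix j r assume j: "j : J" "r : {0..s}" "x : sets (vimage_algebra (space M) (W j r) borel)"
 have x: "x : past j s" unfolding past_def using j by (intro sigma_sets.Basic) auto
 have "x \<subseteq> space M" using sets.sets_into_space[OF j(3)] by simp
 then have "x : past_rectangles s"
  unfolding past_rectangles_def using x j(1) sp sets.top[of F0] sets_F0(2)
  by (intro CollectI exI[of _ "space M"] exI[of _ "%i. if i = j then x else space M"])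
    (auto split: if_splits)
 then show "x : sigma_sets (space M) (past_rectangles s \<union> null_sets M)" by auto
qed

lemma increment_joint_measurable:
 assumes "j : J"
 shows "(%w. W j t w - W j s w) : borel_measurable (sigma (space M) (joint_increment_events s t))"
proof (rule measurableI)
 fix A :: "real set" assume A: "A : sets borel"
 let ?D = "(%w. W j t w - W j s w) -` A \<inter> space M"
 have "?D : joint_increment_events s t"
  unfolding joint_increment_events_def
 proof (intro CollectI exI[of _ "%i. if i = j then ?D else space M"] conjI ballI)
  show "?D = space M \<inter> (\<Inter>i\<in>J. if i = j then ?D else space M)" using assms by (auto split: if_splits)
  show "(if i = j then ?D else space M) : increment_events i s t" for i
   using A space_increment_events by (auto simp: increment_events_def)
 qed
 then show "(%w. W j t w - W j s w) -` A \<inter> space (sigma (space M) (joint_increment_events s t))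
   : sets (sigma (space M) (joint_increment_events s t))"
  by (simp add: sets_measure_of_conv sigma_sets.Basic) (auto simp: joint_increment_events_def)
qed simp

text \<open>The function \<open>g\<close> may depend on the increments of several Brownian motions
  at once; in this way products of two increments are covered.\<close>

lemma raw_increment_indep_var:
 fixes f g :: "'w => real"
 assumes st: "0 <= s" "s < t" and f: "f : borel_measurable (raw s)"
  and g: "g : borel_measurable (sigma (space M) (joint_increment_events s t))"
 shows "indep_var borel f borel g"
proof -
 have ind: "indep_set (sigma_sets (space M) (past_rectangles s \<union> null_sets M))
   (sigma_sets (space M) (joint_increment_events s t))"
  by (intro indep_set_sigma_sets rectangle_increment_indep st Int_stable_past Int_stable_joint)
 have J: "joint_increment_events s t \<subseteq> Pow (space M)" by (auto simp: joint_increment_events_def)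
 have sf: "{f -` A \<inter> space M |A. A : sets borel} \<subseteq> sigma_sets (space M) (past_rectangles s \<union> null_sets M)"
  using measurable_sets[OF f] raw_past by auto
 have sg: "{g -` A \<inter> space M |A. A : sets borel} \<subseteq> sigma_sets (space M) (joint_increment_events s t)"
  using measurable_sets[OF g] J by (auto simp: sets_measure_of)
 have mf: "random_variable borel f"
  by (rule measurable_from_subalg[OF _ f]) (simp add: subalgebra_def sets_raw_subset)
 have mg: "random_variable borel g"
  by (rule measurable_from_subalg[OF _ g]) (use J indep_setD_ev2[OF ind] in \<open>simp add: subalgebra_def sets_measure_of\<close>)
 show ?thesis unfolding indep_var_eq
 proof (rule conjI[OF conjI[OF mf mg]], rule indep_setI)
  fix a b assume "a : sigma_sets (space M) {f -` A \<inter> space M |A. A : sets borel}"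
   "b : sigma_sets (space M) {g -` A \<inter> space M |A. A : sets borel}"
  then have "a : sigma_sets (space M) (past_rectangles s \<union> null_sets M)"
   "b : sigma_sets (space M) (joint_increment_events s t)"
   using sigma_sets_mono[OF sf] sigma_sets_mono[OF sg] by blast+
  then show "prob (a \<inter> b) = prob a * prob b" by (rule indep_setD[OF ind])
 next
  show "sigma_sets (space M) {f -` A \<inter> space M |A. A : sets borel} \<subseteq> events"
   by (rule order_trans[OF sigma_sets_mono[OF sf] indep_setD_ev1[OF ind]])
  show "sigma_sets (space M) {g -` A \<inter> space M |A. A : sets borel} \<subseteq> events"
   by (rule order_trans[OF sigma_sets_mono[OF sg] indep_setD_ev2[OF ind]])
 qed
qed

end

text \<open>Closes the delay between \<open>Fl\<close> and \<open>raw\<close>: an identity that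
  holds up to an error vanishing with \<open>h\<close> is exact.\<close>

lemma zero_if_abs_le_small:
 fixes x \<delta> :: real and f :: "real => real"
 assumes "0 < \<delta>" "!!h. 0 < h ==> h < \<delta> ==> \<bar>x\<bar> <= f h" "(f \<longlongrightarrow> 0) (at_right 0)"
 shows "x = 0"
proof -
 have "\<bar>x\<bar> <= 0"
 proof (rule tendsto_lowerbound[OF assms(3)])
  show "\<forall>\<^sub>F h in at_right 0. \<bar>x\<bar> <= f h"
   using eventually_at_right_less[of 0] eventually_at_right_real[OF assms(1)]
   by eventually_elim (use assms(2) in auto)
 qed simp
 then show ?thesis by simp
qed

section \<open>Moments of Brownian increments against adapted factors\<close>

context brownian_space begin

definition dW :: "nat => real => real => 'w => real" where
 "dW j s t w = W j t w - W j s w"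

lemma dW_measurable: "j : J ==> 0 <= s ==> 0 <= t ==> dW j s t : borel_measurable M"
 unfolding dW_def[abs_def] by (rule increment_measurable)

lemma dW_adapted:
 "j : J ==> 0 <= s ==> s <= r ==> 0 <= t ==> t <= r ==> dW j s t : borel_measurable (Fl r)"
 unfolding dW_def[abs_def] by (intro borel_measurable_diff W_adapted)

lemma dW_split: "dW j s t w = dW j s r w + dW j r t w"
 by (simp add: dW_def)

text \<open>The moments are those of the normal density. Equal times are treated apart, since the
  law of an increment is prescribed for s < t only.\<close>

lemma dW_moments:
 assumes j: "j : J" and st: "0 <= s" "s <= t"
 shows "L2_fun M (dW j s t)" "expectation (dW j s t) = 0" "expectation (%w. (dW j s t w)\<^sup>2) = t - s"
proof -
 have "L2_fun M (dW j s t) \<and> expectation (dW j s t) = 0 \<and> expectation (%w. (dW j s t w)\<^sup>2) = t - s"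
 proof (cases "s = t")
  case True
  then show ?thesis by (simp add: dW_def[abs_def] L2_fun_zero)
 next
  case False
  define \<sigma> where "\<sigma> = sqrt (t - s)"
  have \<sigma>: "0 < \<sigma>" using False st by (simp add: \<sigma>_def)
  have D: "distributed M lborel (dW j s t) (normal_density 0 \<sigma>)"
   using bm[OF j] False st unfolding standard_brownian_motion_def dW_def[abs_def] \<sigma>_def by auto
  have 1: "integrable M (%w. (dW j s t w)\<^sup>2)"
   using distributed_integrable[OF D, of "%x. x\<^sup>2"] integrable_normal_moment[OF \<sigma>, of 0 2] by simp
  have 2: "expectation (dW j s t) = 0"
   using distributed_integral[OF D, of "%x. x"] integral_normal_moment_nz_1[OF \<sigma>, of 0] by simp
  have 3: "expectation (%w. (dW j s t w)\<^sup>2) = \<sigma>\<^sup>2"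
   using distributed_integral[OF D, of "%x. x\<^sup>2"] integral_normal_moment_even[OF \<sigma>, of 0 1] \<sigma>
   by (simp add: numeral_2_eq_2[symmetric])
  show ?thesis
   using 1 2 3 dW_measurable[OF j, of s t] st by (simp add: L2_fun_def \<sigma>_def)
 qed
 then show "L2_fun M (dW j s t)" "expectation (dW j s t) = 0" "expectation (%w. (dW j s t w)\<^sup>2) = t - s"
  by auto
qed

lemma increments_indep_var:
 assumes ij: "i : J" "j : J" "i ~= j" and st: "0 <= s" "s < t"
 shows "indep_var borel (dW i s t) borel (dW j s t)"
proof -
 let ?A = "%i. {dW i s t -` A \<inter> space M |A. A : sets borel}"
 have m: "random_variable borel (dW i s t)" if "i : J" for i
  by (rule dW_measurable) (use that st in auto)
 have eq: "?A i = increment_events i s t" for i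
  by (simp add: increment_events_def dW_def[abs_def])
 have "indep_set (?A i) (?A j)"
 proof (rule indep_setI)
  show "?A i \<subseteq> events" "?A j \<subseteq> events" using measurable_sets[OF m] ij by auto
  fix a b assume "a : ?A i" "b : ?A j"
  then have ab: "a : increment_events i s t" "b : increment_events j s t" unfolding eq by auto
  then have sub: "a \<subseteq> space M" "b \<subseteq> space M" by (auto simp: increment_events_def)
  define B where "B l = (if l = i then a else if l = j then b else space M)" for l
  have B: "B l : increment_events l s t" for l
   using ab space_increment_events by (auto simp: B_def)
  have "prob (space M \<inter> (\<Inter>l\<in>J. B l)) = prob (space M) * (\<Prod>l\<in>J. prob (B l))"
   unfolding sets_F0(2)[symmetric]
   by (rule prob_F0_bm[OF sets.top]) (use B past_future(2)[OF st] in blast)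
  also have "space M \<inter> (\<Inter>l\<in>J. B l) = a \<inter> b"
   using ij sub by (auto simp: B_def split: if_splits)
  also have "(\<Prod>l\<in>J. prob (B l)) = (\<Prod>l\<in>{i, j}. prob (B l))"
   by (rule prod.mono_neutral_right) (use finite_J ij in \<open>auto simp: B_def prob_space\<close>)
  also have "... = prob a * prob b" using ij by (simp add: B_def)
  finally show "prob (a \<inter> b) = prob a * prob b" by (simp add: prob_space)
 qed
 moreover have "Int_stable (?A i)" for i unfolding eq by (rule Int_stable_increment_events)
 ultimately show ?thesis
  unfolding indep_var_eq using m ij by (auto intro!: indep_set_sigma_sets)
qed

lemma dW_cross_moment:
 assumes "i : J" "j : J" "0 <= s" "s <= t"
 shows "expectation (%w. dW i s t w * dW j s t w) = (if i = j then t - s else 0)"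
proof (cases "i = j \<or> s = t")
 case True
 then show ?thesis using dW_moments(3)[OF assms(1,3,4)]
  by (auto simp: power2_eq_square dW_def)
next
 case False
 then have "indep_var borel (dW i s t) borel (dW j s t)" using assms by (intro increments_indep_var) auto
 then show ?thesis
  using False assms dW_moments
  by (subst indep_var_lebesgue_integral) (auto intro!: L2_integrable finite_measure_axioms)
qed

lemma raw_expectation_dW:
 assumes f: "f : borel_measurable (raw s)" "integrable M f" and j: "j : J" and st: "0 <= s" "s < t"
 shows "expectation (%w. f w * dW j s t w) = 0"
proof -
 have "indep_var borel f borel (dW j s t)"
  by (rule raw_increment_indep_var[OF st f(1)])
    (use increment_joint_measurable[OF j] in \<open>simp add: dW_def[abs_def]\<close>)
 then show ?thesis
  using dW_moments[OF j, of s t] st f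
  by (subst indep_var_lebesgue_integral) (auto intro!: L2_integrable finite_measure_axioms)
qed

lemma raw_expectation_dW_dW:
 assumes f: "f : borel_measurable (raw s)" "integrable M f" and ij: "i : J" "j : J" and st: "0 <= s" "s < t"
 shows "expectation (%w. f w * (dW i s t w * dW j s t w)) = (if i = j then t - s else 0) * expectation f"
proof -
 have "indep_var borel f borel (%w. dW i s t w * dW j s t w)"
  by (rule raw_increment_indep_var[OF st f(1)])
    (use increment_joint_measurable ij in \<open>simp add: dW_def[abs_def]\<close>)
 moreover have "integrable M (%w. dW i s t w * dW j s t w)"
  by (rule L2_mult_integrable) (use dW_moments ij st in auto)
 ultimately have "expectation (%w. f w * (dW i s t w * dW j s t w))
   = expectation f * expectation (%w. dW i s t w * dW j s t w)"
  using f(2) by (intro indep_var_lebesgue_integral)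
 then show ?thesis using dW_cross_moment[of i j s t] ij st by simp
qed

lemma sqrt_expectation_dW:
 "j : J ==> 0 <= s ==> s <= t ==> sqrt (expectation (%w. (norm (dW j s t w))\<^sup>2)) = sqrt (t - s)"
 using dW_moments(3) by simp

text \<open>As \<open>f\<close> is known to \<open>Fl s\<close>, it is known to
  \<open>raw (s + h)\<close>. The increment after s + h is independent of \<open>f\<close> and
  centred, and the one over [s, s + h] contributes at most c sqrt h by Cauchy-Schwarz.\<close>

lemma expectation_mult_dW:
 assumes f: "f : borel_measurable (Fl s)" "L2_fun M f" and j: "j : J" and st: "0 <= s" "s <= t"
 shows "expectation (%w. f w * dW j s t w) = 0"
proof (cases "s = t")
 case True
 then show ?thesis by (simp add: dW_def)
next
 case False
 define c where "c = sqrt (expectation (%w. (norm (f w))\<^sup>2))"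
 show ?thesis
 proof (rule zero_if_abs_le_small)
  show "0 < t - s" using False st by simp
  show "((%h. c * sqrt h) \<longlongrightarrow> 0) (at_right 0)"
   by (rule tendsto_eq_intros refl)+ auto
  fix h :: real assume h: "0 < h" "h < t - s"
  have i1: "integrable M (%w. f w * dW j s (s + h) w)" "integrable M (%w. f w * dW j (s + h) t w)"
   by (auto intro!: L2_mult_integrable f dW_moments j st) (use h st in auto)
  have "expectation (%w. f w * dW j (s + h) t w) = 0"
   by (rule raw_expectation_dW)
    (use f h st j usual_measurable_raw[OF f(1)] in \<open>auto intro: L2_integrable finite_measure_axioms\<close>)
  moreover have "expectation (%w. f w * dW j s t w)
    = expectation (%w. f w * dW j s (s + h) w + f w * dW j (s + h) t w)"
   by (rule Bochner_Integration.integral_cong) (simp_all add: dW_split[of j s t _ "s + h"] algebra_simps)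
  ultimately have "expectation (%w. f w * dW j s t w) = expectation (%w. f w * dW j s (s + h) w)"
   using Bochner_Integration.integral_add[OF i1] by simp
  also have "\<bar>...\<bar> <= c * sqrt h"
   using L2_Cauchy_Schwarz[OF f(2) dW_moments(1)[OF j, of s "s + h"]] sqrt_expectation_dW[OF j, of s "s + h"] st h
   by (simp add: c_def)
  finally show "\<bar>expectation (%w. f w * dW j s t w)\<bar> <= c * sqrt h" .
 qed
qed

text \<open>The same delay for products of two increments. Cutting both at s + h gives four terms:
  the one over [s + h, t] is exact and the others vanish with \<open>h\<close> by \<open>bd\<close>.
  The bound on \<open>f\<close> keeps f times an increment square integrable; simple integrands are
  bounded for this reason.\<close>

lemma expectation_mult_dW_dW:
 assumes f: "f : borel_measurable (Fl s)" "!!w. w : space M ==> \<bar>f w\<bar> <= K"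
  and ij: "i : J" "j : J" and st: "0 <= s" "s <= t"
 shows "expectation (%w. f w * (dW i s t w * dW j s t w)) = (if i = j then t - s else 0) * expectation f"
proof (cases "s = t")
 case True
 then show ?thesis by (simp add: dW_def)
next
 case False
 define \<delta> :: real where "\<delta> = (if i = j then 1 else 0)"
 have fM: "f : borel_measurable M" using f(1) by (rule usual_measurable_M)
 have K0: "0 <= K" using f(2) not_empty by fastforce
 have fint: "integrable M f" by (rule integrable_const_bound[of _ K]) (use f(2) fM in auto)
 have fd: "L2_fun M (%w. f w * dW l a b w)" if "l : J" "0 <= a" "a <= b" for l a b
  using L2_fun_bounded_scaleR[OF dW_moments(1)[OF that] fM f(2)] by simp
 have fdi: "integrable M (%w. f w * (dW l a b w * dW m a' b' w))"
  if "l : J" "0 <= a" "a <= b" "m : J" "0 <= a'" "a' <= b'" for l a b m a' b'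
  using L2_mult_integrable[OF fd[OF that(1-3)] dW_moments(1)[OF that(4-6)]] by (simp add: mult.assoc)
 have bd: "\<bar>expectation (%w. f w * (dW l a b w * dW m a' b' w))\<bar> <= K * sqrt (b - a) * sqrt (b' - a')"
  if l: "l : J" "0 <= a" "a <= b" "m : J" "0 <= a'" "a' <= b'" for l a b m a' b'
 proof -
  have "expectation (%w. (norm (f w * dW l a b w))\<^sup>2) <= expectation (%w. K\<^sup>2 * (dW l a b w)^2)"
  proof (rule integral_mono)
   show "integrable M (%w. (norm (f w * dW l a b w))\<^sup>2)" using fd[OF l(1-3)] by (rule L2_fun_integrable)
   show "integrable M (%w. K\<^sup>2 * (dW l a b w)^2)"
    using L2_fun_integrable[OF dW_moments(1)[OF l(1-3)]] by simp
   fix w assume "w : space M"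
   then have "\<bar>f w\<bar>\<^sup>2 <= K\<^sup>2" by (intro power_mono f(2)) auto
   then show "(norm (f w * dW l a b w))^2 <= K\<^sup>2 * (dW l a b w)^2"
    by (simp add: power_mult_distrib mult_right_mono)
  qed
  also have "... = K\<^sup>2 * (b - a)" using dW_moments(3)[OF l(1-3)] by simp
  finally have "sqrt (expectation (%w. (norm (f w * dW l a b w))\<^sup>2)) <= K * sqrt (b - a)"
   using K0 by (metis real_sqrt_le_iff real_sqrt_mult real_sqrt_unique)
  then have "sqrt (expectation (%w. (norm (f w * dW l a b w))\<^sup>2)) * sqrt (b' - a') <= K * sqrt (b - a) * sqrt (b' - a')"
   by (rule mult_right_mono) (use l in auto)
  moreover have "expectation (%w. f w * (dW l a b w * dW m a' b' w)) = expectation (%w. (f w * dW l a b w) \<bullet> dW m a' b' w)"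
   by (simp add: mult.assoc)
  ultimately show ?thesis
   using L2_Cauchy_Schwarz[OF fd[OF l(1-3)] dW_moments(1)[OF l(4-6)]]
   by (simp only: sqrt_expectation_dW[OF l(4-6)])
 qed
 have "expectation (%w. f w * (dW i s t w * dW j s t w)) - \<delta> * (t - s) * expectation f = 0"
 proof (rule zero_if_abs_le_small)
  show "0 < t - s" using False st by simp
  show "((%h. K * sqrt h * sqrt h + 2 * (K * sqrt h * sqrt (t - s)) + \<delta> * h * \<bar>expectation f\<bar>) \<longlongrightarrow> 0) (at_right 0)"
   by (rule tendsto_eq_intros refl)+ auto
  fix h :: real assume h: "0 < h" "h < t - s"
  let ?E = "%l a b m a' b'. expectation (%w. f w * (dW l a b w * dW m a' b' w))"
  have "expectation (%w. f w * (dW i s t w * dW j s t w))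
    = expectation (%w. f w * (dW i s (s+h) w * dW j s (s+h) w)
     + (f w * (dW i s (s+h) w * dW j (s+h) t w) + (f w * (dW i (s+h) t w * dW j s (s+h) w)
     + f w * (dW i (s+h) t w * dW j (s+h) t w))))"
   by (rule Bochner_Integration.integral_cong)
     (simp_all add: dW_split[of _ s t _ "s + h"] algebra_simps)
  also have "... = ?E i s (s+h) j s (s+h) + (?E i s (s+h) j (s+h) t + (?E i (s+h) t j s (s+h) + ?E i (s+h) t j (s+h) t))"
   using h st ij by (subst Bochner_Integration.integral_add | simp add: fdi)+
  finally have eq: "expectation (%w. f w * (dW i s t w * dW j s t w)) = ..." .
  have r: "?E i (s+h) t j (s+h) t = \<delta> * (t - (s + h)) * expectation f"
   using raw_expectation_dW_dW[OF usual_measurable_raw[OF f(1)] fint ij, of "s+h" t] h st by (simp add: \<delta>_def)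
  have b1: "\<bar>?E i s (s+h) j s (s+h)\<bar> <= K * sqrt h * sqrt h"
   using bd[OF ij(1) _ _ ij(2), of s "s+h" s "s+h"] h st by simp
  have m: "K * sqrt h * sqrt (t - (s + h)) <= K * sqrt h * sqrt (t - s)"
   using h K0 by (intro mult_left_mono) auto
  have b2: "\<bar>?E i s (s+h) j (s+h) t\<bar> <= K * sqrt h * sqrt (t - s)"
   using bd[OF ij(1) _ _ ij(2), of s "s+h" "s+h" t] h st m by simp
  have b3: "\<bar>?E i (s+h) t j s (s+h)\<bar> <= K * sqrt h * sqrt (t - s)"
   using bd[OF ij(1) _ _ ij(2), of "s+h" t s "s+h"] h st m by (simp add: algebra_simps)
  have b4: "\<bar>\<delta> * h * expectation f\<bar> = \<delta> * h * \<bar>expectation f\<bar>" using h by (auto simp: \<delta>_def abs_mult)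
  show "\<bar>expectation (%w. f w * (dW i s t w * dW j s t w)) - \<delta> * (t - s) * expectation f\<bar>
    <= K * sqrt h * sqrt h + 2 * (K * sqrt h * sqrt (t - s)) + \<delta> * h * \<bar>expectation f\<bar>"
  proof -
   have "\<delta> * (t - (s + h)) * expectation f = \<delta> * (t - s) * expectation f - \<delta> * h * expectation f"
    by (simp add: algebra_simps)
   then show ?thesis using b1 b2 b3 b4 unfolding eq r by linarith
  qed
 qed
 then show ?thesis by (simp add: \<delta>_def)
qed

text \<open>Here \<open>f\<close> is known at \<open>c\<close>, the later of the two starting times.
  Cutting both intervals at \<open>c\<close> and at the earlier end point leaves products over
  consecutive intervals, which have mean zero by \<open>zero\<close>, and the product over the
  common interval.\<close>

lemma expectation_dW_overlap_aux:
 assumes f: "f : borel_measurable (Fl c)" "!!w. w : space M ==> \<bar>f w\<bar> <= K"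
  and ij: "i : J" "j : J" and ab: "0 <= a" "a <= b" "a <= c" "c <= d"
 shows "expectation (%w. f w * (dW i a b w * dW j c d w)) = (if i = j then max 0 (min b d - c) else 0) * expectation f"
proof -
 have fM: "f : borel_measurable M" using f(1) by (rule usual_measurable_M)
 have fd: "L2_fun M (%w. f w * dW l a b w)" if "l : J" "0 <= a" "a <= b" for l a b
  using L2_fun_bounded_scaleR[OF dW_moments(1)[OF that] fM f(2)] by simp
 have fdi: "integrable M (%w. f w * (dW l a b w * dW m a' b' w))"
  if "l : J" "0 <= a" "a <= b" "m : J" "0 <= a'" "a' <= b'" for l a b m a' b'
  using L2_mult_integrable[OF fd[OF that(1-3)] dW_moments(1)[OF that(4-6)]] by (simp add: mult.assoc)
 have zero: "expectation (%w. f w * (dW l a b w * dW m c' d' w)) = 0"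
  if "l : J" "0 <= a" "a <= b" "m : J" "c <= c'" "b <= c'" "c' <= d'" for l a b m c' d'
  using expectation_mult_dW[of "%w. f w * dW l a b w" c' m d'] that ab
   fd[OF that(1-3)] dW_adapted[of l a c' b] usual_measurable_mono[OF f(1), of c']
  by (simp add: mult.assoc)
 show ?thesis
 proof (cases "b <= c")
  case True
  then show ?thesis using zero[of i a b j c d] ij ab by simp
 next
  case False
  define e where "e = min b d"
  have e: "c <= e" "e <= b" "e <= d" using False ab by (auto simp: e_def)
  \<comment> \<open>As \<open>e\<close> is the earlier of the two end points, at least one of the
    two remaining pieces is degenerate.\<close>
  have z: "dW i e b w * dW j e d w = 0" for w by (auto simp: e_def dW_def min_def)
  let ?E = "%l a b m a' b'. expectation (%w. f w * (dW l a b w * dW m a' b' w))"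
  have "expectation (%w. f w * (dW i a b w * dW j c d w))
   = expectation (%w. f w * (dW i a c w * dW j c d w) + (f w * (dW i c e w * dW j c e w)
     + (f w * (dW i c e w * dW j e d w) + f w * (dW j c e w * dW i e b w))))"
  proof (rule Bochner_Integration.integral_cong)
   fix w
   have 1: "dW i a b w = dW i a c w + dW i c e w + dW i e b w" "dW j c d w = dW j c e w + dW j e d w"
    by (auto simp: dW_def)
   have "f w * (dW i a b w * dW j c d w) = f w * (dW i a c w * dW j c d w) + f w * ((dW i c e w + dW i e b w) * dW j c d w)"
    unfolding 1(1) by (simp add: algebra_simps)
   also have "(dW i c e w + dW i e b w) * dW j c d w = dW i c e w * dW j c e w + (dW i c e w * dW j e d w + dW j c e w * dW i e b w)"
    unfolding 1(2) using z[of w] by (simp add: algebra_simps)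
   finally show "f w * (dW i a b w * dW j c d w) = f w * (dW i a c w * dW j c d w) + (f w * (dW i c e w * dW j c e w)
     + (f w * (dW i c e w * dW j e d w) + f w * (dW j c e w * dW i e b w)))"
    by (simp add: algebra_simps)
  qed simp
  also have "... = ?E i a c j c d + (?E i c e j c e + (?E i c e j e d + ?E j c e i e b))"
   using e ab ij by (subst Bochner_Integration.integral_add | simp add: fdi)+
  also have "?E i a c j c d = 0" using zero[of i a c j c d] ij ab by simp
  also have "?E i c e j e d = 0" using zero[of i c e j e d] ij ab e by simp
  also have "?E j c e i e b = 0" using zero[of j c e i e b] ij ab e by simp
  also have "?E i c e j c e = (if i = j then e - c else 0) * expectation f"
   by (rule expectation_mult_dW_dW[OF f ij]) (use ab e in auto)
  finally show ?thesis using e by (simp add: e_def)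
 qed
qed

lemma expectation_dW_overlap:
 assumes f: "f : borel_measurable (Fl (max a c))" "!!w. w : space M ==> \<bar>f w\<bar> <= K"
  and ij: "i : J" "j : J" and ab: "0 <= a" "a <= b" "0 <= c" "c <= d"
 shows "expectation (%w. f w * (dW i a b w * dW j c d w))
  = (if i = j then max 0 (min b d - max a c) else 0) * expectation f"
proof (cases "a <= c")
 case True
 then show ?thesis using expectation_dW_overlap_aux[of f c K i j a b d] f ij ab by (simp add: max_def)
next
 case False
 then show ?thesis using expectation_dW_overlap_aux[of f a K j i c d b] f ij ab
  by (simp add: max_def min.commute mult.commute[of "dW i a b _"])
qed

end

section \<open>Ito integrals\<close>

text \<open>Sample point first, time second, with time restricted to [0, t]. Processes become
  functions on one product space, finite over a probability space, so their L2 theory is that of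
  \<open>L2_fun\<close>.\<close>

definition horizon :: "'w measure => real => ('w \<times> real) measure" where
 "horizon M t = M \<Otimes>\<^sub>M restrict_space lborel {0..t}"

definition L2_proc :: "'w measure => real => (real => 'w => 'v::euclidean_space) => bool" where
 "L2_proc M t u \<longleftrightarrow> L2_fun (horizon M t) (%(w, s). u s w)"

lemma finite_measure_restrict_lborel: "finite_measure (restrict_space lborel {0..t::real})"
 by (rule finite_measureI) (simp add: emeasure_restrict_space space_restrict_space emeasure_lborel_Icc_eq)

lemma horizon_measurable_mono:
 assumes "s <= t" "f : measurable (horizon M t) N"
 shows "f : measurable (horizon M s) N"
proof -
 have "(%x. x) : measurable (restrict_space lborel {0..s}) (restrict_space lborel {0..t})"
  by (rule measurable_restrict_space2) (use assms in \<open>auto simp: space_restrict_space intro!: measurable_restrict_space1\<close>)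
 then have "(%x. (fst x, snd x)) : measurable (horizon M s) (horizon M t)"
  unfolding horizon_def
  by (intro measurable_Pair measurable_fst) (rule measurable_compose[OF measurable_snd])
 from measurable_compose[OF this assms(2)] show ?thesis by simp
qed

lemma energy_mono: "s <= t ==> energy M {0..s} u <= energy M {0..t} u"
 unfolding energy_def by (intro nn_integral_mono mult_left_mono) (auto simp: indicator_def)

lemma energy_horizon:
 fixes u :: "real => 'w => 'v::euclidean_space"
 assumes "(%(w, s). u s w) : borel_measurable (horizon M t)"
 shows "energy M {0..t} u = sqn (horizon M t) (%x. case x of (w, s) => u s w)"
proof -
 interpret R: finite_measure "restrict_space lborel {0..t}" by (rule finite_measure_restrict_lborel)
 have "sqn (horizon M t) (%x. case x of (w, s) => u s w)
  = (\<integral>\<^sup>+w. sqn (restrict_space lborel {0..t}) (%s. u s w) \<partial>M)"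
  unfolding horizon_def
  by (subst R.nn_integral_fst[symmetric]) (use assms in \<open>simp_all add: horizon_def\<close>)
 also have "... = energy M {0..t} u"
  unfolding energy_def by (simp add: nn_integral_restrict_space)
 finally show ?thesis by simp
qed

lemma L2_proc_iff_energy:
 "L2_proc M t u \<longleftrightarrow> (%(w, s). u s w) : borel_measurable (horizon M t) \<and> energy M {0..t} u < \<infinity>"
 unfolding L2_proc_def L2_fun_iff using energy_horizon[of u M t] by auto

lemma L2_proc_mono: "L2_proc M t u ==> s <= t ==> L2_proc M s u"
 unfolding L2_proc_iff_energy
 using horizon_measurable_mono[of s t _ M borel] le_less_trans[OF energy_mono[of s t M u]] by blast

lemma L2_tendsto_energy:
 fixes u :: "real => 'w => 'v::euclidean_space"
 assumes "(%(w, s). u s w) : borel_measurable (horizon M t)"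
  "!!n. (%(w, s). v n s w) : borel_measurable (horizon M t)"
 shows "L2_tendsto (horizon M t) (%n (w, s). v n s w) (%(w, s). u s w)
  \<longleftrightarrow> (%n. energy M {0..t} (%s w. u s w - v n s w)) \<longlonglongrightarrow> 0"
proof -
 have "energy M {0..t} (%s w. u s w - v n s w)
   = sqn (horizon M t) (%x. (case x of (w, s) => u s w) - (case x of (w, s) => v n s w))" for n
  by (subst energy_horizon)
    (use borel_measurable_diff[OF assms(1) assms(2)[of n]] in \<open>simp_all add: case_prod_beta'\<close>)
 then show ?thesis unfolding L2_tendsto_def by simp
qed

lemma energy_add_le:
 fixes u v :: "real => 'w => 'v::euclidean_space"
 assumes "(%(w, s). u s w) : borel_measurable (horizon M t)"
  "(%(w, s). v s w) : borel_measurable (horizon M t)"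
 shows "energy M {0..t} (%s w. u s w + v s w) <= 2 * energy M {0..t} u + 2 * energy M {0..t} v"
 using nn_integral_square_add_le[OF assms] borel_measurable_add[OF assms]
 by (simp add: energy_horizon[OF assms(1)] energy_horizon[OF assms(2)] energy_horizon case_prod_beta')

lemma overlap_length:
 fixes a b c d t :: real
 assumes "0 <= a" "0 <= c"
 shows "measure lborel ({0..t} \<inter> {a<..b} \<inter> {c<..d}) = max 0 (min (min b t) (min d t) - max (min a t) (min c t))"
proof -
 have "{0..t} \<inter> {a<..b} \<inter> {c<..d} = {max a c<..min (min b d) t}"
  using assms by auto
 moreover have "measure lborel {x<..y} = max 0 (y - x)" for x y :: real
  by (cases "x <= y") auto
 ultimately show ?thesis by (auto simp: min_def max_def)
qed

lemma inner_sum_sum: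
 "(\<Sum>l\<in>A. a l) \<bullet> (\<Sum>m\<in>B. b m) = (\<Sum>l\<in>A. \<Sum>m\<in>B. a l \<bullet> (b m :: 'v::real_inner))"
 unfolding inner_sum_left by (simp only: inner_sum_right)

context brownian_space begin

lemma pair_sigma_finite_horizon: "pair_sigma_finite M (restrict_space lborel {0..t::real})"
proof -
 interpret R: finite_measure "restrict_space lborel {0..t}" by (rule finite_measure_restrict_lborel)
 show ?thesis ..
qed

lemma finite_measure_horizon: "finite_measure (horizon M t)"
 unfolding horizon_def by (intro finite_measure_pair_measure finite_measure_restrict_lborel finite_measure_axioms)

lemma horizon_integral_product:
 fixes f :: "'w => real" and g :: "real => real"
 assumes f: "f : borel_measurable M" "!!w. w : space M ==> \<bar>f w\<bar> <= K"
  and g: "g : borel_measurable borel" "!!s. \<bar>g s\<bar> <= L"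
 shows "integrable (horizon M t) (%(w, s). g s * f w)"
  and "(\<integral>(w, s). g s * f w \<partial>horizon M t) = (LINT s:{0..t}|lborel. g s) * expectation f"
proof -
 interpret pair_sigma_finite M "restrict_space lborel {0..t}" by (rule pair_sigma_finite_horizon)
 interpret H: finite_measure "horizon M t" by (rule finite_measure_horizon)
 have gm: "g : borel_measurable (restrict_space lborel {0..t})"
  using g(1) by (intro measurable_restrict_space1) simp
 have m: "(%(w, s). g s * f w) : borel_measurable (horizon M t)"
  unfolding horizon_def using measurable_compose[OF measurable_fst f(1)] measurable_compose[OF measurable_snd gm]
  unfolding case_prod_beta' by (intro borel_measurable_times)
 show int: "integrable (horizon M t) (%(w, s). g s * f w)"
 proof (rule H.integrable_const_bound[OF _ m, of "L * K"])
  have "norm (g s * f w) <= L * K" if "w : space M" for w s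
   unfolding real_norm_def abs_mult by (rule mult_mono) (use that f(2)[OF that] g(2)[of s] in auto)
  then show "AE x in horizon M t. norm (case x of (w, s) => g s * f w) <= L * K"
   by (intro AE_I2) (auto simp: horizon_def space_pair_measure)
 qed
 have "(\<integral>(w, s). g s * f w \<partial>horizon M t) = (\<integral>w. (\<integral>s. g s * f w \<partial>restrict_space lborel {0..t}) \<partial>M)"
  unfolding horizon_def by (rule integral_fst[symmetric]) (use int in \<open>simp add: horizon_def\<close>)
 then show "(\<integral>(w, s). g s * f w \<partial>horizon M t) = (LINT s:{0..t}|lborel. g s) * expectation f"
  by (simp add: integral_restrict_space set_lebesgue_integral_def)
qed

lemma simple_processD:
 assumes "simple_process M Fl k \<tau> \<eta>"
 shows "0 <= \<tau> l" "\<tau> l <= \<tau> (Suc l)" "l < k ==> \<eta> l : borel_measurable (Fl (\<tau> l))"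
  "l < k ==> \<eta> l : borel_measurable M"
  "l < k ==> \<exists>K. \<forall>w\<in>space M. norm (\<eta> l w) <= K"
proof -
 show "0 <= \<tau> l" "\<tau> l <= \<tau> (Suc l)"
  using assms monoD[of \<tau> 0 l] monoD[of \<tau> l "Suc l"] unfolding simple_process_def by auto
 show m: "l < k ==> \<eta> l : borel_measurable (Fl (\<tau> l))" using assms unfolding simple_process_def by auto
 show "l < k ==> \<eta> l : borel_measurable M" using usual_measurable_M[OF m] .
 show "l < k ==> \<exists>K. \<forall>w\<in>space M. norm (\<eta> l w) <= K"
  using assms unfolding simple_process_def bounded_iff by auto
qed

lemma simple_integral_dW:
 "simple_integral (W j) k \<tau> \<eta> t w = (\<Sum>l<k. dW j (min (\<tau> l) t) (min (\<tau> (Suc l)) t) w *\<^sub>R \<eta> l w)"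
 by (simp add: simple_integral_def dW_def)

lemma bounded_dW_L2:
 fixes \<eta> :: "'w => 'v::euclidean_space"
 assumes "\<eta> : borel_measurable M" "\<exists>K. \<forall>w\<in>space M. norm (\<eta> w) <= K" "j : J" "0 <= a" "a <= b"
 shows "L2_fun M (%w. dW j a b w *\<^sub>R \<eta> w)"
proof -
 obtain K where K: "!!w. w : space M ==> norm (\<eta> w) <= K" using assms(2) by auto
 have m: "dW j a b : borel_measurable M" by (rule dW_measurable) (use assms in auto)
 show ?thesis
  by (rule L2_fun_bound[OF dW_moments(1)[OF assms(3-5)], where c=K])
    (use m assms(1) K in \<open>auto simp: mult.commute intro!: mult_right_mono\<close>)
qed

lemma simple_integral_L2:
 assumes s: "simple_process M Fl k \<tau> \<eta>" and j: "j : J" and t: "0 <= t"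
 shows "L2_fun M (simple_integral (W j) k \<tau> \<eta> t :: 'w => 'v::euclidean_space)"
 unfolding simple_integral_dW[abs_def]
 using simple_processD[OF s] j t by (intro L2_fun_sum bounded_dW_L2) (auto simp: min.coboundedI1)

lemma simple_value_horizon_measurable:
 assumes s: "simple_process M Fl k \<tau> \<eta>"
 shows "(%(w, s). simple_value k \<tau> \<eta> s w :: 'v::euclidean_space) : borel_measurable (horizon M t)"
proof -
 have "(%x. indicator {\<tau> l<..\<tau> (Suc l)} (snd x) *\<^sub>R \<eta> l (fst x)) : borel_measurable (horizon M t)" if "l < k" for l
  unfolding horizon_def
  using measurable_compose[OF measurable_fst simple_processD(4)[OF s that]]
   measurable_compose[OF measurable_snd measurable_restrict_space1[of "indicator {\<tau> l<..\<tau> (Suc l)} :: real => real" lborel borel "{0..t}"]]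
  by (intro borel_measurable_scaleR) auto
 then show ?thesis
  unfolding simple_value_def case_prod_beta' by (intro borel_measurable_sum) auto
qed

lemma simple_value_L2_proc:
 assumes s: "simple_process M Fl k \<tau> \<eta>"
 shows "L2_proc M t (simple_value k \<tau> \<eta> :: real => 'w => 'v::euclidean_space)"
proof -
 have "\<forall>l\<in>{..<k}. \<exists>K. \<forall>w\<in>space M. norm (\<eta> l w) <= K" using simple_processD(5)[OF s] by auto
 then obtain K where K: "!!l w. l < k ==> w : space M ==> norm (\<eta> l w) <= K l" by (metis lessThan_iff)
 have bd: "norm (simple_value k \<tau> \<eta> s w) <= (\<Sum>l<k. K l)" if "w : space M" for s w
  unfolding simple_value_def
 proof (rule sum_norm_le)
  fix l assume l: "l : {..<k}"
  then have "norm (\<eta> l w) <= K l" using K[of l w] that by auto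
  moreover from this have "0 <= K l" using norm_ge_zero[of "\<eta> l w"] by linarith
  ultimately show "norm (indicat_real {\<tau> l<..\<tau> (Suc l)} s *\<^sub>R \<eta> l w) <= K l"
   by (auto simp: indicator_def)
 qed
 show ?thesis unfolding L2_proc_def
  by (rule L2_fun_bounded[OF finite_measure_horizon simple_value_horizon_measurable[OF s], where c="\<Sum>l<k. K l"])
    (auto simp: horizon_def space_pair_measure intro: bd)
qed

text \<open>After expansion the pair (l, m) contributes the length of the overlap of the two
  intervals inside [0, t] times the mean of the inner product of \<open>\<eta> l\<close> and
  \<open>\<theta> m\<close>. Integrating the product of the step functions yields the same numbers,
  so no common refinement of the two partitions is formed.\<close>

lemma simple_integral_isometry:
 fixes \<eta> \<theta> :: "nat => 'w => 'v::euclidean_space"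
 assumes s: "simple_process M Fl k \<tau> \<eta>" and s': "simple_process M Fl k' \<tau>' \<theta>" and ij: "i : J" "j : J" and t: "0 <= t"
 shows "expectation (%w. simple_integral (W i) k \<tau> \<eta> t w \<bullet> simple_integral (W j) k' \<tau>' \<theta> t w)
  = (if i = j then \<integral>(w, s). simple_value k \<tau> \<eta> s w \<bullet> simple_value k' \<tau>' \<theta> s w \<partial>horizon M t else 0)"
proof -
 note D = simple_processD[OF s] and D' = simple_processD[OF s']
 define ov where "ov l m = max 0 (min (min (\<tau> (Suc l)) t) (min (\<tau>' (Suc m)) t) - max (min (\<tau> l) t) (min (\<tau>' m) t))" for l m
 let ?a = "%l. dW i (min (\<tau> l) t) (min (\<tau> (Suc l)) t)" and ?b = "%m. dW j (min (\<tau>' m) t) (min (\<tau>' (Suc m)) t)"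
 have tl: "0 <= min (\<tau> l) t" "min (\<tau> l) t <= min (\<tau> (Suc l)) t" "0 <= min (\<tau>' l) t" "min (\<tau>' l) t <= min (\<tau>' (Suc l)) t" for l
  using D(1,2)[of l] D'(1,2)[of l] t by auto
 have m: "(%w. \<eta> l w \<bullet> \<theta> m w) : borel_measurable M" if "l < k" "m < k'" for l m
  using D(4)[OF that(1)] D'(4)[OF that(2)] by (rule borel_measurable_inner)
 have bnd: "\<exists>K. \<forall>w\<in>space M. \<bar>\<eta> l w \<bullet> \<theta> m w\<bar> <= K" if lm: "l < k" "m < k'" for l m
 proof -
  obtain K K' where K: "\<forall>w\<in>space M. norm (\<eta> l w) <= K" "\<forall>w\<in>space M. norm (\<theta> m w) <= K'"
   using D(5)[OF lm(1)] D'(5)[OF lm(2)] by auto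
  have "\<bar>\<eta> l w \<bullet> \<theta> m w\<bar> <= K * K'" if "w : space M" for w
  proof -
   have "\<bar>\<eta> l w \<bullet> \<theta> m w\<bar> <= norm (\<eta> l w) * norm (\<theta> m w)" by (rule Cauchy_Schwarz_ineq2)
   also have "... <= K * K'"
    by (rule mult_mono) (use K that norm_ge_zero[of "\<eta> l w"] order_trans in \<open>auto, blast\<close>)
   finally show ?thesis .
  qed
  then show ?thesis by auto
 qed
 have trm: "expectation (%w. (?a l w *\<^sub>R \<eta> l w) \<bullet> (?b m w *\<^sub>R \<theta> m w)) = (if i = j then ov l m else 0) * expectation (%w. \<eta> l w \<bullet> \<theta> m w)"
  if lm: "l < k" "m < k'" for l m
 \<comment> \<open>The factor \<open>\<eta> l\<close> is known at \<open>\<tau> l\<close>, whereas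
   the truncated increment starts at \<open>min (\<tau> l) t\<close>. For
   \<open>\<tau> l < t\<close> these agree; otherwise the increment is zero and so is the
   overlap.\<close>
 proof (cases "\<tau> l < t \<and> \<tau>' m < t")
  case True
  obtain K where K: "!!w. w : space M ==> \<bar>\<eta> l w \<bullet> \<theta> m w\<bar> <= K" using bnd[OF lm] by auto
  have "\<eta> l : borel_measurable (Fl (max (\<tau> l) (\<tau>' m)))" "\<theta> m : borel_measurable (Fl (max (\<tau> l) (\<tau>' m)))"
   using usual_measurable_mono[OF D(3)[OF lm(1)]] usual_measurable_mono[OF D'(3)[OF lm(2)]] by auto
  then have "(%w. \<eta> l w \<bullet> \<theta> m w) : borel_measurable (Fl (max (min (\<tau> l) t) (min (\<tau>' m) t)))"
   using True by (simp add: borel_measurable_inner)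
  from expectation_dW_overlap[OF this K ij tl(1,2) tl(3,4)] show ?thesis
   by (simp add: ov_def algebra_simps)
 next
  case False
  then consider "t <= \<tau> l" | "t <= \<tau>' m" by linarith
  then have eq: "min (\<tau> l) t = min (\<tau> (Suc l)) t \<or> min (\<tau>' m) t = min (\<tau>' (Suc m)) t"
   using D(2)[of l] D'(2)[of m] by cases (simp_all add: min_absorb2)
  then have "?a l w * ?b m w = 0" for w by (auto simp: dW_def)
  then have z: "(?a l w *\<^sub>R \<eta> l w) \<bullet> (?b m w *\<^sub>R \<theta> m w) = 0" for w
   by (auto simp: mult.assoc[symmetric])
  have "max 0 (min x y - max u v) = 0" if "u = x \<or> v = y" for x y u v :: real
   using that by (auto simp: max_def min_def)
  then have "ov l m = 0" using eq unfolding ov_def by blast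
  then show ?thesis unfolding z by simp
 qed
 have L: "L2_fun M (%w. ?a l w *\<^sub>R \<eta> l w)" if "l < k" for l
  using D(4,5)[OF that] ij tl by (intro bounded_dW_L2)
 have L': "L2_fun M (%w. ?b m w *\<^sub>R \<theta> m w)" if "m < k'" for m
  using D'(4,5)[OF that] ij tl by (intro bounded_dW_L2)
 have "expectation (%w. simple_integral (W i) k \<tau> \<eta> t w \<bullet> simple_integral (W j) k' \<tau>' \<theta> t w)
  = expectation (%w. \<Sum>l<k. \<Sum>m<k'. (?a l w *\<^sub>R \<eta> l w) \<bullet> (?b m w *\<^sub>R \<theta> m w))"
  unfolding simple_integral_dW inner_sum_sum ..
 also have "... = (\<Sum>l<k. \<Sum>m<k'. expectation (%w. (?a l w *\<^sub>R \<eta> l w) \<bullet> (?b m w *\<^sub>R \<theta> m w)))"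
  by (subst Bochner_Integration.integral_sum;
    intro sum.cong refl Bochner_Integration.integral_sum Bochner_Integration.integrable_sum L2_inner_integrable L L'; simp)
 also have "... = (\<Sum>l<k. \<Sum>m<k'. (if i = j then ov l m else 0) * expectation (%w. \<eta> l w \<bullet> \<theta> m w))"
  by (intro sum.cong refl trm) auto
 finally have lhs: "expectation (%w. simple_integral (W i) k \<tau> \<eta> t w \<bullet> simple_integral (W j) k' \<tau>' \<theta> t w)
  = (if i = j then (\<Sum>l<k. \<Sum>m<k'. ov l m * expectation (%w. \<eta> l w \<bullet> \<theta> m w)) else 0)" by simp
 let ?g = "%l m s. indicat_real {\<tau> l<..\<tau> (Suc l)} s * indicat_real {\<tau>' m<..\<tau>' (Suc m)} s"
 have gm: "?g l m : borel_measurable borel" "\<bar>?g l m s\<bar> <= 1" for l m s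
  by (auto simp: indicator_def)
 have gi: "(LINT s:{0..t}|lborel. ?g l m s) = ov l m" for l m
 proof -
  have "(LINT s:{0..t}|lborel. ?g l m s) = (LINT s|lborel. indicator ({0..t} \<inter> {\<tau> l<..\<tau> (Suc l)} \<inter> {\<tau>' m<..\<tau>' (Suc m)}) s)"
   unfolding set_lebesgue_integral_def by (rule Bochner_Integration.integral_cong) (auto simp: indicator_def)
  also have "... = measure lborel ({0..t} \<inter> {\<tau> l<..\<tau> (Suc l)} \<inter> {\<tau>' m<..\<tau>' (Suc m)})" by simp
  also have "... = ov l m" unfolding ov_def by (rule overlap_length) (use D(1) D'(1) in auto)
  finally show ?thesis .
 qed
 have i2: "integrable (horizon M t) (%x. ?g l m (snd x) * (\<eta> l (fst x) \<bullet> \<theta> m (fst x)))"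
  "(\<integral>x. ?g l m (snd x) * (\<eta> l (fst x) \<bullet> \<theta> m (fst x)) \<partial>horizon M t) = ov l m * expectation (%w. \<eta> l w \<bullet> \<theta> m w)"
  if lm: "l < k" "m < k'" for l m
 proof -
  obtain K where K: "!!w. w : space M ==> \<bar>\<eta> l w \<bullet> \<theta> m w\<bar> <= K" using bnd[OF lm] by auto
  show "integrable (horizon M t) (%x. ?g l m (snd x) * (\<eta> l (fst x) \<bullet> \<theta> m (fst x)))"
   "(\<integral>x. ?g l m (snd x) * (\<eta> l (fst x) \<bullet> \<theta> m (fst x)) \<partial>horizon M t) = ov l m * expectation (%w. \<eta> l w \<bullet> \<theta> m w)"
   using horizon_integral_product[OF m[OF lm] K gm, of t] gi by (simp_all add: case_prod_beta')
 qed
 have "(\<integral>(w, s). simple_value k \<tau> \<eta> s w \<bullet> simple_value k' \<tau>' \<theta> s w \<partial>horizon M t)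
  = (\<integral>x. (\<Sum>l<k. \<Sum>m<k'. ?g l m (snd x) * (\<eta> l (fst x) \<bullet> \<theta> m (fst x))) \<partial>horizon M t)"
  unfolding simple_value_def case_prod_beta' inner_sum_sum
  by (simp only: inner_scaleR_left inner_scaleR_right mult_ac)
 also have "... = (\<Sum>l<k. \<Sum>m<k'. \<integral>x. ?g l m (snd x) * (\<eta> l (fst x) \<bullet> \<theta> m (fst x)) \<partial>horizon M t)"
  by (subst Bochner_Integration.integral_sum;
    intro sum.cong refl Bochner_Integration.integral_sum Bochner_Integration.integrable_sum i2; simp)
 also have "... = (\<Sum>l<k. \<Sum>m<k'. ov l m * expectation (%w. \<eta> l w \<bullet> \<theta> m w))"
  by (intro sum.cong refl i2) auto
 finally show ?thesis unfolding lhs by simp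
qed

section \<open>Ito integrals: isometry, linearity, orthogonality and limits\<close>

abbreviation "ito j \<equiv> has_ito_integral M Fl (W j)"

lemma ito_approx:
 fixes H :: "real => 'w => 'v::euclidean_space"
 assumes "ito j t H Z" "L2_proc M t H" "j : J" "0 <= t"
 obtains k \<tau> \<eta> where "!!n. simple_process M Fl (k n) (\<tau> n) (\<eta> n)"
  "L2_tendsto (horizon M t) (%n (w, s). simple_value (k n) (\<tau> n) (\<eta> n) s w) (%(w, s). H s w)"
  "L2_tendsto M (%n. simple_integral (W j) (k n) (\<tau> n) (\<eta> n) t) Z" "L2_fun M Z"
proof -
 obtain k \<tau> \<eta> where s: "!!n. simple_process M Fl (k n) (\<tau> n) (\<eta> n)"
  and e: "(%n. energy M {0..t} (%s w. H s w - simple_value (k n) (\<tau> n) (\<eta> n) s w)) \<longlonglongrightarrow> 0"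
  and z: "L2_tendsto M (%n. simple_integral (W j) (k n) (\<tau> n) (\<eta> n) t) Z"
  using assms(1) unfolding has_ito_integral_def L2_tendsto_def by auto
 have H: "(%(w, s). H s w) : borel_measurable (horizon M t)" using assms(2) by (simp add: L2_proc_iff_energy)
 have Zm: "Z : borel_measurable M" using assms(1) by (simp add: has_ito_integral_def)
 show thesis
 proof (rule that[OF s _ z L2_tendsto_L2[OF z simple_integral_L2[OF s assms(3,4)] Zm]])
  show "L2_tendsto (horizon M t) (%n (w, s). simple_value (k n) (\<tau> n) (\<eta> n) s w) (%(w, s). H s w)"
   by (rule L2_tendsto_energy[THEN iffD2, OF H simple_value_horizon_measurable[OF s] e])
 qed
qed

lemma ito_L2:
 fixes H :: "real => 'w => 'v::euclidean_space"
 assumes "ito j t H Z" "L2_proc M t H" "j : J" "0 <= t" shows "L2_fun M Z"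
 by (rule ito_approx[OF assms])

text \<open>Polarized, and for two Brownian motions at once: the covariance of two agents pairs
  different integrands, and the value 0 for distinct motions separates their own noises.\<close>

lemma ito_isometry:
 fixes H K :: "real => 'w => 'v::euclidean_space"
 assumes i: "ito i t H Z" "L2_proc M t H" "i : J" and j: "ito j t K V" "L2_proc M t K" "j : J" and t: "0 <= t"
 shows "expectation (%w. Z w \<bullet> V w) = (if i = j then \<integral>(w, s). H s w \<bullet> K s w \<partial>horizon M t else 0)"
proof -
 obtain k \<tau> \<eta> where 1: "!!n. simple_process M Fl (k n) (\<tau> n) (\<eta> n)"
  "L2_tendsto (horizon M t) (%n (w, s). simple_value (k n) (\<tau> n) (\<eta> n) s w) (%(w, s). H s w)"
  "L2_tendsto M (%n. simple_integral (W i) (k n) (\<tau> n) (\<eta> n) t) Z" "L2_fun M Z"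
  by (rule ito_approx[OF i t]) (rule that)
 obtain k' \<tau>' \<theta> where 2: "!!n. simple_process M Fl (k' n) (\<tau>' n) (\<theta> n)"
  "L2_tendsto (horizon M t) (%n (w, s). simple_value (k' n) (\<tau>' n) (\<theta> n) s w) (%(w, s). K s w)"
  "L2_tendsto M (%n. simple_integral (W j) (k' n) (\<tau>' n) (\<theta> n) t) V" "L2_fun M V"
  by (rule ito_approx[OF j t]) (rule that)
 have a: "(%n. expectation (%w. simple_integral (W i) (k n) (\<tau> n) (\<eta> n) t w \<bullet> simple_integral (W j) (k' n) (\<tau>' n) (\<theta> n) t w))
   \<longlonglongrightarrow> expectation (%w. Z w \<bullet> V w)"
  by (intro L2_tendsto_inner simple_integral_L2 1 2 i j t)
 have b: "(%n. \<integral>x. (case x of (w, s) => simple_value (k n) (\<tau> n) (\<eta> n) s w) \<bullet> (case x of (w, s) => simple_value (k' n) (\<tau>' n) (\<theta> n) s w) \<partial>horizon M t)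
   \<longlonglongrightarrow> (\<integral>x. (case x of (w, s) => H s w) \<bullet> (case x of (w, s) => K s w) \<partial>horizon M t)"
  by (intro L2_tendsto_inner 1 2 i(2)[unfolded L2_proc_def] j(2)[unfolded L2_proc_def]
    simple_value_L2_proc[OF 1(1), unfolded L2_proc_def] simple_value_L2_proc[OF 2(1), unfolded L2_proc_def])
 show ?thesis
 proof (cases "i = j")
  case True
  have "(%n. expectation (%w. simple_integral (W i) (k n) (\<tau> n) (\<eta> n) t w \<bullet> simple_integral (W j) (k' n) (\<tau>' n) (\<theta> n) t w))
   \<longlonglongrightarrow> (\<integral>x. (case x of (w, s) => H s w) \<bullet> (case x of (w, s) => K s w) \<partial>horizon M t)"
   using b unfolding simple_integral_isometry[OF 1(1) 2(1) i(3) j(3) t] if_P[OF True]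
   by (simp add: case_prod_beta')
  from LIMSEQ_unique[OF a this] True show ?thesis by (simp add: case_prod_beta')
 next
  case False
  then have "(%n. expectation (%w. simple_integral (W i) (k n) (\<tau> n) (\<eta> n) t w \<bullet> simple_integral (W j) (k' n) (\<tau>' n) (\<theta> n) t w)) \<longlonglongrightarrow> 0"
   by (simp add: simple_integral_isometry[OF 1(1) 2(1) i(3) j(3) t])
  from LIMSEQ_unique[OF a this] False show ?thesis by simp
 qed
qed

text \<open>The square is expanded and the polarized isometry is applied to each of the three terms,
  so additivity of the integral is not involved.\<close>

lemma ito_isometry_diff:
 fixes H K :: "real => 'w => 'v::euclidean_space"
 assumes i: "ito j t H Z" "L2_proc M t H" and k: "ito j t K V" "L2_proc M t K" and j: "j : J" and t: "0 <= t"
 shows "expectation (%w. (norm (Z w - V w))\<^sup>2) = (\<integral>(w, s). (norm (H s w - K s w))\<^sup>2 \<partial>horizon M t)"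
  and "sqn M (%w. Z w - V w) = energy M {0..t} (%s w. H s w - K s w)"
proof -
 have L: "L2_fun M Z" "L2_fun M V" using ito_L2[OF i j t] ito_L2[OF k j t] .
 have P: "L2_fun (horizon M t) (%x. case x of (w, s) => H s w)" "L2_fun (horizon M t) (%x. case x of (w, s) => K s w)"
  using i(2) k(2) by (auto simp: L2_proc_def)
 have sq: "(norm (a - b))^2 = a \<bullet> a - 2 * (a \<bullet> b) + b \<bullet> b" for a b :: 'v
  by (simp add: power2_norm_eq_inner inner_diff_left inner_diff_right inner_commute)
 have "expectation (%w. (norm (Z w - V w))\<^sup>2) = expectation (%w. Z w \<bullet> Z w) - 2 * expectation (%w. Z w \<bullet> V w) + expectation (%w. V w \<bullet> V w)"
  unfolding sq using L by (simp add: L2_inner_integrable)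
 also have "... = (\<integral>x. (case x of (w, s) => H s w) \<bullet> (case x of (w, s) => H s w) \<partial>horizon M t)
   - 2 * (\<integral>x. (case x of (w, s) => H s w) \<bullet> (case x of (w, s) => K s w) \<partial>horizon M t)
   + (\<integral>x. (case x of (w, s) => K s w) \<bullet> (case x of (w, s) => K s w) \<partial>horizon M t)"
  using ito_isometry[OF i j i j t] ito_isometry[OF i j k j t] ito_isometry[OF k j k j t]
  by (simp add: case_prod_beta')
 also have "... = (\<integral>x. (norm ((case x of (w, s) => H s w) - (case x of (w, s) => K s w)))\<^sup>2 \<partial>horizon M t)"
  unfolding sq using P by (simp add: L2_inner_integrable)
 finally show 1: "expectation (%w. (norm (Z w - V w))\<^sup>2) = (\<integral>(w, s). (norm (H s w - K s w))\<^sup>2 \<partial>horizon M t)"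
  by (simp add: case_prod_beta')
 have D: "L2_fun (horizon M t) (%(w, s). H s w - K s w)"
  using L2_fun_diff[OF P] by (simp add: case_prod_beta')
 show "sqn M (%w. Z w - V w) = energy M {0..t} (%s w. H s w - K s w)"
  unfolding L2_fun_nn_integral[OF L2_fun_diff[OF L]] 1
  by (subst energy_horizon[OF L2_fun_measurable[OF D]], subst L2_fun_nn_integral[OF D]) (simp add: case_prod_beta')
qed

lemma ito_simple:
 fixes \<eta> :: "nat => 'w => 'v::euclidean_space"
 assumes "simple_process M Fl k \<tau> \<eta>" "j : J" "0 <= t"
 shows "ito j t (simple_value k \<tau> \<eta>) (simple_integral (W j) k \<tau> \<eta> t)"
 unfolding has_ito_integral_def
 using L2_fun_measurable[OF simple_integral_L2[OF assms]] assms(1)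
 by (intro conjI exI[of _ "%_. k"] exI[of _ "%_. \<tau>"] exI[of _ "%_. \<eta>"]) (auto simp: energy_def)

lemma ito_zero: "ito j t (%_ _. 0 :: 'v::euclidean_space) (%_. 0)"
 unfolding has_ito_integral_def
 by (intro conjI exI[of _ "%_. 0"] exI[of _ "%_ n. real n"] exI[of _ "%_ _ _. 0"])
   (auto simp: energy_def simple_process_def simple_value_def simple_integral_def mono_def)

text \<open>Applying \<open>h\<close> to the approximating simple processes multiplies both errors
  by at most C^2. The main use is for coordinates of vector-valued processes.\<close>

lemma ito_linear:
 fixes H :: "real => 'w => 'v::euclidean_space" and h :: "'v => 'u::euclidean_space"
 assumes h: "bounded_linear h" and H: "ito j t H Z" "L2_proc M t H" and j: "j : J" and t: "0 <= t"
 shows "ito j t (%s w. h (H s w)) (%w. h (Z w))"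
proof -
 interpret h: bounded_linear h by (rule h)
 obtain C where C: "0 < C" "!!x. norm (h x) <= norm x * C" using h.pos_bounded by blast
 have [measurable]: "h : borel_measurable borel"
  by (intro borel_measurable_continuous_onI linear_continuous_on h)
 obtain k \<tau> \<eta> where s: "!!n. simple_process M Fl (k n) (\<tau> n) (\<eta> n)"
  and e: "(%n. energy M {0..t} (%s w. H s w - simple_value (k n) (\<tau> n) (\<eta> n) s w)) \<longlonglongrightarrow> 0"
  and z: "(%n. sqn M (%w. Z w - simple_integral (W j) (k n) (\<tau> n) (\<eta> n) t w)) \<longlonglongrightarrow> 0"
  and Zm[measurable]: "Z : borel_measurable M"
  using H(1) unfolding has_ito_integral_def by auto
 have Sm[measurable]: "simple_integral (W j) (k n) (\<tau> n) (\<eta> n) t : borel_measurable M" for n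
  by (rule L2_fun_measurable[OF simple_integral_L2[OF s j t]])
 have Hm: "(%x. case x of (w, s) => H s w) : borel_measurable (horizon M t)" using H(2) by (simp add: L2_proc_iff_energy)
 have Dm: "(%(w, s). H s w - simple_value (k n) (\<tau> n) (\<eta> n) s w) : borel_measurable (horizon M t)" for n
  using borel_measurable_diff[OF Hm simple_value_horizon_measurable[OF s[of n]]] by (simp add: case_prod_beta')
 have hsq: "ennreal ((norm (h x))^2) <= ennreal (C\<^sup>2) * ennreal ((norm x)^2)" for x
 proof -
  have "(norm (h x))^2 <= (norm x * C)^2" by (intro power_mono C) auto
  then show ?thesis by (simp add: ennreal_mult'[symmetric] power_mult_distrib mult.commute ennreal_leI)
 qed
 have sv: "simple_value (k n) (\<tau> n) (%l w. h (\<eta> n l w)) s w = h (simple_value (k n) (\<tau> n) (\<eta> n) s w)"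
  and si: "simple_integral (W j) (k n) (\<tau> n) (%l w. h (\<eta> n l w)) t w = h (simple_integral (W j) (k n) (\<tau> n) (\<eta> n) t w)"
  for n s w by (simp_all add: simple_value_def simple_integral_def h.sum h.scaleR)
 show ?thesis
  unfolding has_ito_integral_def
 proof (intro conjI exI[of _ k] exI[of _ \<tau>] exI[of _ "%n l w. h (\<eta> n l w)"] allI)
  show "(%w. h (Z w)) : borel_measurable M" by measurable
  show "simple_process M Fl (k n) (\<tau> n) (%l w. h (\<eta> n l w))" for n
  proof -
   have "bounded ((%w. h (\<eta> n l w)) ` space M)" if "l < k n" for l
    using bounded_linear_image[OF _ h, of "\<eta> n l ` space M"] s[of n] that by (simp add: simple_process_def image_image)
   moreover have "(%w. h (\<eta> n l w)) : borel_measurable (Fl (\<tau> n l))" if "l < k n" for l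
    using simple_processD(3)[OF s that] by measurable
   ultimately show ?thesis using s[of n] by (auto simp: simple_process_def)
  qed
  show "(%n. energy M {0..t} (%s w. h (H s w) - simple_value (k n) (\<tau> n) (%l w. h (\<eta> n l w)) s w)) \<longlonglongrightarrow> 0"
  proof (rule tendsto_sandwich[OF _ _ tendsto_const])
   have "energy M {0..t} (%s w. h (H s w) - simple_value (k n) (\<tau> n) (%l w. h (\<eta> n l w)) s w)
    <= ennreal (C\<^sup>2) * energy M {0..t} (%s w. H s w - simple_value (k n) (\<tau> n) (\<eta> n) s w)" for n
   proof -
    have m2: "(%(w, s). h (H s w - simple_value (k n) (\<tau> n) (\<eta> n) s w)) : borel_measurable (horizon M t)"
     using measurable_compose[OF Dm[of n], of h borel] by (simp add: case_prod_beta')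
    have "energy M {0..t} (%s w. h (H s w - simple_value (k n) (\<tau> n) (\<eta> n) s w))
     <= (\<integral>\<^sup>+x. ennreal (C\<^sup>2) * ennreal ((norm (case x of (w, s) => H s w - simple_value (k n) (\<tau> n) (\<eta> n) s w))^2) \<partial>horizon M t)"
     unfolding energy_horizon[OF m2] by (rule nn_integral_mono) (simp add: case_prod_beta' hsq)
    also have "... = ennreal (C\<^sup>2) * energy M {0..t} (%s w. H s w - simple_value (k n) (\<tau> n) (\<eta> n) s w)"
     unfolding energy_horizon[OF Dm] by (rule nn_integral_cmult) (use Dm[of n] in measurable)
    finally show ?thesis by (simp add: sv h.diff)
   qed
   then show "\<forall>\<^sub>F n in sequentially. energy M {0..t} (%s w. h (H s w) - simple_value (k n) (\<tau> n) (%l w. h (\<eta> n l w)) s w)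
    <= ennreal (C\<^sup>2) * energy M {0..t} (%s w. H s w - simple_value (k n) (\<tau> n) (\<eta> n) s w)" by simp
   show "(%n. ennreal (C\<^sup>2) * energy M {0..t} (%s w. H s w - simple_value (k n) (\<tau> n) (\<eta> n) s w)) \<longlonglongrightarrow> 0"
    using ennreal_tendsto_cmult[OF _ e, of "ennreal (C\<^sup>2)"] by simp
  qed simp
  show "(%n. sqn M (%w. h (Z w) - simple_integral (W j) (k n) (\<tau> n) (%l w. h (\<eta> n l w)) t w)) \<longlonglongrightarrow> 0"
  proof (rule tendsto_sandwich[OF _ _ tendsto_const])
   have "sqn M (%w. h (Z w) - simple_integral (W j) (k n) (\<tau> n) (%l w. h (\<eta> n l w)) t w)
    <= ennreal (C\<^sup>2) * sqn M (%w. Z w - simple_integral (W j) (k n) (\<tau> n) (\<eta> n) t w)" for n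
    unfolding si h.diff[symmetric]
    by (subst nn_integral_cmult[symmetric]) (auto intro!: nn_integral_mono hsq)
   then show "\<forall>\<^sub>F n in sequentially. sqn M (%w. h (Z w) - simple_integral (W j) (k n) (\<tau> n) (%l w. h (\<eta> n l w)) t w)
    <= ennreal (C\<^sup>2) * sqn M (%w. Z w - simple_integral (W j) (k n) (\<tau> n) (\<eta> n) t w)" by simp
   show "(%n. ennreal (C\<^sup>2) * sqn M (%w. Z w - simple_integral (W j) (k n) (\<tau> n) (\<eta> n) t w)) \<longlonglongrightarrow> 0"
    using ennreal_tendsto_cmult[OF _ z, of "ennreal (C\<^sup>2)"] by simp
  qed simp
 qed
qed

text \<open>The difference of the integrals up to \<open>t\<close> and \<open>s\<close> is again a
  sum of increments, with the grid points clipped to [s, t]. For \<open>\<tau> l < t\<close> both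
  \<open>G\<close> and \<open>\<eta> l\<close> are known when the clipped increment starts;
  otherwise that increment is degenerate.\<close>

lemma simple_integral_orthogonal:
 fixes \<eta> :: "nat => 'w => 'v::euclidean_space"
 assumes sp: "simple_process M Fl k \<tau> \<eta>" and j: "j : J" and st: "0 <= s" "s <= t"
  and G: "G : borel_measurable (Fl s)" "L2_fun M G"
 shows "expectation (%w. G w \<bullet> (simple_integral (W j) k \<tau> \<eta> t w - simple_integral (W j) k \<tau> \<eta> s w)) = 0"
proof -
 note D = simple_processD[OF sp]
 let ?a = "%l. max (min (\<tau> l) t) s"
 have eq: "W j (min x t) w - W j (min x s) w = W j (max (min x t) s) w - W j s w" for x w
  using st by (auto simp: min_def max_def)
 have diff: "simple_integral (W j) k \<tau> \<eta> t w - simple_integral (W j) k \<tau> \<eta> s w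
  = (\<Sum>l<k. dW j (?a l) (?a (Suc l)) w *\<^sub>R \<eta> l w)" for w
  unfolding simple_integral_def sum_subtractf[symmetric] scaleR_diff_left[symmetric] dW_def
 proof (intro sum.cong refl arg_cong2[where f="(*\<^sub>R)"])
  fix l
  show "W j (min (\<tau> (Suc l)) t) w - W j (min (\<tau> l) t) w - (W j (min (\<tau> (Suc l)) s) w - W j (min (\<tau> l) s) w)
   = W j (?a (Suc l)) w - W j (?a l) w"
   using eq[of "\<tau> l" w] eq[of "\<tau> (Suc l)" w] by linarith
 qed
 have a: "0 <= ?a l" "?a l <= ?a (Suc l)" for l using D(2)[of l] st by auto
 have L: "L2_fun M (%w. dW j (?a l) (?a (Suc l)) w *\<^sub>R \<eta> l w)" if "l < k" for l
  by (rule bounded_dW_L2[OF D(4,5)[OF that] j a])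
 have "expectation (%w. G w \<bullet> (dW j (?a l) (?a (Suc l)) w *\<^sub>R \<eta> l w)) = 0" if l: "l < k" for l
 proof (cases "\<tau> l < t")
  case True
  obtain K where K: "!!w. w : space M ==> norm (\<eta> l w) <= K" using D(5)[OF l] by auto
  have m: "G : borel_measurable (Fl (?a l))" "\<eta> l : borel_measurable (Fl (?a l))"
   using usual_measurable_mono[OF G(1), of "?a l"] usual_measurable_mono[OF D(3)[OF l], of "?a l"] True by auto
  have "expectation (%w. (G w \<bullet> \<eta> l w) * dW j (?a l) (?a (Suc l)) w) = 0"
  proof (rule expectation_mult_dW[OF _ _ j a])
   show "(%w. G w \<bullet> \<eta> l w) : borel_measurable (Fl (?a l))" by (rule borel_measurable_inner[OF m])
   show "L2_fun M (%w. G w \<bullet> \<eta> l w)"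
   proof (rule L2_fun_bound[OF G(2), where c=K])
    show "(%w. G w \<bullet> \<eta> l w) : borel_measurable M"
     by (rule borel_measurable_inner[OF L2_fun_measurable[OF G(2)] D(4)[OF l]])
    fix w assume w: "w : space M"
    have "\<bar>G w \<bullet> \<eta> l w\<bar> <= norm (G w) * norm (\<eta> l w)" by (rule Cauchy_Schwarz_ineq2)
    also have "... <= norm (G w) * K" by (intro mult_left_mono K w) auto
    finally show "norm (G w \<bullet> \<eta> l w) <= K * norm (G w)" by (simp add: mult.commute)
   qed
  qed
  then show ?thesis by (simp add: mult.commute)
 next
  case False
  then have "?a l = ?a (Suc l)" using D(2)[of l] by (auto simp: min_def)
  then show ?thesis by (simp add: dW_def)
 qed
 moreover have "expectation (%w. \<Sum>l<k. G w \<bullet> (dW j (?a l) (?a (Suc l)) w *\<^sub>R \<eta> l w))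
  = (\<Sum>l<k. expectation (%w. G w \<bullet> (dW j (?a l) (?a (Suc l)) w *\<^sub>R \<eta> l w)))"
  by (rule Bochner_Integration.integral_sum) (intro L2_inner_integrable G L; simp)
 ultimately show ?thesis
  unfolding diff inner_sum_right by simp
qed

text \<open>The martingale property in weak form: increments are tested against square-integrable
  \<open>G\<close> known at \<open>s\<close>, and conditional expectations never appear.\<close>

lemma ito_orthogonal:
 fixes H :: "real => 'w => 'v::euclidean_space"
 assumes Z: "ito j t H Z" "L2_proc M t H" and V: "ito j s H V" and j: "j : J" and st: "0 <= s" "s <= t"
  and G: "G : borel_measurable (Fl s)" "L2_fun M G"
 shows "expectation (%w. G w \<bullet> (Z w - V w)) = 0"
proof -
 have t: "0 <= t" using st by simp
 have Hs: "L2_proc M s H" by (rule L2_proc_mono[OF Z(2) st(2)])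
 obtain k \<tau> \<eta> where sp: "!!n. simple_process M Fl (k n) (\<tau> n) (\<eta> n)"
  and e: "L2_tendsto (horizon M t) (%n (w, s). simple_value (k n) (\<tau> n) (\<eta> n) s w) (%(w, s). H s w)"
  and z: "L2_tendsto M (%n. simple_integral (W j) (k n) (\<tau> n) (\<eta> n) t) Z" "L2_fun M Z"
  by (rule ito_approx[OF Z j t]) (rule that)
 have e': "(%n. energy M {0..t} (%s w. H s w - simple_value (k n) (\<tau> n) (\<eta> n) s w)) \<longlonglongrightarrow> 0"
  using e Z(2) by (subst (asm) L2_tendsto_energy) (auto simp: L2_proc_iff_energy intro: simple_value_horizon_measurable[OF sp])
 \<comment> \<open>One sequence of simple processes serves both times: by the isometry its integrals
   up to \<open>s\<close> converge to \<open>V\<close>, whichever approximation \<open>V\<close> was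
   obtained from.\<close>
 have v: "L2_tendsto M (%n. simple_integral (W j) (k n) (\<tau> n) (\<eta> n) s) V"
  unfolding L2_tendsto_def
 proof (rule tendsto_sandwich[OF _ _ tendsto_const e'])
  have "sqn M (%w. V w - simple_integral (W j) (k n) (\<tau> n) (\<eta> n) s w)
    <= energy M {0..t} (%s w. H s w - simple_value (k n) (\<tau> n) (\<eta> n) s w)" for n
   unfolding ito_isometry_diff(2)[OF V Hs ito_simple[OF sp[of n] j st(1)] simple_value_L2_proc[OF sp[of n]] j st(1)]
   by (rule energy_mono[OF st(2)])
  then show "\<forall>\<^sub>F n in sequentially. sqn M (%w. V w - simple_integral (W j) (k n) (\<tau> n) (\<eta> n) s w)
    <= energy M {0..t} (%s w. H s w - simple_value (k n) (\<tau> n) (\<eta> n) s w)" by simp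
 qed simp
 have LV: "L2_fun M V" by (rule ito_L2[OF V Hs j st(1)])
 have "(%n. expectation (%w. G w \<bullet> simple_integral (W j) (k n) (\<tau> n) (\<eta> n) t w) - expectation (%w. G w \<bullet> simple_integral (W j) (k n) (\<tau> n) (\<eta> n) s w))
   \<longlonglongrightarrow> expectation (%w. G w \<bullet> Z w) - expectation (%w. G w \<bullet> V w)"
  by (intro tendsto_diff L2_tendsto_inner L2_tendsto_const G simple_integral_L2 sp j st t z v LV)
 moreover have "expectation (%w. G w \<bullet> simple_integral (W j) (k n) (\<tau> n) (\<eta> n) t w) - expectation (%w. G w \<bullet> simple_integral (W j) (k n) (\<tau> n) (\<eta> n) s w) = 0" for n
  using simple_integral_orthogonal[OF sp[of n] j st G] G
  by (simp add: inner_diff_right L2_inner_integrable simple_integral_L2[OF sp j t] simple_integral_L2[OF sp j st(1)])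
 ultimately have "expectation (%w. G w \<bullet> Z w) - expectation (%w. G w \<bullet> V w) = 0"
  by (simp add: LIMSEQ_const_iff)
 then show ?thesis using G z(2) LV by (simp add: inner_diff_right L2_inner_integrable)
qed

text \<open>Diagonal choice: for every \<open>n\<close> a simple process whose squared distance from
  \<open>Hn n\<close>, in energy and in the value of the integral, is below 1 / (n + 1).\<close>

lemma ito_limit:
 fixes H :: "real => 'w => 'v::euclidean_space"
 assumes H: "!!n. ito j t (Hn n) (Zn n)" "!!n. L2_proc M t (Hn n)" "L2_proc M t H" and j: "j : J" "0 <= t"
  and e: "(%n. energy M {0..t} (%s w. H s w - Hn n s w)) \<longlonglongrightarrow> 0"
  and z: "L2_tendsto M Zn Z" and Zm[measurable]: "Z : borel_measurable M"
 shows "ito j t H Z"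
proof -
 define Q where "Q n k \<tau> \<eta> \<longleftrightarrow> simple_process M Fl k \<tau> \<eta> \<and>
   energy M {0..t} (%s w. Hn n s w - simple_value k \<tau> \<eta> s w) < ennreal (1 / Suc n) \<and>
   sqn M (%w. Zn n w - simple_integral (W j) k \<tau> \<eta> t w) < ennreal (1 / Suc n)" for n k \<tau> \<eta>
 have "\<exists>k \<tau> \<eta>. Q n k \<tau> \<eta>" for n
 proof -
  obtain k \<tau> \<eta> where s: "!!m. simple_process M Fl (k m) (\<tau> m) (\<eta> m)"
   and e: "(%m. energy M {0..t} (%s w. Hn n s w - simple_value (k m) (\<tau> m) (\<eta> m) s w)) \<longlonglongrightarrow> 0"
   and z: "(%m. sqn M (%w. Zn n w - simple_integral (W j) (k m) (\<tau> m) (\<eta> m) t w)) \<longlonglongrightarrow> 0"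
   using H(1)[of n] unfolding has_ito_integral_def by auto
  have "\<forall>\<^sub>F m in sequentially. Q n (k m) (\<tau> m) (\<eta> m)"
   unfolding Q_def
   by (intro eventually_conj order_tendstoD(2)[OF e] order_tendstoD(2)[OF z] always_eventually allI s) simp_all
  then obtain m where "Q n (k m) (\<tau> m) (\<eta> m)" by (auto simp: eventually_sequentially)
  then show ?thesis by blast
 qed
 then obtain k \<tau> \<eta> where Q: "!!n. Q n (k n) (\<tau> n) (\<eta> n)" by metis
 then have s: "!!n. simple_process M Fl (k n) (\<tau> n) (\<eta> n)"
  and b1: "!!n. energy M {0..t} (%s w. Hn n s w - simple_value (k n) (\<tau> n) (\<eta> n) s w) < ennreal (1 / Suc n)"
  and b2: "!!n. sqn M (%w. Zn n w - simple_integral (W j) (k n) (\<tau> n) (\<eta> n) t w) < ennreal (1 / Suc n)"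
  unfolding Q_def by blast+
 have lim0: "(%n. ennreal (1 / Suc n)) \<longlonglongrightarrow> 0"
  using tendsto_ennrealI[OF LIMSEQ_inverse_real_of_nat] by (simp add: inverse_eq_divide)
 have [measurable]: "Zn n : borel_measurable M" "simple_integral (W j) (k n) (\<tau> n) (\<eta> n) t : borel_measurable M" for n
  using H(1)[of n] L2_fun_measurable[OF simple_integral_L2[OF s j]] by (simp_all add: has_ito_integral_def)
 note Hm = L2_fun_measurable[OF H(2)[unfolded L2_proc_def]] L2_fun_measurable[OF H(3)[unfolded L2_proc_def]]
 have d1: "(%(w, s). H s w - Hn n s w) : borel_measurable (horizon M t)" for n
  using borel_measurable_diff[OF Hm(2) Hm(1)[of n]] by (simp add: case_prod_beta')
 have d2: "(%(w, s). Hn n s w - simple_value (k n) (\<tau> n) (\<eta> n) s w) : borel_measurable (horizon M t)" for n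
  using borel_measurable_diff[OF Hm(1)[of n] simple_value_horizon_measurable[OF s[of n]]] by (simp add: case_prod_beta')
 show ?thesis
  unfolding has_ito_integral_def
 proof (intro conjI exI[of _ k] exI[of _ \<tau>] exI[of _ \<eta>] allI Zm s)
  show "(%n. energy M {0..t} (%s w. H s w - simple_value (k n) (\<tau> n) (\<eta> n) s w)) \<longlonglongrightarrow> 0"
  proof (rule tendsto_sandwich[OF _ _ tendsto_const])
   have "energy M {0..t} (%s w. H s w - simple_value (k n) (\<tau> n) (\<eta> n) s w)
    <= 2 * energy M {0..t} (%s w. H s w - Hn n s w) + 2 * ennreal (1 / Suc n)" for n
   proof -
    have "energy M {0..t} (%s w. (H s w - Hn n s w) + (Hn n s w - simple_value (k n) (\<tau> n) (\<eta> n) s w))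
     <= 2 * energy M {0..t} (%s w. H s w - Hn n s w) + 2 * energy M {0..t} (%s w. Hn n s w - simple_value (k n) (\<tau> n) (\<eta> n) s w)"
     by (rule energy_add_le[OF d1 d2])
    also have "... <= 2 * energy M {0..t} (%s w. H s w - Hn n s w) + 2 * ennreal (1 / Suc n)"
     by (intro add_left_mono mult_left_mono less_imp_le[OF b1]) simp
    finally show ?thesis by simp
   qed
   then show "\<forall>\<^sub>F n in sequentially. energy M {0..t} (%s w. H s w - simple_value (k n) (\<tau> n) (\<eta> n) s w)
    <= 2 * energy M {0..t} (%s w. H s w - Hn n s w) + 2 * ennreal (1 / Suc n)" by simp
   show "(%n. 2 * energy M {0..t} (%s w. H s w - Hn n s w) + 2 * ennreal (1 / Suc n)) \<longlonglongrightarrow> 0"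
    using tendsto_add[OF ennreal_tendsto_cmult[OF _ e, of 2] ennreal_tendsto_cmult[OF _ lim0, of 2]] by simp
  qed simp
  show "(%n. sqn M (%w. Z w - simple_integral (W j) (k n) (\<tau> n) (\<eta> n) t w)) \<longlonglongrightarrow> 0"
  proof (rule tendsto_sandwich[OF _ _ tendsto_const])
   have "sqn M (%w. Z w - simple_integral (W j) (k n) (\<tau> n) (\<eta> n) t w)
    <= 2 * sqn M (%w. Z w - Zn n w) + 2 * ennreal (1 / Suc n)" for n
   proof -
    have "sqn M (%w. (Z w - Zn n w) + (Zn n w - simple_integral (W j) (k n) (\<tau> n) (\<eta> n) t w))
     <= 2 * sqn M (%w. Z w - Zn n w) + 2 * sqn M (%w. Zn n w - simple_integral (W j) (k n) (\<tau> n) (\<eta> n) t w)"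
     by (rule nn_integral_square_add_le) measurable
    also have "... <= 2 * sqn M (%w. Z w - Zn n w) + 2 * ennreal (1 / Suc n)"
     by (intro add_left_mono mult_left_mono less_imp_le[OF b2]) simp
    finally show ?thesis by simp
   qed
   then show "\<forall>\<^sub>F n in sequentially. sqn M (%w. Z w - simple_integral (W j) (k n) (\<tau> n) (\<eta> n) t w)
    <= 2 * sqn M (%w. Z w - Zn n w) + 2 * ennreal (1 / Suc n)" by simp
   show "(%n. 2 * sqn M (%w. Z w - Zn n w) + 2 * ennreal (1 / Suc n)) \<longlonglongrightarrow> 0"
    using tendsto_add[OF ennreal_tendsto_cmult[OF _ z[unfolded L2_tendsto_def], of 2] ennreal_tendsto_cmult[OF _ lim0, of 2]] by simp
  qed simp
 qed
qed

end

section \<open>The product formula in expectation\<close>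

text \<open>Cauchy-Schwarz against the constant 1. If \<open>f\<close> is not integrable, its
  Bochner integral is 0 by convention and the bound is trivial.\<close>

lemma norm_integral_square_le:
 fixes f :: "'a => 'v::euclidean_space"
 assumes f[measurable]: "f : borel_measurable N"
 shows "ennreal ((norm (\<integral>x. f x \<partial>N))^2) <= emeasure N (space N) * sqn N f"
proof (cases "integrable N f")
 case True
 have "ennreal ((norm (\<integral>x. f x \<partial>N))^2) = (ennreal (norm (\<integral>x. f x \<partial>N)))^2" by (simp add: ennreal_power)
 also have "... <= (\<integral>\<^sup>+x. ennreal (norm (f x)) * 1 \<partial>N)^2"
  using integral_norm_bound_ennreal[OF True] by (intro power_mono) auto
 also have "... <= (\<integral>\<^sup>+x. (ennreal (norm (f x)))\<^sup>2 \<partial>N) * (\<integral>\<^sup>+x. 1\<^sup>2 \<partial>N)"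
  by (rule Cauchy_Schwarz_nn_integral) auto
 finally show ?thesis by (simp add: ennreal_power mult.commute)
qed (simp add: not_integrable_integral_eq)

lemma LINT_restrict:
 fixes f :: "real => 'v::euclidean_space"
 shows "(LINT s:{0..t::real}|lborel. f s) = (\<integral>s. f s \<partial>restrict_space lborel {0..t})"
 by (simp add: integral_restrict_space set_lebesgue_integral_def)

lemma LINT_restrict_le:
 fixes f :: "real => 'v::euclidean_space"
 assumes "s : {0..t}"
 shows "(LINT r:{0..s}|lborel. f r) = (\<integral>r. indicator {..s} r *\<^sub>R f r \<partial>restrict_space lborel {0..t})"
proof -
 have "(%x. indicator {0..s} x *\<^sub>R f x) = (%x. indicator {0..t} x *\<^sub>R indicator {..s} x *\<^sub>R f x)"
  using assms by (auto simp: indicator_def fun_eq_iff)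
 then show ?thesis by (simp add: integral_restrict_space set_lebesgue_integral_def)
qed

lemma AE_restrict_neq: "AE r in restrict_space lborel {0..t::real}. r ~= s"
proof -
 have "AE r in lborel. r ~= s" by (rule AE_lborel_singleton)
 then show ?thesis by (subst AE_restrict_space_iff) auto
qed

text \<open>Fubini on the square [0, t] x [0, t], cut along the diagonal into two triangles, one for
  each summand. The rule is phrased with integrals instead of derivatives because the factors are
  merely integrable in time.\<close>

lemma integral_product_rule:
 fixes f g :: "real => 'v::euclidean_space" and t :: real
 defines "R \<equiv> restrict_space lborel {0..t}"
 assumes f: "integrable R f" and g: "integrable R g"
 shows "integrable R (%s. f s \<bullet> (LINT r:{0..s}|lborel. g r) + (LINT r:{0..s}|lborel. f r) \<bullet> g s)"
  and "(\<integral>s. f s \<partial>R) \<bullet> (\<integral>s. g s \<partial>R) = (\<integral>s. f s \<bullet> (LINT r:{0..s}|lborel. g r) + (LINT r:{0..s}|lborel. f r) \<bullet> g s \<partial>R)"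
proof -
 interpret R: finite_measure R unfolding R_def by (rule finite_measure_restrict_lborel)
 interpret pair_sigma_finite R R ..
 have [measurable]: "f : borel_measurable R" "g : borel_measurable R" using f g by auto
 have idm: "(%x. x) : borel_measurable R" unfolding R_def by (rule measurable_restrict_space1) simp
 have ig: "integrable R (%y. indicator {..x} y *\<^sub>R h y)" if "integrable R h" for h :: "real => 'v" and x
 proof (rule Bochner_Integration.integrable_bound[OF that])
  show "(%y. indicator {..x} y *\<^sub>R h y) : borel_measurable R"
   using measurable_compose[OF idm, of "indicator {..x} :: real => real" borel] that
   by (intro borel_measurable_scaleR) auto
  show "AE y in R. norm (indicator {..x} y *\<^sub>R h y) <= norm (h y)" by (auto simp: indicator_def)
 qed
 have fst_m[measurable]: "fst : borel_measurable (R \<Otimes>\<^sub>M R)" "snd : borel_measurable (R \<Otimes>\<^sub>M R)"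
  using measurable_compose[OF measurable_fst idm] measurable_compose[OF measurable_snd idm] by auto
 have int: "integrable (R \<Otimes>\<^sub>M R) (%(x, y). f x \<bullet> g y)"
 proof (rule Bochner_Integration.integrable_bound)
  show "integrable (R \<Otimes>\<^sub>M R) (%(x, y). norm (f x) * norm (g y))"
  proof (rule Fubini_integrable)
   show "integrable R (%x. \<integral>y. norm (case (x, y) of (x, y) => norm (f x) * norm (g y)) \<partial>R)"
    using f by simp
   show "AE x in R. integrable R (%y. case (x, y) of (x, y) => norm (f x) * norm (g y))"
    using g by simp
  qed measurable
  show "(%(x, y). f x \<bullet> g y) : borel_measurable (R \<Otimes>\<^sub>M R)" by measurable
  show "AE x in R \<Otimes>\<^sub>M R. norm (case x of (x, y) => f x \<bullet> g y) <= norm (case x of (x, y) => norm (f x) * norm (g y))"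
   by (auto intro!: AE_I2 simp: Cauchy_Schwarz_ineq2)
 qed
 have m1: "{x : space (R \<Otimes>\<^sub>M R). snd x <= fst x} : sets (R \<Otimes>\<^sub>M R)"
  "{x : space (R \<Otimes>\<^sub>M R). fst x < snd x} : sets (R \<Otimes>\<^sub>M R)" by measurable
 have i1: "integrable (R \<Otimes>\<^sub>M R) (%(x, y). indicator {..x} y * (f x \<bullet> g y))"
 proof -
  have "integrable (R \<Otimes>\<^sub>M R) (%z. indicator {x : space (R \<Otimes>\<^sub>M R). snd x <= fst x} z *\<^sub>R (case z of (x, y) => f x \<bullet> g y))"
   by (rule integrable_mult_indicator[OF m1(1) int])
  then show ?thesis by (rule Bochner_Integration.integrable_cong[THEN iffD1, rotated 2]) (auto simp: indicator_def)
 qed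
 have i2: "integrable (R \<Otimes>\<^sub>M R) (%(x, y). indicator {x<..} y * (f x \<bullet> g y))"
 proof -
  have "integrable (R \<Otimes>\<^sub>M R) (%z. indicator {x : space (R \<Otimes>\<^sub>M R). fst x < snd x} z *\<^sub>R (case z of (x, y) => f x \<bullet> g y))"
   by (rule integrable_mult_indicator[OF m1(2) int])
  then show ?thesis by (rule Bochner_Integration.integrable_cong[THEN iffD1, rotated 2]) (auto simp: indicator_def)
 qed
 have sp: "space R = {0..t}" by (simp add: R_def space_restrict_space)
 have e1: "(\<integral>y. indicator {..x} y * (f x \<bullet> g y) \<partial>R) = f x \<bullet> (LINT r:{0..x}|lborel. g r)" if "x : space R" for x
 proof -
  have gi: "integrable R (%y. indicator {..x} y *\<^sub>R g y)"
   by (rule ig[OF g])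
  have "(\<integral>y. indicator {..x} y * (f x \<bullet> g y) \<partial>R) = (\<integral>y. f x \<bullet> (indicator {..x} y *\<^sub>R g y) \<partial>R)"
   by simp
  also have "... = f x \<bullet> (\<integral>y. indicator {..x} y *\<^sub>R g y \<partial>R)"
   by (rule integral_inner_right) (use gi in simp)
  finally show ?thesis using that LINT_restrict_le[of x t g] by (simp add: R_def[symmetric] sp)
 qed
 have e2: "(\<integral>x. indicator {x<..} y * (f x \<bullet> g y) \<partial>R) = (LINT r:{0..y}|lborel. f r) \<bullet> g y" if "y : space R" for y
 proof -
  have fi: "integrable R (%x. indicator {..y} x *\<^sub>R f x)"
   by (rule ig[OF f])
  have "(\<integral>x. indicator {x<..} y * (f x \<bullet> g y) \<partial>R) = (\<integral>x. (indicator {..y} x *\<^sub>R f x) \<bullet> g y \<partial>R)"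
  proof (rule integral_cong_AE)
   have "AE x in R. x ~= y" unfolding R_def by (rule AE_restrict_neq)
   then show "AE x in R. indicator {x<..} y * (f x \<bullet> g y) = (indicator {..y} x *\<^sub>R f x) \<bullet> g y"
    by eventually_elim (auto simp: indicator_def)
   have [measurable]: "(%x. indicat_real {x<..} y) : borel_measurable R"
   proof -
    have "(%x. indicat_real {x<..} y) = indicat_real {..<y}" by (auto simp: indicator_def fun_eq_iff)
    then show ?thesis using idm by simp
   qed
   show "(%x. indicator {x<..} y * (f x \<bullet> g y)) : borel_measurable R" by measurable
   show "(%x. (indicator {..y} x *\<^sub>R f x) \<bullet> g y) : borel_measurable R" using fi by measurable
  qed
  also have "... = (\<integral>x. indicator {..y} x *\<^sub>R f x \<partial>R) \<bullet> g y"
   by (rule integral_inner_left) (use fi in simp)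
  finally show ?thesis using that LINT_restrict_le[of y t f] by (simp add: R_def[symmetric] sp)
 qed
 have j1: "integrable R (%x. f x \<bullet> (LINT r:{0..x}|lborel. g r))"
  using integrable_fst'[OF i1] by (rule Bochner_Integration.integrable_cong[THEN iffD1, rotated 2]) (auto simp: e1)
 have j2: "integrable R (%y. (LINT r:{0..y}|lborel. f r) \<bullet> g y)"
  using integrable_snd[OF i2] by (rule Bochner_Integration.integrable_cong[THEN iffD1, rotated 2]) (auto simp: e2)
 show "integrable R (%s. f s \<bullet> (LINT r:{0..s}|lborel. g r) + (LINT r:{0..s}|lborel. f r) \<bullet> g s)"
  using j1 j2 by simp
 have "(\<integral>s. f s \<partial>R) \<bullet> (\<integral>s. g s \<partial>R) = (\<integral>x. (\<integral>y. f x \<bullet> g y \<partial>R) \<partial>R)"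
  using f g by simp
 also have "... = (\<integral>(x, y). f x \<bullet> g y \<partial>(R \<Otimes>\<^sub>M R))" by (rule integral_fst[OF int])
 also have "... = (\<integral>z. (case z of (x, y) => indicator {..x} y * (f x \<bullet> g y)) + (case z of (x, y) => indicator {x<..} y * (f x \<bullet> g y)) \<partial>(R \<Otimes>\<^sub>M R))"
  by (rule Bochner_Integration.integral_cong) (auto simp: indicator_def)
 also have "... = (\<integral>(x, y). indicator {..x} y * (f x \<bullet> g y) \<partial>(R \<Otimes>\<^sub>M R)) + (\<integral>(x, y). indicator {x<..} y * (f x \<bullet> g y) \<partial>(R \<Otimes>\<^sub>M R))"
  by (rule Bochner_Integration.integral_add[OF i1 i2])
 also have "(\<integral>(x, y). indicator {..x} y * (f x \<bullet> g y) \<partial>(R \<Otimes>\<^sub>M R)) = (\<integral>x. f x \<bullet> (LINT r:{0..x}|lborel. g r) \<partial>R)"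
  unfolding integral_fst[OF i1, symmetric] by (rule Bochner_Integration.integral_cong) (auto simp: e1)
 also have "(\<integral>(x, y). indicator {x<..} y * (f x \<bullet> g y) \<partial>(R \<Otimes>\<^sub>M R)) = (\<integral>y. (LINT r:{0..y}|lborel. f r) \<bullet> g y \<partial>R)"
  unfolding integral_snd[OF i2, symmetric] by (rule Bochner_Integration.integral_cong) (auto simp: e2)
 finally show "(\<integral>s. f s \<partial>R) \<bullet> (\<integral>s. g s \<partial>R) = (\<integral>s. f s \<bullet> (LINT r:{0..s}|lborel. g r) + (LINT r:{0..s}|lborel. f r) \<bullet> g s \<partial>R)"
  using j1 j2 by simp
qed

section \<open>Drift integrals\<close>

context brownian_space begin

abbreviation "drift \<beta> t w \<equiv> (LINT s:{0..t}|lborel. \<beta> s w)"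

lemma horizon_measurableD:
 assumes "(%(w, s). u s w) : measurable (horizon M t) N"
 shows "w : space M ==> (%s. u s w) : measurable (restrict_space lborel {0..t}) N"
  and "s : {0..t} ==> u s : measurable M N"
proof -
 show "w : space M ==> (%s. u s w) : measurable (restrict_space lborel {0..t}) N"
  using measurable_Pair2[OF assms[unfolded horizon_def]] by simp
 show "s : {0..t} ==> u s : measurable M N"
  using measurable_Pair1[OF assms[unfolded horizon_def]] by (simp add: space_restrict_space)
qed

text \<open>The variable upper limit is moved into an indicator; what remains is a parametrized
  integral over the fixed interval [0, t], which is jointly measurable in its parameters.\<close>

lemma drift_measurable:
 fixes \<beta> :: "real => 'w => 'v::euclidean_space"
 assumes b: "(%(w, s). \<beta> s w) : borel_measurable (horizon M t)"
 shows "(%(w, s). drift \<beta> s w) : borel_measurable (horizon M t)"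
proof -
 let ?R = "restrict_space lborel {0..t}"
 interpret R: finite_measure ?R by (rule finite_measure_restrict_lborel)
 have idm: "(%x. x) : borel_measurable ?R" by (rule measurable_restrict_space1) simp
 have a: "(%z. snd (fst z)) : borel_measurable (horizon M t \<Otimes>\<^sub>M ?R)" "(%z. snd z) : borel_measurable (horizon M t \<Otimes>\<^sub>M ?R)"
  unfolding horizon_def
  using measurable_compose[OF measurable_compose[OF measurable_fst measurable_snd] idm] measurable_compose[OF measurable_snd idm] by auto
 have "(%z. (fst (fst z), snd z)) : measurable (horizon M t \<Otimes>\<^sub>M ?R) (horizon M t)"
  unfolding horizon_def by (intro measurable_Pair measurable_snd measurable_compose[OF measurable_fst measurable_fst])
 from measurable_compose[OF this b]
 have b': "(%z. \<beta> (snd z) (fst (fst z))) : borel_measurable (horizon M t \<Otimes>\<^sub>M ?R)" by simp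
 have "(%z. (if snd z <= snd (fst z) then 1 else 0 :: real) *\<^sub>R \<beta> (snd z) (fst (fst z))) : borel_measurable (horizon M t \<Otimes>\<^sub>M ?R)"
  using a b' by measurable
 then have "(%(x, r). indicator {..snd x} r *\<^sub>R \<beta> r (fst x)) : borel_measurable (horizon M t \<Otimes>\<^sub>M ?R)"
  by (simp add: case_prod_beta' indicator_def of_bool_def cong: if_cong)
 from R.borel_measurable_lebesgue_integral[OF this]
 have "(%x. \<integral>r. indicator {..snd x} r *\<^sub>R \<beta> r (fst x) \<partial>?R) : borel_measurable (horizon M t)" .
 then show ?thesis
  by (rule measurable_cong[THEN iffD1, rotated])
    (auto simp: horizon_def space_pair_measure space_restrict_space LINT_restrict_le)
qed

lemma nn_integral_drift_le:
 fixes \<beta> :: "real => 'w => 'v::euclidean_space"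
 assumes b: "(%(w, s). \<beta> s w) : borel_measurable (horizon M t)" and st: "0 <= s" "s <= t"
 shows "sqn M (%w. drift \<beta> s w) <= ennreal s * energy M {0..s} \<beta>"
proof -
 let ?R = "restrict_space lborel {0..s}"
 interpret R: finite_measure ?R by (rule finite_measure_restrict_lborel)
 have bs: "(%(w, r). \<beta> r w) : borel_measurable (horizon M s)" by (rule horizon_measurable_mono[OF st(2) b])
 have em: "emeasure ?R (space ?R) = ennreal s"
  using st by (simp add: space_restrict_space emeasure_restrict_space)
 have "sqn M (%w. drift \<beta> s w)
  <= (\<integral>\<^sup>+w. ennreal s * sqn ?R (%r. \<beta> r w) \<partial>M)"
  unfolding LINT_restrict em[symmetric]
  by (intro nn_integral_mono norm_integral_square_le horizon_measurableD(1)[OF bs])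
 also have "... = ennreal s * (\<integral>\<^sup>+w. sqn ?R (%r. \<beta> r w) \<partial>M)"
 proof (rule nn_integral_cmult)
  have "(%x. ennreal ((norm (case x of (w, r) => \<beta> r w))^2)) : borel_measurable (M \<Otimes>\<^sub>M ?R)"
   using bs unfolding horizon_def by measurable
  from R.borel_measurable_nn_integral_fst[OF this]
  show "(%w. sqn ?R (%r. \<beta> r w)) : borel_measurable M" by simp
 qed
 also have "(\<integral>\<^sup>+w. sqn ?R (%r. \<beta> r w) \<partial>M) = energy M {0..s} \<beta>"
  by (simp add: energy_def nn_integral_restrict_space)
 finally show ?thesis .
qed

lemma drift_L2:
 fixes \<beta> :: "real => 'w => 'v::euclidean_space"
 assumes b: "L2_proc M t \<beta>" and st: "0 <= s" "s <= t"
 shows "L2_fun M (drift \<beta> s)"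
proof -
 have bm: "(%(w, s). \<beta> s w) : borel_measurable (horizon M t)" using b by (simp add: L2_proc_iff_energy)
 have "energy M {0..s} \<beta> < \<infinity>" using L2_proc_mono[OF b st(2)] by (simp add: L2_proc_iff_energy)
 then have "ennreal s * energy M {0..s} \<beta> < \<infinity>" by (simp add: ennreal_mult_less_top)
 then show ?thesis
  unfolding L2_fun_iff
  using horizon_measurableD(2)[OF drift_measurable[OF bm], of s] st le_less_trans[OF nn_integral_drift_le[OF bm st]] by auto
qed

lemma drift_L2_proc:
 fixes \<beta> :: "real => 'w => 'v::euclidean_space"
 assumes b: "L2_proc M t \<beta>"
 shows "L2_proc M t (drift \<beta>)"
proof -
 let ?R = "restrict_space lborel {0..t}"
 have bm: "(%(w, s). \<beta> s w) : borel_measurable (horizon M t)" using b by (simp add: L2_proc_iff_energy)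
 interpret P: pair_sigma_finite M ?R by (rule pair_sigma_finite_horizon)
 interpret R: finite_measure ?R by (rule finite_measure_restrict_lborel)
 have fin: "energy M {0..t} \<beta> < \<infinity>" using b by (simp add: L2_proc_iff_energy)
 have "energy M {0..t} (drift \<beta>) = sqn (M \<Otimes>\<^sub>M ?R) (%x. case x of (w, s) => drift \<beta> s w)"
  using energy_horizon[OF drift_measurable[OF bm]] by (simp add: horizon_def)
 also have "... = (\<integral>\<^sup>+s. sqn M (%w. drift \<beta> s w) \<partial>?R)"
  using drift_measurable[OF bm] unfolding horizon_def
  by (subst P.nn_integral_snd[symmetric]) (simp_all add: case_prod_beta')
 also have "... <= (\<integral>\<^sup>+s. ennreal t * energy M {0..t} \<beta> \<partial>?R)"
 proof (rule nn_integral_mono)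
  fix s assume "s : space ?R"
  then have s: "0 <= s" "s <= t" by (auto simp: space_restrict_space)
  have "sqn M (%w. drift \<beta> s w) <= ennreal s * energy M {0..s} \<beta>"
   by (rule nn_integral_drift_le[OF bm s])
  also have "... <= ennreal t * energy M {0..t} \<beta>"
   using s by (intro mult_mono energy_mono ennreal_leI) auto
  finally show "sqn M (%w. drift \<beta> s w) <= ennreal t * energy M {0..t} \<beta>" .
 qed
 also have "... < \<infinity>"
  using fin R.emeasure_finite[of "{0..t}"]
  by (simp add: ennreal_mult_less_top ennreal_mult_eq_top_iff space_restrict_space less_top[symmetric])
 finally show ?thesis
  unfolding L2_proc_iff_energy using drift_measurable[OF bm] by simp
qed

lemma L2_proc_AE_integrable:
 fixes \<beta> :: "real => 'w => 'v::euclidean_space"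
 assumes b: "L2_proc M t \<beta>"
 shows "AE w in M. integrable (restrict_space lborel {0..t}) (%s. \<beta> s w)"
  and "AE s in restrict_space lborel {0..t}. L2_fun M (\<beta> s)"
proof -
 let ?R = "restrict_space lborel {0..t}"
 interpret P: pair_sigma_finite M ?R by (rule pair_sigma_finite_horizon)
 have bm: "(%(w, s). \<beta> s w) : borel_measurable (horizon M t)" using b by (simp add: L2_proc_iff_energy)
 have i2: "integrable (M \<Otimes>\<^sub>M ?R) (%(w, s). (norm (\<beta> s w))\<^sup>2)"
  using b unfolding L2_proc_def L2_fun_def horizon_def by (simp add: case_prod_beta')
 interpret H: finite_measure "horizon M t" by (rule finite_measure_horizon)
 have "integrable (M \<Otimes>\<^sub>M ?R) (%(w, s). \<beta> s w)"
 proof (rule Bochner_Integration.integrable_bound)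
  show "integrable (M \<Otimes>\<^sub>M ?R) (%x. 1 + (case x of (w, s) => (norm (\<beta> s w))^2))"
   using i2 H.integrable_const[of 1] by (auto simp: horizon_def)
  show "(%(w, s). \<beta> s w) : borel_measurable (M \<Otimes>\<^sub>M ?R)" using bm by (simp add: horizon_def)
  have "a <= 1 + a\<^sup>2" for a :: real using sum_squares_bound[of a 1] by (simp) (smt (verit, best) zero_le_power2)
  then show "AE x in M \<Otimes>\<^sub>M ?R. norm (case x of (w, s) => \<beta> s w) <= norm (1 + (case x of (w, s) => (norm (\<beta> s w))^2))"
   by (auto intro!: AE_I2)
 qed
 from P.AE_integrable_fst'[OF this] show "AE w in M. integrable ?R (%s. \<beta> s w)" by simp
 from P.AE_integrable_snd[OF i2] show "AE s in ?R. L2_fun M (\<beta> s)"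
 proof (rule AE_mp, intro AE_I2 impI)
  fix s assume "s : space ?R" "integrable M (%x. (norm (\<beta> s x))\<^sup>2)"
  then show "L2_fun M (\<beta> s)" using horizon_measurableD(2)[OF bm, of s] by (simp add: L2_fun_def space_restrict_space)
 qed
qed

lemma horizon_inner_integrable:
 fixes u v :: "real => 'w => 'v::euclidean_space"
 assumes "L2_proc M t u" "L2_proc M t v"
 shows "integrable (horizon M t) (%(w, s). u s w \<bullet> v s w)"
 using L2_inner_integrable[OF assms[unfolded L2_proc_def]] by (simp add: case_prod_beta')

lemma L2_proc_const_time:
 fixes G :: "'w => 'v::euclidean_space"
 assumes "L2_fun M G"
 shows "L2_proc M t (%s. G)"
proof -
 have m: "(%(w, s). G w) : borel_measurable (horizon M t)"
  unfolding horizon_def using measurable_compose[OF measurable_fst L2_fun_measurable[OF assms]] by (simp add: case_prod_beta')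
 have "energy M {0..t} (%s. G) = (\<integral>\<^sup>+w. ennreal ((norm (G w))^2) * emeasure lborel {0..t} \<partial>M)"
  unfolding energy_def by (simp add: nn_integral_cmult_indicator)
 also have "... = sqn M G * emeasure lborel {0..t}"
  using L2_fun_measurable[OF assms] by (intro nn_integral_multc) measurable
 also have "... < \<infinity>" using assms by (simp add: L2_fun_iff ennreal_mult_less_top emeasure_lborel_Icc_eq)
 finally show ?thesis unfolding L2_proc_iff_energy using m by simp
qed

lemma expectation_drift_inner:
 fixes \<beta> :: "real => 'w => 'v::euclidean_space"
 assumes b: "L2_proc M t \<beta>" and G: "L2_fun M G"
 shows "expectation (%w. drift \<beta> t w \<bullet> G w) = (\<integral>(w, s). \<beta> s w \<bullet> G w \<partial>horizon M t)"
proof -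
 let ?R = "restrict_space lborel {0..t}"
 interpret P: pair_sigma_finite M ?R by (rule pair_sigma_finite_horizon)
 have int: "integrable (M \<Otimes>\<^sub>M ?R) (%(w, s). \<beta> s w \<bullet> G w)"
  using horizon_inner_integrable[OF b L2_proc_const_time[OF G]] by (simp add: horizon_def)
 have "(\<integral>(w, s). \<beta> s w \<bullet> G w \<partial>horizon M t) = expectation (%w. \<integral>s. \<beta> s w \<bullet> G w \<partial>?R)"
  unfolding horizon_def by (rule P.integral_fst[OF int, symmetric])
 also have "... = expectation (%w. drift \<beta> t w \<bullet> G w)"
 proof (rule integral_cong_AE)
  show "(%w. \<integral>s. \<beta> s w \<bullet> G w \<partial>?R) : borel_measurable M"
   using P.integrable_fst[OF int] by simp
  \<comment> \<open>For negative \<open>t\<close> the interval is empty and the drift is constantly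
    0.\<close>
  have "L2_fun M (drift \<beta> t) \<or> t < 0" using drift_L2[OF b, of t] by linarith
  then show "(%w. drift \<beta> t w \<bullet> G w) : borel_measurable M"
   using L2_fun_measurable[OF G] by (auto simp: L2_fun_def set_lebesgue_integral_def)
  show "AE w in M. (\<integral>s. \<beta> s w \<bullet> G w \<partial>?R) = drift \<beta> t w \<bullet> G w"
   using L2_proc_AE_integrable(1)[OF b]
   by eventually_elim (simp add: LINT_restrict)
 qed
 finally show ?thesis by simp
qed

lemma expectation_drift_drift:
 fixes \<beta> \<gamma> :: "real => 'w => 'v::euclidean_space"
 assumes b: "L2_proc M t \<beta>" and c: "L2_proc M t \<gamma>" and t: "0 <= t"
 shows "expectation (%w. drift \<beta> t w \<bullet> drift \<gamma> t w)
  = (\<integral>(w, s). \<beta> s w \<bullet> drift \<gamma> s w + drift \<beta> s w \<bullet> \<gamma> s w \<partial>horizon M t)"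
proof -
 let ?R = "restrict_space lborel {0..t}"
 interpret P: pair_sigma_finite M ?R by (rule pair_sigma_finite_horizon)
 have int: "integrable (M \<Otimes>\<^sub>M ?R) (%(w, s). \<beta> s w \<bullet> drift \<gamma> s w + drift \<beta> s w \<bullet> \<gamma> s w)"
  using Bochner_Integration.integrable_add[OF horizon_inner_integrable[OF b drift_L2_proc[OF c]] horizon_inner_integrable[OF drift_L2_proc[OF b] c]]
  by (simp add: horizon_def case_prod_beta')
 have "(\<integral>(w, s). \<beta> s w \<bullet> drift \<gamma> s w + drift \<beta> s w \<bullet> \<gamma> s w \<partial>horizon M t)
   = expectation (%w. \<integral>s. \<beta> s w \<bullet> drift \<gamma> s w + drift \<beta> s w \<bullet> \<gamma> s w \<partial>?R)"
  unfolding horizon_def by (rule P.integral_fst[OF int, symmetric])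
 also have "... = expectation (%w. drift \<beta> t w \<bullet> drift \<gamma> t w)"
 proof (rule integral_cong_AE)
  show "(%w. \<integral>s. \<beta> s w \<bullet> drift \<gamma> s w + drift \<beta> s w \<bullet> \<gamma> s w \<partial>?R) : borel_measurable M"
   using P.integrable_fst[OF int] by simp
  show "(%w. drift \<beta> t w \<bullet> drift \<gamma> t w) : borel_measurable M"
   using L2_fun_measurable[OF drift_L2[OF b t order_refl]] L2_fun_measurable[OF drift_L2[OF c t order_refl]]
   by (rule borel_measurable_inner)
  show "AE w in M. (\<integral>s. \<beta> s w \<bullet> drift \<gamma> s w + drift \<beta> s w \<bullet> \<gamma> s w \<partial>?R) = drift \<beta> t w \<bullet> drift \<gamma> t w"
   using L2_proc_AE_integrable(1)[OF b] L2_proc_AE_integrable(1)[OF c]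
  proof eventually_elim
   case (elim w)
   from integral_product_rule(2)[OF elim] show ?case by (simp add: LINT_restrict)
  qed
 qed
 finally show ?thesis by simp
qed

section \<open>Ito processes and expectations of their products\<close>

lemma energy_at_zero: "energy M {0..0} u = 0"
proof -
 have "(\<integral>\<^sup>+t. ennreal ((norm (u t w))^2) * indicator {0..0::real} t \<partial>lborel) = 0" for w
 proof -
  have "AE t in lborel. ennreal ((norm (u t w))^2) * indicator {0..0::real} t = 0"
   using AE_lborel_singleton[of "0::real"] by eventually_elim (auto simp: indicator_def)
  then have "(\<integral>\<^sup>+t. ennreal ((norm (u t w))^2) * indicator {0..0::real} t \<partial>lborel) = (\<integral>\<^sup>+t. 0 \<partial>(lborel::real measure))"
   by (rule nn_integral_cong_AE)
  then show ?thesis by simp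
 qed
 then show ?thesis unfolding energy_def by simp
qed

text \<open>Over the degenerate interval every process has energy zero, so 0 is an integral of any
  \<open>H\<close>. With s = 0, \<open>ito_orthogonal\<close> then becomes orthogonality to initial
  data.\<close>

lemma ito_at_zero: "ito j 0 (H :: real => 'w => 'v::euclidean_space) (%_. 0)"
 unfolding has_ito_integral_def
 by (intro conjI exI[of _ "%_. 0"] exI[of _ "%_ n. real n"] exI[of _ "%_ _ _. 0"])
   (auto simp: energy_at_zero[simplified] simple_process_def simple_value_def simple_integral_def mono_def)

lemma ito_initial_orthogonal:
 fixes H :: "real => 'w => 'v::euclidean_space"
 assumes "ito j t H Z" "L2_proc M t H" "j : J" "0 <= t" "G : borel_measurable (Fl 0)" "L2_fun M G"
 shows "expectation (%w. G w \<bullet> Z w) = 0"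
 using ito_orthogonal[OF assms(1,2) ito_at_zero assms(3) order_refl assms(4-6)] by simp

text \<open>Tailored to expectations of products: square-integrable coefficients, an adapted drift,
  and the integral equation at each fixed time almost surely rather than pathwise. The noise is
  indexed by all of \<open>J\<close>, so any two such processes can be paired.\<close>

definition ito_process ::
 "real => ('w => 'v::euclidean_space) => (real => 'w => 'v) => (nat => real => 'w => 'v) => (real => 'w => 'v) => bool" where
 "ito_process T \<xi> \<beta> \<sigma> X \<longleftrightarrow>
  L2_proc M T X \<and> L2_proc M T \<beta> \<and> (\<forall>j\<in>J. L2_proc M T (\<sigma> j)) \<and>
  (\<forall>s\<in>{0..T}. X s : borel_measurable M \<and> \<beta> s : borel_measurable (Fl s)) \<and>
  \<xi> : borel_measurable (Fl 0) \<and> L2_fun M \<xi> \<and>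
  (\<forall>t\<in>{0..T}. \<exists>Z. (\<forall>j\<in>J. ito j t (\<sigma> j) (Z j)) \<and>
    (AE w in M. X t w = \<xi> w + drift \<beta> t w + (\<Sum>j\<in>J. Z j w)))"

text \<open>Without its drift the process is the initial value plus a sum of Ito integrals; the
  third fact is their orthogonality summed over \<open>J\<close>.\<close>

lemma ito_process_martingale:
 assumes X: "ito_process T \<xi> \<beta> \<sigma> X"
 shows "t : {0..T} ==> L2_fun M (X t)"
  and "t : {0..T} ==> L2_fun M (%w. X t w - drift \<beta> t w)"
  and "0 <= s ==> s <= t ==> t <= T ==> G : borel_measurable (Fl s) ==> L2_fun M G ==>
   expectation (%w. G w \<bullet> (X t w - drift \<beta> t w)) = expectation (%w. G w \<bullet> (X s w - drift \<beta> s w))"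
proof -
 have b: "L2_proc M T \<beta>" and sg: "!!j. j : J ==> L2_proc M T (\<sigma> j)"
  and xi: "L2_fun M \<xi>" and Xm: "!!s. s : {0..T} ==> X s : borel_measurable M"
  using X unfolding ito_process_def by auto
 have ex: "\<exists>Z. (\<forall>j\<in>J. ito j t (\<sigma> j) (Z j)) \<and> (\<forall>j\<in>J. L2_fun M (Z j)) \<and>
    (AE w in M. X t w - drift \<beta> t w = \<xi> w + (\<Sum>j\<in>J. Z j w))" if t: "t : {0..T}" for t
 proof -
  obtain Z where Z: "\<forall>j\<in>J. ito j t (\<sigma> j) (Z j)" "AE w in M. X t w = \<xi> w + drift \<beta> t w + (\<Sum>j\<in>J. Z j w)"
   using X t unfolding ito_process_def by blast
  have "\<forall>j\<in>J. L2_fun M (Z j)"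
   using Z(1) ito_L2[OF _ L2_proc_mono[OF sg]] t by auto
  moreover have "AE w in M. X t w - drift \<beta> t w = \<xi> w + (\<Sum>j\<in>J. Z j w)"
   using Z(2) by eventually_elim simp
  ultimately show ?thesis using Z(1) by blast
 qed
 show L: "L2_fun M (%w. X t w - drift \<beta> t w)" if t: "t : {0..T}" for t
 proof -
  obtain Z where Z: "\<forall>j\<in>J. L2_fun M (Z j)" "AE w in M. X t w - drift \<beta> t w = \<xi> w + (\<Sum>j\<in>J. Z j w)"
   using ex[OF t] by blast
  have "L2_fun M (%w. \<xi> w + (\<Sum>j\<in>J. Z j w))" by (intro L2_fun_add xi L2_fun_sum) (use Z in auto)
  moreover have "(%w. X t w - drift \<beta> t w) : borel_measurable M"
   using Xm[OF t] L2_fun_measurable[OF drift_L2[OF b, of t]] t by auto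
  ultimately show ?thesis by (rule L2_fun_AE_cong) (use Z(2) in auto)
 qed
 show "L2_fun M (X t)" if t: "t : {0..T}" for t
  using L2_fun_add[OF L[OF t] drift_L2[OF b, of t]] t by simp
 assume st: "0 <= s" "s <= t" "t <= T" and G: "G : borel_measurable (Fl s)" "L2_fun M G"
 have s': "s : {0..T}" and t': "t : {0..T}" using st by auto
 obtain Z where Z: "\<forall>j\<in>J. ito j t (\<sigma> j) (Z j)" "\<forall>j\<in>J. L2_fun M (Z j)" "AE w in M. X t w - drift \<beta> t w = \<xi> w + (\<Sum>j\<in>J. Z j w)"
  using ex[OF t'] by blast
 obtain V where V: "\<forall>j\<in>J. ito j s (\<sigma> j) (V j)" "\<forall>j\<in>J. L2_fun M (V j)" "AE w in M. X s w - drift \<beta> s w = \<xi> w + (\<Sum>j\<in>J. V j w)"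
  using ex[OF s'] by blast
 have LZ: "L2_fun M (%w. Z j w - V j w)" if "j : J" for j using Z(2) V(2) that by (intro L2_fun_diff) auto
 have "expectation (%w. G w \<bullet> ((X t w - drift \<beta> t w) - (X s w - drift \<beta> s w))) = expectation (%w. \<Sum>j\<in>J. G w \<bullet> (Z j w - V j w))"
 proof (rule integral_cong_AE)
  show "AE w in M. G w \<bullet> ((X t w - drift \<beta> t w) - (X s w - drift \<beta> s w)) = (\<Sum>j\<in>J. G w \<bullet> (Z j w - V j w))"
   using Z(3) V(3) by eventually_elim (simp add: inner_sum_right[symmetric] sum_subtractf)
  show "(%w. G w \<bullet> ((X t w - drift \<beta> t w) - (X s w - drift \<beta> s w))) : borel_measurable M"
   using L2_inner_integrable[OF G(2) L2_fun_diff[OF L[OF t'] L[OF s']]] by (rule borel_measurable_integrable)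
  show "(%w. \<Sum>j\<in>J. G w \<bullet> (Z j w - V j w)) : borel_measurable M"
   by (intro borel_measurable_sum borel_measurable_integrable[OF L2_inner_integrable] G LZ)
 qed
 also have "... = (\<Sum>j\<in>J. expectation (%w. G w \<bullet> (Z j w - V j w)))"
  by (rule Bochner_Integration.integral_sum) (intro L2_inner_integrable G LZ)
 also have "... = 0"
 proof (rule sum.neutral, rule ballI)
  fix j assume j: "j : J"
  show "expectation (%w. G w \<bullet> (Z j w - V j w)) = 0"
   by (rule ito_orthogonal[OF _ L2_proc_mono[OF sg[OF j]] _ j st(1,2) G]) (use Z(1) V(1) j st in auto)
 qed
 finally have "expectation (%w. G w \<bullet> (X t w - drift \<beta> t w) - G w \<bullet> (X s w - drift \<beta> s w)) = 0"
  by (simp add: inner_diff_right)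
 moreover have "expectation (%w. G w \<bullet> (X t w - drift \<beta> t w) - G w \<bullet> (X s w - drift \<beta> s w))
   = expectation (%w. G w \<bullet> (X t w - drift \<beta> t w)) - expectation (%w. G w \<bullet> (X s w - drift \<beta> s w))"
  by (rule Bochner_Integration.integral_diff) (intro L2_inner_integrable G L s' t')+
 ultimately show "expectation (%w. G w \<bullet> (X t w - drift \<beta> t w)) = expectation (%w. G w \<bullet> (X s w - drift \<beta> s w))"
  by simp
qed

lemma ito_process_covariance:
 assumes X: "ito_process T \<xi> \<beta> \<sigma> X" and Y: "ito_process T \<eta> \<gamma> \<rho> Y" and t: "t : {0..T}"
 shows "expectation (%w. (X t w - drift \<beta> t w) \<bullet> (Y t w - drift \<gamma> t w))
  = expectation (%w. \<xi> w \<bullet> \<eta> w) + (\<Sum>j\<in>J. \<integral>(w, s). \<sigma> j s w \<bullet> \<rho> j s w \<partial>horizon M t)"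
proof -
 have t0: "0 <= t" using t by simp
 have sg: "!!j. j : J ==> L2_proc M t (\<sigma> j)" and rh: "!!j. j : J ==> L2_proc M t (\<rho> j)"
  using X Y L2_proc_mono[of M T _ t] t unfolding ito_process_def by auto
 have xi: "\<xi> : borel_measurable (Fl 0)" "L2_fun M \<xi>" and et: "\<eta> : borel_measurable (Fl 0)" "L2_fun M \<eta>"
  using X Y unfolding ito_process_def by auto
 obtain Z where Z: "\<forall>j\<in>J. ito j t (\<sigma> j) (Z j)" "AE w in M. X t w = \<xi> w + drift \<beta> t w + (\<Sum>j\<in>J. Z j w)"
  using X t unfolding ito_process_def by blast
 obtain V where V: "\<forall>j\<in>J. ito j t (\<rho> j) (V j)" "AE w in M. Y t w = \<eta> w + drift \<gamma> t w + (\<Sum>j\<in>J. V j w)"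
  using Y t unfolding ito_process_def by blast
 have LZ: "L2_fun M (Z j)" and LV: "L2_fun M (V j)" if "j : J" for j
  using ito_L2[OF _ sg[OF that] that t0] ito_L2[OF _ rh[OF that] that t0] Z(1) V(1) that by auto
 have "expectation (%w. (X t w - drift \<beta> t w) \<bullet> (Y t w - drift \<gamma> t w))
  = expectation (%w. \<xi> w \<bullet> \<eta> w + ((\<Sum>j\<in>J. \<xi> w \<bullet> V j w) + ((\<Sum>j\<in>J. \<eta> w \<bullet> Z j w) + (\<Sum>j\<in>J. \<Sum>l\<in>J. Z j w \<bullet> V l w))))"
 proof (rule integral_cong_AE)
  show "AE w in M. (X t w - drift \<beta> t w) \<bullet> (Y t w - drift \<gamma> t w)
   = \<xi> w \<bullet> \<eta> w + ((\<Sum>j\<in>J. \<xi> w \<bullet> V j w) + ((\<Sum>j\<in>J. \<eta> w \<bullet> Z j w) + (\<Sum>j\<in>J. \<Sum>l\<in>J. Z j w \<bullet> V l w)))"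
   using Z(2) V(2)
  proof eventually_elim
   case (elim w)
   have "(X t w - drift \<beta> t w) \<bullet> (Y t w - drift \<gamma> t w) = (\<xi> w + (\<Sum>j\<in>J. Z j w)) \<bullet> (\<eta> w + (\<Sum>j\<in>J. V j w))"
    using elim by simp
   then show ?case
    unfolding inner_sum_sum[symmetric]
    by (simp add: inner_add_left inner_add_right inner_sum_right[symmetric] inner_commute[of _ "\<eta> w"])
  qed
  show "(%w. (X t w - drift \<beta> t w) \<bullet> (Y t w - drift \<gamma> t w)) : borel_measurable M"
   by (intro borel_measurable_integrable L2_inner_integrable ito_process_martingale[OF X] ito_process_martingale[OF Y] t)
  show "(%w. \<xi> w \<bullet> \<eta> w + ((\<Sum>j\<in>J. \<xi> w \<bullet> V j w) + ((\<Sum>j\<in>J. \<eta> w \<bullet> Z j w) + (\<Sum>j\<in>J. \<Sum>l\<in>J. Z j w \<bullet> V l w)))) : borel_measurable M"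
   by (intro borel_measurable_integrable Bochner_Integration.integrable_add Bochner_Integration.integrable_sum L2_inner_integrable xi et LZ LV)
 qed
 also have "... = expectation (%w. \<xi> w \<bullet> \<eta> w) + ((\<Sum>j\<in>J. expectation (%w. \<xi> w \<bullet> V j w))
   + ((\<Sum>j\<in>J. expectation (%w. \<eta> w \<bullet> Z j w)) + (\<Sum>j\<in>J. \<Sum>l\<in>J. expectation (%w. Z j w \<bullet> V l w))))"
  by (simp add: L2_inner_integrable xi et LZ LV)
 also have "(\<Sum>j\<in>J. expectation (%w. \<xi> w \<bullet> V j w)) = 0"
  using V(1) ito_initial_orthogonal[OF _ rh _ t0 xi] by (intro sum.neutral) auto
 also have "(\<Sum>j\<in>J. expectation (%w. \<eta> w \<bullet> Z j w)) = 0"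
  using Z(1) ito_initial_orthogonal[OF _ sg _ t0 et] by (intro sum.neutral) auto
 also have "(\<Sum>j\<in>J. \<Sum>l\<in>J. expectation (%w. Z j w \<bullet> V l w)) = (\<Sum>j\<in>J. \<integral>(w, s). \<sigma> j s w \<bullet> \<rho> j s w \<partial>horizon M t)"
 proof (rule sum.cong[OF refl])
  fix j assume j: "j : J"
  have "(\<Sum>l\<in>J. expectation (%w. Z j w \<bullet> V l w)) = (\<Sum>l\<in>J. if j = l then \<integral>(w, s). \<sigma> j s w \<bullet> \<rho> l s w \<partial>horizon M t else 0)"
   by (rule sum.cong[OF refl], rule ito_isometry) (use Z(1) V(1) sg rh j t0 in auto)
  then show "(\<Sum>l\<in>J. expectation (%w. Z j w \<bullet> V l w)) = (\<integral>(w, s). \<sigma> j s w \<bullet> \<rho> j s w \<partial>horizon M t)"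
   using j finite_J by simp
 qed
 finally show ?thesis by simp
qed

text \<open>By Fubini the left side is the time integral of the pairing of \<open>\<beta> s\<close>
  with the martingale part at the final time. Since \<open>\<beta> s\<close> is known at
  \<open>s\<close>, the martingale property replaces the final time by \<open>s\<close>; adaptedness
  of the drift enters here.\<close>

lemma ito_process_drift_martingale:
 assumes X: "ito_process T \<xi> \<beta> \<sigma> X" and Y: "ito_process T \<eta> \<gamma> \<rho> Y" and t: "t : {0..T}"
 shows "expectation (%w. drift \<beta> t w \<bullet> (Y t w - drift \<gamma> t w)) = (\<integral>(w, s). \<beta> s w \<bullet> (Y s w - drift \<gamma> s w) \<partial>horizon M t)"
proof -
 let ?R = "restrict_space lborel {0..t}"
 interpret P: pair_sigma_finite M ?R by (rule pair_sigma_finite_horizon)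
 have b: "L2_proc M t \<beta>" and y: "L2_proc M t Y" and c: "L2_proc M t \<gamma>"
  using X Y L2_proc_mono[of M T _ t] t unfolding ito_process_def by auto
 have G: "L2_fun M (%w. Y t w - drift \<gamma> t w)" by (rule ito_process_martingale(2)[OF Y t])
 have L: "L2_proc M t (%s w. Y s w - drift \<gamma> s w)"
  using L2_fun_diff[OF y[unfolded L2_proc_def] drift_L2_proc[OF c, unfolded L2_proc_def]] by (simp add: L2_proc_def case_prod_beta')
 have i1: "integrable (M \<Otimes>\<^sub>M ?R) (%(w, s). \<beta> s w \<bullet> (Y t w - drift \<gamma> t w))"
  using horizon_inner_integrable[OF b L2_proc_const_time[OF G]] by (simp add: horizon_def)
 have i2: "integrable (M \<Otimes>\<^sub>M ?R) (%(w, s). \<beta> s w \<bullet> (Y s w - drift \<gamma> s w))"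
  using horizon_inner_integrable[OF b L] by (simp add: horizon_def)
 have "expectation (%w. drift \<beta> t w \<bullet> (Y t w - drift \<gamma> t w)) = (\<integral>(w, s). \<beta> s w \<bullet> (Y t w - drift \<gamma> t w) \<partial>horizon M t)"
  by (rule expectation_drift_inner[OF b G])
 also have "... = (\<integral>s. expectation (%w. \<beta> s w \<bullet> (Y t w - drift \<gamma> t w)) \<partial>?R)"
  unfolding horizon_def by (rule P.integral_snd[OF i1, symmetric])
 also have "... = (\<integral>s. expectation (%w. \<beta> s w \<bullet> (Y s w - drift \<gamma> s w)) \<partial>?R)"
 proof (rule integral_cong_AE)
  show "AE s in ?R. expectation (%w. \<beta> s w \<bullet> (Y t w - drift \<gamma> t w)) = expectation (%w. \<beta> s w \<bullet> (Y s w - drift \<gamma> s w))"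
   using L2_proc_AE_integrable(2)[OF b]
  proof (rule AE_mp, intro AE_I2 impI)
   fix s assume s: "s : space ?R" and L: "L2_fun M (\<beta> s)"
   have "\<beta> s : borel_measurable (Fl s)" using X s t unfolding ito_process_def by (auto simp: space_restrict_space)
   then show "expectation (%w. \<beta> s w \<bullet> (Y t w - drift \<gamma> t w)) = expectation (%w. \<beta> s w \<bullet> (Y s w - drift \<gamma> s w))"
    using s t by (intro ito_process_martingale(3)[OF Y _ _ _ _ L]) (auto simp: space_restrict_space)
  qed
  show "(%s. expectation (%w. \<beta> s w \<bullet> (Y t w - drift \<gamma> t w))) : borel_measurable ?R"
   using P.integrable_snd[OF i1] by (rule borel_measurable_integrable)
  show "(%s. expectation (%w. \<beta> s w \<bullet> (Y s w - drift \<gamma> s w))) : borel_measurable ?R"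
   using P.integrable_snd[OF i2] by (rule borel_measurable_integrable)
 qed
 also have "... = (\<integral>(w, s). \<beta> s w \<bullet> (Y s w - drift \<gamma> s w) \<partial>horizon M t)"
  unfolding horizon_def by (rule P.integral_snd[OF i2])
 finally show ?thesis .
qed

text \<open>Both processes are split into martingale part and drift. The covariance lemma gives the
  product of the martingale parts, the two mixed products come from
  \<open>ito_process_drift_martingale\<close>, and \<open>expectation_drift_drift\<close> gives the
  last one; collecting the time integrals restores \<open>X\<close> and \<open>Y\<close>.\<close>

theorem ito_process_inner:
 assumes X: "ito_process T \<xi> \<beta> \<sigma> X" and Y: "ito_process T \<eta> \<gamma> \<rho> Y" and t: "t : {0..T}"
 shows "integrable (horizon M t) (%(w, s). \<beta> s w \<bullet> Y s w + X s w \<bullet> \<gamma> s w + (\<Sum>j\<in>J. \<sigma> j s w \<bullet> \<rho> j s w))"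
  and "expectation (%w. X t w \<bullet> Y t w) = expectation (%w. \<xi> w \<bullet> \<eta> w)
   + (\<integral>(w, s). \<beta> s w \<bullet> Y s w + X s w \<bullet> \<gamma> s w + (\<Sum>j\<in>J. \<sigma> j s w \<bullet> \<rho> j s w) \<partial>horizon M t)"
proof -
 have t0: "0 <= t" using t by simp
 have b: "L2_proc M t \<beta>" and x: "L2_proc M t X" and y: "L2_proc M t Y" and c: "L2_proc M t \<gamma>"
  and sg: "!!j. j : J ==> L2_proc M t (\<sigma> j)" and rh: "!!j. j : J ==> L2_proc M t (\<rho> j)"
  using X Y L2_proc_mono[of M T _ t] t unfolding ito_process_def by auto
 define N where "N = (%s w. X s w - drift \<beta> s w)"
 define L where "L = (%s w. Y s w - drift \<gamma> s w)"
 have Np: "L2_proc M t N" and Lp: "L2_proc M t L"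
  using L2_fun_diff[OF y[unfolded L2_proc_def] drift_L2_proc[OF c, unfolded L2_proc_def]]
   L2_fun_diff[OF x[unfolded L2_proc_def] drift_L2_proc[OF b, unfolded L2_proc_def]]
  by (simp_all add: L2_proc_def case_prod_beta' N_def L_def)
 have Nt: "L2_fun M (N t)" "L2_fun M (L t)" "L2_fun M (drift \<beta> t)" "L2_fun M (drift \<gamma> t)"
  using ito_process_martingale(2)[OF X t] ito_process_martingale(2)[OF Y t] drift_L2[OF b t0 order_refl] drift_L2[OF c t0 order_refl]
  by (simp_all add: N_def L_def)
 note HI = horizon_inner_integrable
 note hi = HI[OF b y] HI[OF x c] HI[OF b Lp] HI[OF Np c] HI[OF b drift_L2_proc[OF c]] HI[OF drift_L2_proc[OF b] c] HI[OF sg rh]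
 have hi': "integrable (horizon M t) (%z. \<beta> (snd z) (fst z) \<bullet> Y (snd z) (fst z))"
  "integrable (horizon M t) (%z. X (snd z) (fst z) \<bullet> \<gamma> (snd z) (fst z))"
  "integrable (horizon M t) (%z. \<beta> (snd z) (fst z) \<bullet> L (snd z) (fst z))"
  "integrable (horizon M t) (%z. N (snd z) (fst z) \<bullet> \<gamma> (snd z) (fst z))"
  "integrable (horizon M t) (%z. \<beta> (snd z) (fst z) \<bullet> drift \<gamma> (snd z) (fst z))"
  "integrable (horizon M t) (%z. drift \<beta> (snd z) (fst z) \<bullet> \<gamma> (snd z) (fst z))"
  using hi(1-6) by (simp_all add: case_prod_beta')
 have hi7: "!!j. j : J ==> integrable (horizon M t) (%z. \<sigma> j (snd z) (fst z) \<bullet> \<rho> j (snd z) (fst z))"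
  using hi(7) by (simp add: case_prod_beta')
 show "integrable (horizon M t) (%(w, s). \<beta> s w \<bullet> Y s w + X s w \<bullet> \<gamma> s w + (\<Sum>j\<in>J. \<sigma> j s w \<bullet> \<rho> j s w))"
  unfolding case_prod_beta' by (intro Bochner_Integration.integrable_add Bochner_Integration.integrable_sum hi' hi7)
 have "expectation (%w. X t w \<bullet> Y t w) = expectation (%w. N t w \<bullet> L t w + (drift \<beta> t w \<bullet> L t w + (drift \<gamma> t w \<bullet> N t w + drift \<beta> t w \<bullet> drift \<gamma> t w)))"
  by (rule Bochner_Integration.integral_cong) (simp_all add: N_def L_def algebra_simps inner_commute)
 also have "... = expectation (%w. N t w \<bullet> L t w) + (expectation (%w. drift \<beta> t w \<bullet> L t w)
   + (expectation (%w. drift \<gamma> t w \<bullet> N t w) + expectation (%w. drift \<beta> t w \<bullet> drift \<gamma> t w)))"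
  by (simp add: L2_inner_integrable Nt)
 also have "expectation (%w. N t w \<bullet> L t w) = expectation (%w. \<xi> w \<bullet> \<eta> w) + (\<Sum>j\<in>J. \<integral>z. \<sigma> j (snd z) (fst z) \<bullet> \<rho> j (snd z) (fst z) \<partial>horizon M t)"
  using ito_process_covariance[OF X Y t] by (simp add: N_def L_def case_prod_beta')
 also have "expectation (%w. drift \<beta> t w \<bullet> L t w) = (\<integral>z. \<beta> (snd z) (fst z) \<bullet> L (snd z) (fst z) \<partial>horizon M t)"
  using ito_process_drift_martingale[OF X Y t] by (simp add: L_def case_prod_beta')
 also have "expectation (%w. drift \<gamma> t w \<bullet> N t w) = (\<integral>z. N (snd z) (fst z) \<bullet> \<gamma> (snd z) (fst z) \<partial>horizon M t)"
  using ito_process_drift_martingale[OF Y X t] by (simp add: N_def case_prod_beta' inner_commute[of "X _ _ - _"])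
 also have "expectation (%w. drift \<beta> t w \<bullet> drift \<gamma> t w)
   = (\<integral>z. \<beta> (snd z) (fst z) \<bullet> drift \<gamma> (snd z) (fst z) \<partial>horizon M t) + (\<integral>z. drift \<beta> (snd z) (fst z) \<bullet> \<gamma> (snd z) (fst z) \<partial>horizon M t)"
  unfolding expectation_drift_drift[OF b c t0] case_prod_beta' by (rule Bochner_Integration.integral_add[OF hi'(5,6)])
 finally have 1: "expectation (%w. X t w \<bullet> Y t w) = expectation (%w. \<xi> w \<bullet> \<eta> w)
   + ((\<integral>z. \<beta> (snd z) (fst z) \<bullet> L (snd z) (fst z) \<partial>horizon M t) + (\<integral>z. \<beta> (snd z) (fst z) \<bullet> drift \<gamma> (snd z) (fst z) \<partial>horizon M t))
   + ((\<integral>z. N (snd z) (fst z) \<bullet> \<gamma> (snd z) (fst z) \<partial>horizon M t) + (\<integral>z. drift \<beta> (snd z) (fst z) \<bullet> \<gamma> (snd z) (fst z) \<partial>horizon M t))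
   + (\<Sum>j\<in>J. \<integral>z. \<sigma> j (snd z) (fst z) \<bullet> \<rho> j (snd z) (fst z) \<partial>horizon M t)" by simp
 have 2: "(\<integral>z. \<beta> (snd z) (fst z) \<bullet> L (snd z) (fst z) \<partial>horizon M t) + (\<integral>z. \<beta> (snd z) (fst z) \<bullet> drift \<gamma> (snd z) (fst z) \<partial>horizon M t)
   = (\<integral>z. \<beta> (snd z) (fst z) \<bullet> Y (snd z) (fst z) \<partial>horizon M t)"
  unfolding Bochner_Integration.integral_add[OF hi'(3,5), symmetric]
  by (rule Bochner_Integration.integral_cong) (simp_all add: L_def inner_diff_right)
 have 3: "(\<integral>z. N (snd z) (fst z) \<bullet> \<gamma> (snd z) (fst z) \<partial>horizon M t) + (\<integral>z. drift \<beta> (snd z) (fst z) \<bullet> \<gamma> (snd z) (fst z) \<partial>horizon M t)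
   = (\<integral>z. X (snd z) (fst z) \<bullet> \<gamma> (snd z) (fst z) \<partial>horizon M t)"
  unfolding Bochner_Integration.integral_add[OF hi'(4,6), symmetric]
  by (rule Bochner_Integration.integral_cong) (simp_all add: N_def inner_diff_left)
 have 4: "(\<integral>z. \<beta> (snd z) (fst z) \<bullet> Y (snd z) (fst z) + X (snd z) (fst z) \<bullet> \<gamma> (snd z) (fst z) + (\<Sum>j\<in>J. \<sigma> j (snd z) (fst z) \<bullet> \<rho> j (snd z) (fst z)) \<partial>horizon M t)
   = (\<integral>z. \<beta> (snd z) (fst z) \<bullet> Y (snd z) (fst z) \<partial>horizon M t) + (\<integral>z. X (snd z) (fst z) \<bullet> \<gamma> (snd z) (fst z) \<partial>horizon M t)
   + (\<Sum>j\<in>J. \<integral>z. \<sigma> j (snd z) (fst z) \<bullet> \<rho> j (snd z) (fst z) \<partial>horizon M t)"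
  using hi'(1,2) hi7 by (simp add: Bochner_Integration.integrable_sum)
 show "expectation (%w. X t w \<bullet> Y t w) = expectation (%w. \<xi> w \<bullet> \<eta> w)
   + (\<integral>(w, s). \<beta> s w \<bullet> Y s w + X s w \<bullet> \<gamma> s w + (\<Sum>j\<in>J. \<sigma> j s w \<bullet> \<rho> j s w) \<partial>horizon M t)"
  unfolding 1 2 3 case_prod_beta' 4 by simp
qed

end

lemma FTC_restrict:
 fixes F f :: "real => real"
 assumes "0 <= T" and d: "!!s. s : {0..T} ==> (F has_vector_derivative f s) (at s within {0..T})"
  and c: "continuous_on {0..T} f" and t: "t : {0..T}"
 shows "integrable (restrict_space lborel {0..T}) f" "(LINT s:{0..t}|lborel. f s) = F t - F 0"
proof -
 have "has_bochner_integral lborel (%x. indicator {0..T} x *\<^sub>R f x) (F T - F 0)"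
  by (rule has_bochner_integral_FTC_Icc) (use assms in auto)
 then show "integrable (restrict_space lborel {0..T}) f"
  by (simp add: integrable_restrict_space has_bochner_integral_iff)
 have "has_bochner_integral lborel (%x. indicator {0..t} x *\<^sub>R f x) (F t - F 0)"
 proof (rule has_bochner_integral_FTC_Icc)
  show "0 <= t" using t by simp
  show "continuous_on {0..t} f" by (rule continuous_on_subset[OF c]) (use t in auto)
  fix x assume "0 <= x" "x <= t"
  then show "(F has_vector_derivative f x) (at x within {0..t})"
   using t by (intro has_vector_derivative_within_subset[OF d]) auto
 qed
 then show "(LINT s:{0..t}|lborel. f s) = F t - F 0"
  by (simp add: has_bochner_integral_iff set_lebesgue_integral_def)
qed

lemma continuous_on_restrict_measurable:
 fixes f :: "real => 'v::euclidean_space"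
 assumes "continuous_on {0..T} f"
 shows "f : borel_measurable (restrict_space lborel {0..T})" "f : borel_measurable (restrict_space borel {0..T})"
proof -
 show "f : borel_measurable (restrict_space borel {0..T})"
  using borel_measurable_continuous_on_restrict[OF assms] .
 then show "f : borel_measurable (restrict_space lborel {0..T})"
  by (simp cong: measurable_cong_sets sets_restrict_space_cong)
qed

lemma continuous_on_Icc_bounded:
 fixes f :: "real => 'v::euclidean_space"
 assumes "continuous_on {0..T} f"
 shows "\<exists>B. \<forall>s\<in>{0..T}. norm (f s) <= B"
proof -
 have "bounded (f ` {0..T})" by (intro compact_imp_bounded compact_continuous_image assms) auto
 then show ?thesis by (auto simp: bounded_iff)
qed

section \<open>Linear images and deterministic weights\<close>

context brownian_space begin

lemma L2_proc_linear:
 assumes "bounded_linear h" "L2_proc M t u"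
 shows "L2_proc M t (%s w. h (u s w))"
 using L2_fun_linear[OF assms(1) assms(2)[unfolded L2_proc_def]] by (simp add: L2_proc_def case_prod_beta')

lemma ito_process_linear:
 fixes h :: "'v::euclidean_space => 'u::euclidean_space"
 assumes h: "bounded_linear h" and X: "ito_process T \<xi> \<beta> \<sigma> X"
 shows "ito_process T (%w. h (\<xi> w)) (%s w. h (\<beta> s w)) (%j s w. h (\<sigma> j s w)) (%s w. h (X s w))"
proof -
 interpret h: bounded_linear h by (rule h)
 have hm: "h : borel_measurable borel"
  by (intro borel_measurable_continuous_onI linear_continuous_on h)
 have b: "L2_proc M T \<beta>" and sg: "!!j. j : J ==> L2_proc M T (\<sigma> j)" using X unfolding ito_process_def by auto
 have "\<exists>Z. (\<forall>j\<in>J. ito j t (%s w. h (\<sigma> j s w)) (Z j)) \<and>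
    (AE w in M. h (X t w) = h (\<xi> w) + drift (%s w. h (\<beta> s w)) t w + (\<Sum>j\<in>J. Z j w))" if t: "t : {0..T}" for t
 proof -
  obtain Z where Z: "\<forall>j\<in>J. ito j t (\<sigma> j) (Z j)" "AE w in M. X t w = \<xi> w + drift \<beta> t w + (\<Sum>j\<in>J. Z j w)"
   using X t unfolding ito_process_def by blast
  have "AE w in M. integrable (restrict_space lborel {0..t}) (%s. \<beta> s w)"
   by (rule L2_proc_AE_integrable(1)[OF L2_proc_mono[OF b]]) (use t in auto)
  with Z(2) have "AE w in M. h (X t w) = h (\<xi> w) + drift (%s w. h (\<beta> s w)) t w + (\<Sum>j\<in>J. h (Z j w))"
  proof eventually_elim
   case (elim w)
   then show ?case by (simp add: h.add h.sum LINT_restrict integral_bounded_linear[OF h])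
  qed
  moreover have "ito j t (%s w. h (\<sigma> j s w)) (%w. h (Z j w))" if j: "j : J" for j
   by (rule ito_linear[OF h _ L2_proc_mono[OF sg[OF j]] j]) (use Z(1) t j in auto)
  ultimately show ?thesis by (intro exI[of _ "%j w. h (Z j w)"]) auto
 qed
 then show ?thesis
  using X unfolding ito_process_def
  by (intro conjI ballI L2_proc_linear[OF h] L2_fun_linear[OF h] measurable_compose[OF _ hm]) auto
qed

lemma L2_proc_zero: "L2_proc M t (%_ _. 0)"
 by (simp add: L2_proc_def case_prod_beta' L2_fun_zero)

lemma ito_process_const:
 assumes "\<xi> : borel_measurable (Fl 0)" "L2_fun M \<xi>"
 shows "ito_process T \<xi> (%_ _. 0) (%_ _ _. 0) (%_. \<xi> :: 'w => 'v::euclidean_space)"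
 unfolding ito_process_def
 using assms L2_proc_zero L2_proc_const_time[OF assms(2)] ito_zero
 by (auto simp: usual_measurable_M intro!: exI[of _ "%_ _. 0"])

lemma horizon_weight:
 fixes f :: "real => real" and g :: "'w \<times> real => real"
 assumes f: "continuous_on {0..T} f" and g: "integrable (horizon M T) g"
 shows "integrable (horizon M T) (%z. f (snd z) * g z)"
  and "(\<integral>z. f (snd z) * g z \<partial>horizon M T) = (\<integral>s. f s * expectation (%w. g (w, s)) \<partial>restrict_space lborel {0..T})"
  and "integrable (restrict_space lborel {0..T}) (%s. expectation (%w. g (w, s)))"
proof -
 let ?R = "restrict_space lborel {0..T}"
 interpret P: pair_sigma_finite M ?R by (rule pair_sigma_finite_horizon)
 obtain B where B: "!!s. s : {0..T} ==> norm (f s) <= B" using continuous_on_Icc_bounded[OF f] by blast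
 have g': "integrable (M \<Otimes>\<^sub>M ?R) g" using g by (simp add: horizon_def)
 show i: "integrable (horizon M T) (%z. f (snd z) * g z)"
 proof (rule Bochner_Integration.integrable_bound)
  show "integrable (horizon M T) (%z. B * g z)" using g by simp
  show "(%z. f (snd z) * g z) : borel_measurable (horizon M T)"
   using measurable_compose[OF measurable_snd continuous_on_restrict_measurable(1)[OF f]] borel_measurable_integrable[OF g]
   unfolding horizon_def by (intro borel_measurable_times)
  show "AE z in horizon M T. norm (f (snd z) * g z) <= norm (B * g z)"
  proof (rule AE_I2)
   fix z assume "z : space (horizon M T)"
   then have "\<bar>f (snd z)\<bar> <= B" using B[of "snd z"] by (auto simp: horizon_def space_pair_measure space_restrict_space)
   then have "\<bar>f (snd z)\<bar> <= \<bar>B\<bar>" by simp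
   then show "norm (f (snd z) * g z) <= norm (B * g z)" by (simp add: abs_mult mult_right_mono)
  qed
 qed
 have i': "integrable (M \<Otimes>\<^sub>M ?R) (%(w, s). f s * g (w, s))" using i by (simp add: horizon_def case_prod_beta')
 have "(\<integral>z. f (snd z) * g z \<partial>horizon M T) = (\<integral>(w, s). f s * g (w, s) \<partial>(M \<Otimes>\<^sub>M ?R))"
  by (simp add: horizon_def case_prod_beta')
 also have "... = (\<integral>s. expectation (%w. f s * g (w, s)) \<partial>?R)" by (rule P.integral_snd[OF i', symmetric])
 finally show "(\<integral>z. f (snd z) * g z \<partial>horizon M T) = (\<integral>s. f s * expectation (%w. g (w, s)) \<partial>?R)" by simp
 have "integrable (M \<Otimes>\<^sub>M ?R) (%(w, s). g (w, s))" using g' by (simp add: case_prod_beta')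
 from P.integrable_snd[OF this] show "integrable ?R (%s. expectation (%w. g (w, s)))" .
qed

text \<open>The mean \<open>m\<close> of the product is the integral of a rate \<open>h\<close> that
  is merely integrable in time. Multiplication by the weight \<open>f\<close> therefore goes through
  \<open>integral_product_rule\<close> instead of a derivative of \<open>m\<close>.\<close>

lemma ito_process_weighted:
 fixes X Y :: "real => 'w => real"
 assumes X: "ito_process T \<xi> \<beta> \<sigma> X" and Y: "ito_process T \<eta> \<gamma> \<rho> Y" and T: "0 <= T"
  and f: "!!s. s : {0..T} ==> (f has_vector_derivative f' s) (at s within {0..T})"
  and f': "continuous_on {0..T} f'"
 shows "integrable (horizon M T) (%(w, s). f' s * (X s w * Y s w) + f s * (\<beta> s w * Y s w + X s w * \<gamma> s w + (\<Sum>j\<in>J. \<sigma> j s w * \<rho> j s w)))"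
  and "f T * expectation (%w. X T w * Y T w) = f 0 * expectation (%w. \<xi> w * \<eta> w)
   + (\<integral>(w, s). f' s * (X s w * Y s w) + f s * (\<beta> s w * Y s w + X s w * \<gamma> s w + (\<Sum>j\<in>J. \<sigma> j s w * \<rho> j s w)) \<partial>horizon M T)"
proof -
 let ?R = "restrict_space lborel {0..T}"
 define g where "g = (%(w, s). \<beta> s w * Y s w + X s w * \<gamma> s w + (\<Sum>j\<in>J. \<sigma> j s w * \<rho> j s w))"
 define h where "h s = expectation (%w. g (w, s))" for s
 define m where "m t = expectation (%w. X t w * Y t w)" for t
 define m0 where "m0 = expectation (%w. \<xi> w * \<eta> w)"
 have TT: "T : {0..T}" using T by simp
 have fc: "continuous_on {0..T} f"
  using f by (intro continuous_on_vector_derivative) auto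
 have gi: "integrable (horizon M t) g" and mt: "m t = m0 + (\<integral>z. g z \<partial>horizon M t)" if "t : {0..T}" for t
  using ito_process_inner[OF X Y that] by (simp_all add: g_def m_def m0_def)
 have mh: "m t = m0 + (LINT s:{0..t}|lborel. h s)" if t: "t : {0..T}" for t
  using horizon_weight(2)[of t "%_. 1", OF continuous_on_const gi[OF t]] mt[OF t] by (simp add: h_def LINT_restrict)
 have xy: "integrable (horizon M T) (%z. X (snd z) (fst z) * Y (snd z) (fst z))"
  using horizon_inner_integrable[of T X Y] X Y unfolding ito_process_def by (simp add: case_prod_beta')
 note w1 = horizon_weight[OF f' xy] and w2 = horizon_weight[OF fc gi[OF TT]]
 show "integrable (horizon M T) (%(w, s). f' s * (X s w * Y s w) + f s * (\<beta> s w * Y s w + X s w * \<gamma> s w + (\<Sum>j\<in>J. \<sigma> j s w * \<rho> j s w)))"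
  using Bochner_Integration.integrable_add[OF w1(1) w2(1)] by (simp add: g_def case_prod_beta')
 have eq: "(\<integral>(w, s). f' s * (X s w * Y s w) + f s * (\<beta> s w * Y s w + X s w * \<gamma> s w + (\<Sum>j\<in>J. \<sigma> j s w * \<rho> j s w)) \<partial>horizon M T)
   = (\<integral>s. f' s * m s \<partial>?R) + (\<integral>s. f s * h s \<partial>?R)"
  using Bochner_Integration.integral_add[OF w1(1) w2(1)] w1(2) w2(2) by (simp add: g_def case_prod_beta' m_def h_def)
 have hi: "integrable ?R h" using w2(3) by (simp add: h_def[abs_def])
 have F: "integrable ?R f'" "!!t. t : {0..T} ==> (LINT s:{0..t}|lborel. f' s) = f t - f 0"
  using FTC_restrict[OF T f f'] T by auto
 have f'i: "integrable ?R f'" by (rule F(1))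
 have pr: "(\<integral>s. f' s \<partial>?R) * (\<integral>s. h s \<partial>?R) = (\<integral>s. f' s * (m s - m0) + (f s - f 0) * h s \<partial>?R)"
  using integral_product_rule(2)[OF f'i hi] mh F(2)
  by (simp, intro Bochner_Integration.integral_cong) (auto simp: space_restrict_space)
 interpret PP: finite_measure ?R by (rule finite_measure_restrict_lborel)
 have i1: "integrable ?R (%s. f' s * m s)"
 proof -
  interpret P: pair_sigma_finite M ?R by (rule pair_sigma_finite_horizon)
  have "integrable (M \<Otimes>\<^sub>M ?R) (%(w, s). f' s * (X s w * Y s w))" using w1(1) by (simp add: horizon_def case_prod_beta')
  from P.integrable_snd[OF this] show ?thesis by (simp add: m_def)
 qed
 have i2: "integrable ?R (%s. f s * h s)"
 proof -
  interpret P: pair_sigma_finite M ?R by (rule pair_sigma_finite_horizon)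
  have "integrable (M \<Otimes>\<^sub>M ?R) (%(w, s). f s * g (w, s))" using w2(1) by (simp add: horizon_def case_prod_beta')
  from P.integrable_snd[OF this] show ?thesis by (simp add: h_def)
 qed
 have "(\<integral>s. f' s * (m s - m0) + (f s - f 0) * h s \<partial>?R) = (\<integral>s. (f' s * m s - m0 * f' s) + (f s * h s - f 0 * h s) \<partial>?R)"
  by (rule Bochner_Integration.integral_cong) (simp_all add: algebra_simps)
 also have "... = ((\<integral>s. f' s * m s \<partial>?R) - m0 * (\<integral>s. f' s \<partial>?R)) + ((\<integral>s. f s * h s \<partial>?R) - f 0 * (\<integral>s. h s \<partial>?R))"
  using i1 i2 hi f'i by simp
 finally have "(\<integral>s. f' s * m s \<partial>?R) + (\<integral>s. f s * h s \<partial>?R) = (\<integral>s. f' s \<partial>?R) * (\<integral>s. h s \<partial>?R) + m0 * (\<integral>s. f' s \<partial>?R) + f 0 * (\<integral>s. h s \<partial>?R)"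
  using pr by simp
 moreover have "(\<integral>s. f' s \<partial>?R) = f T - f 0" using F(2)[OF TT] by (simp add: LINT_restrict)
 moreover have "(\<integral>s. h s \<partial>?R) = m T - m0" using mh[OF TT] by (simp add: LINT_restrict)
 ultimately have "(\<integral>s. f' s * m s \<partial>?R) + (\<integral>s. f s * h s \<partial>?R) = f T * m T - f 0 * m0" by (simp add: algebra_simps)
 then show "f T * expectation (%w. X T w * Y T w) = f 0 * expectation (%w. \<xi> w * \<eta> w)
   + (\<integral>(w, s). f' s * (X s w * Y s w) + f s * (\<beta> s w * Y s w + X s w * \<gamma> s w + (\<Sum>j\<in>J. \<sigma> j s w * \<rho> j s w)) \<partial>horizon M T)"
  unfolding eq by (simp add: m_def m0_def)
qed

end

lemma bounded_bilinear_matrix_vector: "bounded_bilinear ((*v) :: real^'b^'a => real^'b => real^'a)"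
 unfolding bilinear_conv_bounded_bilinear[symmetric] bilinear_def
 by (auto intro!: linearI simp: matrix_vector_mult_def vec_eq_iff sum.distrib sum_distrib_left algebra_simps)

lemma inner_matrix_vector: "x \<bullet> (A *v y) = (\<Sum>a\<in>UNIV. \<Sum>b\<in>UNIV. A $ a $ b * (x $ a * y $ b))"
 by (simp add: inner_vec_def matrix_vector_mult_def sum_distrib_left ac_simps)

lemma has_vector_derivative_nth:
 "(F has_vector_derivative F') A ==> ((%s. F s $ a) has_vector_derivative F' $ a) A"
 by (rule bounded_linear.has_vector_derivative[OF bounded_linear_vec_nth])

lemma integral_sum_sum:
 fixes f :: "'a => 'b => 'c => real"
 assumes "!!a b. a : A ==> b : B ==> integrable N (f a b)"
 shows "(\<integral>x. (\<Sum>a\<in>A. \<Sum>b\<in>B. f a b x) \<partial>N) = (\<Sum>a\<in>A. \<Sum>b\<in>B. \<integral>x. f a b x \<partial>N)"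
  and "integrable N (%x. \<Sum>a\<in>A. \<Sum>b\<in>B. f a b x)"
proof -
 have "(\<integral>x. (\<Sum>a\<in>A. \<Sum>b\<in>B. f a b x) \<partial>N) = (\<Sum>a\<in>A. \<integral>x. (\<Sum>b\<in>B. f a b x) \<partial>N)"
  by (rule Bochner_Integration.integral_sum) (intro Bochner_Integration.integrable_sum assms)
 also have "... = (\<Sum>a\<in>A. \<Sum>b\<in>B. \<integral>x. f a b x \<partial>N)"
  by (intro sum.cong refl Bochner_Integration.integral_sum assms)
 finally show "(\<integral>x. (\<Sum>a\<in>A. \<Sum>b\<in>B. f a b x) \<partial>N) = (\<Sum>a\<in>A. \<Sum>b\<in>B. \<integral>x. f a b x \<partial>N)" .
 show "integrable N (%x. \<Sum>a\<in>A. \<Sum>b\<in>B. f a b x)"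
  by (intro Bochner_Integration.integrable_sum assms)
qed

context brownian_space begin

text \<open>A bilinear form is a weighted sum of products of coordinates, and every coordinate is a
  scalar Ito process by \<open>ito_process_linear\<close>; the weighted product formula is applied
  entry by entry.\<close>

theorem ito_process_quadratic:
 fixes X Y :: "real => 'w => real^'n" and P P' :: "real => real^'n^'n"
 assumes X: "ito_process T \<xi> \<beta> \<sigma> X" and Y: "ito_process T \<eta> \<gamma> \<rho> Y" and T: "0 <= T"
  and P: "!!s. s : {0..T} ==> (P has_vector_derivative P' s) (at s within {0..T})"
  and P': "continuous_on {0..T} P'"
 shows "integrable (horizon M T) (%(w, s). X s w \<bullet> (P' s *v Y s w) + \<beta> s w \<bullet> (P s *v Y s w) + X s w \<bullet> (P s *v \<gamma> s w)
    + (\<Sum>j\<in>J. \<sigma> j s w \<bullet> (P s *v \<rho> j s w)))"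
  and "expectation (%w. X T w \<bullet> (P T *v Y T w)) = expectation (%w. \<xi> w \<bullet> (P 0 *v \<eta> w))
   + (\<integral>(w, s). X s w \<bullet> (P' s *v Y s w) + \<beta> s w \<bullet> (P s *v Y s w) + X s w \<bullet> (P s *v \<gamma> s w)
    + (\<Sum>j\<in>J. \<sigma> j s w \<bullet> (P s *v \<rho> j s w)) \<partial>horizon M T)"
proof -
 have TT: "T : {0..T}" using T by simp
 let ?g = "%a b z. P' (snd z) $ a $ b * (X (snd z) (fst z) $ a * Y (snd z) (fst z) $ b)
   + P (snd z) $ a $ b * (\<beta> (snd z) (fst z) $ a * Y (snd z) (fst z) $ b + X (snd z) (fst z) $ a * \<gamma> (snd z) (fst z) $ b
   + (\<Sum>j\<in>J. \<sigma> j (snd z) (fst z) $ a * \<rho> j (snd z) (fst z) $ b))"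
 have c: "continuous_on {0..T} (%s. P' s $ a $ b)" for a b by (intro continuous_intros P')
 note W = ito_process_weighted[OF ito_process_linear[OF bounded_linear_vec_nth X] ito_process_linear[OF bounded_linear_vec_nth Y] T
   has_vector_derivative_nth[OF has_vector_derivative_nth[OF P]] c]
 have gi: "integrable (horizon M T) (?g a b)" for a b using W(1)[of a b a b] by (simp add: case_prod_beta')
 have ge: "P T $ a $ b * expectation (%w. X T w $ a * Y T w $ b) = P 0 $ a $ b * expectation (%w. \<xi> w $ a * \<eta> w $ b) + (\<integral>z. ?g a b z \<partial>horizon M T)" for a b
  using W(2)[of a b a b] by (simp add: case_prod_beta')
 have expand: "x \<bullet> (A' *v y) + b \<bullet> (A *v y) + x \<bullet> (A *v c) + (\<Sum>j\<in>J. s j \<bullet> (A *v r j))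
   = (\<Sum>i\<in>UNIV. \<Sum>k\<in>UNIV. A' $ i $ k * (x $ i * y $ k) + A $ i $ k * (b $ i * y $ k + x $ i * c $ k + (\<Sum>j\<in>J. s j $ i * r j $ k)))"
  for x y b c :: "real^'n" and A A' :: "real^'n^'n" and s r :: "nat => real^'n"
 proof -
  have "(\<Sum>j\<in>J. s j \<bullet> (A *v r j)) = (\<Sum>i\<in>UNIV. \<Sum>k\<in>UNIV. \<Sum>j\<in>J. A $ i $ k * (s j $ i * r j $ k))"
   unfolding inner_matrix_vector by (subst sum.swap, rule sum.cong[OF refl], subst sum.swap) simp
  then show ?thesis
   by (simp add: inner_matrix_vector sum.distrib[symmetric] distrib_left sum_distrib_left add.assoc)
 qed
 have eq: "(%(w, s). X s w \<bullet> (P' s *v Y s w) + \<beta> s w \<bullet> (P s *v Y s w) + X s w \<bullet> (P s *v \<gamma> s w)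
    + (\<Sum>j\<in>J. \<sigma> j s w \<bullet> (P s *v \<rho> j s w))) = (%z. \<Sum>a\<in>UNIV. \<Sum>b\<in>UNIV. ?g a b z)"
  unfolding expand case_prod_beta' ..
 show "integrable (horizon M T) (%(w, s). X s w \<bullet> (P' s *v Y s w) + \<beta> s w \<bullet> (P s *v Y s w) + X s w \<bullet> (P s *v \<gamma> s w)
    + (\<Sum>j\<in>J. \<sigma> j s w \<bullet> (P s *v \<rho> j s w)))"
  unfolding eq by (rule integral_sum_sum(2)[OF gi])
 have comp: "integrable M (%w. U w $ a * V w $ b)" if "L2_fun M U" "L2_fun M V" for U V :: "'w => real^'n" and a b
  by (intro L2_mult_integrable L2_fun_linear[OF bounded_linear_vec_nth] that)
 have lin: "expectation (%w. U w \<bullet> (A *v V w)) = (\<Sum>a\<in>UNIV. \<Sum>b\<in>UNIV. A $ a $ b * expectation (%w. U w $ a * V w $ b))"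
  if "L2_fun M U" "L2_fun M V" for U V :: "'w => real^'n" and A
  unfolding inner_matrix_vector
  by (subst integral_sum_sum(1)) (auto intro!: integrable_mult_right comp that)
 have L: "L2_fun M (X T)" "L2_fun M (Y T)" "L2_fun M \<xi>" "L2_fun M \<eta>"
  using ito_process_martingale(1)[OF X TT] ito_process_martingale(1)[OF Y TT] X Y by (auto simp: ito_process_def)
 show "expectation (%w. X T w \<bullet> (P T *v Y T w)) = expectation (%w. \<xi> w \<bullet> (P 0 *v \<eta> w))
   + (\<integral>(w, s). X s w \<bullet> (P' s *v Y s w) + \<beta> s w \<bullet> (P s *v Y s w) + X s w \<bullet> (P s *v \<gamma> s w)
    + (\<Sum>j\<in>J. \<sigma> j s w \<bullet> (P s *v \<rho> j s w)) \<partial>horizon M T)"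
  unfolding eq integral_sum_sum(1)[OF gi] lin[OF L(1,2)] lin[OF L(3,4)] ge by (simp add: sum.distrib)
qed

text \<open>Each coordinate is paired with the constant process 1, so the linear term is a special
  case of the weighted product formula.\<close>

theorem ito_process_affine:
 fixes X :: "real => 'w => real^'n" and p p' :: "real => real^'n"
 assumes X: "ito_process T \<xi> \<beta> \<sigma> X" and T: "0 <= T"
  and p: "!!s. s : {0..T} ==> (p has_vector_derivative p' s) (at s within {0..T})"
  and p': "continuous_on {0..T} p'"
 shows "integrable (horizon M T) (%(w, s). p' s \<bullet> X s w + p s \<bullet> \<beta> s w)"
  and "expectation (%w. p T \<bullet> X T w) = expectation (%w. p 0 \<bullet> \<xi> w)
   + (\<integral>(w, s). p' s \<bullet> X s w + p s \<bullet> \<beta> s w \<partial>horizon M T)"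
proof -
 have TT: "T : {0..T}" using T by simp
 have one: "ito_process T (%_. 1::real) (%_ _. 0) (%_ _ _. 0) (%_ _. 1)"
  by (rule ito_process_const) (simp_all add: L2_fun_const finite_measure_axioms)
 let ?g = "%a z. p' (snd z) $ a * X (snd z) (fst z) $ a + p (snd z) $ a * \<beta> (snd z) (fst z) $ a"
 have c: "continuous_on {0..T} (%s. p' s $ a)" for a by (intro continuous_intros p')
 note W = ito_process_weighted[OF ito_process_linear[OF bounded_linear_vec_nth X] one T has_vector_derivative_nth[OF p] c]
 have gi: "integrable (horizon M T) (?g a)" for a using W(1)[of a a] by (simp add: case_prod_beta')
 have ge: "p T $ a * expectation (%w. X T w $ a) = p 0 $ a * expectation (%w. \<xi> w $ a) + (\<integral>z. ?g a z \<partial>horizon M T)" for a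
  using W(2)[of a a] by (simp add: case_prod_beta')
 have eq: "(%(w, s). p' s \<bullet> X s w + p s \<bullet> \<beta> s w) = (%z. \<Sum>a\<in>UNIV. ?g a z)"
  by (simp add: fun_eq_iff inner_vec_def sum.distrib)
 show "integrable (horizon M T) (%(w, s). p' s \<bullet> X s w + p s \<bullet> \<beta> s w)"
  unfolding eq by (rule Bochner_Integration.integrable_sum[OF gi])
 have lin: "expectation (%w. c \<bullet> U w) = (\<Sum>a\<in>UNIV. c $ a * expectation (%w. U w $ a))"
  if "L2_fun M U" for U :: "'w => real^'n" and c
 proof -
  have "integrable M (%w. U w $ a)" for a
   by (intro L2_integrable finite_measure_axioms L2_fun_linear[OF bounded_linear_vec_nth] that)
  then show ?thesis unfolding inner_vec_def by simp
 qed
 have L: "L2_fun M (X T)" "L2_fun M \<xi>"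
  using ito_process_martingale(1)[OF X TT] X by (auto simp: ito_process_def)
 show "expectation (%w. p T \<bullet> X T w) = expectation (%w. p 0 \<bullet> \<xi> w)
   + (\<integral>(w, s). p' s \<bullet> X s w + p s \<bullet> \<beta> s w \<partial>horizon M T)"
  unfolding eq Bochner_Integration.integral_sum[OF gi] lin[OF L(1)] lin[OF L(2)] ge by (simp add: sum.distrib)
qed

subsection \<open>Progressive processes\<close>

lemma prog_measurable_horizon:
 assumes u: "prog_measurable Fl T u" and T: "0 <= T"
 shows "(%(w, s). u s w) : borel_measurable (horizon M T)"
proof -
 have m: "(%(s, w). u s w) : borel_measurable (restrict_space borel {0..T} \<Otimes>\<^sub>M Fl T)"
  using u T unfolding prog_measurable_def by simp
 have "(%z. (snd z, fst z)) : measurable (horizon M T) (restrict_space borel {0..T} \<Otimes>\<^sub>M Fl T)"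
  unfolding horizon_def
 proof (rule measurable_Pair)
  show "snd : measurable (M \<Otimes>\<^sub>M restrict_space lborel {0..T}) (restrict_space borel {0..T})"
   by (simp cong: measurable_cong_sets sets_restrict_space_cong)
  show "fst : measurable (M \<Otimes>\<^sub>M restrict_space lborel {0..T}) (Fl T)"
   using measurable_compose[OF measurable_fst usual_measurable_M[OF measurable_ident[of "Fl T"]]] by (simp add: id_def)
 qed
 from measurable_compose[OF this m] show ?thesis by (simp add: case_prod_beta')
qed

lemma prog_measurable_adapted:
 assumes u: "prog_measurable Fl T u" and s: "s : {0..T}"
 shows "u s : borel_measurable (Fl s)"
proof -
 have m: "(%(s, w). u s w) : borel_measurable (restrict_space borel {0..s} \<Otimes>\<^sub>M Fl s)"
  using u s unfolding prog_measurable_def by simp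
 show ?thesis using measurable_Pair2[OF m, of s] s by (simp add: space_restrict_space)
qed

text \<open>An agent is driven by two Brownian motions only. Zero coefficients for the remaining
  ones put all agents over the same index set, so that different agents can be multiplied.\<close>

lemma solves_sde_ito_process:
 fixes X :: "real => 'w => real^'n"
 assumes X: "solves_sde M Fl W J' T \<xi> \<beta> \<sigma> X" and J': "J' \<subseteq> J" and T: "0 <= T"
  and b: "prog_measurable Fl T \<beta>" "L2_proc M T \<beta>" and sg: "!!j. j : J' ==> L2_proc M T (\<sigma> j)"
  and xi: "\<xi> : borel_measurable (Fl 0)" "L2_fun M \<xi>"
 shows "ito_process T \<xi> \<beta> (%j. if j : J' then \<sigma> j else (%_ _. 0)) X"
proof -
 have Xp: "prog_measurable Fl T X" "energy M {0..T} X < \<infinity>" using X by (auto simp: solves_sde_def)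
 have "L2_proc M T X" unfolding L2_proc_iff_energy using prog_measurable_horizon[OF Xp(1) T] Xp(2) by simp
 moreover have "\<exists>Z. (\<forall>j\<in>J. ito j t (if j : J' then \<sigma> j else (%_ _. 0)) (Z j)) \<and>
    (AE w in M. X t w = \<xi> w + drift \<beta> t w + (\<Sum>j\<in>J. Z j w))" if t: "t : {0..T}" for t
 proof -
  obtain Z where Z: "\<forall>j\<in>J'. ito j t (\<sigma> j) (Z j)" "AE w in M. X t w = \<xi> w + drift \<beta> t w + (\<Sum>j\<in>J'. Z j w)"
   using X t unfolding solves_sde_def by blast
  define Z' where "Z' j = (if j : J' then Z j else (%_. 0))" for j
  have "(\<Sum>j\<in>J. Z' j w) = (\<Sum>j\<in>J'. Z j w)" for w
   unfolding Z'_def by (rule sum.mono_neutral_cong_right) (use finite_J J' in auto)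
  then show ?thesis using Z ito_zero by (intro exI[of _ Z']) (auto simp: Z'_def)
 qed
 ultimately show ?thesis
  unfolding ito_process_def
  using b sg xi L2_proc_zero prog_measurable_adapted[OF b(1)] usual_measurable_M[OF prog_measurable_adapted[OF Xp(1)]] by auto
qed

lemma prog_measurable_add:
 fixes u v :: "real => 'w => 'v::euclidean_space"
 shows "prog_measurable Fl T u ==> prog_measurable Fl T v ==> prog_measurable Fl T (%s w. u s w + v s w)"
 unfolding prog_measurable_def case_prod_beta' by (intro ballI borel_measurable_add) blast+

lemma prog_measurable_const: "prog_measurable Fl T (%_ _. c)"
 unfolding prog_measurable_def by simp

lemma prog_measurable_sum:
 fixes u :: "'i => real => 'w => 'v::euclidean_space"
 shows "(!!i. i : I ==> prog_measurable Fl T (u i)) ==> prog_measurable Fl T (%s w. \<Sum>i\<in>I. u i s w)"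
 by (induction I rule: infinite_finite_induct) (auto intro: prog_measurable_add prog_measurable_const)

lemma prog_measurable_time:
 fixes f :: "real => 'v::euclidean_space"
 assumes "continuous_on {0..T} f"
 shows "prog_measurable Fl T (%s _. f s)"
proof -
 have "f : borel_measurable (restrict_space borel {0..t})" if "t : {0..T}" for t
  by (rule continuous_on_restrict_measurable(2)[OF continuous_on_subset[OF assms]]) (use that in auto)
 then show ?thesis
  unfolding prog_measurable_def case_prod_beta'
  using measurable_compose[OF measurable_fst] by blast
qed

lemma prog_measurable_bounded_bilinear:
 fixes u :: "real => 'w => 'a::euclidean_space" and v :: "real => 'w => 'b::euclidean_space"
  and h :: "'a => 'b => 'c::euclidean_space"
 assumes h: "bounded_bilinear h" and u: "prog_measurable Fl T u" and v: "prog_measurable Fl T v"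
 shows "prog_measurable Fl T (%s w. h (u s w) (v s w))"
proof -
 have c: "(%x. h (fst x) (snd x)) : borel_measurable borel"
  by (intro borel_measurable_continuous_onI bounded_bilinear.continuous_on[OF h] continuous_intros)
 show ?thesis
  unfolding prog_measurable_def
 proof
  fix t assume "t : {0..T}"
  then have "(%z. u (fst z) (snd z)) : borel_measurable (restrict_space borel {0..t} \<Otimes>\<^sub>M Fl t)"
   "(%z. v (fst z) (snd z)) : borel_measurable (restrict_space borel {0..t} \<Otimes>\<^sub>M Fl t)"
   using u v by (auto simp: prog_measurable_def case_prod_beta')
  from measurable_compose[OF borel_measurable_Pair[OF this] c]
  show "(%(s, w). h (u s w) (v s w)) : borel_measurable (restrict_space borel {0..t} \<Otimes>\<^sub>M Fl t)"
   by (simp add: case_prod_beta')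
 qed
qed

lemma prog_measurable_matrix:
 fixes A :: "real^'a^'b"
 shows "prog_measurable Fl T u ==> prog_measurable Fl T (%s w. A *v u s w)"
 by (rule prog_measurable_bounded_bilinear[OF bounded_bilinear_matrix_vector prog_measurable_const])

lemma L2_proc_add:
 "L2_proc M t u ==> L2_proc M t v ==> L2_proc M t (%s w. u s w + v s w)"
 unfolding L2_proc_def case_prod_beta' by (rule L2_fun_add)

lemma L2_proc_const: "L2_proc M t (%_ _. c)"
 unfolding L2_proc_def case_prod_beta' by (rule L2_fun_const[OF finite_measure_horizon])

lemma L2_proc_sum:
 "(!!i. i : I ==> L2_proc M t (u i)) ==> L2_proc M t (%s w. \<Sum>i\<in>I. u i s w)"
 unfolding L2_proc_def case_prod_beta' by (rule L2_fun_sum)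

lemma L2_proc_matrix: "L2_proc M t u ==> L2_proc M t (%s w. (A :: real^'a^'b) *v u s w)"
 by (rule L2_proc_linear[OF matrix_vector_mul_bounded_linear])

lemma L2_proc_time_matrix:
 fixes A :: "real => real^'a^'b"
 assumes A: "continuous_on {0..T} A" and u: "prog_measurable Fl T u" "L2_proc M T u" and T: "0 <= T"
 shows "L2_proc M T (%s w. A s *v u s w)"
proof -
 obtain K where K: "!!a b. norm ((a::real^'a^'b) *v b) <= norm a * norm b * K" "0 <= K"
  using bounded_bilinear.nonneg_bounded[OF bounded_bilinear_matrix_vector] by metis
 obtain B where B: "!!s. s : {0..T} ==> norm (A s) <= B" using continuous_on_Icc_bounded[OF A] by blast
 show ?thesis
  unfolding L2_proc_def
 proof (rule L2_fun_bound[OF u(2)[unfolded L2_proc_def], where c="B * K"])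
  show "(%(w, s). A s *v u s w) : borel_measurable (horizon M T)"
   by (rule prog_measurable_horizon[OF prog_measurable_bounded_bilinear[OF bounded_bilinear_matrix_vector prog_measurable_time[OF A] u(1)] T])
  fix z assume "z : space (horizon M T)"
  then have z: "snd z : {0..T}" by (auto simp: horizon_def space_pair_measure space_restrict_space)
  have "norm (A (snd z) *v u (snd z) (fst z)) <= norm (A (snd z)) * norm (u (snd z) (fst z)) * K" by (rule K)
  also have "... <= B * norm (u (snd z) (fst z)) * K" by (intro mult_right_mono B z K) auto
  finally show "norm (case z of (w, s) => A s *v u s w) <= B * K * norm (case z of (w, s) => u s w)"
   by (simp add: case_prod_beta' algebra_simps)
 qed
qed

end

section \<open>Continuous versions of Ito integrals\<close>

text \<open>Radial projection onto the ball of radius \<open>R\<close>: it bounds an integrand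
  without destroying continuity.\<close>

definition clip :: "real => 'v::euclidean_space => 'v" where
 "clip R x = (R / max R (norm x)) *\<^sub>R x"

lemma clip_norm_le: "0 < R ==> norm (clip R x) <= R"
 by (auto simp: clip_def divide_simps max_def mult_le_cancel_left_pos)

lemma clip_id: "0 < R ==> norm x <= R ==> clip R x = x"
 by (simp add: clip_def max_def)

lemma clip_diff_le: "0 < R ==> norm (x - clip R x) <= norm x"
proof -
 assume R: "0 < R"
 have "x - clip R x = (1 - R / max R (norm x)) *\<^sub>R x" by (simp add: clip_def algebra_simps)
 moreover have "0 <= R / max R (norm x)" "R / max R (norm x) <= 1" using R by (auto simp: divide_simps)
 ultimately show ?thesis by (simp add: mult_left_le_one_le)
qed

lemma continuous_clip: "0 < R ==> continuous_on UNIV (clip R)"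
 unfolding clip_def by (intro continuous_intros) auto

lemma simple_value_eq:
 assumes "mono \<tau>" "l < k" "s : {\<tau> l<..\<tau> (Suc l)}"
 shows "simple_value k \<tau> \<eta> s w = \<eta> l w"
proof -
 have "indicator {\<tau> l'<..\<tau> (Suc l')} s *\<^sub>R \<eta> l' w = (if l' = l then \<eta> l w else 0)" for l'
 proof (cases l l' rule: linorder_cases)
  case less
  then have "\<tau> (Suc l) <= \<tau> l'" using assms(1) by (auto intro: monoD)
  then show ?thesis using assms(3) less by auto
 next
  case greater
  then have "\<tau> (Suc l') <= \<tau> l" using assms(1) by (auto intro: monoD)
  then show ?thesis using assms(3) greater by auto
 qed (use assms(3) in auto)
 then show ?thesis unfolding simple_value_def using assms(2) by simp
qed

context brownian_space begin

text \<open>Continuity is demanded at every sample point, not just almost surely. Constructions that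
  succeed off a null set are put equal to 0 on it, which keeps them adapted because every
  \<open>Fl t\<close> contains the null sets of \<open>M\<close>.\<close>

definition cont_adapted :: "(real => 'w => 'v::euclidean_space) => bool" where
 "cont_adapted X \<longleftrightarrow> (\<forall>w\<in>space M. continuous_on {0..} (%t. X t w)) \<and> (\<forall>t\<ge>0. X t : borel_measurable (Fl t))"

definition loc_bounded_L2 :: "(real => 'w => 'v::euclidean_space) => bool" where
 "loc_bounded_L2 X \<longleftrightarrow> (\<forall>T\<ge>0. \<exists>C\<ge>0. \<forall>t\<in>{0..T}. sqn M (X t) <= ennreal C)"

lemma cont_adapted_M: "cont_adapted X ==> 0 <= t ==> X t : borel_measurable M"
 unfolding cont_adapted_def using usual_measurable_M by blast

text \<open>Rounding time down to multiples of 1 / (n + 1) leaves countably many sampled times, for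
  which joint measurability is clear; continuous paths make the rounded processes converge.\<close>

lemma cont_adapted_prog:
 assumes X: "cont_adapted X"
 shows "prog_measurable Fl T X"
 unfolding prog_measurable_def
proof
 fix t assume t: "t : {0..T}"
 \<comment> \<open>Clamping to [0, t] makes every sample measurable for \<open>Fl t\<close>,
   whatever the integer \<open>i\<close>; for actual times in [0, t] the rounded value is not
   changed by it.\<close>
 define c where "c n i = min t (max 0 (of_int i / real (Suc n)))" for n :: nat and i :: int
 define f where "f n = (%z. X (c n \<lfloor>fst z * real (Suc n)\<rfloor>) (snd z))" for n
 have "(%z. X (fst z) (snd z)) : borel_measurable (restrict_space borel {0..t} \<Otimes>\<^sub>M Fl t)"
 proof (rule borel_measurable_LIMSEQ_metric[where f=f])
  fix n
  show "f n : borel_measurable (restrict_space borel {0..t} \<Otimes>\<^sub>M Fl t)"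
   unfolding f_def
  proof (rule measurable_compose_countable)
   fix i :: int
   have "0 <= c n i" "c n i <= t" using t by (auto simp: c_def)
   then have "X (c n i) : borel_measurable (Fl t)"
    using X usual_measurable_mono unfolding cont_adapted_def by blast
   then show "(%z. X (c n i) (snd z)) : borel_measurable (restrict_space borel {0..t} \<Otimes>\<^sub>M Fl t)"
    by (rule measurable_compose[OF measurable_snd])
   have "(%s. \<lfloor>s * real (Suc n)\<rfloor>) : measurable borel (count_space UNIV)" by measurable
   then have "(%s. \<lfloor>s * real (Suc n)\<rfloor>) : measurable (restrict_space borel {0..t}) (count_space UNIV)"
    by (rule measurable_restrict_space1)
   then show "(%z. \<lfloor>fst z * real (Suc n)\<rfloor>) : measurable (restrict_space borel {0..t} \<Otimes>\<^sub>M Fl t) (count_space UNIV)"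
    by (rule measurable_compose[OF measurable_fst])
  qed
 next
  fix z assume z: "z : space (restrict_space borel {0..t} \<Otimes>\<^sub>M Fl t)"
  then have s: "fst z : {0..t}" and w: "snd z : space M" by (auto simp: space_pair_measure space_restrict_space)
  have "(%n. c n \<lfloor>fst z * real (Suc n)\<rfloor>) \<longlonglongrightarrow> fst z"
  proof (rule LIMSEQ_I)
   fix r :: real assume "0 < r"
   then obtain N where N: "inverse (real (Suc N)) < r" using reals_Archimedean by blast
   show "\<exists>no. \<forall>n\<ge>no. norm (c n \<lfloor>fst z * real (Suc n)\<rfloor> - fst z) < r"
   proof (intro exI[of _ N] allI impI)
    fix n assume n: "N <= n"
    let ?q = "of_int \<lfloor>fst z * real (Suc n)\<rfloor> / real (Suc n)"
    have q1: "?q <= fst z" by (simp add: divide_le_eq)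
    have "fst z * real (Suc n) - 1 <= of_int \<lfloor>fst z * real (Suc n)\<rfloor>" by linarith
    then have "(fst z * real (Suc n) - 1) / real (Suc n) <= ?q" by (intro divide_right_mono) auto
    then have q2: "fst z - inverse (real (Suc n)) <= ?q" by (simp add: field_simps)
    have q0: "0 <= ?q" using s by simp
    have "c n \<lfloor>fst z * real (Suc n)\<rfloor> = ?q" using q0 q1 s by (auto simp: c_def min_def max_def)
    moreover have "inverse (real (Suc n)) <= inverse (real (Suc N))" using n by simp
    ultimately show "norm (c n \<lfloor>fst z * real (Suc n)\<rfloor> - fst z) < r"
     using q1 q2 N unfolding real_norm_def by linarith
   qed
  qed
  moreover have "continuous_on {0..} (%t. X t (snd z))" using X w by (auto simp: cont_adapted_def)
  ultimately show "(%n. f n z) \<longlonglongrightarrow> X (fst z) (snd z)"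
   unfolding f_def using s t
   by (intro continuous_on_tendsto_compose[of "{0..}" "%t. X t (snd z)"] always_eventually allI) (auto simp: c_def)
 qed
 then show "(%(s, w). X s w) : borel_measurable (restrict_space borel {0..t} \<Otimes>\<^sub>M Fl t)"
  by (simp add: case_prod_beta')
qed

lemma cont_adapted_horizon:
 assumes "cont_adapted X"
 shows "(%(w, s). X s w) : borel_measurable (horizon M T)"
proof -
 have "(%(w, s). X s w) : borel_measurable (horizon M (max 0 T))"
  by (rule prog_measurable_horizon[OF cont_adapted_prog[OF assms]]) simp
 then show ?thesis by (rule horizon_measurable_mono[rotated]) simp
qed

lemma energy_time_integral:
 fixes u :: "real => 'w => 'v::euclidean_space"
 assumes u: "(%(w, s). u s w) : borel_measurable (horizon M t)"
 shows "energy M {0..t} u = (\<integral>\<^sup>+s. sqn M (u s) \<partial>restrict_space lborel {0..t})"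
proof -
 let ?R = "restrict_space lborel {0..t}"
 interpret P: pair_sigma_finite M ?R by (rule pair_sigma_finite_horizon)
 have "energy M {0..t} u = sqn (M \<Otimes>\<^sub>M ?R) (%x. case x of (w, s) => u s w)"
  using energy_horizon[OF u] by (simp add: horizon_def)
 also have "... = (\<integral>\<^sup>+s. sqn M (u s) \<partial>?R)"
  using u unfolding horizon_def
  by (subst P.nn_integral_snd[symmetric]) (simp_all add: case_prod_beta')
 finally show ?thesis .
qed

lemma energy_le_bound:
 fixes u :: "real => 'w => 'v::euclidean_space"
 assumes u: "(%(w, s). u s w) : borel_measurable (horizon M t)"
  and b: "!!s. s : {0..t} ==> sqn M (u s) <= B" and t: "0 <= t"
 shows "energy M {0..t} u <= B * ennreal t"
proof -
 have "energy M {0..t} u <= (\<integral>\<^sup>+s. B \<partial>restrict_space lborel {0..t})"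
  unfolding energy_time_integral[OF u] by (rule nn_integral_mono) (auto simp: space_restrict_space intro!: b)
 also have "... = B * ennreal t" using t by (simp add: space_restrict_space emeasure_restrict_space)
 finally show ?thesis .
qed

lemma cont_L2_proc:
 assumes X: "cont_adapted X" "loc_bounded_L2 X"
 shows "L2_proc M T X"
proof (cases "0 <= T")
 case True
 obtain C where C: "!!t. t : {0..T} ==> sqn M (X t) <= ennreal C"
  using X(2) True unfolding loc_bounded_L2_def by blast
 have "energy M {0..T} X <= ennreal C * ennreal T"
  by (rule energy_le_bound[OF cont_adapted_horizon[OF X(1)] C True])
 also have "... < \<infinity>" by (simp add: ennreal_mult_less_top)
 finally show ?thesis unfolding L2_proc_iff_energy using cont_adapted_horizon[OF X(1)] by simp
next
 case False
 then show ?thesis unfolding L2_proc_iff_energy using cont_adapted_horizon[OF X(1)] by (simp add: energy_def)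
qed

lemma clip_energy:
 fixes H :: "real => 'w => 'v::euclidean_space"
 assumes H: "L2_proc M T H"
 shows "(%n. energy M {0..T} (%s w. H s w - clip (real (Suc n)) (H s w))) \<longlonglongrightarrow> 0"
proof -
 have Hm[measurable]: "(%z. H (snd z) (fst z)) : borel_measurable (horizon M T)" using H by (simp add: L2_proc_iff_energy case_prod_beta')
 have [measurable]: "clip (real (Suc n)) : borel_measurable (borel :: 'v measure)" for n
  by (intro borel_measurable_continuous_onI continuous_clip) simp
 have m: "(%(w, s). H s w - clip (real (Suc n)) (H s w)) : borel_measurable (horizon M T)" for n
  unfolding case_prod_beta' by measurable
 have "(%n. sqn (horizon M T) (%z. H (snd z) (fst z) - clip (real (Suc n)) (H (snd z) (fst z))))
   \<longlonglongrightarrow> (\<integral>\<^sup>+z. 0 \<partial>horizon M T)"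
 proof (rule nn_integral_dominated_convergence[where w="%z. ennreal ((norm (H (snd z) (fst z)))^2)"])
  show "sqn (horizon M T) (%z. H (snd z) (fst z)) < \<infinity>"
   using H by (simp add: L2_proc_def L2_fun_iff case_prod_beta')
  show "AE z in horizon M T. ennreal ((norm (H (snd z) (fst z) - clip (real (Suc n)) (H (snd z) (fst z))))^2) <= ennreal ((norm (H (snd z) (fst z)))^2)" for n
   by (intro AE_I2 ennreal_leI power_mono clip_diff_le) auto
  show "AE z in horizon M T. (%n. ennreal ((norm (H (snd z) (fst z) - clip (real (Suc n)) (H (snd z) (fst z))))^2)) \<longlonglongrightarrow> 0"
  proof (intro AE_I2 tendsto_eventually)
   fix z
   obtain N where N: "norm (H (snd z) (fst z)) <= real N" using real_arch_simple by blast
   show "\<forall>\<^sub>F n in sequentially. ennreal ((norm (H (snd z) (fst z) - clip (real (Suc n)) (H (snd z) (fst z))))^2) = 0"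
    using eventually_ge_at_top[of N]
   proof eventually_elim
    case (elim n)
    then have "clip (real (Suc n)) (H (snd z) (fst z)) = H (snd z) (fst z)" using N by (intro clip_id) auto
    then show ?case by simp
   qed
  qed
 qed measurable
 then show ?thesis using energy_horizon[OF m] by (simp add: case_prod_beta')
qed

text \<open>Sampling at left end points keeps the approximants adapted. Continuity of the paths
  gives pointwise convergence and the bound \<open>B\<close> the dominating constant.\<close>

lemma bounded_step_energy:
 fixes H :: "real => 'w => 'v::euclidean_space"
 assumes H: "cont_adapted H" and B: "!!t w. norm (H t w) <= B" and T: "0 < T"
 defines "\<tau> \<equiv> %n l. real l * T / real (Suc n)"
 shows "simple_process M Fl (Suc n) (\<tau> n) (%l. H (\<tau> n l))"
  and "(%n. energy M {0..T} (%s w. H s w - simple_value (Suc n) (\<tau> n) (%l. H (\<tau> n l)) s w)) \<longlonglongrightarrow> 0"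
proof -
 have \<tau>0: "0 <= \<tau> n l" for n l using T by (simp add: \<tau>_def)
 have mono: "mono (\<tau> n)" for n using T by (auto simp: \<tau>_def mono_def intro!: divide_right_mono mult_right_mono)
 show sp: "simple_process M Fl (Suc n) (\<tau> n) (%l. H (\<tau> n l))" for n
  unfolding simple_process_def using H \<tau>0 mono B by (auto simp: cont_adapted_def bounded_iff intro!: exI[of _ B])
 let ?S = "%n. simple_value (Suc n) (\<tau> n) (%l. H (\<tau> n l))"
 have Sm: "(%z. ?S n (snd z) (fst z)) : borel_measurable (horizon M T)" for n
  using simple_value_horizon_measurable[OF sp, of n T] by (simp add: case_prod_beta')
 have Hm: "(%z. H (snd z) (fst z)) : borel_measurable (horizon M T)"
  using cont_adapted_horizon[OF H] by (simp add: case_prod_beta')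
 have loc: "\<exists>l<Suc n. s : {\<tau> n l<..\<tau> n (Suc l)} \<and> ?S n s w = H (\<tau> n l) w" if s: "0 < s" "s <= T" for n s w
 proof -
  \<comment> \<open>The intervals of a simple process are open on the left and closed on the right,
    hence ceiling minus one instead of floor.\<close>
  define l where "l = nat (\<lceil>s * real (Suc n) / T\<rceil> - 1)"
  have pos: "0 < s * real (Suc n) / T" using s T by simp
  have c1: "1 <= \<lceil>s * real (Suc n) / T\<rceil>" using pos by (simp add: one_le_ceiling)
  have rl: "real l = of_int \<lceil>s * real (Suc n) / T\<rceil> - 1" using c1 by (simp add: l_def)
  have a: "real l < s * real (Suc n) / T" "s * real (Suc n) / T <= real l + 1" unfolding rl by linarith+
  have "s * real (Suc n) / T <= real (Suc n)" using s T by (simp add: divide_le_eq mult.commute mult_left_mono)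
  then have "real l < real (Suc n)" using a by linarith
  then have lk: "l < Suc n" by linarith
  have "\<tau> n l < s" using a(1) T by (simp add: \<tau>_def field_simps)
  moreover have "s <= \<tau> n (Suc l)" using a(2) T by (simp add: \<tau>_def field_simps)
  ultimately have sl: "s : {\<tau> n l<..\<tau> n (Suc l)}" by simp
  show ?thesis by (intro exI[of _ l] conjI lk sl simple_value_eq[OF mono lk sl])
 qed
 have B0: "0 <= B" using B[of 0 undefined] norm_ge_zero order_trans by blast
 \<comment> \<open>At time 0 every simple process on this grid vanishes, so convergence may fail
   there; the time slice is a null set.\<close>
 have R: "AE z in horizon M T. snd z ~= 0"
 proof -
  interpret P: pair_sigma_finite M "restrict_space lborel {0..T}" by (rule pair_sigma_finite_horizon)
  have "AE x in M. AE y in restrict_space lborel {0..T}. snd (x, y) ~= 0"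
   using AE_restrict_neq by simp
  then show ?thesis unfolding horizon_def
  proof (rule P.AE_pair_measure[rotated])
   have "snd : borel_measurable (M \<Otimes>\<^sub>M restrict_space lborel {0..T})"
    using measurable_compose[OF measurable_snd measurable_restrict_space1[OF measurable_ident[of "lborel :: real measure"]]] by (simp add: id_def)
   then show "{x : space (M \<Otimes>\<^sub>M restrict_space lborel {0..T}). snd x ~= 0} : sets (M \<Otimes>\<^sub>M restrict_space lborel {0..T})"
    by measurable
  qed
 qed
 have "(%n. sqn (horizon M T) (%z. H (snd z) (fst z) - ?S n (snd z) (fst z)))
   \<longlonglongrightarrow> (\<integral>\<^sup>+z. 0 \<partial>horizon M T)"
 proof (rule nn_integral_dominated_convergence[where w="%z. ennreal ((2 * B)^2)"])
  interpret HH: finite_measure "horizon M T" by (rule finite_measure_horizon)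
  show "(\<integral>\<^sup>+z. ennreal ((2 * B)^2) \<partial>horizon M T) < \<infinity>"
   using HH.emeasure_finite[of "space (horizon M T)"]
   by (simp add: ennreal_mult_less_top ennreal_mult_eq_top_iff less_top[symmetric])
  have ae: "AE z in horizon M T. 0 < snd z \<and> snd z <= T \<and> fst z : space M"
   using R AE_space
  proof eventually_elim
   case (elim z)
   then show ?case by (auto simp: horizon_def space_pair_measure space_restrict_space)
  qed
  show "AE z in horizon M T. ennreal ((norm (H (snd z) (fst z) - ?S n (snd z) (fst z)))^2) <= ennreal ((2 * B)^2)" for n
   using ae
  proof eventually_elim
   case (elim z)
   then obtain l where "?S n (snd z) (fst z) = H (\<tau> n l) (fst z)" using loc by blast
   then have "norm (H (snd z) (fst z) - ?S n (snd z) (fst z)) <= 2 * B"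
    using norm_triangle_ineq4[of "H (snd z) (fst z)" "H (\<tau> n l) (fst z)"] B[of "snd z" "fst z"] B[of "\<tau> n l" "fst z"] by simp
   then show ?case by (intro ennreal_leI power_mono) auto
  qed
  show "AE z in horizon M T. (%n. ennreal ((norm (H (snd z) (fst z) - ?S n (snd z) (fst z)))^2)) \<longlonglongrightarrow> 0"
   using ae
  proof eventually_elim
   case (elim z)
   let ?s = "snd z" and ?w = "fst z"
   have "\<forall>n. \<exists>l. ?s : {\<tau> n l<..\<tau> n (Suc l)} \<and> ?S n ?s ?w = H (\<tau> n l) ?w" using loc elim by blast
   from choice[OF this] obtain l where
    l: "!!n. ?s : {\<tau> n (l n)<..\<tau> n (Suc (l n))}" "!!n. ?S n ?s ?w = H (\<tau> n (l n)) ?w" by blast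
   have "(%n. \<tau> n (l n)) \<longlonglongrightarrow> ?s"
   proof (rule tendsto_sandwich[OF _ _ _ tendsto_const])
    show "\<forall>\<^sub>F n in sequentially. ?s - T / real (Suc n) <= \<tau> n (l n)"
    proof (intro always_eventually allI)
     fix n
     have "\<tau> n (Suc (l n)) = \<tau> n (l n) + T / real (Suc n)"
      unfolding \<tau>_def of_nat_Suc[of "l n"] distrib_right add_divide_distrib by simp
     then show "?s - T / real (Suc n) <= \<tau> n (l n)" using l(1)[of n] by auto
    qed
    show "\<forall>\<^sub>F n in sequentially. \<tau> n (l n) <= ?s" using l(1) by (auto intro!: always_eventually less_imp_le)
    have "(%n. ?s - T * inverse (real (Suc n))) \<longlonglongrightarrow> ?s - T * 0"
     by (intro tendsto_intros LIMSEQ_inverse_real_of_nat)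
    then show "(%n. ?s - T / real (Suc n)) \<longlonglongrightarrow> ?s" by (simp add: divide_inverse)
   qed
   then have "(%n. H (\<tau> n (l n)) ?w) \<longlonglongrightarrow> H ?s ?w"
    using H elim \<tau>0 by (intro continuous_on_tendsto_compose[of "{0..}" "%t. H t ?w"] always_eventually allI) (auto simp: cont_adapted_def)
   then have "(%n. ennreal ((norm (H ?s ?w - H (\<tau> n (l n)) ?w))^2)) \<longlonglongrightarrow> ennreal ((norm (H ?s ?w - H ?s ?w))^2)"
    by (intro tendsto_intros)
   then show ?case using l(2) by simp
  qed
 qed (use Hm Sm in measurable)
 moreover have "energy M {0..T} (%s w. H s w - ?S n s w) = sqn (horizon M T) (%z. H (snd z) (fst z) - ?S n (snd z) (fst z))" for n
  by (subst energy_horizon) (use borel_measurable_diff[OF Hm Sm[of n]] in \<open>simp_all add: case_prod_beta'\<close>)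
 ultimately show "(%n. energy M {0..T} (%s w. H s w - ?S n s w)) \<longlonglongrightarrow> 0" by simp
qed

text \<open>Clip, then sample. Two errors below e / 4 suffice, because the energy of a sum is at
  most twice the sum of the energies.\<close>

lemma simple_process_dense:
 fixes H :: "real => 'w => 'v::euclidean_space"
 assumes H: "cont_adapted H" "loc_bounded_L2 H" and T: "0 < T" and e: "0 < e"
 shows "\<exists>k \<tau> \<eta>. simple_process M Fl k \<tau> \<eta> \<and> energy M {0..T} (%s w. H s w - simple_value k \<tau> \<eta> s w) < ennreal e"
proof -
 have e4: "(0::ennreal) < ennreal (e / 4)" using e by simp
 have "\<forall>\<^sub>F n in sequentially. energy M {0..T} (%s w. H s w - clip (real (Suc n)) (H s w)) < ennreal (e / 4)"
  by (rule order_tendstoD(2)[OF clip_energy[OF cont_L2_proc[OF H]] e4])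
 then obtain m where m: "energy M {0..T} (%s w. H s w - clip (real (Suc m)) (H s w)) < ennreal (e / 4)"
  by (auto simp: eventually_sequentially)
 define G where "G = (%s w. clip (real (Suc m)) (H s w))"
 have cl: "continuous_on UNIV (clip (real (Suc m)) :: 'v => 'v)" by (rule continuous_clip) simp
 have clm: "(clip (real (Suc m)) :: 'v => 'v) : borel_measurable borel" by (rule borel_measurable_continuous_onI[OF cl])
 have G: "cont_adapted G"
  using H(1) unfolding cont_adapted_def G_def
  by (intro conjI ballI allI impI continuous_on_compose2[OF cl] measurable_compose[OF _ clm]) auto
 have Gb: "norm (G t w) <= real (Suc m)" for t w unfolding G_def by (rule clip_norm_le) simp
 note S = bounded_step_energy[OF G Gb T]
 have "\<forall>\<^sub>F n in sequentially. energy M {0..T} (%s w. G s w - simple_value (Suc n) (%l. real l * T / real (Suc n)) (%l. G (real l * T / real (Suc n))) s w) < ennreal (e / 4)"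
  by (rule order_tendstoD(2)[OF S(2) e4])
 then obtain n where n: "energy M {0..T} (%s w. G s w - simple_value (Suc n) (%l. real l * T / real (Suc n)) (%l. G (real l * T / real (Suc n))) s w) < ennreal (e / 4)"
  by (auto simp: eventually_sequentially)
 define S' where "S' = simple_value (Suc n) (%l. real l * T / real (Suc n)) (%l. G (real l * T / real (Suc n)))"
 have mH: "(%(w, s). H s w - G s w) : borel_measurable (horizon M T)"
  using borel_measurable_diff[OF cont_adapted_horizon[OF H(1), of T] cont_adapted_horizon[OF G, of T]] by (simp add: case_prod_beta')
 have mG: "(%(w, s). G s w - S' s w) : borel_measurable (horizon M T)"
  using borel_measurable_diff[OF cont_adapted_horizon[OF G, of T] simple_value_horizon_measurable[OF S(1)[of n], of T]]
  by (simp add: case_prod_beta' S'_def)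
 have "energy M {0..T} (%s w. (H s w - G s w) + (G s w - S' s w)) <= 2 * energy M {0..T} (%s w. H s w - G s w) + 2 * energy M {0..T} (%s w. G s w - S' s w)"
  by (rule energy_add_le[OF mH mG])
 also have "... < 2 * ennreal (e / 4) + 2 * ennreal (e / 4)"
 proof (intro add_strict_mono ennreal_mult_strict_left_mono)
  show "energy M {0..T} (%s w. H s w - G s w) < ennreal (e / 4)" using m by (simp only: G_def)
  show "energy M {0..T} (%s w. G s w - S' s w) < ennreal (e / 4)" using n by (simp only: S'_def)
 qed simp_all
 also have "... = ennreal e" using e by (simp add: ennreal_plus[symmetric] ennreal_mult''[symmetric] ennreal_numeral[symmetric] del: ennreal_plus ennreal_numeral)
 finally show ?thesis using S(1)[of n] unfolding S'_def by (intro exI[of _ "Suc n"] exI) auto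
qed

subsection \<open>A maximal inequality\<close>

text \<open>Orthogonality of increments against everything square integrable and known at
  \<open>s\<close> stands in for conditional expectations.\<close>

definition L2_martingale :: "(real => 'w => 'v::euclidean_space) => bool" where
 "L2_martingale X \<longleftrightarrow> cont_adapted X \<and> (\<forall>t\<ge>0. L2_fun M (X t)) \<and>
  (\<forall>s t G. 0 <= s \<longrightarrow> s <= t \<longrightarrow> G : borel_measurable (Fl s) \<longrightarrow> L2_fun M G \<longrightarrow> expectation (%w. G w \<bullet> (X t w - X s w)) = 0)"

text \<open>Doob's inequality by the first index of exceedance. On the event \<open>A k\<close> that
  this index is \<open>k\<close>, the later increment is orthogonal to the indicator times
  \<open>X (t k)\<close>; hence the second moment at \<open>T\<close> on \<open>A k\<close> is at
  least the one at \<open>t k\<close>, which exceeds lev^2 times the probability. The events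
  \<open>A k\<close> are disjoint, so the pieces add up.\<close>

lemma maximal_inequality_discrete:
 fixes X :: "real => 'w => 'v::euclidean_space" and t :: "nat => real"
 assumes X: "L2_martingale X" and t: "!!i k. i <= k ==> t i <= t k" "!!k. 0 <= t k" "!!k. k <= n ==> t k <= T" and lev: "0 < lev"
 shows "lev\<^sup>2 * prob {w\<in>space M. \<exists>k\<le>n. lev < norm (X (t k) w)} <= expectation (%w. (norm (X T w))\<^sup>2)"
proof -
 have T0: "0 <= T" using t(2)[of 0] t(3)[of 0] by simp
 have Xa: "X (t k) : borel_measurable (Fl (t k))" for k using X t(2) by (auto simp: L2_martingale_def cont_adapted_def)
 have XL: "L2_fun M (X s)" if "0 <= s" for s using X that by (auto simp: L2_martingale_def)
 define A where "A k = {w\<in>space M. lev < norm (X (t k) w) \<and> (\<forall>i<k. norm (X (t i) w) <= lev)}" for k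
 have AF: "A k : sets (Fl (t k))" for k
 proof -
  have m: "X (t i) : borel_measurable (Fl (t k))" if "i <= k" for i by (rule usual_measurable_mono[OF Xa t(1)[OF that]])
  have "{w\<in>space (Fl (t k)). lev < norm (X (t k) w)} : sets (Fl (t k))" using m[of k] by measurable
  moreover have "{w\<in>space (Fl (t k)). \<forall>i\<in>{..<k}. norm (X (t i) w) <= lev} : sets (Fl (t k))"
  proof (rule sets.sets_Collect_finite_All)
   fix i assume "i : {..<k}"
   then have "X (t i) : borel_measurable (Fl (t k))" by (intro m) simp
   then show "{w\<in>space (Fl (t k)). norm (X (t i) w) <= lev} : sets (Fl (t k))" by measurable
  qed simp
  ultimately have "{w\<in>space (Fl (t k)). lev < norm (X (t k) w)} \<inter> {w\<in>space (Fl (t k)). \<forall>i\<in>{..<k}. norm (X (t i) w) <= lev} : sets (Fl (t k))"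
   by (rule sets.Int)
  moreover have "{w\<in>space (Fl (t k)). lev < norm (X (t k) w)} \<inter> {w\<in>space (Fl (t k)). \<forall>i\<in>{..<k}. norm (X (t i) w) <= lev} = A k"
   by (auto simp: A_def)
  ultimately show ?thesis by simp
 qed
 have AM: "A k : events" for k using AF sets_usual_subset by blast
 have disj: "disjoint_family_on A {..n}"
 proof (unfold disjoint_family_on_def, intro ballI impI)
  fix i k :: nat assume "i ~= k"
  then show "A i \<inter> A k = {}"
  proof (cases "i < k")
   case True then show ?thesis by (force simp: A_def)
  next
   case False
   then have "k < i" using \<open>i ~= k\<close> by simp
   then show ?thesis by (force simp: A_def)
  qed
 qed
 have un: "{w\<in>space M. \<exists>k\<le>n. lev < norm (X (t k) w)} = (\<Union>k\<in>{..n}. A k)"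
 proof (intro equalityI subsetI)
  fix w assume "w : {w\<in>space M. \<exists>k\<le>n. lev < norm (X (t k) w)}"
  then obtain k where k: "w : space M" "k <= n" "lev < norm (X (t k) w)" by auto
  define k0 where "k0 = (LEAST k. lev < norm (X (t k) w))"
  have "lev < norm (X (t k0) w)" unfolding k0_def by (rule LeastI[of "%k. lev < norm (X (t k) w)", OF k(3)])
  moreover have "k0 <= k" unfolding k0_def by (rule Least_le[of "%k. lev < norm (X (t k) w)", OF k(3)])
  moreover have "norm (X (t i) w) <= lev" if "i < k0" for i using not_less_Least[OF that[unfolded k0_def]] by simp
  ultimately show "w : (\<Union>k\<in>{..n}. A k)" using k by (auto simp: A_def intro!: bexI[of _ k0])
 qed (auto simp: A_def)
 have ind[measurable]: "indicat_real (A k) : borel_measurable M" for k using AM by simp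
 have LA: "L2_fun M (%w. indicat_real (A k) w *\<^sub>R X s w)" if "0 <= s" for k s
  by (rule L2_fun_bounded_scaleR[OF XL[OF that] ind, of _ 1]) (auto simp: indicator_def)
 have each: "lev\<^sup>2 * prob (A k) <= expectation (%w. indicat_real (A k) w * (norm (X T w))^2)" if k: "k <= n" for k
 proof -
  have tk: "0 <= t k" "t k <= T" using t that by auto
  let ?G = "%w. indicat_real (A k) w *\<^sub>R X (t k) w"
  have Gm: "?G : borel_measurable (Fl (t k))" using AF Xa by (intro borel_measurable_scaleR) auto
  have orth: "expectation (%w. ?G w \<bullet> (X T w - X (t k) w)) = 0"
   using X tk Gm LA[OF tk(1)] unfolding L2_martingale_def by blast
  have i1: "integrable M (%w. ?G w \<bullet> (X T w - X (t k) w))"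
   by (intro L2_inner_integrable LA L2_fun_diff XL tk T0)
  have i0: "integrable M (indicat_real (A k))"
   using AM[of k] emeasure_finite[of "A k"] by (simp add: integrable_indicator_iff less_top[symmetric])
  then have i2: "integrable M (%w. lev\<^sup>2 * indicat_real (A k) w)" by simp
  have i3: "integrable M (%w. indicat_real (A k) w * (norm (X T w))^2)"
   using integrable_mult_indicator[OF AM L2_fun_integrable[OF XL[OF T0]], of k] by simp
  have "lev\<^sup>2 * prob (A k) = expectation (%w. lev\<^sup>2 * indicat_real (A k) w + 2 * (?G w \<bullet> (X T w - X (t k) w)))"
   using i1 i2 orth AM by simp
  also have "... <= expectation (%w. indicat_real (A k) w * (norm (X T w))^2)"
  proof (rule integral_mono)
   show "integrable M (%w. lev\<^sup>2 * indicat_real (A k) w + 2 * (?G w \<bullet> (X T w - X (t k) w)))" using i1 i2 by simp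
   show "integrable M (%w. indicat_real (A k) w * (norm (X T w))^2)" by (rule i3)
   fix w assume "w : space M"
   show "lev\<^sup>2 * indicat_real (A k) w + 2 * (?G w \<bullet> (X T w - X (t k) w)) <= indicat_real (A k) w * (norm (X T w))^2"
   proof (cases "w : A k")
    case True
    then have "lev <= norm (X (t k) w)" by (simp add: A_def)
    then have "lev\<^sup>2 <= (norm (X (t k) w))^2" using lev by (intro power_mono) auto
    moreover have "(norm (X T w))^2 = (norm (X (t k) w))^2 + 2 * (X (t k) w \<bullet> (X T w - X (t k) w)) + (norm (X T w - X (t k) w))^2"
     by (simp add: power2_norm_eq_inner algebra_simps inner_commute)
    ultimately have "lev\<^sup>2 + 2 * (X (t k) w \<bullet> (X T w - X (t k) w)) <= (norm (X T w))^2" by (smt (verit) zero_le_power2)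
    then show ?thesis using True by simp
   qed simp
  qed
  finally show ?thesis .
 qed
 have "lev\<^sup>2 * prob (\<Union>k\<in>{..n}. A k) = (\<Sum>k\<le>n. lev\<^sup>2 * prob (A k))"
  using finite_measure_finite_Union[OF _ _ disj] AM by (simp add: sum_distrib_left image_subset_iff)
 also have "... <= (\<Sum>k\<le>n. expectation (%w. indicat_real (A k) w * (norm (X T w))^2))" by (intro sum_mono each) auto
 also have "... = expectation (%w. \<Sum>k\<le>n. indicat_real (A k) w * (norm (X T w))^2)"
  using integrable_mult_indicator[OF AM L2_fun_integrable[OF XL[OF T0]]] by (subst Bochner_Integration.integral_sum) auto
 also have "... <= expectation (%w. (norm (X T w))\<^sup>2)"
 proof (rule integral_mono)
  show "integrable M (%w. \<Sum>k\<le>n. indicat_real (A k) w * (norm (X T w))^2)"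
   using integrable_mult_indicator[OF AM L2_fun_integrable[OF XL[OF T0]]]
   by (intro Bochner_Integration.integrable_sum) (simp only: real_scaleR_def)
  show "integrable M (%w. (norm (X T w))\<^sup>2)" by (rule L2_fun_integrable[OF XL[OF T0]])
  fix w
  have "(\<Sum>k\<le>n. indicat_real (A k) w) = indicat_real (\<Union>k\<in>{..n}. A k) w"
   by (rule indicator_UN_disjoint[symmetric, OF _ disj]) simp
  then have "(\<Sum>k\<le>n. indicat_real (A k) w) <= 1" by (simp only: indicator_def) simp
  then show "(\<Sum>k\<le>n. indicat_real (A k) w * (norm (X T w))^2) <= (norm (X T w))^2"
   unfolding sum_distrib_right[symmetric] by (rule mult_left_le_one_le[rotated 2]) (auto intro: sum_nonneg)
 qed
 finally show ?thesis unfolding un .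
qed

definition exceeds :: "(real => 'w => 'v::euclidean_space) => real => real => 'w set" where
 "exceeds X T lev = {w\<in>space M. \<exists>t\<in>{0..T}. lev < norm (X t w)}"

definition dyadic_exceeds :: "(real => 'w => 'v::euclidean_space) => real => real => nat => 'w set" where
 "dyadic_exceeds X T lev m = {w\<in>space M. \<exists>k\<le>(2::nat)^m. lev < norm (X (real k * T / 2^m) w)}"

lemma incseq_dyadic: "incseq (dyadic_exceeds X T lev)"
proof (rule incseq_SucI, rule subsetI)
 fix m w assume "w : dyadic_exceeds X T lev m"
 then obtain k where "w : space M" "k <= (2::nat)^m" "lev < norm (X (real k * T / 2^m) w)" by (auto simp: dyadic_exceeds_def)
 then show "w : dyadic_exceeds X T lev (Suc m)"
  unfolding dyadic_exceeds_def by (intro CollectI conjI exI[of _ "2 * k"]) auto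
qed

text \<open>The inequality is strict, so by continuity an exceedance at \<open>t\<close> is seen at
  nearby dyadic points; these are taken below \<open>t\<close> to stay in [0, T]. This also makes
  the uncountable union measurable.\<close>

lemma exceeds_dyadic:
 assumes X: "cont_adapted X" and T: "0 <= T"
 shows "exceeds X T lev = (\<Union>m. dyadic_exceeds X T lev m)"
proof (intro equalityI subsetI)
 fix w assume "w : (\<Union>m. dyadic_exceeds X T lev m)"
 then obtain m k where m: "w : space M" "k <= (2::nat)^m" "lev < norm (X (real k * T / 2^m) w)" by (auto simp: dyadic_exceeds_def)
 have "real k <= 2^m" using m(2) by (metis of_nat_le_iff of_nat_numeral of_nat_power)
 then have "real k * T / 2^m : {0..T}" using T by (auto simp: divide_le_eq mult.commute[of T] intro: mult_right_mono)
 then show "w : exceeds X T lev" using m by (auto simp: exceeds_def)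
next
 fix w assume "w : exceeds X T lev"
 then obtain t where t: "w : space M" "0 <= t" "t <= T" "lev < norm (X t w)" by (auto simp: exceeds_def)
 define c where "c m = nat \<lfloor>t * 2^m / T\<rfloor>" for m :: nat
 have "\<exists>m. lev < norm (X (real (c m) * T / 2^m) w) \<and> c m <= 2^m"
 proof (cases "T = 0")
  case True
  then show ?thesis using t by (auto simp: c_def intro!: exI[of _ 0])
 next
  case False
  then have Tp: "0 < T" using T by simp
  have rc: "real (c m) = of_int \<lfloor>t * 2^m / T\<rfloor>" for m using t Tp by (simp add: c_def)
  have le: "real (c m) * T / 2^m <= t" for m
  proof -
   have "real (c m) <= t * 2^m / T" unfolding rc by simp
   then show ?thesis using Tp by (simp add: field_simps)
  qed
  have ge: "t - T * (1/2)^m <= real (c m) * T / 2^m" for m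
  proof -
   have "t * 2^m / T - 1 <= real (c m)" unfolding rc by linarith
   then have "t * 2^m - T <= real (c m) * T" using Tp by (simp add: field_simps)
   then have "(t * 2^m - T) / 2^m <= real (c m) * T / 2^m" by (intro divide_right_mono) auto
   then show ?thesis by (simp add: diff_divide_distrib power_divide)
  qed
  have "(%m. t - T * (1/2)^m) \<longlonglongrightarrow> t - T * 0"
   by (intro tendsto_diff tendsto_mult tendsto_const LIMSEQ_power_zero) simp
  then have lim: "(%m. t - T * (1/2)^m) \<longlonglongrightarrow> t" by simp
  have "(%m. real (c m) * T / 2^m) \<longlonglongrightarrow> t"
   by (rule tendsto_sandwich[OF _ _ lim tendsto_const]) (use ge le in auto)
  then have "(%m. X (real (c m) * T / 2^m) w) \<longlonglongrightarrow> X t w"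
   using X t Tp by (intro continuous_on_tendsto_compose[of "{0..}" "%t. X t w"] always_eventually allI) (auto simp: cont_adapted_def)
  then have "\<forall>\<^sub>F m in sequentially. lev < norm (X (real (c m) * T / 2^m) w)"
   by (rule order_tendstoD(1)[OF tendsto_norm t(4)])
  then obtain m where m: "lev < norm (X (real (c m) * T / 2^m) w)" by (auto simp: eventually_sequentially)
  have "real (c m) <= t * 2^m / T" unfolding rc by simp
  also have "... <= 2^m" using t Tp by (simp add: divide_le_eq mult.commute mult_right_mono)
  finally have "c m <= 2^m" by (metis of_nat_le_iff of_nat_numeral of_nat_power)
  then show ?thesis using m by blast
 qed
 then show "w : (\<Union>m. dyadic_exceeds X T lev m)" using t(1) unfolding dyadic_exceeds_def by blast
qed

lemma dyadic_exceeds_events: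
 assumes X: "cont_adapted X" and T: "0 <= T"
 shows "dyadic_exceeds X T lev m : events"
proof -
 have "{w\<in>space M. lev < norm (X (real k * T / 2^m) w)} : events" for k :: nat
 proof -
  have "X (real k * T / 2^m) : borel_measurable M" by (rule cont_adapted_M[OF X]) (use T in simp)
  then show ?thesis by measurable
 qed
 then have "(\<Union>k\<in>{..(2::nat)^m}. {w\<in>space M. lev < norm (X (real k * T / 2^m) w)}) : events" by auto
 moreover have "(\<Union>k\<in>{..(2::nat)^m}. {w\<in>space M. lev < norm (X (real k * T / 2^m) w)}) = dyadic_exceeds X T lev m"
  by (auto simp: dyadic_exceeds_def)
 ultimately show ?thesis by simp
qed

lemma exceeds_events: "cont_adapted X ==> 0 <= T ==> exceeds X T lev : events"
 by (subst exceeds_dyadic) (auto intro!: dyadic_exceeds_events)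

text \<open>The dyadic grids are nested, so the discrete bound, which does not depend on the grid,
  passes to the union by continuity from below.\<close>

lemma maximal_inequality:
 assumes X: "L2_martingale X" and T: "0 <= T" and lev: "0 < lev"
 shows "emeasure M (exceeds X T lev) <= ennreal (1 / lev\<^sup>2) * sqn M (X T)"
proof -
 have c: "cont_adapted X" using X by (simp add: L2_martingale_def)
 have L: "L2_fun M (X T)" using X T by (simp add: L2_martingale_def)
 have "emeasure M (dyadic_exceeds X T lev m) <= ennreal (1 / lev\<^sup>2) * sqn M (X T)" for m
 proof -
  have le: "real k * T / 2^m <= T" if "k <= (2::nat)^m" for k
  proof -
   have "real k <= 2^m" using that by (metis of_nat_le_iff of_nat_numeral of_nat_power)
   then show ?thesis using T by (simp add: divide_le_eq mult.commute[of T] mult_right_mono)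
  qed
  have "lev\<^sup>2 * prob (dyadic_exceeds X T lev m) <= expectation (%w. (norm (X T w))\<^sup>2)"
   unfolding dyadic_exceeds_def
   by (rule maximal_inequality_discrete[OF X]) (use T lev le in \<open>auto intro!: divide_right_mono mult_right_mono\<close>)
  then have "prob (dyadic_exceeds X T lev m) <= 1 / lev\<^sup>2 * expectation (%w. (norm (X T w))\<^sup>2)"
   using lev by (simp add: field_simps)
  then show ?thesis
   unfolding L2_fun_nn_integral[OF L] emeasure_eq_measure using lev
   by (simp add: ennreal_mult''[symmetric] ennreal_leI del: times_divide_eq_left)
 qed
 then have "(SUP m. emeasure M (dyadic_exceeds X T lev m)) <= ennreal (1 / lev\<^sup>2) * sqn M (X T)"
  by (rule SUP_least)
 also have "(SUP m. emeasure M (dyadic_exceeds X T lev m)) = emeasure M (exceeds X T lev)"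
  unfolding exceeds_dyadic[OF c T]
  by (rule SUP_emeasure_incseq[OF _ incseq_dyadic]) (use dyadic_exceeds_events[OF c T] in auto)
 finally show ?thesis .
qed

end

lemma continuous_on_atLeast_exhaust:
 fixes f :: "real => 'v::metric_space"
 assumes "!!m::nat. continuous_on {0..real m} f"
 shows "continuous_on {0..} f"
 unfolding continuous_on_eq_continuous_within
proof
 fix x :: real assume x: "x : {0..}"
 obtain m :: nat where m: "x < real m" using reals_Archimedean2 by blast
 have "at x within {0..} = at x within {0..real m}"
  by (rule at_within_nhd[of x "{..<real m}"]) (use m in auto)
 moreover have "continuous (at x within {0..real m}) f"
  using assms[of m] x m by (auto simp: continuous_on_eq_continuous_within)
 ultimately show "continuous (at x within {0..}) f" by (simp add: continuous_within)
qed

section \<open>Limits of continuous adapted processes and continuous integrals\<close>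

context brownian_space begin

lemma ennreal_twice_add: "0 <= a ==> 0 <= b ==> 2 * ennreal a + 2 * ennreal b = ennreal (2 * a + 2 * b)"
 by (simp add: ennreal_mult'')

lemma cont_adapted_const: "\<xi> : borel_measurable (Fl 0) ==> cont_adapted (%_. \<xi>)"
 unfolding cont_adapted_def by (auto intro: usual_measurable_mono)

lemma cont_adapted_add: "cont_adapted X ==> cont_adapted Y ==> cont_adapted (%t w. X t w + Y t w)"
 unfolding cont_adapted_def by (auto intro!: continuous_on_add borel_measurable_add)

lemma cont_adapted_diff: "cont_adapted X ==> cont_adapted Y ==> cont_adapted (%t w. X t w - Y t w)"
 unfolding cont_adapted_def by (auto intro!: continuous_on_diff borel_measurable_diff)

lemma cont_adapted_sum:
 "(!!i. i : I ==> cont_adapted (X i)) ==> cont_adapted (%t w. \<Sum>i\<in>I. X i t w)"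
 unfolding cont_adapted_def
 by (intro conjI ballI allI impI continuous_on_sum borel_measurable_sum) blast+

lemma cont_adapted_linear:
 assumes "bounded_linear h" "cont_adapted X"
 shows "cont_adapted (%t w. h (X t w))"
proof -
 have hc: "continuous_on UNIV h" by (rule linear_continuous_on[OF assms(1)])
 then have hm: "h : borel_measurable borel" by (rule borel_measurable_continuous_onI)
 show ?thesis using assms(2) unfolding cont_adapted_def
  by (intro conjI ballI allI impI continuous_on_compose2[OF hc] measurable_compose[OF _ hm]) auto
qed

lemma loc_bounded_L2_add:
 assumes X: "cont_adapted X" "loc_bounded_L2 X" and Y: "cont_adapted Y" "loc_bounded_L2 Y"
 shows "loc_bounded_L2 (%t w. X t w + Y t w)"
 unfolding loc_bounded_L2_def
proof (intro allI impI)
 fix T :: real assume T: "0 <= T"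
 obtain C where C: "0 <= C" "!!t. t : {0..T} ==> sqn M (X t) <= ennreal C"
  using X(2) T unfolding loc_bounded_L2_def by blast
 obtain D where D: "0 <= D" "!!t. t : {0..T} ==> sqn M (Y t) <= ennreal D"
  using Y(2) T unfolding loc_bounded_L2_def by blast
 show "\<exists>C\<ge>0. \<forall>t\<in>{0..T}. sqn M (%w. X t w + Y t w) <= ennreal C"
 proof (intro exI[of _ "2 * C + 2 * D"] conjI ballI)
  fix t assume t: "t : {0..T}"
  have "sqn M (%w. X t w + Y t w) <= 2 * sqn M (X t) + 2 * sqn M (Y t)"
   by (rule nn_integral_square_add_le) (use cont_adapted_M[OF X(1)] cont_adapted_M[OF Y(1)] t in auto)
  also have "... <= 2 * ennreal C + 2 * ennreal D" by (intro add_mono mult_left_mono C D t) auto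
  also have "... = ennreal (2 * C + 2 * D)" by (rule ennreal_twice_add[OF C(1) D(1)])
  finally show "sqn M (%w. X t w + Y t w) <= ennreal (2 * C + 2 * D)" .
 qed (use C D in simp)
qed

lemma loc_bounded_L2_const:
 assumes "L2_fun M \<xi>" shows "loc_bounded_L2 (%_. \<xi>)"
 unfolding loc_bounded_L2_def L2_fun_nn_integral[OF assms]
 by (intro allI impI exI[of _ "expectation (%w. (norm (\<xi> w))\<^sup>2)"]) auto

lemma loc_bounded_L2_sum:
 assumes "!!i. i : I ==> cont_adapted (X i)" "!!i. i : I ==> loc_bounded_L2 (X i)"
 shows "loc_bounded_L2 (%t w. \<Sum>i\<in>I. X i t w)"
 using assms
proof (induction I rule: infinite_finite_induct)
 case (insert i I)
 have "loc_bounded_L2 (%t w. X i t w + (\<Sum>i\<in>I. X i t w))"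
  by (intro loc_bounded_L2_add cont_adapted_sum insert) (use insert.prems in auto)
 then show ?case using insert.hyps by simp
qed (simp_all add: loc_bounded_L2_const[OF L2_fun_zero])

lemma loc_bounded_L2_linear:
 assumes "bounded_linear h" "cont_adapted X" "loc_bounded_L2 X"
 shows "loc_bounded_L2 (%t w. h (X t w))"
 unfolding loc_bounded_L2_def
proof (intro allI impI)
 obtain K where K: "!!x. norm (h x) <= norm x * K" using bounded_linear.bounded[OF assms(1)] by blast
 fix T :: real assume "0 <= T"
 then obtain C where C: "0 <= C" "!!t. t : {0..T} ==> sqn M (X t) <= ennreal C"
  using assms(3) unfolding loc_bounded_L2_def by blast
 show "\<exists>C\<ge>0. \<forall>t\<in>{0..T}. sqn M (%w. h (X t w)) <= ennreal C"
 proof (intro exI[of _ "K\<^sup>2 * C"] conjI ballI)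
  fix t assume t: "t : {0..T}"
  have "sqn M (%w. h (X t w)) <= (\<integral>\<^sup>+w. ennreal (K\<^sup>2) * ennreal ((norm (X t w))^2) \<partial>M)"
  proof (rule nn_integral_mono)
   fix w
   have "(norm (h (X t w)))^2 <= (norm (X t w) * K)^2" by (intro power_mono K) auto
   then show "ennreal ((norm (h (X t w)))^2) <= ennreal (K\<^sup>2) * ennreal ((norm (X t w))^2)"
    by (simp add: ennreal_mult''[symmetric] power_mult_distrib mult.commute ennreal_leI)
  qed
  also have "... = ennreal (K\<^sup>2) * sqn M (X t)"
  proof (rule nn_integral_cmult)
   have "X t : borel_measurable M" by (rule cont_adapted_M[OF assms(2)]) (use t in simp)
   then show "(%w. ennreal ((norm (X t w))^2)) : borel_measurable M" by measurable
  qed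
  also have "... <= ennreal (K\<^sup>2) * ennreal C" by (intro mult_left_mono C t) auto
  finally show "sqn M (%w. h (X t w)) <= ennreal (K\<^sup>2 * C)" using C(1) by (simp add: ennreal_mult'')
 qed (use C in simp)
qed

text \<open>The ratio 1/8 beats the factor 2 lost in squaring a sum: relative to (1/8)^n one step
  gives 2 * 4 C / 8 + 2 C = 3 C, which stays below 4 C.\<close>

lemma fast_L2_Cauchy:
 fixes Y :: "nat => 'w => 'v::euclidean_space"
 assumes Y: "!!n. Y n : borel_measurable M" and C: "0 <= C"
  and b: "!!n. n >= m ==> sqn M (%w. Y (Suc n) w - Y n w) <= ennreal (C * (1/8)^n)"
 shows "n >= m ==> sqn M (%w. Y (n + d) w - Y n w) <= ennreal (4 * C * (1/8)^n)"
proof (induction d arbitrary: n)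
 case 0
 then show ?case by simp
next
 case (Suc d)
 have "sqn M (%w. (Y (n + Suc d) w - Y (Suc n) w) + (Y (Suc n) w - Y n w))
   <= 2 * sqn M (%w. Y (n + Suc d) w - Y (Suc n) w) + 2 * sqn M (%w. Y (Suc n) w - Y n w)"
  by (rule nn_integral_square_add_le) (use Y in auto)
 also have "... <= 2 * ennreal (4 * C * (1/8)^Suc n) + 2 * ennreal (C * (1/8)^n)"
  using Suc.IH[of "Suc n"] b[of n] Suc.prems by (intro add_mono mult_left_mono) auto
 also have "... = ennreal (2 * (4 * C * (1/8)^Suc n) + 2 * (C * (1/8)^n))"
  by (rule ennreal_twice_add) (use C in auto)
 also have "... <= ennreal (4 * C * (1/8)^n)" using C by (intro ennreal_leI) (simp add: algebra_simps)
 finally show ?case by simp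
qed

text \<open>Summable exceedance probabilities and Borel-Cantelli: on almost every path the n-th step
  is eventually at most 2^-n on [0, m], for every \<open>m\<close>, and Weierstrass yields uniform
  convergence on bounded intervals. Constants may depend on \<open>m\<close>, since only n \<ge> m
  is considered.\<close>

lemma continuous_limit:
 fixes Y :: "nat => real => 'w => 'v::euclidean_space"
 assumes Y: "!!n. cont_adapted (Y n)" "!!n. loc_bounded_L2 (Y n)"
  and a: "!!m::nat. \<exists>C. \<forall>n\<ge>m. emeasure M (exceeds (%t w. Y (Suc n) t w - Y n t w) (real m) ((1/2)^n)) <= ennreal (C * (1/2)^n)"
  and b: "!!m::nat. \<exists>C\<ge>0. \<forall>n\<ge>m. \<forall>t\<in>{0..real m}. sqn M (%w. Y (Suc n) t w - Y n t w) <= ennreal (C * (1/8)^n)"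
 shows "\<exists>X. cont_adapted X \<and> loc_bounded_L2 X \<and>
  (\<forall>m::nat. \<exists>C\<ge>0. \<forall>n\<ge>m. \<forall>t\<in>{0..real m}. sqn M (%w. X t w - Y n t w) <= ennreal (C * (1/8)^n))"
proof -
 define E where "E m n = exceeds (%t w. Y (Suc n) t w - Y n t w) (real m) ((1/2)^n)" for m n :: nat
 have Ee: "E m n : events" for m n unfolding E_def by (intro exceeds_events cont_adapted_diff Y) simp
 have "AE w in M. eventually (%n. w : space M - E m n) sequentially" for m
 proof (rule borel_cantelli_AE1)
  show "E m n : events" for n by (rule Ee)
  show "emeasure M (E m n) < \<infinity>" for n by (simp add: less_top[symmetric])
  obtain C where C: "!!n. n >= m ==> emeasure M (E m n) <= ennreal (C * (1/2)^n)" using a[of m] unfolding E_def by blast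
  show "summable (%n. measure M (E m n))"
  proof (rule summable_comparison_test)
   show "\<exists>N. \<forall>n\<ge>N. norm (measure M (E m n)) <= \<bar>C\<bar> * (1/2)^n"
   proof (intro exI[of _ m] allI impI)
    fix n assume "m <= n"
    then have "ennreal (measure M (E m n)) <= ennreal (\<bar>C\<bar> * (1/2)^n)"
     using C[of n] by (simp add: emeasure_eq_measure[symmetric]) (erule order_trans, intro ennreal_leI mult_right_mono, auto)
    then show "norm (measure M (E m n)) <= \<bar>C\<bar> * (1/2)^n" by (subst (asm) ennreal_le_iff) auto
   qed
   show "summable (%n. \<bar>C\<bar> * (1/2)^n)" by (intro summable_mult summable_geometric) simp
  qed
 qed
 then have "AE w in M. \<forall>m. eventually (%n. w : space M - E m n) sequentially" by (simp add: AE_all_countable)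
 then obtain N where N: "!!w. w : space M - N ==> \<forall>m. eventually (%n. w : space M - E m n) sequentially" "N : null_sets M"
  by (rule AE_E3) (rule that)
 \<comment> \<open>The telescoping series off the exceptional set; the value 0 on it keeps all paths
   continuous.\<close>
 define X where "X t w = (if w : N then 0 else Y 0 t w + (\<Sum>i. Y (Suc i) t w - Y i t w))" for t w
 have ul: "uniform_limit {0..real m} (%n t. Y n t w) (%t. X t w) sequentially" if w: "w : space M - N" for w m
 proof -
  have "uniform_limit {0..real m} (%n t. \<Sum>i<n. Y (Suc i) t w - Y i t w) (%t. \<Sum>i. Y (Suc i) t w - Y i t w) sequentially"
  proof (rule Weierstrass_m_test_ev)
   have "eventually (%n. w : space M - E m n) sequentially" using N(1)[OF w] by blast
   then show "\<forall>\<^sub>F n in sequentially. \<forall>t\<in>{0..real m}. norm (Y (Suc n) t w - Y n t w) <= (1/2)^n"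
    by eventually_elim (auto simp: E_def exceeds_def not_less)
   show "summable (%n. (1/2::real)^n)" by (rule summable_geometric) simp
  qed
  then have "uniform_limit {0..real m} (%n t. Y n t w - Y 0 t w) (%t. \<Sum>i. Y (Suc i) t w - Y i t w) sequentially"
   by (simp only: sum_lessThan_telescope[of "%i. Y i _ w"])
  have c: "uniform_limit {0..real m} (%n t. Y 0 t w) (%t. Y 0 t w) sequentially"
   by (rule uniform_limitI) simp
  from uniform_limit_add[OF \<open>uniform_limit {0..real m} (%n t. Y n t w - Y 0 t w) _ sequentially\<close> c]
  show ?thesis using w by (simp add: X_def add.commute)
 qed
 have lim: "(%n. Y n t w) \<longlonglongrightarrow> X t w" if "w : space M - N" "0 <= t" for t w
 proof -
  obtain m :: nat where "t <= real m" using real_arch_simple by blast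
  then show ?thesis using tendsto_uniform_limitI[OF ul[OF that(1), of m], of t] that by simp
 qed
 have cX: "cont_adapted X"
  unfolding cont_adapted_def
 proof (intro conjI ballI allI impI)
  fix w assume w: "w : space M"
  show "continuous_on {0..} (%t. X t w)"
  proof (cases "w : N")
   case True then show ?thesis by (simp add: X_def)
  next
   case False
   show ?thesis
   proof (rule continuous_on_atLeast_exhaust)
    fix m :: nat
    show "continuous_on {0..real m} (%t. X t w)"
    proof (rule uniform_limit_theorem[OF _ ul])
     have "continuous_on {0..real m} (%t. Y n t w)" for n
      by (rule continuous_on_subset[of "{0..}"]) (use Y(1)[of n] w in \<open>auto simp: cont_adapted_def\<close>)
     then show "\<forall>\<^sub>F n in sequentially. continuous_on {0..real m} (%t. Y n t w)" by simp
    qed (use w False in auto)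
   qed
  qed
 next
  fix t :: real assume t: "0 <= t"
  show "X t : borel_measurable (Fl t)"
  proof (rule borel_measurable_LIMSEQ_metric[where f="%n w. if w : N then 0 else Y n t w"])
   fix n
   have "{w : space (Fl t). w : N} = N" using N(2) sets.sets_into_space by auto
   then have "{w : space (Fl t). w : N} : sets (Fl t)" using N(2) null_sets_usual by auto
   then show "(%w. if w : N then 0 else Y n t w) : borel_measurable (Fl t)"
    using Y(1)[of n] t by (intro measurable_If) (auto simp: cont_adapted_def)
  next
   fix w assume "w : space (Fl t)"
   then show "(%n. if w : N then 0 else Y n t w) \<longlonglongrightarrow> X t w"
    using lim[of w t] t by (cases "w : N") (auto simp: X_def)
  qed
 qed
 have rate: "\<exists>C\<ge>0. \<forall>n\<ge>m. \<forall>t\<in>{0..real m}. sqn M (%w. X t w - Y n t w) <= ennreal (C * (1/8)^n)" for m :: nat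
 proof -
  obtain C where C: "0 <= C" "!!n t. n >= m ==> t : {0..real m} ==> sqn M (%w. Y (Suc n) t w - Y n t w) <= ennreal (C * (1/8)^n)"
   using b[of m] by blast
  have "sqn M (%w. X t w - Y n t w) <= ennreal (4 * C * (1/8)^n)" if n: "n >= m" and t: "t : {0..real m}" for n t
  proof -
   have Ym: "Y k t : borel_measurable M" for k using cont_adapted_M[OF Y(1)] t by auto
   \<comment> \<open>Fatou's lemma along \<open>d\<close>: the bound from
     \<open>fast_L2_Cauchy\<close> is uniform in \<open>d\<close> and so survives in the almost sure
     limit.\<close>
   have "AE w in M. ennreal ((norm (X t w - Y n t w))^2) = liminf (%d. ennreal ((norm (Y (n + d) t w - Y n t w))^2))"
    using AE_not_in[OF N(2)] AE_space
   proof eventually_elim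
    case (elim w)
    then have "(%d. Y (n + d) t w) \<longlonglongrightarrow> X t w" using LIMSEQ_ignore_initial_segment[OF lim[of w t], of n] t by (auto simp: add.commute)
    then have "(%d. ennreal ((norm (Y (n + d) t w - Y n t w))^2)) \<longlonglongrightarrow> ennreal ((norm (X t w - Y n t w))^2)"
     by (intro tendsto_intros)
    then show ?case by (rule lim_imp_Liminf[symmetric, rotated]) simp
   qed
   then have "sqn M (%w. X t w - Y n t w) = (\<integral>\<^sup>+w. liminf (%d. ennreal ((norm (Y (n + d) t w - Y n t w))^2)) \<partial>M)"
    by (rule nn_integral_cong_AE)
   also have "... <= liminf (%d. sqn M (%w. Y (n + d) t w - Y n t w))"
    by (rule nn_integral_liminf) (use Ym in measurable)
   also have "... <= liminf (%d::nat. ennreal (4 * C * (1/8)^n))"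
    by (intro Liminf_mono always_eventually allI fast_L2_Cauchy[OF Ym C(1) C(2)[OF _ t] n])
   also have "... = ennreal (4 * C * (1/8)^n)" by (simp add: Liminf_const)
   finally show ?thesis .
  qed
  then show ?thesis using C(1) by (intro exI[of _ "4 * C"]) auto
 qed
 moreover have "loc_bounded_L2 X"
  unfolding loc_bounded_L2_def
 proof (intro allI impI)
  fix T :: real assume T: "0 <= T"
  obtain m :: nat where m: "T <= real m" using real_arch_simple by blast
  obtain C where C: "0 <= C" "!!t. t : {0..real m} ==> sqn M (%w. X t w - Y m t w) <= ennreal (C * (1/8)^m)"
   using rate[of m] by blast
  obtain D where D: "0 <= D" "!!t. t : {0..T} ==> sqn M (Y m t) <= ennreal D"
   using Y(2)[of m] T unfolding loc_bounded_L2_def by blast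
  show "\<exists>C\<ge>0. \<forall>t\<in>{0..T}. sqn M (X t) <= ennreal C"
  proof (intro exI[of _ "2 * (C * (1/8)^m) + 2 * D"] conjI ballI)
   fix t assume t: "t : {0..T}"
   have "sqn M (%w. (X t w - Y m t w) + Y m t w)
    <= 2 * sqn M (%w. X t w - Y m t w) + 2 * sqn M (Y m t)"
    by (rule nn_integral_square_add_le) (use cont_adapted_M[OF cX, of t] cont_adapted_M[OF Y(1), of t] t in auto)
   also have "... <= 2 * ennreal (C * (1/8)^m) + 2 * ennreal D"
    using t m by (intro add_mono mult_left_mono C D) auto
   also have "... = ennreal (2 * (C * (1/8)^m) + 2 * D)" by (rule ennreal_twice_add) (use C(1) D(1) in auto)
   finally show "sqn M (X t) <= ennreal (2 * (C * (1/8)^m) + 2 * D)" by simp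
  qed (use C D in simp)
 qed
 ultimately show ?thesis using cX by blast
qed

lemma ito_AE_cong:
 assumes "ito j t H Z" "Z' : borel_measurable M" "AE w in M. Z w = Z' w"
 shows "ito j t H Z'"
proof -
 have "sqn M (%w. Z' w - S w) = sqn M (%w. Z w - S w)" for S
  by (rule nn_integral_cong_AE) (use assms(3) in eventually_elim, simp)
 then show ?thesis using assms(1,2) unfolding has_ito_integral_def by simp
qed

lemma ito_martingale:
 fixes H :: "real => 'w => 'v::euclidean_space"
 assumes I: "cont_adapted I" "!!t. 0 <= t ==> ito j t H (I t)" and H: "!!T. L2_proc M T H" and j: "j : J"
 shows "L2_martingale I"
 unfolding L2_martingale_def
proof (intro conjI allI impI)
 show "L2_fun M (I t)" if "0 <= t" for t by (rule ito_L2[OF I(2) H j that]) (rule that)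
 fix s t and G :: "'w => 'v" assume "0 <= s" "s <= t" "G : borel_measurable (Fl s)" "L2_fun M G"
 then show "expectation (%w. G w \<bullet> (I t w - I s w)) = 0"
  by (intro ito_orthogonal[OF I(2) H I(2) j]) auto
qed (rule I)

lemma L2_martingale_diff:
 fixes X Y :: "real => 'w => 'v::euclidean_space"
 assumes X: "L2_martingale X" and Y: "L2_martingale Y"
 shows "L2_martingale (%t w. X t w - Y t w)"
 unfolding L2_martingale_def
proof (intro conjI allI impI)
 have L: "L2_fun M (X t)" "L2_fun M (Y t)" if "0 <= t" for t using X Y that by (auto simp: L2_martingale_def)
 show "cont_adapted (%t w. X t w - Y t w)" using X Y by (auto simp: L2_martingale_def intro: cont_adapted_diff)
 show "L2_fun M (%w. X t w - Y t w)" if "0 <= t" for t by (intro L2_fun_diff L that)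
 fix s t and G :: "'w => 'v" assume st: "0 <= s" "s <= t" and G: "G : borel_measurable (Fl s)" "L2_fun M G"
 have t: "0 <= t" using st by simp
 have "expectation (%w. G w \<bullet> (X t w - Y t w - (X s w - Y s w)))
  = expectation (%w. G w \<bullet> (X t w - X s w) - G w \<bullet> (Y t w - Y s w))"
  by (rule Bochner_Integration.integral_cong) (simp_all add: algebra_simps)
 also have "... = expectation (%w. G w \<bullet> (X t w - X s w)) - expectation (%w. G w \<bullet> (Y t w - Y s w))"
  by (rule Bochner_Integration.integral_diff) (intro L2_inner_integrable G L2_fun_diff L st t)+
 also have "... = 0"
 proof -
  have "expectation (%w. G w \<bullet> (X t w - X s w)) = 0" "expectation (%w. G w \<bullet> (Y t w - Y s w)) = 0"
   using X Y st G unfolding L2_martingale_def by blast+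
  then show ?thesis by simp
 qed
 finally show "expectation (%w. G w \<bullet> (X t w - Y t w - (X s w - Y s w))) = 0" .
qed

lemma ito_exceeds:
 fixes H H' :: "real => 'w => 'v::euclidean_space"
 assumes I: "cont_adapted I" "!!t. 0 <= t ==> ito j t H (I t)" "!!T. L2_proc M T H"
  and I': "cont_adapted I'" "!!t. 0 <= t ==> ito j t H' (I' t)" "!!T. L2_proc M T H'" and j: "j : J"
  and T: "0 <= T" and c: "0 < c"
 shows "emeasure M (exceeds (%t w. I t w - I' t w) T c) <= ennreal (1 / c\<^sup>2) * energy M {0..T} (%s w. H s w - H' s w)"
 using maximal_inequality[OF L2_martingale_diff[OF ito_martingale[OF I j] ito_martingale[OF I' j]] T c]
 unfolding ito_isometry_diff(2)[OF I(2)[OF T] I(3) I'(2)[OF T] I'(3) j T] .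

lemma ito_loc_bounded:
 fixes H :: "real => 'w => 'v::euclidean_space"
 assumes I: "!!t. 0 <= t ==> ito j t H (I t)" and H: "!!T. L2_proc M T H" and j: "j : J"
 shows "loc_bounded_L2 I"
 unfolding loc_bounded_L2_def
proof (intro allI impI)
 fix T :: real assume T: "0 <= T"
 have fin: "energy M {0..T} H < \<infinity>" using H by (simp add: L2_proc_iff_energy)
 show "\<exists>C\<ge>0. \<forall>t\<in>{0..T}. sqn M (I t) <= ennreal C"
 proof (intro exI[of _ "enn2real (energy M {0..T} H)"] conjI ballI)
  fix t assume t: "t : {0..T}"
  then have t0: "0 <= t" by simp
  have "sqn M (I t) = energy M {0..t} H"
   using ito_isometry_diff(2)[OF I[OF t0] H ito_zero L2_proc_zero j t0] by simp
  also have "... <= energy M {0..T} H" by (rule energy_mono) (use t in simp)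
  finally show "sqn M (I t) <= ennreal (enn2real (energy M {0..T} H))"
   using fin by simp
 qed simp
qed

text \<open>Brownian paths are continuous only almost surely, so the elementary integral is replaced
  by 0 on the exceptional null set; as an Ito integral it is only determined up to such
  changes.\<close>

lemma simple_integral_continuous:
 fixes \<eta> :: "nat => 'w => 'v::euclidean_space"
 assumes s: "simple_process M Fl k \<tau> \<eta>" and j: "j : J"
 shows "\<exists>S. cont_adapted S \<and> (\<forall>t\<ge>0. ito j t (simple_value k \<tau> \<eta>) (S t))"
proof -
 note D = simple_processD[OF s]
 obtain N where N: "!!w. w : space M - N ==> continuous_on {0..} (%t. W j t w)" "N : null_sets M"
  by (rule AE_E3[OF W_continuous[OF j]]) (rule that)
 define S where "S t w = (if w : N then 0 else simple_integral (W j) k \<tau> \<eta> t w)" for t w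
 have c: "cont_adapted S"
  unfolding cont_adapted_def
 proof (intro conjI ballI allI impI)
  fix w assume w: "w : space M"
  show "continuous_on {0..} (%t. S t w)"
  proof (cases "w : N")
   case False
   then have W: "continuous_on {0..} (%t. W j t w)" using N(1) w by auto
   have "continuous_on {0..} (%t. W j (min x t) w)" if "0 <= x" for x
    by (rule continuous_on_compose2[OF W]) (use that in \<open>auto intro!: continuous_intros\<close>)
   then have "continuous_on {0..} (%t. simple_integral (W j) k \<tau> \<eta> t w)"
    unfolding simple_integral_def by (intro continuous_intros) (use D(1) in auto)
   then show ?thesis using False by (simp add: S_def)
  qed (simp add: S_def)
 next
  fix t :: real assume t: "0 <= t"
  have "(%w. dW j (min (\<tau> l) t) (min (\<tau> (Suc l)) t) w *\<^sub>R \<eta> l w) : borel_measurable (Fl t)" if l: "l < k" for l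
  proof (cases "\<tau> l <= t")
   case True
   have "dW j (min (\<tau> l) t) (min (\<tau> (Suc l)) t) : borel_measurable (Fl t)"
    by (rule dW_adapted[OF j]) (use D(1) t in auto)
   then show ?thesis using usual_measurable_mono[OF D(3)[OF l] True] by (intro borel_measurable_scaleR)
  next
   case False
   then have "min (\<tau> l) t = min (\<tau> (Suc l)) t" using D(2)[of l] by (simp add: min_absorb2)
   then show ?thesis by (simp add: dW_def)
  qed
  then have m: "simple_integral (W j) k \<tau> \<eta> t : borel_measurable (Fl t)"
   unfolding simple_integral_dW[abs_def] by (intro borel_measurable_sum) auto
  have "{w : space (Fl t). w : N} = N" using N(2) sets.sets_into_space by auto
  then have "{w : space (Fl t). w : N} : sets (Fl t)" using N(2) null_sets_usual by auto
  then show "S t : borel_measurable (Fl t)" unfolding S_def[abs_def] using m by (intro measurable_If) auto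
 qed
 have "ito j t (simple_value k \<tau> \<eta>) (S t)" if t: "0 <= t" for t
 proof (rule ito_AE_cong[OF ito_simple[OF s j t] cont_adapted_M[OF c t]])
  show "AE w in M. simple_integral (W j) k \<tau> \<eta> t w = S t w"
   using AE_not_in[OF N(2)] by eventually_elim (simp add: S_def)
 qed
 with c show ?thesis by blast
qed

text \<open>The m-th approximant has squared distance below 64^-m on [0, m + 1]. Consecutive
  integrals then exceed the level 2^-n with probability at most 4^n * 4 * 64^-n = 4 * 16^-n, and
  their squared L2 distances are at most 4 * 64^-n: both are fast enough for
  \<open>continuous_limit\<close>.\<close>

theorem ito_continuous_version:
 fixes H :: "real => 'w => 'v::euclidean_space"
 assumes H: "cont_adapted H" "loc_bounded_L2 H" and j: "j : J"
 shows "\<exists>I. cont_adapted I \<and> loc_bounded_L2 I \<and> (\<forall>t\<ge>0. ito j t H (I t))"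
proof -
 note HL = cont_L2_proc[OF H]
 have "\<exists>V. (\<exists>k \<tau> \<eta>. simple_process M Fl k \<tau> \<eta> \<and> V = simple_value k \<tau> \<eta>) \<and> energy M {0..real (Suc m)} (%s w. H s w - V s w) < ennreal ((1/64)^m)" for m
  using simple_process_dense[OF H, of "real (Suc m)" "(1/64)^m"] by fastforce
 then obtain V where V: "!!m. \<exists>k \<tau> \<eta>. simple_process M Fl k \<tau> \<eta> \<and> V m = simple_value k \<tau> \<eta>"
  and e: "!!m. energy M {0..real (Suc m)} (%s w. H s w - V m s w) < ennreal ((1/64)^m)"
  by metis
 have VL: "L2_proc M T (V m)" for T m using V[of m] simple_value_L2_proc by auto
 have "\<forall>m. \<exists>S. cont_adapted S \<and> (\<forall>t\<ge>0. ito j t (V m) (S t))" using V simple_integral_continuous[OF _ j] by metis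
 from choice[OF this] obtain S where S: "!!m. cont_adapted (S m)" "!!m t. 0 <= t ==> ito j t (V m) (S m t)" by blast
 have Sb: "loc_bounded_L2 (S m)" for m by (rule ito_loc_bounded[OF S(2) VL j])
 have en: "energy M {0..real m} (%s w. V (Suc n) s w - V n s w) <= ennreal (4 * (1/64)^n)" if nm: "n >= m" for n m
 proof -
  note Hm = cont_adapted_horizon[OF H(1), of "real m"]
  have Vm: "(%(w, s). V i s w) : borel_measurable (horizon M (real m))" for i using VL by (simp add: L2_proc_iff_energy)
  have d1: "(%(w, s). V (Suc n) s w - H s w) : borel_measurable (horizon M (real m))"
   using borel_measurable_diff[OF Vm[of "Suc n"] Hm] by (simp add: case_prod_beta')
  have d2: "(%(w, s). H s w - V n s w) : borel_measurable (horizon M (real m))"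
   using borel_measurable_diff[OF Hm Vm[of n]] by (simp add: case_prod_beta')
  have "energy M {0..real m} (%s w. (V (Suc n) s w - H s w) + (H s w - V n s w))
   <= 2 * energy M {0..real m} (%s w. V (Suc n) s w - H s w) + 2 * energy M {0..real m} (%s w. H s w - V n s w)"
   by (rule energy_add_le[OF d1 d2])
  also have "energy M {0..real m} (%s w. V (Suc n) s w - H s w) = energy M {0..real m} (%s w. H s w - V (Suc n) s w)"
   by (simp add: energy_def norm_minus_commute)
  also have "energy M {0..real m} (%s w. H s w - V (Suc n) s w) <= ennreal ((1/64)^n)"
  proof -
   have "energy M {0..real m} (%s w. H s w - V (Suc n) s w) <= energy M {0..real (Suc (Suc n))} (%s w. H s w - V (Suc n) s w)"
    by (rule energy_mono) (use nm in simp)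
   also have "... <= ennreal ((1/64)^Suc n)" by (rule less_imp_le[OF e])
   also have "... <= ennreal ((1/64)^n)" by (intro ennreal_leI power_decreasing) auto
   finally show ?thesis .
  qed
  also have "energy M {0..real m} (%s w. H s w - V n s w) <= ennreal ((1/64)^n)"
  proof -
   have "energy M {0..real m} (%s w. H s w - V n s w) <= energy M {0..real (Suc n)} (%s w. H s w - V n s w)"
    by (rule energy_mono) (use nm in simp)
   also have "... <= ennreal ((1/64)^n)" by (rule less_imp_le[OF e])
   finally show ?thesis .
  qed
  also have "2 * ennreal ((1/64)^n) + 2 * ennreal ((1/64)^n) = ennreal (4 * (1/64)^n)"
   by (subst ennreal_twice_add) auto
  finally show ?thesis by (simp add: add_mono mult_left_mono)
 qed
 have p64: "(1/64::real)^n <= (1/8)^n" for n by (intro power_mono) auto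
 have "\<exists>I. cont_adapted I \<and> loc_bounded_L2 I \<and>
  (\<forall>m::nat. \<exists>C\<ge>0. \<forall>n\<ge>m. \<forall>t\<in>{0..real m}. sqn M (%w. I t w - S n t w) <= ennreal (C * (1/8)^n))"
 proof (rule continuous_limit[OF S(1) Sb])
  fix m :: nat
  show "\<exists>C. \<forall>n\<ge>m. emeasure M (exceeds (%t w. S (Suc n) t w - S n t w) (real m) ((1/2)^n)) <= ennreal (C * (1/2)^n)"
  proof (intro exI[of _ 4] allI impI)
   fix n assume n: "m <= n"
   have "emeasure M (exceeds (%t w. S (Suc n) t w - S n t w) (real m) ((1/2)^n))
    <= ennreal (1 / ((1/2)^n)^2) * energy M {0..real m} (%s w. V (Suc n) s w - V n s w)"
    by (rule ito_exceeds[OF S(1) S(2) VL S(1) S(2) VL j]) auto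
   also have "... <= ennreal (1 / ((1/2)^n)^2) * ennreal (4 * (1/64)^n)" by (intro mult_left_mono en n) simp
   also have "... = ennreal (4 * (1/16)^n)"
   proof -
    have "1 / ((1/2::real)^n)^2 * (4 * (1/64)^n) = 4 * (1/16)^n"
    proof -
     have 1: "((1/2::real)^n)^2 = (1/4)^n" by (simp add: power2_eq_square power_mult_distrib[symmetric])
     have 2: "(1/64::real)^n = (1/4)^n * (1/16)^n" by (simp add: power_mult_distrib[symmetric])
     have "(1/4::real)^n ~= 0" by simp
     then show ?thesis unfolding 1 2 by simp
    qed
    then show ?thesis by (simp add: ennreal_mult'[symmetric] del: ennreal_power)
   qed
   also have "... <= ennreal (4 * (1/2)^n)" by (intro ennreal_leI mult_left_mono power_mono) auto
   finally show "emeasure M (exceeds (%t w. S (Suc n) t w - S n t w) (real m) ((1/2)^n)) <= ennreal (4 * (1/2)^n)" .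
  qed
  show "\<exists>C\<ge>0. \<forall>n\<ge>m. \<forall>t\<in>{0..real m}. sqn M (%w. S (Suc n) t w - S n t w) <= ennreal (C * (1/8)^n)"
  proof (intro exI[of _ 4] conjI allI impI ballI)
   fix n t assume n: "m <= n" and t: "t : {0..real m}"
   then have t0: "0 <= t" by simp
   have "sqn M (%w. S (Suc n) t w - S n t w) = energy M {0..t} (%s w. V (Suc n) s w - V n s w)"
    by (rule ito_isometry_diff(2)[OF S(2)[OF t0] VL S(2)[OF t0] VL j t0])
   also have "... <= energy M {0..real m} (%s w. V (Suc n) s w - V n s w)" by (rule energy_mono) (use t in simp)
   also have "... <= ennreal (4 * (1/64)^n)" by (rule en[OF n])
   also have "... <= ennreal (4 * (1/8)^n)" using p64 by (intro ennreal_leI mult_left_mono) auto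
   finally show "sqn M (%w. S (Suc n) t w - S n t w) <= ennreal (4 * (1/8)^n)" .
  qed simp
 qed
 then obtain I where I: "cont_adapted I" "loc_bounded_L2 I"
  and rate: "!!m::nat. \<exists>C\<ge>0. \<forall>n\<ge>m. \<forall>t\<in>{0..real m}. sqn M (%w. I t w - S n t w) <= ennreal (C * (1/8)^n)"
  by blast
 have "ito j t H (I t)" if t: "0 <= t" for t
 proof (rule ito_limit[OF S(2)[OF t] VL HL j t])
  obtain m :: nat where m: "t <= real m" using real_arch_simple by blast
  show "(%n. energy M {0..t} (%s w. H s w - V n s w)) \<longlonglongrightarrow> 0"
  proof (rule tendsto_sandwich[OF _ _ tendsto_const])
   show "\<forall>\<^sub>F n in sequentially. energy M {0..t} (%s w. H s w - V n s w) <= ennreal ((1/64)^n)"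
    using eventually_ge_at_top[of m]
   proof eventually_elim
    case (elim n)
    have "energy M {0..t} (%s w. H s w - V n s w) <= energy M {0..real (Suc n)} (%s w. H s w - V n s w)"
     by (rule energy_mono) (use m elim in simp)
    also have "... <= ennreal ((1/64)^n)" by (rule less_imp_le[OF e])
    finally show ?case .
   qed
   have "(%n. ennreal ((1/64)^n)) \<longlonglongrightarrow> ennreal 0" by (intro tendsto_ennrealI LIMSEQ_power_zero) simp
   then show "(%n. ennreal ((1/64)^n)) \<longlonglongrightarrow> 0" by (simp del: ennreal_power)
  qed simp
  show "L2_tendsto M (%n. S n t) (I t)"
   unfolding L2_tendsto_def
  proof -
   obtain C where C': "\<forall>n\<ge>m. \<forall>t\<in>{0..real m}. sqn M (%w. I t w - S n t w) <= ennreal (C * (1/8)^n)"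
    using rate[of m] by blast
   have C: "sqn M (%w. I t w - S n t w) <= ennreal (C * (1/8)^n)" if "n >= m" for n
    using C' that t m by simp
   have "(%n. C * (1/8)^n) \<longlonglongrightarrow> C * 0" by (intro tendsto_mult tendsto_const LIMSEQ_power_zero) simp
   then have "(%n. ennreal (C * (1/8)^n)) \<longlonglongrightarrow> ennreal (C * 0)" by (rule tendsto_ennrealI)
   then have lim: "(%n. ennreal (C * (1/8)^n)) \<longlonglongrightarrow> 0" by simp
   show "(%n. sqn M (%w. I t w - S n t w)) \<longlonglongrightarrow> 0"
    by (rule tendsto_sandwich[OF _ _ tendsto_const lim])
      (use C in \<open>auto simp: eventually_sequentially\<close>)
  qed
 qed (rule cont_adapted_M[OF I(1) t])
 then show ?thesis using I by blast
qed

end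

section \<open>Existence of solutions of linear equations\<close>

lemma norm_sum_square_le:
 fixes f :: "'i => 'v::real_normed_vector"
 shows "(norm (\<Sum>i\<in>I. f i))^2 <= real (card I) * (\<Sum>i\<in>I. (norm (f i))\<^sup>2)"
proof -
 have "(norm (\<Sum>i\<in>I. f i))^2 <= (\<Sum>i\<in>I. norm (f i))^2" by (intro power_mono norm_sum) auto
 also have "... <= (\<Sum>i\<in>I. (norm (f i))\<^sup>2) * card I" by (rule sum_squared_le_sum_of_squares)
 finally show ?thesis by (simp add: mult.commute)
qed

lemma nn_integral_exp_le:
 fixes L t :: real
 assumes L: "0 < L" and t: "0 <= t" and c: "0 <= c"
 shows "(\<integral>\<^sup>+s. ennreal (c * exp (L * s)) \<partial>restrict_space lborel {0..t}) <= ennreal (c * exp (L * t) / L)"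
proof -
 have "(\<integral>\<^sup>+s. ennreal (c * exp (L * s)) \<partial>restrict_space lborel {0..t}) = (\<integral>\<^sup>+s. ennreal (c * exp (L * s)) * indicator {0..t} s \<partial>lborel)"
  by (simp add: nn_integral_restrict_space)
 also have "... = ennreal (c * exp (L * t) / L - c * exp (L * 0) / L)"
 proof (rule nn_integral_FTC_Icc)
  show "(%s. c * exp (L * s)) : borel_measurable borel" by measurable
  show "((%s. c * exp (L * s) / L) has_real_derivative c * exp (L * x)) (at x)" for x
   using L by (auto intro!: derivative_eq_intros)
 qed (use c t in auto)
 also have "... <= ennreal (c * exp (L * t) / L)" using L c by (intro ennreal_leI) simp
 finally show ?thesis .
qed

section \<open>Time integrals of continuous adapted processes\<close>

context brownian_space begin

lemma drift_adapted:
 fixes u :: "real => 'w => 'v::euclidean_space"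
 assumes u: "prog_measurable Fl t u" and t: "0 <= t"
 shows "drift u t : borel_measurable (Fl t)"
proof -
 let ?R = "restrict_space lborel {0..t}"
 interpret R: finite_measure ?R by (rule finite_measure_restrict_lborel)
 have m: "(%(s, w). u s w) : borel_measurable (restrict_space borel {0..t} \<Otimes>\<^sub>M Fl t)"
  using u t unfolding prog_measurable_def by simp
 have "(%z. (snd z, fst z)) : measurable (Fl t \<Otimes>\<^sub>M ?R) (restrict_space borel {0..t} \<Otimes>\<^sub>M Fl t)"
 proof (rule measurable_Pair)
  show "snd : measurable (Fl t \<Otimes>\<^sub>M ?R) (restrict_space borel {0..t})"
   by (simp cong: measurable_cong_sets sets_restrict_space_cong)
 qed simp
 from measurable_compose[OF this m]
 have "(%(w, s). u s w) : borel_measurable (Fl t \<Otimes>\<^sub>M ?R)" by (simp add: case_prod_beta')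
 from R.borel_measurable_lebesgue_integral[OF this]
 show ?thesis unfolding LINT_restrict .
qed

lemma drift_cont_adapted:
 fixes u :: "real => 'w => 'v::euclidean_space"
 assumes u: "cont_adapted u"
 shows "cont_adapted (drift u)"
 unfolding cont_adapted_def
proof (intro conjI ballI allI impI)
 show "drift u t : borel_measurable (Fl t)" if "0 <= t" for t
  by (rule drift_adapted[OF cont_adapted_prog[OF u] that])
 fix w assume w: "w : space M"
 then have c: "continuous_on {0..} (%t. u t w)" using u by (simp add: cont_adapted_def)
 show "continuous_on {0..} (%t. drift u t w)"
 proof (rule continuous_on_atLeast_exhaust)
  fix m :: nat
  have cm: "continuous_on {0..real m} (%t. u t w)" by (rule continuous_on_subset[OF c]) auto
  have "drift u t w = integral {0..t} (%s. u s w)" if "t : {0..real m}" for t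
  proof (rule set_borel_integral_eq_integral(2))
   show "set_integrable lborel {0..t} (%s. u s w)"
    unfolding set_integrable_def
    by (rule borel_integrable_compact) (use that in \<open>auto intro: continuous_on_subset[OF c]\<close>)
  qed
  moreover have "continuous_on {0..real m} (%t. integral {0..t} (%s. u s w))"
   by (rule indefinite_integral_continuous_1[OF integrable_continuous_real[OF cm]])
  ultimately show "continuous_on {0..real m} (%t. drift u t w)" by (subst continuous_on_cong[OF refl]) auto
 qed
qed

lemma drift_loc_bounded:
 fixes u :: "real => 'w => 'v::euclidean_space"
 assumes u: "cont_adapted u" "loc_bounded_L2 u"
 shows "loc_bounded_L2 (drift u)"
 unfolding loc_bounded_L2_def
proof (intro allI impI)
 fix T :: real assume T: "0 <= T"
 have fin: "energy M {0..T} u < \<infinity>" using cont_L2_proc[OF u] by (simp add: L2_proc_iff_energy)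
 show "\<exists>C\<ge>0. \<forall>t\<in>{0..T}. sqn M (drift u t) <= ennreal C"
 proof (intro exI[of _ "T * enn2real (energy M {0..T} u)"] conjI ballI)
  fix t assume t: "t : {0..T}"
  have "sqn M (drift u t) <= ennreal t * energy M {0..t} u"
   by (rule nn_integral_drift_le[OF cont_adapted_horizon[OF u(1), of t]]) (use t in auto)
  also have "... <= ennreal T * energy M {0..T} u" using t by (intro mult_mono ennreal_leI energy_mono) auto
  also have "... = ennreal (T * enn2real (energy M {0..T} u))" using fin T by (simp add: ennreal_mult)
  finally show "sqn M (drift u t) <= ennreal (T * enn2real (energy M {0..T} u))" .
 qed (use T in simp)
qed

text \<open>Cauchy-Schwarz bounds the squared drift at every time up to \<open>T\<close> by one
  random variable \<open>f\<close>, so the maximum over time is covered by Markov's inequality for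
  \<open>f\<close>.\<close>

lemma drift_exceeds:
 fixes u :: "real => 'w => 'v::euclidean_space"
 assumes u: "cont_adapted u" and T: "0 <= T" and c: "0 < c"
 shows "emeasure M (exceeds (drift u) T c) <= ennreal (1 / c\<^sup>2) * (ennreal T * energy M {0..T} u)"
proof -
 let ?R = "restrict_space lborel {0..T}"
 interpret R: finite_measure ?R by (rule finite_measure_restrict_lborel)
 note um = cont_adapted_horizon[OF u, of T]
 define f where "f w = ennreal T * sqn ?R (%s. u s w)" for w
 have gm: "(%w. sqn ?R (%s. u s w)) : borel_measurable M"
 proof -
  have "(%x. ennreal ((norm (case x of (w, r) => u r w))^2)) : borel_measurable (M \<Otimes>\<^sub>M ?R)"
   using um unfolding horizon_def by measurable
  from R.borel_measurable_nn_integral_fst[OF this] show ?thesis by simp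
 qed
 have fm: "f : borel_measurable M" unfolding f_def using gm by measurable
 have sub: "exceeds (drift u) T c \<subseteq> {w\<in>space M. 1 <= ennreal (1 / c\<^sup>2) * f w}"
 proof
  fix w assume "w : exceeds (drift u) T c"
  then obtain t where t: "w : space M" "t : {0..T}" "c < norm (drift u t w)" by (auto simp: exceeds_def)
  let ?Rt = "restrict_space lborel {0..t}"
  have ut: "(%s. u s w) : borel_measurable ?Rt"
   by (rule horizon_measurableD(1)[OF cont_adapted_horizon[OF u] t(1)])
  have em: "emeasure ?Rt (space ?Rt) = ennreal t" using t by (simp add: space_restrict_space emeasure_restrict_space)
  have "ennreal ((norm (drift u t w))^2) <= ennreal t * sqn ?Rt (%s. u s w)"
   unfolding LINT_restrict em[symmetric] by (rule norm_integral_square_le[OF ut])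
  also have "... <= f w"
   unfolding f_def using t
   by (intro mult_mono ennreal_leI) (auto simp: nn_integral_restrict_space indicator_def intro!: nn_integral_mono)
  finally have "ennreal (1 / c\<^sup>2) * ennreal ((norm (drift u t w))^2) <= ennreal (1 / c\<^sup>2) * f w" by (rule mult_left_mono) simp
  moreover have "1 <= ennreal (1 / c\<^sup>2) * ennreal ((norm (drift u t w))^2)"
  proof -
   have "c\<^sup>2 <= (norm (drift u t w))^2" using t c by (intro power_mono) auto
   then have "1 <= 1 / c\<^sup>2 * (norm (drift u t w))^2" using c by (simp add: divide_simps)
   then have "ennreal 1 <= ennreal (1 / c\<^sup>2 * (norm (drift u t w))^2)" by (rule ennreal_leI)
   then show ?thesis by (subst ennreal_mult'[symmetric]) auto
  qed
  ultimately show "w : {w\<in>space M. 1 <= ennreal (1 / c\<^sup>2) * f w}" using t(1) by auto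
 qed
 have "emeasure M (exceeds (drift u) T c) <= emeasure M {w\<in>space M. 1 <= ennreal (1 / c\<^sup>2) * f w}"
  by (rule emeasure_mono[OF sub]) (use fm in measurable)
 also have "... <= ennreal (1 / c\<^sup>2) * (\<integral>\<^sup>+w. f w * indicator (space M) w \<partial>M)"
  using nn_integral_Markov_inequality[OF _ sets.top, of f M "ennreal (1 / c\<^sup>2)"] fm by simp
 also have "(\<integral>\<^sup>+w. f w * indicator (space M) w \<partial>M) = (\<integral>\<^sup>+w. f w \<partial>M)"
  by (rule nn_integral_cong) simp
 also have "... = ennreal T * energy M {0..T} u"
  unfolding f_def using gm by (subst nn_integral_cmult) (auto simp: energy_def nn_integral_restrict_space)
 finally show ?thesis .
qed

lemma energy_linear_le:
 fixes u :: "real => 'w => 'v::euclidean_space" and h :: "'v => 'u::euclidean_space"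
 assumes h: "bounded_linear h" "!!x. norm (h x) <= K * norm x" and u: "(%(w, s). u s w) : borel_measurable (horizon M t)"
 shows "energy M {0..t} (%s w. h (u s w)) <= ennreal (K\<^sup>2) * energy M {0..t} u"
proof -
 have hm: "h : borel_measurable borel"
  by (intro borel_measurable_continuous_onI linear_continuous_on h)
 have m2: "(%(w, s). h (u s w)) : borel_measurable (horizon M t)"
  using measurable_compose[OF u hm] by (simp add: case_prod_beta')
 have "energy M {0..t} (%s w. h (u s w)) <= (\<integral>\<^sup>+x. ennreal (K\<^sup>2) * ennreal ((norm (case x of (w, s) => u s w))^2) \<partial>horizon M t)"
  unfolding energy_horizon[OF m2]
 proof (rule nn_integral_mono)
  fix x :: "'w \<times> real"
  have "(norm (h (u (snd x) (fst x))))^2 <= (K * norm (u (snd x) (fst x)))^2" by (intro power_mono h) auto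
  then show "ennreal ((norm (case x of (w, s) => h (u s w)))^2) <= ennreal (K\<^sup>2) * ennreal ((norm (case x of (w, s) => u s w))^2)"
   by (simp add: case_prod_beta' ennreal_mult'[symmetric] power_mult_distrib ennreal_leI)
 qed
 also have "... = ennreal (K\<^sup>2) * energy M {0..t} u"
  unfolding energy_horizon[OF u] by (rule nn_integral_cmult) (use u in measurable)
 finally show ?thesis .
qed

text \<open>\<open>SOME\<close> turns the existence of a continuous version into an operator, so
  that the Picard map is a function of the process.\<close>

definition ito_version :: "nat => (real => 'w => 'v::euclidean_space) => real => 'w => 'v" where
 "ito_version j H = (SOME I. cont_adapted I \<and> loc_bounded_L2 I \<and> (\<forall>t\<ge>0. ito j t H (I t)))"

lemma ito_version:
 fixes H :: "real => 'w => 'v::euclidean_space"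
 assumes "cont_adapted H" "loc_bounded_L2 H" "j : J"
 shows "cont_adapted (ito_version j H)" "loc_bounded_L2 (ito_version j H)" "0 <= t ==> ito j t H (ito_version j H t)"
proof -
 have "cont_adapted (ito_version j H) \<and> loc_bounded_L2 (ito_version j H) \<and> (\<forall>t\<ge>0. ito j t H (ito_version j H t))"
  unfolding ito_version_def by (rule someI_ex[OF ito_continuous_version[OF assms]])
 then show "cont_adapted (ito_version j H)" "loc_bounded_L2 (ito_version j H)" "0 <= t ==> ito j t H (ito_version j H t)"
  by auto
qed

end

section \<open>Picard iteration for linear equations\<close>

locale linear_sde = brownian_space M F0 W J
 for M :: "'w measure" and F0 W J +
 fixes \<xi> :: "'w => real^'n" and A :: "real^'n^'n" and G :: "nat => real^'n^'n" and J' :: "nat set" and K :: real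
 assumes \<xi>: "\<xi> : borel_measurable (Fl 0)" "L2_fun M \<xi>" and J': "J' \<subseteq> J"
  and K: "0 < K" "!!x. norm (A *v x) <= K * norm x" "!!j x. j : J' ==> norm (G j *v x) <= K * norm x"
begin

definition picard :: "(real => 'w => real^'n) => real => 'w => real^'n" where
 "picard H t w = \<xi> w + drift (%s w. A *v H s w) t w + (\<Sum>j\<in>J'. ito_version j (%s w. G j *v H s w) t w)"

definition good :: "(real => 'w => real^'n) => bool" where
 "good H \<longleftrightarrow> cont_adapted H \<and> loc_bounded_L2 H"

lemma good_matrix: "good H ==> good (%s w. B *v H s w)"
 unfolding good_def
 by (auto intro: cont_adapted_linear[OF matrix_vector_mul_bounded_linear] loc_bounded_L2_linear[OF matrix_vector_mul_bounded_linear])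

lemma good_diff: "good H ==> good H' ==> good (%s w. H s w - H' s w)"
 using loc_bounded_L2_add[of H "%s w. (-1) *\<^sub>R H' s w"]
  cont_adapted_linear[OF bounded_linear_scaleR_right[of "-1"], of H'] loc_bounded_L2_linear[OF bounded_linear_scaleR_right[of "-1"], of H']
 unfolding good_def by (auto intro: cont_adapted_diff)

lemma good_version:
 assumes "good H" "j : J'"
 shows "good (ito_version j (%s w. G j *v H s w))" "0 <= t ==> ito j t (%s w. G j *v H s w) (ito_version j (%s w. G j *v H s w) t)"
 using ito_version[of "%s w. G j *v H s w" j] good_matrix[OF assms(1)] assms(2) J' unfolding good_def by auto

lemma good_picard:
 assumes H: "good H"
 shows "good (picard H)"
proof -
 have AH: "cont_adapted (%s w. A *v H s w)" "loc_bounded_L2 (%s w. A *v H s w)" using good_matrix[OF H] by (auto simp: good_def)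
 have V: "cont_adapted (ito_version j (%s w. G j *v H s w))" "loc_bounded_L2 (ito_version j (%s w. G j *v H s w))" if "j : J'" for j
  using good_version(1)[OF H that] by (auto simp: good_def)
 show ?thesis
  unfolding good_def picard_def[abs_def]
  by (intro conjI cont_adapted_add cont_adapted_sum cont_adapted_const loc_bounded_L2_add loc_bounded_L2_sum
    loc_bounded_L2_const drift_cont_adapted drift_loc_bounded \<xi> AH V)
qed

lemma good_horizon: "good H ==> (%(w, s). H s w) : borel_measurable (horizon M T)"
 unfolding good_def by (auto intro: cont_adapted_horizon)

lemma good_L2_proc: "good H ==> L2_proc M T H"
 unfolding good_def by (auto intro: cont_L2_proc)

lemma good_M: "good H ==> 0 <= t ==> H t : borel_measurable M"
 unfolding good_def by (auto intro: cont_adapted_M)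

lemma drift_diff:
 assumes H: "good H" and H': "good H'" and t: "0 <= t" and w: "w : space M"
 shows "drift (%s w. A *v H s w) t w - drift (%s w. A *v H' s w) t w = drift (%s w. A *v (H s w - H' s w)) t w"
proof -
 have "set_integrable lborel {0..t} (%s. A *v F s w)" if "good F" for F
 proof -
  have "continuous_on {0..} (%s. A *v F s w)" using good_matrix[OF that, of A] w by (auto simp: good_def cont_adapted_def)
  then show ?thesis unfolding set_integrable_def
   by (intro borel_integrable_compact) (auto intro: continuous_on_subset)
 qed
 from set_integral_diff(2)[OF this[OF H] this[OF H']] show ?thesis
  by (simp add: matrix_vector_mult_diff_distrib)
qed

lemma picard_diff_eq:
 assumes H: "good H" and H': "good H'" and t: "0 <= t" and w: "w : space M"
 shows "picard H t w - picard H' t w = drift (%s w. A *v (H s w - H' s w)) t w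
  + (\<Sum>j\<in>J'. ito_version j (%s w. G j *v H s w) t w - ito_version j (%s w. G j *v H' s w) t w)"
 unfolding picard_def drift_diff[OF assms, symmetric] sum_subtractf by (simp add: algebra_simps)

lemma energy_matrix:
 assumes H: "good H" and B: "!!x. norm (B *v x) <= K * norm x"
 shows "energy M {0..t} (%s w. (B :: real^'n^'n) *v H s w) <= ennreal (K\<^sup>2) * energy M {0..t} H"
 by (rule energy_linear_le[OF matrix_vector_mul_bounded_linear B good_horizon[OF H]])

text \<open>Lipschitz constant of the Picard map, in mean square at one time against energy up to
  that time. The first summand comes from Cauchy-Schwarz for the drift, the second from the isometry
  for the integrals, and the 1 keeps the constant positive.\<close>

definition contr :: "real => real" where
 "contr T = 2 * (T * K\<^sup>2) + 2 * ((real (card J'))^2 * K\<^sup>2) + 1"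

lemma contr_pos: "0 <= T ==> 0 < contr T"
 unfolding contr_def by (intro add_nonneg_pos add_nonneg_nonneg mult_nonneg_nonneg) auto

lemma version_diff_energy:
 assumes H: "good H" and H': "good H'" and j: "j : J'" and t: "0 <= t"
 shows "sqn M (%w. ito_version j (%s w. G j *v H s w) t w - ito_version j (%s w. G j *v H' s w) t w)
  <= ennreal (K\<^sup>2) * energy M {0..t} (%s w. H s w - H' s w)"
proof -
 have jJ: "j : J" using j J' by auto
 have "sqn M (%w. ito_version j (%s w. G j *v H s w) t w - ito_version j (%s w. G j *v H' s w) t w)
  = energy M {0..t} (%s w. G j *v H s w - G j *v H' s w)"
  by (rule ito_isometry_diff(2)[OF good_version(2)[OF H j t] good_L2_proc[OF good_matrix[OF H]]
    good_version(2)[OF H' j t] good_L2_proc[OF good_matrix[OF H']] jJ t])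
 also have "... = energy M {0..t} (%s w. G j *v (H s w - H' s w))" by (simp add: matrix_vector_mult_diff_distrib)
 also have "... <= ennreal (K\<^sup>2) * energy M {0..t} (%s w. H s w - H' s w)"
  by (rule energy_matrix[OF good_diff[OF H H'] K(3)[OF j]])
 finally show ?thesis .
qed

lemma picard_diff:
 assumes H: "good H" and H': "good H'" and t: "0 <= t" "t <= T"
 shows "sqn M (%w. picard H t w - picard H' t w)
  <= ennreal (contr T) * energy M {0..t} (%s w. H s w - H' s w)"
proof -
 let ?e = "energy M {0..t} (%s w. H s w - H' s w)" and ?c = "real (card J')"
 let ?D = "drift (%s w. A *v (H s w - H' s w))"
 let ?I = "%j w. ito_version j (%s w. G j *v H s w) t w - ito_version j (%s w. G j *v H' s w) t w"
 have gD: "good (%s w. A *v (H s w - H' s w))" by (rule good_matrix[OF good_diff[OF H H']])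
 have Dm: "?D t : borel_measurable M"
  using cont_adapted_M[OF drift_cont_adapted, of _ t] gD t by (auto simp: good_def)
 have Im: "?I j : borel_measurable M" if "j : J'" for j
  using good_M[OF good_version(1)[OF H that] t(1)] good_M[OF good_version(1)[OF H' that] t(1)] by (rule borel_measurable_diff)
 have "sqn M (%w. picard H t w - picard H' t w) = sqn M (%w. ?D t w + (\<Sum>j\<in>J'. ?I j w))"
  by (rule nn_integral_cong) (simp only: picard_diff_eq[OF H H' t(1)])
 also have "... <= 2 * sqn M (?D t) + 2 * sqn M (%w. \<Sum>j\<in>J'. ?I j w)"
  by (rule nn_integral_square_add_le[OF Dm]) (rule borel_measurable_sum[OF Im])
 also have "sqn M (?D t) <= ennreal (T * K\<^sup>2) * ?e"
 proof -
  have "sqn M (?D t) <= ennreal t * energy M {0..t} (%s w. A *v (H s w - H' s w))"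
   by (rule nn_integral_drift_le[OF good_horizon[OF gD] t(1) order_refl])
  also have "... <= ennreal T * (ennreal (K\<^sup>2) * ?e)"
   using t by (intro mult_mono ennreal_leI energy_matrix[OF good_diff[OF H H'] K(2)]) auto
  finally show ?thesis using t by (simp add: ennreal_mult mult.assoc)
 qed
 also have "sqn M (%w. \<Sum>j\<in>J'. ?I j w) <= ennreal (?c\<^sup>2 * K\<^sup>2) * ?e"
 proof -
  have "sqn M (%w. \<Sum>j\<in>J'. ?I j w) <= (\<integral>\<^sup>+w. ennreal ?c * (\<Sum>j\<in>J'. ennreal ((norm (?I j w))^2)) \<partial>M)"
  proof (rule nn_integral_mono)
   fix w
   have "ennreal ((norm (\<Sum>j\<in>J'. ?I j w))^2) <= ennreal (?c * (\<Sum>j\<in>J'. (norm (?I j w))\<^sup>2))"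
    by (intro ennreal_leI norm_sum_square_le)
   then show "ennreal ((norm (\<Sum>j\<in>J'. ?I j w))^2) <= ennreal ?c * (\<Sum>j\<in>J'. ennreal ((norm (?I j w))^2))"
    by (simp add: ennreal_mult' sum_ennreal)
  qed
  also have "... = ennreal ?c * (\<Sum>j\<in>J'. sqn M (?I j))"
  proof -
   have m: "(%w. ennreal ((norm (?I j w))^2)) : borel_measurable M" if "j : J'" for j using Im[OF that] by measurable
   have "(\<integral>\<^sup>+w. ennreal ?c * (\<Sum>j\<in>J'. ennreal ((norm (?I j w))^2)) \<partial>M) = ennreal ?c * (\<integral>\<^sup>+w. (\<Sum>j\<in>J'. ennreal ((norm (?I j w))^2)) \<partial>M)"
    by (rule nn_integral_cmult) (rule borel_measurable_sum[OF m])
   also have "(\<integral>\<^sup>+w. (\<Sum>j\<in>J'. ennreal ((norm (?I j w))^2)) \<partial>M) = (\<Sum>j\<in>J'. sqn M (?I j))"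
    by (rule nn_integral_sum[OF m])
   finally show ?thesis .
  qed
  also have "... <= ennreal ?c * (\<Sum>j\<in>J'. ennreal (K\<^sup>2) * ?e)"
   by (intro mult_left_mono sum_mono version_diff_energy[OF H H' _ t(1)]) auto
  also have "... = ennreal (?c\<^sup>2 * K\<^sup>2) * ?e"
   by (simp add: ennreal_mult' power2_eq_square mult.assoc ennreal_of_nat_eq_real_of_nat)
  finally show ?thesis .
 qed
 also have "2 * (ennreal (T * K\<^sup>2) * ?e) + 2 * (ennreal (?c\<^sup>2 * K\<^sup>2) * ?e) = (2 * ennreal (T * K\<^sup>2) + 2 * ennreal (?c\<^sup>2 * K\<^sup>2)) * ?e"
  by (simp add: distrib_right mult.assoc)
 also have "2 * ennreal (T * K\<^sup>2) + 2 * ennreal (?c\<^sup>2 * K\<^sup>2) = ennreal (2 * (T * K\<^sup>2) + 2 * (?c\<^sup>2 * K\<^sup>2))"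
  by (rule ennreal_twice_add) (use t in auto)
 also have "... * ?e <= ennreal (contr T) * ?e" unfolding contr_def by (intro mult_right_mono ennreal_leI) auto
 finally show ?thesis by (simp add: add_mono mult_left_mono)
qed

text \<open>The level \<open>c\<close> is shared equally by the drift and the integrals: if none of
  these card J' + 1 terms exceeds \<open>d\<close>, their sum does not exceed
  \<open>c\<close>.\<close>

lemma picard_exceeds:
 assumes H: "good H" and H': "good H'" and T: "0 <= T" and c: "0 < c"
 shows "emeasure M (exceeds (%t w. picard H t w - picard H' t w) T c)
  <= ennreal (1 / (c / (real (card J') + 1))^2 * (T + real (card J')) * K\<^sup>2) * energy M {0..T} (%s w. H s w - H' s w)"
proof -
 let ?e = "energy M {0..T} (%s w. H s w - H' s w)" and ?c = "real (card J')"
 let ?D = "drift (%s w. A *v (H s w - H' s w))"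
 let ?I = "%j t w. ito_version j (%s w. G j *v H s w) t w - ito_version j (%s w. G j *v H' s w) t w"
 define d where "d = c / (?c + 1)"
 have d: "0 < d" using c by (simp add: d_def)
 have fJ: "finite J'" using J' finite_J by (rule finite_subset)
 have gD: "cont_adapted (%s w. A *v (H s w - H' s w))" using good_matrix[OF good_diff[OF H H']] by (simp add: good_def)
 have Dc: "cont_adapted ?D" by (rule drift_cont_adapted[OF gD])
 have Ic: "cont_adapted (?I j)" if "j : J'" for j
  using good_version(1)[OF H that] good_version(1)[OF H' that] by (auto simp: good_def intro: cont_adapted_diff)
 have sub: "exceeds (%t w. picard H t w - picard H' t w) T c \<subseteq> exceeds ?D T d \<union> (\<Union>j\<in>J'. exceeds (?I j) T d)"
 proof
  fix w assume "w : exceeds (%t w. picard H t w - picard H' t w) T c"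
  then obtain t where t: "w : space M" "t : {0..T}" "c < norm (picard H t w - picard H' t w)" by (auto simp: exceeds_def)
  show "w : exceeds ?D T d \<union> (\<Union>j\<in>J'. exceeds (?I j) T d)"
  proof (rule ccontr)
   assume n: "w \<notin> exceeds ?D T d \<union> (\<Union>j\<in>J'. exceeds (?I j) T d)"
   have 1: "norm (?D t w) <= d" using n t by (force simp: exceeds_def not_less)
   have 2: "norm (?I j t w) <= d" if "j : J'" for j using n t that by (force simp: exceeds_def not_less)
   have "norm (picard H t w - picard H' t w) <= norm (?D t w) + norm (\<Sum>j\<in>J'. ?I j t w)"
    unfolding picard_diff_eq[OF H H' _ t(1)[THEN iffD2[OF refl]], of t] using t picard_diff_eq[OF H H', of t w] norm_triangle_ineq by auto
   also have "... <= d + (\<Sum>j\<in>J'. d)" by (intro add_mono 1 sum_norm_le 2)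
   also have "... = (?c + 1) * d" by (simp add: algebra_simps)
   also have "... = c" by (simp add: d_def add_pos_nonneg)
   finally show False using t(3) by simp
  qed
 qed
 have m1: "exceeds ?D T d : events" by (rule exceeds_events[OF Dc T])
 have m2: "exceeds (?I j) T d : events" if "j : J'" for j by (rule exceeds_events[OF Ic[OF that] T])
 have m3: "(\<Union>j\<in>J'. exceeds (?I j) T d) : events" using fJ m2 by auto
 have "emeasure M (exceeds (%t w. picard H t w - picard H' t w) T c) <= emeasure M (exceeds ?D T d \<union> (\<Union>j\<in>J'. exceeds (?I j) T d))"
  by (rule emeasure_mono[OF sub]) (use m1 m3 in auto)
 also have "... <= emeasure M (exceeds ?D T d) + emeasure M (\<Union>j\<in>J'. exceeds (?I j) T d)"
  by (rule emeasure_subadditive[OF m1 m3])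
 also have "... <= emeasure M (exceeds ?D T d) + (\<Sum>j\<in>J'. emeasure M (exceeds (?I j) T d))"
  by (intro add_left_mono emeasure_subadditive_finite fJ) (use m2 in auto)
 also have "... <= ennreal (1 / d\<^sup>2) * (ennreal T * (ennreal (K\<^sup>2) * ?e)) + (\<Sum>j\<in>J'. ennreal (1 / d\<^sup>2) * (ennreal (K\<^sup>2) * ?e))"
 proof (intro add_mono sum_mono)
  have "emeasure M (exceeds ?D T d) <= ennreal (1 / d\<^sup>2) * (ennreal T * energy M {0..T} (%s w. A *v (H s w - H' s w)))"
   by (rule drift_exceeds[OF gD T d])
  also have "... <= ennreal (1 / d\<^sup>2) * (ennreal T * (ennreal (K\<^sup>2) * ?e))"
   by (intro mult_left_mono energy_matrix[OF good_diff[OF H H'] K(2)]) auto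
  finally show "emeasure M (exceeds ?D T d) <= ennreal (1 / d\<^sup>2) * (ennreal T * (ennreal (K\<^sup>2) * ?e))" .
  fix j assume j: "j : J'"
  then have jJ: "j : J" using J' by auto
  have V: "cont_adapted (ito_version j (%s w. G j *v H s w))" "cont_adapted (ito_version j (%s w. G j *v H' s w))"
   using good_version(1)[OF H j] good_version(1)[OF H' j] by (auto simp: good_def)
  have "emeasure M (exceeds (?I j) T d) <= ennreal (1 / d\<^sup>2) * energy M {0..T} (%s w. G j *v H s w - G j *v H' s w)"
   by (rule ito_exceeds[OF V(1) good_version(2)[OF H j] good_L2_proc[OF good_matrix[OF H]]
     V(2) good_version(2)[OF H' j] good_L2_proc[OF good_matrix[OF H']] jJ T d])
  also have "... = ennreal (1 / d\<^sup>2) * energy M {0..T} (%s w. G j *v (H s w - H' s w))" by (simp add: matrix_vector_mult_diff_distrib)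
  also have "... <= ennreal (1 / d\<^sup>2) * (ennreal (K\<^sup>2) * ?e)"
   by (intro mult_left_mono energy_matrix[OF good_diff[OF H H'] K(3)[OF j]]) auto
  finally show "emeasure M (exceeds (?I j) T d) <= ennreal (1 / d\<^sup>2) * (ennreal (K\<^sup>2) * ?e)" .
 qed
 also have "... = (ennreal (1 / d\<^sup>2) * (ennreal T * ennreal (K\<^sup>2)) + ennreal ?c * (ennreal (1 / d\<^sup>2) * ennreal (K\<^sup>2))) * ?e"
  by (simp add: distrib_right mult.assoc ennreal_of_nat_eq_real_of_nat)
 also have "ennreal (1 / d\<^sup>2) * (ennreal T * ennreal (K\<^sup>2)) + ennreal ?c * (ennreal (1 / d\<^sup>2) * ennreal (K\<^sup>2)) = ennreal (1 / d\<^sup>2 * (T * K\<^sup>2) + ?c * (1 / d\<^sup>2 * K\<^sup>2))"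
 proof -
  have "ennreal (1 / d\<^sup>2 * (T * K\<^sup>2) + ?c * (1 / d\<^sup>2 * K\<^sup>2)) = ennreal (1 / d\<^sup>2 * (T * K\<^sup>2)) + ennreal (?c * (1 / d\<^sup>2 * K\<^sup>2))"
   by (rule ennreal_plus) (use T in auto)
  then show ?thesis using T by (simp only: ennreal_mult zero_le_divide_1_iff zero_le_power2 mult_nonneg_nonneg of_nat_0_le_iff)
 qed
 also have "1 / d\<^sup>2 * (T * K\<^sup>2) + ?c * (1 / d\<^sup>2 * K\<^sup>2) = 1 / d\<^sup>2 * (T + ?c) * K\<^sup>2" by (simp add: algebra_simps add_divide_distrib)
 finally show ?thesis unfolding d_def .
qed

primrec iter :: "nat => real => 'w => real^'n" where
 "iter 0 = (%_. \<xi>)"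
| "iter (Suc n) = picard (iter n)"

lemma good_iter: "good (iter n)"
proof (induction n)
 case 0
 show ?case by (simp add: good_def cont_adapted_const loc_bounded_L2_const \<xi>)
next
 case (Suc n)
 then show ?case by (simp add: good_picard)
qed

text \<open>An exponentially weighted estimate: integrating exp (L s) gains 1 / L, and L = 64 *
  contr T makes every iteration gain the factor 1/64. In this way the whole interval [0, T] is
  treated at once, however long it is.\<close>

lemma iter_rate:
 assumes T: "0 <= T"
 shows "\<exists>D\<ge>0. \<forall>n. \<forall>t\<in>{0..T}. sqn M (%w. iter (Suc n) t w - iter n t w) <= ennreal (D * (1/64)^n)"
proof -
 define L where "L = 64 * contr T"
 have L: "0 < L" using contr_pos[OF T] by (simp add: L_def)
 obtain D where D: "0 <= D" "!!t. t : {0..T} ==> sqn M (%w. iter (Suc 0) t w - iter 0 t w) <= ennreal D"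
  using good_diff[OF good_iter good_iter, of "Suc 0" 0] T unfolding good_def loc_bounded_L2_def by blast
 have key: "sqn M (%w. iter (Suc n) t w - iter n t w) <= ennreal (D * (1/64)^n * exp (L * t))" if "t : {0..T}" for n t
  using that
 proof (induction n arbitrary: t)
  case 0
  have "D * 1 <= D * exp (L * t)" using D(1) L 0 by (intro mult_left_mono) auto
  then have "ennreal D <= ennreal (D * (1/64)^0 * exp (L * t))" by (intro ennreal_leI) simp
  with D(2)[OF 0] show ?case by (rule order_trans)
 next
  case (Suc n)
  have t: "0 <= t" "t <= T" using Suc.prems by auto
  let ?d = "%s w. iter (Suc n) s w - iter n s w"
  have "sqn M (%w. iter (Suc (Suc n)) t w - iter (Suc n) t w) <= ennreal (contr T) * energy M {0..t} ?d"
   using picard_diff[OF good_iter[of "Suc n"] good_iter[of n] t] by simp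
  also have "energy M {0..t} ?d = (\<integral>\<^sup>+s. sqn M (?d s) \<partial>restrict_space lborel {0..t})"
   by (rule energy_time_integral[OF good_horizon[OF good_diff[OF good_iter good_iter]]])
  also have "... <= (\<integral>\<^sup>+s. ennreal (D * (1/64)^n * exp (L * s)) \<partial>restrict_space lborel {0..t})"
   by (rule nn_integral_mono) (rule Suc.IH, use t in \<open>auto simp: space_restrict_space\<close>)
  also have "... <= ennreal (D * (1/64)^n * exp (L * t) / L)" by (rule nn_integral_exp_le[OF L t(1)]) (use D in simp)
  also have "ennreal (contr T) * ennreal (D * (1/64)^n * exp (L * t) / L) = ennreal (D * (1/64)^Suc n * exp (L * t))"
  proof -
   have "contr T * (D * (1/64)^n * exp (L * t) / L) = D * (1/64)^Suc n * exp (L * t)"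
    using contr_pos[OF T] by (simp add: L_def)
   then show ?thesis using contr_pos[OF T] by (metis ennreal_mult' less_imp_le)
  qed
  finally show ?case by (simp add: mult_left_mono)
 qed
 show ?thesis
 proof (intro exI[of _ "D * exp (L * T)"] conjI allI ballI)
  fix n t assume t: "t : {0..T}"
  have "D * (1/64)^n * exp (L * t) <= D * (1/64)^n * exp (L * T)"
   using t L D(1) by (intro mult_left_mono) auto
  then have "D * (1/64)^n * exp (L * t) <= D * exp (L * T) * (1/64)^n"
   by (simp only: mult_ac)
  then show "sqn M (%w. iter (Suc n) t w - iter n t w) <= ennreal (D * exp (L * T) * (1/64)^n)"
   using key[OF t, of n] by (auto intro: order_trans ennreal_leI)
 qed (use D in simp)
qed

text \<open>At each fixed time the squared distance between the limit and its Picard image is at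
  most a multiple of 8^-n for all large \<open>n\<close>, hence zero. The equation thus holds almost
  surely at each time, which is the form required by \<open>solves_sde\<close>.\<close>

lemma fixpoint_exists:
 "\<exists>X. good X \<and> (\<forall>t\<ge>0. AE w in M. X t w = picard X t w)"
proof -
 let ?Y = iter
 have Yc: "cont_adapted (?Y n)" "loc_bounded_L2 (?Y n)" for n using good_iter[of n] by (auto simp: good_def)
 have "\<exists>X. cont_adapted X \<and> loc_bounded_L2 X \<and>
  (\<forall>m::nat. \<exists>C\<ge>0. \<forall>n\<ge>m. \<forall>t\<in>{0..real m}. sqn M (%w. X t w - ?Y n t w) <= ennreal (C * (1/8)^n))"
 proof (rule continuous_limit[OF Yc])
  fix m :: nat
  obtain D where D: "0 <= D" "!!n t. t : {0..real m} ==> sqn M (%w. ?Y (Suc n) t w - ?Y n t w) <= ennreal (D * (1/64)^n)"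
   using iter_rate[of "real m"] by auto
  define B where "B = (real (card J') + 1)^2 * (real m + real (card J')) * K\<^sup>2"
  have B: "0 <= B" by (simp add: B_def)
  show "\<exists>C. \<forall>n\<ge>m. emeasure M (exceeds (%t w. ?Y (Suc n) t w - ?Y n t w) (real m) ((1/2)^n)) <= ennreal (C * (1/2)^n)"
  \<comment> \<open>The n-th step is estimated by the energy of the step before it, at rate 64^-(n -
    1); this produces the factor 64. The summand 1 covers n = 0, where the probability is bounded by
    1.\<close>
  proof (intro exI[of _ "64 * B * D * real m + 1"] allI impI)
   fix n
   show "emeasure M (exceeds (%t w. ?Y (Suc n) t w - ?Y n t w) (real m) ((1/2)^n)) <= ennreal ((64 * B * D * real m + 1) * (1/2)^n)"
   proof (cases n)
    case 0
    have "emeasure M (exceeds (%t w. ?Y (Suc n) t w - ?Y n t w) (real m) ((1/2)^n)) <= ennreal 1"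
     unfolding emeasure_eq_measure by (rule ennreal_leI) simp
    also have "... <= ennreal ((64 * B * D * real m + 1) * (1/2)^n)" using 0 B D by (intro ennreal_leI) simp
    finally show ?thesis .
   next
    case (Suc k)
    let ?d = "%s w. ?Y (Suc k) s w - ?Y k s w"
    have en: "energy M {0..real m} ?d <= ennreal (D * (1/64)^k * real m)"
    proof -
     have "energy M {0..real m} ?d <= ennreal (D * (1/64)^k) * ennreal (real m)"
      by (rule energy_le_bound[OF good_horizon[OF good_diff[OF good_iter good_iter]] D(2)]) auto
     then show ?thesis using D by (simp add: ennreal_mult)
    qed
    have "emeasure M (exceeds (%t w. ?Y (Suc n) t w - ?Y n t w) (real m) ((1/2)^n))
      <= ennreal (1 / ((1/2)^n / (real (card J') + 1))^2 * (real m + real (card J')) * K\<^sup>2) * energy M {0..real m} ?d"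
     using picard_exceeds[OF good_iter[of "Suc k"] good_iter[of k], of "real m" "(1/2)^n"] Suc by simp
    also have "1 / ((1/2)^n / (real (card J') + 1))^2 * (real m + real (card J')) * K\<^sup>2 = 4^n * B"
    proof -
     have 1: "((1/2::real)^n)^2 = (1/4)^n" by (simp add: power2_eq_square power_mult_distrib[symmetric])
     have 2: "1 / ((1/2)^n / (real (card J') + 1))^2 = 4^n * (real (card J') + 1)^2"
      unfolding power_divide[of "(1/2::real)^n"] 1 by (simp add: power_one_over)
     show ?thesis unfolding 2 B_def by (simp add: mult.assoc)
    qed
    also have "ennreal (4^n * B) * energy M {0..real m} ?d <= ennreal (4^n * B) * ennreal (D * (1/64)^k * real m)"
     by (intro mult_left_mono en) simp
    also have "... = ennreal (64 * B * D * real m * (1/16)^n)"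
    proof -
     have "(4::real)^n * (1/64)^k = 64 * (1/16)^n"
     proof -
      have "(4::real)^n * (1/64)^n = (1/16)^n" by (simp add: power_mult_distrib[symmetric])
      moreover have "(1/64::real)^k = 64 * (1/64)^n" using Suc by simp
      ultimately show ?thesis by simp
     qed
     moreover have "4^n * B * (D * (1/64)^k * real m) = B * D * real m * (4^n * (1/64)^k)"
      by (simp only: mult_ac)
     ultimately have "4^n * B * (D * (1/64)^k * real m) = 64 * B * D * real m * (1/16)^n"
      by simp
     then show ?thesis using B D by (subst ennreal_mult'[symmetric]) auto
    qed
    also have "... <= ennreal ((64 * B * D * real m + 1) * (1/2)^n)"
     using B D by (intro ennreal_leI mult_mono power_mono) auto
    finally show ?thesis .
   qed
  qed
  show "\<exists>C\<ge>0. \<forall>n\<ge>m. \<forall>t\<in>{0..real m}. sqn M (%w. ?Y (Suc n) t w - ?Y n t w) <= ennreal (C * (1/8)^n)"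
  proof (intro exI[of _ D] conjI allI impI ballI)
   fix n t assume t: "t : {0..real m}"
   have "D * (1/64)^n <= D * (1/8)^n" using D by (intro mult_left_mono power_mono) auto
   then show "sqn M (%w. ?Y (Suc n) t w - ?Y n t w) <= ennreal (D * (1/8)^n)"
    using D(2)[OF t, of n] by (auto intro: order_trans ennreal_leI)
  qed (rule D)
 qed
 then obtain X where X: "cont_adapted X" "loc_bounded_L2 X"
  and rate: "!!m::nat. \<exists>C\<ge>0. \<forall>n\<ge>m. \<forall>t\<in>{0..real m}. sqn M (%w. X t w - ?Y n t w) <= ennreal (C * (1/8)^n)"
  by blast
 have gX: "good X" using X by (simp add: good_def)
 have "AE w in M. X t w = picard X t w" if t: "0 <= t" for t
 proof -
  obtain m :: nat where m: "t <= real m" using real_arch_simple by blast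
  obtain C where C: "0 <= C" and C': "\<forall>n\<ge>m. \<forall>t\<in>{0..real m}. sqn M (%w. X t w - ?Y n t w) <= ennreal (C * (1/8)^n)"
   using rate[of m] by blast
  define B where "B = 2 * C + 2 * (contr t * (C * t))"
  have B0: "0 <= B" using C t contr_pos[OF t] by (simp add: B_def)
  have bd: "sqn M (%w. X t w - picard X t w) <= ennreal (B * (1/8)^n)" if n: "n >= m" for n
  proof -
   have "sqn M (%w. (X t w - ?Y (Suc n) t w) + (picard (?Y n) t w - picard X t w))
    <= 2 * sqn M (%w. X t w - ?Y (Suc n) t w) + 2 * sqn M (%w. picard (?Y n) t w - picard X t w)"
    by (rule nn_integral_square_add_le)
      (use good_M[OF good_diff[OF gX good_iter[of "Suc n"]] t] good_M[OF good_diff[OF good_picard[OF good_iter[of n]] good_picard[OF gX]] t] in simp_all)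
   also have "sqn M (%w. X t w - ?Y (Suc n) t w) <= ennreal (C * (1/8)^n)"
   proof -
    have "sqn M (%w. X t w - ?Y (Suc n) t w) <= ennreal (C * (1/8)^Suc n)"
     using C' n t m by (simp del: power_Suc iter.simps)
    also have "... <= ennreal (C * (1/8)^n)" using C by (intro ennreal_leI mult_left_mono power_decreasing) auto
    finally show ?thesis .
   qed
   also have "sqn M (%w. picard (?Y n) t w - picard X t w) <= ennreal (contr t * (C * t) * (1/8)^n)"
   proof -
    have "sqn M (%w. picard (?Y n) t w - picard X t w) <= ennreal (contr t) * energy M {0..t} (%s w. ?Y n s w - X s w)"
     by (rule picard_diff[OF good_iter gX t order_refl])
    also have "energy M {0..t} (%s w. ?Y n s w - X s w) <= ennreal (C * (1/8)^n) * ennreal t"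
    proof (rule energy_le_bound[OF good_horizon[OF good_diff[OF good_iter gX]] _ t])
     fix s assume "s : {0..t}"
     then show "sqn M (%w. ?Y n s w - X s w) <= ennreal (C * (1/8)^n)"
      using C' n m by (simp add: norm_minus_commute)
    qed
    also have "ennreal (contr t) * (ennreal (C * (1/8)^n) * ennreal t) = ennreal (contr t * (C * t) * (1/8)^n)"
    proof -
     have "contr t * (C * t) * (1/8)^n = contr t * (C * (1/8)^n * t)" by simp
     then show ?thesis using C t contr_pos[OF t] by (simp add: ennreal_mult mult_ac)
    qed
    finally show ?thesis by (simp add: mult_left_mono)
   qed
   also have "2 * ennreal (C * (1/8)^n) + 2 * ennreal (contr t * (C * t) * (1/8)^n) = ennreal (2 * (C * (1/8)^n) + 2 * (contr t * (C * t) * (1/8)^n))"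
    by (rule ennreal_twice_add) (use C t contr_pos[OF t] in auto)
   also have "2 * (C * (1/8)^n) + 2 * (contr t * (C * t) * (1/8)^n) = B * (1/8)^n" by (simp add: B_def algebra_simps)
   finally show ?thesis by (simp add: add_mono mult_left_mono)
  qed
  have lim: "(%n. ennreal (B * (1/8)^n)) \<longlonglongrightarrow> 0"
  proof -
   have "(%n. B * (1/8)^n) \<longlonglongrightarrow> B * 0" by (intro tendsto_mult tendsto_const LIMSEQ_power_zero) simp
   then have "(%n. ennreal (B * (1/8)^n)) \<longlonglongrightarrow> ennreal (B * 0)" by (rule tendsto_ennrealI)
   then show ?thesis by simp
  qed
  have "sqn M (%w. X t w - picard X t w) <= 0"
   by (rule tendsto_lowerbound[OF lim]) (use bd in \<open>auto simp: eventually_sequentially\<close>)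
  then have z: "sqn M (%w. X t w - picard X t w) = 0" by simp
  have m: "(%w. ennreal ((norm (X t w - picard X t w))^2)) : borel_measurable M"
   using good_M[OF good_diff[OF gX good_picard[OF gX]] t] by measurable
  have "AE w in M. ennreal ((norm (X t w - picard X t w))^2) = 0"
   using z nn_integral_0_iff_AE[OF m] by simp
  then show ?thesis by eventually_elim simp
 qed
 then show ?thesis using gX by blast
qed

lemma solution_exists:
 "\<exists>X. \<forall>T>0. solves_sde M Fl W J' T \<xi> (%t w. A *v X t w) (%j t w. G j *v X t w) X"
proof -
 obtain X where X: "good X" and ae: "!!t. 0 <= t ==> AE w in M. X t w = picard X t w"
  using fixpoint_exists by blast
 have c: "cont_adapted X" using X by (simp add: good_def)
 have "solves_sde M Fl W J' T \<xi> (%t w. A *v X t w) (%j t w. G j *v X t w) X" if "0 < T" for T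
  unfolding solves_sde_def
 proof (intro conjI ballI)
  show "prog_measurable Fl T X" by (rule cont_adapted_prog[OF c])
  show "energy M {0..T} X < \<infinity>" using good_L2_proc[OF X] by (simp add: L2_proc_iff_energy)
  have "continuous_on {0..T} (%t. X t w)" if "w : space M" for w
   by (rule continuous_on_subset[of "{0..}"]) (use c that in \<open>auto simp: cont_adapted_def\<close>)
  then show "AE w in M. continuous_on {0..T} (%t. X t w)" by (rule AE_I2)
  fix t assume t: "t : {0..T}"
  show "\<exists>Z. (\<forall>j\<in>J'. ito j t (%t w. G j *v X t w) (Z j)) \<and> (AE w in M. X t w = \<xi> w + drift (%s w. A *v X s w) t w + (\<Sum>j\<in>J'. Z j w))"
  proof (intro exI[of _ "%j. ito_version j (%s w. G j *v X s w) t"] conjI ballI)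
   show "ito j t (%t w. G j *v X t w) (ito_version j (%s w. G j *v X s w) t)" if "j : J'" for j
    by (rule good_version(2)[OF X that]) (use t in simp)
   show "AE w in M. X t w = \<xi> w + drift (%s w. A *v X s w) t w + (\<Sum>j\<in>J'. ito_version j (%s w. G j *v X s w) t w)"
    using ae[of t] t by (simp add: picard_def)
  qed
 qed
 then show ?thesis by blast
qed

end

theorem (in brownian_space) linear_sde_exists:
 fixes A :: "real^'n^'n" and G :: "nat => real^'n^'n"
 assumes \<xi>: "\<xi> : borel_measurable (Fl 0)" "L2_fun M \<xi>" and J': "J' \<subseteq> J"
 shows "\<exists>X. \<forall>T>0. solves_sde M Fl W J' T \<xi> (%t w. A *v X t w) (%j t w. G j *v X t w) X"
proof -
 obtain K0 where K0: "!!a b. norm ((a::real^'n^'n) *v b) <= norm a * norm b * K0" "0 <= K0"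
  using bounded_bilinear.nonneg_bounded[OF bounded_bilinear_matrix_vector] by metis
 define K where "K = (norm A + (\<Sum>j\<in>J'. norm (G j))) * K0 + 1"
 have fJ: "finite J'" using J' finite_J by (rule finite_subset)
 have s0: "0 <= (\<Sum>j\<in>J'. norm (G j))" by (rule sum_nonneg) simp
 have bd: "norm (B *v x) <= K * norm x" if "norm B <= norm A + (\<Sum>j\<in>J'. norm (G j))" for B :: "real^'n^'n" and x
 proof -
  have "norm (B *v x) <= norm B * norm x * K0" by (rule K0)
  also have "... <= (norm A + (\<Sum>j\<in>J'. norm (G j))) * norm x * K0" by (intro mult_right_mono that K0) auto
  also have "... <= K * norm x" by (simp add: K_def algebra_simps)
  finally show ?thesis .
 qed
 interpret L: linear_sde M F0 W J \<xi> A G J' K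
 proof unfold_locales
  show "0 < K" using K0(2) s0 by (auto simp: K_def intro!: add_nonneg_pos)
  show "norm (A *v x) <= K * norm x" for x by (rule bd) (use s0 in simp)
  show "norm (G j *v x) <= K * norm x" if "j : J'" for j x
  proof (rule bd)
   have "norm (G j) <= (\<Sum>j\<in>J'. norm (G j))" by (rule member_le_sum) (use that fJ in auto)
   then show "norm (G j) <= norm A + (\<Sum>j\<in>J'. norm (G j))" using norm_ge_zero[of A] by linarith
  qed
 qed (use \<xi> J' in auto)
 show ?thesis by (rule L.solution_exists)
qed

section \<open>Quadratic forms and Riccati equations\<close>

lemma bounded_bilinear_matrix_mult:
 "bounded_bilinear ((**) :: real^'b^'a => real^'c^'b => real^'c^'a)"
 unfolding bilinear_conv_bounded_bilinear[symmetric] bilinear_def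
 by (auto intro!: linearI simp: matrix_matrix_mult_def vec_eq_iff sum.distrib sum_distrib_left algebra_simps)

lemmas continuous_on_matrix_mult [continuous_intros] = bounded_bilinear.continuous_on[OF bounded_bilinear_matrix_mult]
lemmas continuous_on_matrix_vector [continuous_intros] = bounded_bilinear.continuous_on[OF bounded_bilinear_matrix_vector]

lemma continuous_on_transpose [continuous_intros]:
 "continuous_on S f ==> continuous_on S (%x. transpose (f x :: real^'a^'b))"
 by (rule continuous_on_compose2[OF linear_continuous_on[of transpose UNIV]])
   (auto simp: linear_conv_bounded_linear[symmetric] transpose_def vec_eq_iff intro!: linearI)

lemma inner_vector_matrix: "x \<bullet> (y v* A) = (A *v x) \<bullet> (y :: real^'a)"
 by (metis dot_lmul_matrix inner_commute)

lemma transpose_add: "transpose (A + B) = transpose A + transpose (B :: real^'a^'b)"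
 by (simp add: transpose_def vec_eq_iff)

lemma minus_matrix_vector: "(- A) *v x = - (A *v (x :: real^'a))"
 by (simp add: matrix_vector_mult_def vec_eq_iff sum_negf)

lemma symmetric_matrix_inner: "symmetric_matrix P ==> (P *v x) \<bullet> y = x \<bullet> (P *v y)"
 unfolding symmetric_matrix_def by (metis inner_vector_matrix transpose_matrix_vector inner_commute)

lemma quadratic_coercive:
 fixes q :: "'a::euclidean_space => real"
 assumes q: "continuous_on UNIV q" "!!s x. q (s *\<^sub>R x) = s\<^sup>2 * q x" "!!x. x ~= 0 ==> 0 < q x"
 shows "\<exists>c>0. \<forall>x. c * (norm x)^2 <= q x"
proof -
 have "compact (sphere 0 1 :: 'a set)" "sphere 0 1 ~= ({} :: 'a set)" by auto
 then obtain z where z: "z : sphere 0 1" "!!y. y : sphere 0 1 ==> q z <= q y"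
  using continuous_attains_inf[of "sphere (0::'a) 1" q] continuous_on_subset[OF q(1)] by blast
 have "q z * (norm x)^2 <= q x" for x
 proof (cases "x = 0")
  case True
  then show ?thesis using q(2)[of 0 0] by simp
 next
  case False
  have "q z * (norm x)^2 <= q ((1 / norm x) *\<^sub>R x) * (norm x)^2" by (intro mult_right_mono z) (use False in auto)
  also have "... = q x" using False by (simp add: q(2) power2_eq_square)
  finally show ?thesis .
 qed
 moreover have "z ~= 0" using z(1) by auto
 ultimately show ?thesis using q(3) by blast
qed

lemma coercive_matrix_inv:
 fixes A :: "real^'a^'a"
 assumes c: "0 < c" "!!v. c * (norm v)^2 <= v \<bullet> (A *v v)"
 shows "A *v (matrix_inv A *v y) = y" "matrix_inv A *v (A *v y) = y" "c * norm (matrix_inv A *v y) <= norm y"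
proof -
 have bd: "c * norm v <= norm (A *v v)" for v
 proof -
  have "c * (norm v)^2 <= norm v * norm (A *v v)" using c(2)[of v] norm_cauchy_schwarz[of v "A *v v"] by linarith
  then show ?thesis by (cases "norm v = 0") (simp_all add: power2_eq_square)
 qed
 have "inj ((*v) A)"
 proof (rule injI)
  fix x y assume "A *v x = A *v y"
  then show "x = y" using bd[of "x - y"] c(1) by (simp add: matrix_vector_mult_diff_distrib mult_le_0_iff)
 qed
 then have "invertible A" by (metis invertible_left_inverse matrix_left_invertible_injective)
 then have "A ** matrix_inv A = mat 1 \<and> matrix_inv A ** A = mat 1"
  unfolding invertible_def matrix_inv_def by (rule someI_ex)
 then show 1: "A *v (matrix_inv A *v y) = y" "matrix_inv A *v (A *v y) = y"
  by (simp_all add: matrix_vector_mul_assoc)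
 show "c * norm (matrix_inv A *v y) <= norm y" using bd[of "matrix_inv A *v y"] by (simp add: 1)
qed

text \<open>On a fixed vector, the difference of the inverses at \<open>t\<close> and
  \<open>s\<close> is the inverse at \<open>t\<close> applied to the change of the matrix on the old
  solution; uniform coercivity bounds that inverse. The images of the unit vectors then give the
  matrix.\<close>

lemma continuous_on_matrix_inv:
 fixes A :: "'s::topological_space => real^'a^'a"
 assumes A: "continuous_on S A" and c: "0 < c" "!!s v. s : S ==> c * (norm v)^2 <= v \<bullet> (A s *v v)"
 shows "continuous_on S (%s. matrix_inv (A s))"
proof -
 have v: "continuous_on S (%s. matrix_inv (A s) *v w)" for w
  unfolding continuous_on_def
 proof
  fix s assume s: "s : S"
  let ?z = "matrix_inv (A s) *v w"
  have lim: "((%t. A t *v ?z) \<longlongrightarrow> A s *v ?z) (at s within S)"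
   using A s unfolding continuous_on_def by (intro bounded_bilinear.tendsto[OF bounded_bilinear_matrix_vector]) auto
  have "((%t. matrix_inv (A t) *v w - ?z) \<longlongrightarrow> 0) (at s within S)"
  proof (rule Lim_null_comparison)
   show "\<forall>\<^sub>F t in at s within S. norm (matrix_inv (A t) *v w - ?z) <= norm (A t *v ?z - A s *v ?z) / c"
    unfolding eventually_at_filter
   proof (intro always_eventually allI impI)
    fix t assume t: "t ~= s" "t : S"
    have "matrix_inv (A t) *v w - ?z = matrix_inv (A t) *v (A s *v ?z - A t *v ?z)"
     using coercive_matrix_inv(1,2)[OF c(1) c(2)[OF s]] coercive_matrix_inv(1,2)[OF c(1) c(2)[OF t(2)]]
     by (simp add: matrix_vector_mult_diff_distrib)
    then show "norm (matrix_inv (A t) *v w - ?z) <= norm (A t *v ?z - A s *v ?z) / c"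
     using coercive_matrix_inv(3)[OF c(1) c(2)[OF t(2)], of "A s *v ?z - A t *v ?z"] c(1)
     by (simp add: field_simps norm_minus_commute)
   qed
   have "((%t. norm (A t *v ?z - A s *v ?z) / c) \<longlongrightarrow> norm (A s *v ?z - A s *v ?z) / c) (at s within S)"
    by (intro tendsto_intros lim) (use c in simp)
   then show "((%t. norm (A t *v ?z - A s *v ?z) / c) \<longlongrightarrow> 0) (at s within S)" by simp
  qed
  then show "((%t. matrix_inv (A t) *v w) \<longlongrightarrow> ?z) (at s within S)" by (rule LIM_zero_cancel)
 qed
 have "matrix_inv (A s) = (\<chi> i j. (matrix_inv (A s) *v axis j 1) $ i)" for s
  by (simp add: vec_eq_iff matrix_vector_mul_component inner_axis)
 moreover have "continuous_on S (%s. \<chi> i j. (matrix_inv (A s) *v axis j 1) $ i)"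
  by (intro continuous_on_vec_lambda continuous_intros v)
 ultimately show ?thesis by simp
qed

text \<open>In a positive semidefinite matrix the diagonal controls the other entries, as testing
  with the sum and the difference of two unit vectors shows. It is therefore enough to follow
  solutions started at unit vectors.\<close>

lemma psd_norm_le:
 fixes P :: "real^'a^'a"
 assumes P: "psd_matrix P" and K: "!!i. axis i 1 \<bullet> (P *v axis i 1) <= K"
 shows "norm P <= (real CARD('a))^2 * K"
proof -
 have e: "\<bar>P $ i $ j\<bar> <= K" for i j
 proof -
  let ?x = "axis i 1 :: real^'a" and ?y = "axis j 1 :: real^'a"
  have s: "?x \<bullet> (P *v ?y) = P $ i $ j" by (simp add: matrix_vector_mul_component inner_axis inner_axis')
  have s': "?y \<bullet> (P *v ?x) = P $ i $ j" using s P symmetric_matrix_inner[of P ?x ?y] by (simp add: psd_matrix_def inner_commute)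
  have "0 <= (?x + ?y) \<bullet> (P *v (?x + ?y))" "0 <= (?x - ?y) \<bullet> (P *v (?x - ?y))" using P by (auto simp: psd_matrix_def)
  then show ?thesis using K[of i] K[of j] s s'
   by (simp add: matrix_vector_right_distrib matrix_vector_mult_diff_distrib inner_add_left inner_add_right inner_diff_left inner_diff_right)
 qed
 have "norm P <= (\<Sum>i\<in>UNIV. norm (P $ i))" unfolding norm_vec_def by (rule L2_set_le_sum) simp
 also have "... <= (\<Sum>i\<in>UNIV. \<Sum>j\<in>UNIV. \<bar>P $ i $ j\<bar>)" by (intro sum_mono norm_le_l1_cart)
 also have "... <= (\<Sum>i\<in>(UNIV::'a set). \<Sum>j\<in>(UNIV::'a set). K)" by (intro sum_mono e)
 finally show ?thesis by (simp add: power2_eq_square)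
qed

lemma closed_psd: "closed {P :: real^'a^'a. psd_matrix P}"
proof -
 have "{P :: real^'a^'a. psd_matrix P} = {P. transpose P = P} \<inter> (\<Inter>x. {P. 0 <= x \<bullet> (P *v x)})"
  by (auto simp: psd_matrix_def symmetric_matrix_def)
 moreover have "closed {P :: real^'a^'a. transpose P = P}" by (intro closed_Collect_eq continuous_intros)
 moreover have "closed {P :: real^'a^'a. 0 <= x \<bullet> (P *v x)}" for x by (intro closed_Collect_le continuous_intros)
 ultimately show ?thesis by (simp only: ) (intro closed_Int closed_INT, auto)
qed

text \<open>The mean of the closed-loop system sees the coefficients \<^term>\<open>hA d\<close>, \<^term>\<open>hC d\<close>, \<^term>\<open>hG d\<close>,
 \<^term>\<open>hQ d\<close>; the deviations from the mean see those of the following problem without mean field terms.\<close>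

definition decoupled :: "('n::finite, 'm::finite) lq_data => ('n, 'm) lq_data" where
 "decoupled d = d\<lparr>mAbar := 0, mCbar := 0, mGbar := 0, mQbar := 0\<rparr>"

lemma decoupled_simps [simp]:
 "mA (decoupled d) = mA d" "mC (decoupled d) = mC d" "mG (decoupled d) = mG d" "mQ (decoupled d) = mQ d"
 "mAbar (decoupled d) = 0" "mCbar (decoupled d) = 0" "mGbar (decoupled d) = 0" "mQbar (decoupled d) = 0"
 "mB (decoupled d) = mB d" "mD (decoupled d) = mD d" "mS (decoupled d) = mS d" "mR (decoupled d) = mR d"
 "opR (decoupled d) P = opR d P" "op_hatQ (decoupled d) P P = opQ d P" "op_hatS (decoupled d) P P = opS d P"
 "fb_Theta_bar (decoupled d) P P = fb_Theta d P"
 by (simp_all add: decoupled_def opR_def op_hatQ_def opQ_def op_hatS_def opS_def fb_Theta_def fb_Theta_bar_def)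

text \<open>The derivative of \<open>L\<close> prescribed by its equation. The equation for
  \<open>P\<close> is the same one for \<open>decoupled d\<close> with both arguments equal to
  \<open>P\<close>, so each algebraic identity is proved only once.\<close>

definition riccati_rhs :: "('n::finite, 'm::finite) lq_data => real^'n^'n => real^'n^'n => real^'n^'n" where
 "riccati_rhs d P L = transpose (op_hatS d P L) ** matrix_inv (opR d P) ** op_hatS d P L - op_hatQ d P L"

definition costate_rhs :: "('n::finite, 'm::finite) lq_data => real^'n^'n => real^'n^'n => real^'n => real^'n" where
 "costate_rhs d P L p = - (transpose (hA d + mB d ** fb_Theta_bar d P L) *v p
   + transpose (hC d + mD d ** fb_Theta_bar d P L) *v (P *v vsig d)
   + transpose (fb_Theta_bar d P L) *v vr d + L *v vb d + transpose (hG d) *v (L *v vgam d) + vq d)"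

text \<open>What is left of the completed square once neither state nor control occurs: the
  integrand of the part of the cost on which the control has no influence.\<close>

definition running_offset :: "('n::finite, 'm::finite) lq_data => real^'n^'n => real^'n^'n => real^'n => real" where
 "running_offset d P L p = - (fb_theta d P p \<bullet> (opR d P *v fb_theta d P p)) + 2 * (p \<bullet> vb d)
   + vsig d \<bullet> (P *v vsig d) + vgam d \<bullet> (L *v vgam d)"

text \<open>Instantiated both with \<open>d\<close> and with \<open>decoupled d\<close>; the two
  instances provide the identities and the coercivity for the mean and for the deviations from
  it.\<close>

locale lq =
 fixes d :: "('n::finite, 'm::finite) lq_data"
 assumes sym_hQ: "symmetric_matrix (hQ d)" and pd_R: "pd_matrix (mR d)"
  and pd_cost: "pd_matrix (hQ d - transpose (mS d) ** matrix_inv (mR d) ** mS d)"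
begin

lemma R_coercive: "\<exists>c>0. \<forall>v. c * (norm v)^2 <= v \<bullet> (mR d *v v)"
 by (rule quadratic_coercive)
   (use pd_R in \<open>auto intro!: continuous_intros simp: pd_matrix_def matrix_vector_mult_scaleR power2_eq_square\<close>)

definition cR :: real where "cR = (SOME c. 0 < c \<and> (\<forall>v. c * (norm v)^2 <= v \<bullet> (mR d *v v)))"

lemma cR: "0 < cR" "cR * (norm v)^2 <= v \<bullet> (mR d *v v)"
 using someI_ex[OF R_coercive[unfolded Bex_def]] unfolding cR_def by auto

lemma sym_opR: "psd_matrix P ==> symmetric_matrix (opR d P)"
 using pd_R unfolding psd_matrix_def pd_matrix_def symmetric_matrix_def opR_def
 by (simp add: transpose_add matrix_transpose_mul matrix_mul_assoc)

lemma inner_opR: "v \<bullet> (opR d P *v w) = v \<bullet> (mR d *v w) + (mD d *v v) \<bullet> (P *v (mD d *v w))"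
 by (simp add: opR_def matrix_vector_mult_add_rdistrib matrix_vector_mul_assoc[symmetric] inner_add_right inner_vector_matrix)

lemma opR_coercive: "psd_matrix P ==> cR * (norm v)^2 <= v \<bullet> (opR d P *v v)"
 using cR(2)[of v] by (simp add: inner_opR psd_matrix_def add_increasing2)

lemmas opR_inv = coercive_matrix_inv[OF cR(1) opR_coercive]

text \<open>With k = R^-1 S x, completing the square in \<open>v\<close> leaves the Schur complement
  in \<open>x\<close>, positive by \<open>pd_cost\<close>, plus a positive form in v + k. Hence the
  form is definite, and compactness makes it coercive.\<close>

lemma cost_coercive:
 "\<exists>c>0. \<forall>x v. c * ((norm x)^2 + (norm v)^2) <= x \<bullet> (hQ d *v x) + 2 * ((mS d *v x) \<bullet> v) + v \<bullet> (mR d *v v)"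
proof -
 let ?q = "%z. fst z \<bullet> (hQ d *v fst z) + 2 * ((mS d *v fst z) \<bullet> snd z) + snd z \<bullet> (mR d *v snd z)"
 have "\<exists>c>0. \<forall>z. c * (norm z)^2 <= ?q z"
 proof (rule quadratic_coercive)
  show "continuous_on UNIV ?q" by (intro continuous_intros)
  show "?q (s *\<^sub>R z) = s\<^sup>2 * ?q z" for s z
   by (simp add: matrix_vector_mult_scaleR power2_eq_square algebra_simps)
  fix z :: "(real^'n) \<times> (real^'m)" assume z: "z ~= 0"
  define x v where "x = fst z" and "v = snd z"
  define k where "k = matrix_inv (mR d) *v (mS d *v x)"
  have k: "mR d *v k = mS d *v x" unfolding k_def by (rule coercive_matrix_inv(1)[OF cR])
  have sR: "(mR d *v a) \<bullet> b = a \<bullet> (mR d *v b)" for a b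
   using pd_R unfolding pd_matrix_def by (intro symmetric_matrix_inner) auto
  have "?q z = x \<bullet> ((hQ d - transpose (mS d) ** matrix_inv (mR d) ** mS d) *v x) + (v + k) \<bullet> (mR d *v (v + k))"
   unfolding x_def[symmetric] v_def[symmetric]
   by (simp add: matrix_vector_mult_diff_rdistrib matrix_vector_mul_assoc[symmetric] inner_vector_matrix k_def[symmetric]
     inner_add_left inner_add_right inner_diff_right matrix_vector_right_distrib k sR[of k v, symmetric] inner_commute)
  moreover have "x \<bullet> ((hQ d - transpose (mS d) ** matrix_inv (mR d) ** mS d) *v x) > 0" if "x ~= 0"
   using pd_cost that unfolding pd_matrix_def by auto
  moreover have "(v + k) \<bullet> (mR d *v (v + k)) > 0" if "v + k ~= 0" using pd_R that unfolding pd_matrix_def by auto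
  moreover have "k = 0" if "x = 0" using that by (simp add: k_def)
  moreover have "x ~= 0 \<or> v ~= 0" using z unfolding x_def v_def by (metis prod.collapse zero_prod_def)
  ultimately show "0 < ?q z" by (cases "x = 0"; cases "v + k = 0") (auto simp: add_pos_pos)
 qed
 then obtain c where c: "0 < c" "!!z. c * (norm z)^2 <= ?q z" by auto
 show ?thesis
 proof (intro exI[of _ c] conjI allI c(1))
  fix x v show "c * ((norm x)^2 + (norm v)^2) <= x \<bullet> (hQ d *v x) + 2 * ((mS d *v x) \<bullet> v) + v \<bullet> (mR d *v v)"
   using c(2)[of "(x, v)"] by (simp add: norm_Pair)
 qed
qed

lemma opR_feedback: "psd_matrix P ==> opR d P *v (fb_Theta_bar d P L *v x) = - (op_hatS d P L *v x)"
 "psd_matrix P ==> opR d P *v fb_theta d P p = - (transpose (mB d) *v p + transpose (mD d) *v (P *v vsig d) + vr d)"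
 unfolding fb_Theta_bar_def fb_theta_def
 by (simp_all only: minus_matrix_vector matrix_vector_mul_assoc[symmetric] vec.neg opR_inv(1))

text \<open>Without its first term the left side is a quadratic in \<open>v\<close> with leading
  form \<open>opR d P\<close> and minimizer \<open>fb_Theta_bar d P L *v x\<close>, and the form of
  \<open>riccati_rhs\<close> is minus its minimal value. The uses differ in \<open>v\<close>: a
  stabilizing feedback for the bounds, the minimizer for the costate, the actual control for the
  cost.\<close>

lemma riccati_square:
 assumes P: "psd_matrix P" and L: "symmetric_matrix L"
 shows "x \<bullet> (riccati_rhs d P L *v x) + 2 * ((hA d *v x + mB d *v v) \<bullet> (L *v x))
   + (hC d *v x + mD d *v v) \<bullet> (P *v (hC d *v x + mD d *v v)) + (hG d *v x) \<bullet> (L *v (hG d *v x))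
   + (x \<bullet> (hQ d *v x) + 2 * ((mS d *v x) \<bullet> v) + v \<bullet> (mR d *v v))
  = (v - fb_Theta_bar d P L *v x) \<bullet> (opR d P *v (v - fb_Theta_bar d P L *v x))"
proof -
 define k s where "k = fb_Theta_bar d P L *v x" and "s = op_hatS d P L *v x"
 have k: "opR d P *v k = - s" "matrix_inv (opR d P) *v s = - k"
  unfolding k_def s_def using opR_feedback(1)[OF P] by (simp_all add: fb_Theta_bar_def minus_matrix_vector matrix_vector_mul_assoc)
 have kv: "k \<bullet> (opR d P *v v) = - (s \<bullet> v)" using symmetric_matrix_inner[OF sym_opR[OF P], of k v] by (simp add: k)
 have sP: "a \<bullet> (P *v b) = b \<bullet> (P *v a)" for a b using P symmetric_matrix_inner[of P a b] by (simp add: psd_matrix_def inner_commute)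
 have sL: "x \<bullet> (L *v b) = b \<bullet> (L *v x)" for b using symmetric_matrix_inner[OF L, of x b] by (simp add: inner_commute)
 have rhs: "(v - k) \<bullet> (opR d P *v (v - k)) = v \<bullet> (opR d P *v v) + 2 * (s \<bullet> v) - s \<bullet> k"
  by (simp add: matrix_vector_mult_diff_distrib k inner_diff_left inner_diff_right inner_add_right kv inner_commute)
 have Q: "x \<bullet> (op_hatQ d P L *v x) = 2 * ((hA d *v x) \<bullet> (L *v x)) + (hC d *v x) \<bullet> (P *v (hC d *v x))
   + (hG d *v x) \<bullet> (L *v (hG d *v x)) + x \<bullet> (hQ d *v x)"
  unfolding op_hatQ_def matrix_vector_mult_add_rdistrib[of _ _ x] matrix_vector_mul_assoc[symmetric] inner_add_right
  by (simp add: inner_vector_matrix sL[of "mA d *v x + mAbar d *v x"] inner_add_right matrix_vector_mult_add_rdistrib)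
 have S: "s \<bullet> v = (mB d *v v) \<bullet> (L *v x) + (mD d *v v) \<bullet> (P *v (hC d *v x)) + (mS d *v x) \<bullet> v"
  unfolding s_def op_hatS_def matrix_vector_mult_add_rdistrib[of _ _ x] matrix_vector_mul_assoc[symmetric] inner_add_left
  by (simp only: transpose_matrix_vector dot_lmul_matrix) (simp add: inner_commute)
 have ric: "x \<bullet> (riccati_rhs d P L *v x) = - (s \<bullet> k) - x \<bullet> (op_hatQ d P L *v x)"
  unfolding riccati_rhs_def matrix_vector_mult_diff_rdistrib matrix_vector_mul_assoc[symmetric] s_def[symmetric] k(2)
  by (simp add: inner_diff_right inner_vector_matrix s_def[symmetric] vec.neg)
 show ?thesis
  unfolding k_def[symmetric] rhs unfolding ric Q S inner_opR
  by (simp add: inner_add_left inner_add_right matrix_vector_right_distrib sP[of "hC d *v x" "mD d *v v"])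
qed

text \<open>The costate does for the inhomogeneous terms what the Riccati functions do for the
  quadratic ones: \<open>costate_rhs\<close> cancels all that is linear in \<open>x\<close>, and
  \<open>fb_theta\<close> shifts the minimizer.\<close>

lemma riccati_affine_square:
 fixes x p v
 assumes P: "psd_matrix P" and L: "symmetric_matrix L"
 defines "k \<equiv> v - fb_Theta_bar d P L *v x - fb_theta d P p"
 shows "x \<bullet> (riccati_rhs d P L *v x) + 2 * ((hA d *v x + mB d *v v + vb d) \<bullet> (L *v x))
   + (hC d *v x + mD d *v v + vsig d) \<bullet> (P *v (hC d *v x + mD d *v v + vsig d))
   + (hG d *v x + vgam d) \<bullet> (L *v (hG d *v x + vgam d))
   + 2 * (costate_rhs d P L p \<bullet> x + p \<bullet> (hA d *v x + mB d *v v + vb d))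
   + (x \<bullet> (hQ d *v x) + 2 * ((mS d *v x) \<bullet> v) + v \<bullet> (mR d *v v)) + 2 * (vq d \<bullet> x) + 2 * (vr d \<bullet> v)
  = k \<bullet> (opR d P *v k) + running_offset d P L p"
proof -
 define K w th where "K = fb_Theta_bar d P L" and "w = v - K *v x" and "th = fb_theta d P p"
 have kw: "k = w - th" unfolding k_def w_def K_def th_def ..
 note th = opR_feedback(2)[OF P, of p, folded th_def]
 have wt: "th \<bullet> (opR d P *v w) = w \<bullet> (opR d P *v th)"
  using symmetric_matrix_inner[OF sym_opR[OF P], of th w] by (simp add: inner_commute)
 have k: "k \<bullet> (opR d P *v k) = w \<bullet> (opR d P *v w) - 2 * (w \<bullet> (opR d P *v th)) + th \<bullet> (opR d P *v th)"
  unfolding kw by (simp add: matrix_vector_mult_diff_distrib inner_diff_left inner_diff_right wt)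
 have cs: "costate_rhs d P L p \<bullet> x = - (p \<bullet> (hA d *v x + mB d *v (K *v x)) + (hC d *v x + mD d *v (K *v x)) \<bullet> (P *v vsig d)
   + vr d \<bullet> (K *v x) + x \<bullet> (L *v vb d) + (hG d *v x) \<bullet> (L *v vgam d) + vq d \<bullet> x)"
  unfolding costate_rhs_def K_def[symmetric]
  by (simp only: inner_minus_left inner_add_left transpose_matrix_vector dot_lmul_matrix matrix_vector_mult_add_rdistrib
    matrix_vector_mul_assoc[symmetric]) (simp add: inner_commute inner_add_right)
 have sP: "a \<bullet> (P *v b) = b \<bullet> (P *v a)" for a b using P symmetric_matrix_inner[of P a b] by (simp add: psd_matrix_def inner_commute)
 have sL: "a \<bullet> (L *v b) = b \<bullet> (L *v a)" for a b using symmetric_matrix_inner[OF L, of a b] by (simp add: inner_commute)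
 have wth: "w \<bullet> (opR d P *v th) = - (p \<bullet> (mB d *v w) + (mD d *v w) \<bullet> (P *v vsig d) + vr d \<bullet> w)"
  unfolding th by (simp add: inner_add_right inner_diff_right inner_vector_matrix inner_commute)
 have w: "mB d *v w = mB d *v v - mB d *v (K *v x)" "mD d *v w = mD d *v v - mD d *v (K *v x)" "vr d \<bullet> w = vr d \<bullet> v - vr d \<bullet> (K *v x)"
  by (simp_all add: w_def matrix_vector_mult_diff_distrib inner_diff_right)
 have e1: "(y + vsig d) \<bullet> (P *v (y + vsig d)) = y \<bullet> (P *v y) + 2 * (y \<bullet> (P *v vsig d)) + vsig d \<bullet> (P *v vsig d)" for y
  by (simp add: inner_add_left inner_add_right matrix_vector_right_distrib sP[of "vsig d" y])
 have e2: "(y + vgam d) \<bullet> (L *v (y + vgam d)) = y \<bullet> (L *v y) + 2 * (y \<bullet> (L *v vgam d)) + vgam d \<bullet> (L *v vgam d)" for y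
  by (simp add: inner_add_left inner_add_right matrix_vector_right_distrib sL[of "vgam d" y])
 have e3: "(y + vb d) \<bullet> (L *v x) = y \<bullet> (L *v x) + x \<bullet> (L *v vb d)" for y
  by (simp add: inner_add_left sL[of x "vb d"])
 have o: "running_offset d P L p = - (th \<bullet> (opR d P *v th)) + 2 * (p \<bullet> vb d) + vsig d \<bullet> (P *v vsig d) + vgam d \<bullet> (L *v vgam d)"
  by (simp add: running_offset_def th_def)
 show ?thesis
  unfolding k o wth w cs riccati_square[OF P L, of x v, folded K_def, folded w_def, symmetric] e1 e2 e3
  by (simp only: inner_add_left inner_add_right inner_diff_left inner_diff_right) (simp add: algebra_simps del: matrix_vector_mult_add_rdistrib)
qed

context
 fixes S :: "'s::topological_space set" and P L :: "'s => real^'n^'n" and p :: "'s => real^'n"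
 assumes P: "continuous_on S P" and L: "continuous_on S L" and p: "continuous_on S p"
  and psd: "!!s. s : S ==> psd_matrix (P s)"
begin

lemma continuous_opR: "continuous_on S (%s. opR d (P s))"
 unfolding opR_def by (intro continuous_intros P)

lemma continuous_opR_inv: "continuous_on S (%s. matrix_inv (opR d (P s)))"
 by (rule continuous_on_matrix_inv[OF continuous_opR cR(1) opR_coercive[OF psd]])

lemma continuous_fb_Theta_bar: "continuous_on S (%s. fb_Theta_bar d (P s) (L s))"
 unfolding fb_Theta_bar_def op_hatS_def by (intro continuous_intros continuous_opR_inv P L)

lemma continuous_fb_theta: "continuous_on S (%s. fb_theta d (P s) (p s))"
 unfolding fb_theta_def by (intro continuous_intros continuous_opR_inv P p)

lemma continuous_riccati_rhs: "continuous_on S (%s. riccati_rhs d (P s) (L s))"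
 unfolding riccati_rhs_def op_hatS_def op_hatQ_def by (intro continuous_intros continuous_opR_inv P L)

lemma continuous_costate_rhs: "continuous_on S (%s. costate_rhs d (P s) (L s) (p s))"
 unfolding costate_rhs_def by (intro continuous_intros continuous_fb_Theta_bar P L p)

lemma continuous_running_offset: "continuous_on S (%s. running_offset d (P s) (L s) (p s))"
 unfolding running_offset_def by (intro continuous_intros continuous_fb_theta continuous_opR P L p)

end

end

section \<open>Tools for bounds independent of the horizon\<close>

lemma bounded_on_psd:
 fixes f :: "(real^'n^'n) \<times> (real^'n^'n) \<times> (real^'n) => 'b::real_normed_vector"
 assumes "continuous_on {z. psd_matrix (fst z)} f"
 obtains K' where "0 < K'"
  "!!P L p. psd_matrix P ==> norm P <= K ==> norm L <= K ==> norm p <= K ==> norm (f (P, L, p)) <= K'"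
proof -
 \<comment> \<open>Positive semidefinite matrices form a closed set, and on it \<open>opR\<close> is
   coercive, which is where the feedback coefficients are known to be continuous; its intersection
   with a ball is compact.\<close>
 have "compact (({P. psd_matrix P} \<inter> cball 0 K) \<times> (cball 0 K \<times> cball 0 K) :: ((real^'n^'n) \<times> (real^'n^'n) \<times> (real^'n)) set)"
  by (intro compact_Times closed_Int_compact closed_psd compact_cball)
 then have "bounded (f ` (({P. psd_matrix P} \<inter> cball 0 K) \<times> (cball 0 K \<times> cball 0 K)))"
  by (intro compact_imp_bounded compact_continuous_image continuous_on_subset[OF assms]) auto
 then obtain K' where "0 < K'" "\<forall>x\<in>f ` (({P. psd_matrix P} \<inter> cball 0 K) \<times> (cball 0 K \<times> cball 0 K)). norm x <= K'"
  by (auto simp: bounded_pos)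
 then show ?thesis by (intro that[of K']) auto
qed

text \<open>Mean value estimate from the zero terminal value; the source of the factor
  \<open>T\<close> for short horizons.\<close>

lemma norm_initial_le:
 fixes f :: "real => 'a::real_normed_vector"
 assumes T: "0 <= T" "f T = 0" and f: "!!t. t : {0..T} ==> (f has_vector_derivative f' t) (at t within {0..T})"
  and b: "!!t. t : {0..T} ==> norm (f' t) <= B"
 shows "norm (f 0) <= B * T"
proof -
 have "norm (f 0 - f T) <= B * norm (0 - T)"
 proof (rule differentiable_bound)
  show "(f has_derivative (%h. h *\<^sub>R f' t)) (at t within {0..T})" if "t : {0..T}" for t
   using f[OF that] by (simp add: has_vector_derivative_def)
  show "onorm (%h. h *\<^sub>R f' t) <= B" if "t : {0..T}" for t
   using b[OF that] order_trans[OF norm_ge_zero b[OF that]] by (intro onorm_bound) (auto simp: mult.commute[of B] intro!: mult_left_mono)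
 qed (use T in auto)
 then show ?thesis using T by simp
qed

text \<open>With \<open>L\<^sub>\<epsilon> = L + \<epsilon>\<close>, the function \<open>\<psi>(t) = p \<bullet> L\<^sub>\<epsilon>\<^sup>-\<^sup>1 p\<close> is the maximum over \<open>y\<close> of
 \<open>2 p \<bullet> y - y \<bullet> L\<^sub>\<epsilon> y\<close>. At a time maximizing \<open>\<psi>\<close> the right derivative of this expression, at the optimal \<open>y\<close>, is
 not positive, which bounds \<open>y\<close> by the Lyapunov inequality; no fundamental solution of \<open>F\<close> is needed.\<close>

lemma costate_bound:
 fixes p g :: "real => real^'n" and L L' F :: "real => real^'n^'n"
 assumes p: "!!t. t : {0..T} ==> (p has_vector_derivative - (transpose (F t) *v p t + g t)) (at t within {0..T})" "p T = 0"
  and L: "!!t. t : {0..T} ==> (L has_vector_derivative L' t) (at t within {0..T})"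
   "!!t. t : {0..T} ==> psd_matrix (L t)" "!!t x. t : {0..T} ==> x \<bullet> (L t *v x) <= K * (norm x)^2"
  and lyap: "!!t x. t : {0..T} ==> x \<bullet> (L' t *v x) + 2 * ((F t *v x) \<bullet> (L t *v x)) <= - (c * (norm x)^2)"
  and F: "!!t x. t : {0..T} ==> norm (F t *v x) <= B * norm x" and g: "!!t. t : {0..T} ==> norm (g t) <= G"
  and pos: "0 < c" "0 < B" "0 < G" "0 <= K" and t: "t : {0..T}"
 shows "norm (p t) <= (K + c / (4 * B)) * (4 * G / c)"
proof -
 \<comment> \<open>With this size the perturbation costs half of the available decay: 2 e B = c /
   2.\<close>
 define e where "e = c / (4 * B)"
 have e: "0 < e" using pos by (simp add: e_def)
 define E where "E t = L t + e *\<^sub>R mat 1" for t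
 have Ev: "E t *v y = L t *v y + e *\<^sub>R y" for t y
  by (simp add: E_def matrix_vector_mult_add_rdistrib scaleR_matrix_vector_assoc[symmetric])
 have Ec: "e * (norm v)^2 <= v \<bullet> (E t *v v)" "v \<bullet> (E t *v v) <= (K + e) * (norm v)^2" if "t : {0..T}" for t v
  using L(2)[OF that] L(3)[OF that, of v] by (auto simp: Ev inner_add_right psd_matrix_def power2_norm_eq_inner algebra_simps)
 have Es: "(E t *v x) \<bullet> y = x \<bullet> (E t *v y)" if "t : {0..T}" for t x y
  using symmetric_matrix_inner[of "L t" x y] L(2)[OF that] by (simp add: Ev inner_add_left inner_add_right psd_matrix_def)
 define x where "x t = matrix_inv (E t) *v p t" for t
 have Ex: "E t *v x t = p t" if "t : {0..T}" for t
  unfolding x_def by (rule coercive_matrix_inv(1)[OF e Ec(1)[OF that]])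
 define \<Phi> where "\<Phi> t y = 2 * (p t \<bullet> y) - y \<bullet> (E t *v y)" for t y
 have le: "\<Phi> t y <= p t \<bullet> x t" if "t : {0..T}" for t y
 proof -
  have "0 <= e * (norm (y - x t))^2" using e by simp
  also have "... <= (y - x t) \<bullet> (E t *v (y - x t))" by (rule Ec[OF that])
  also have "... = p t \<bullet> x t - \<Phi> t y"
   using Es[OF that, of "x t" y]
   by (simp add: \<Phi>_def matrix_vector_mult_diff_distrib Ex[OF that] inner_diff_left inner_diff_right inner_commute)
  finally show ?thesis by simp
 qed
 have contp: "continuous_on {0..T} p" "continuous_on {0..T} L"
  by (rule continuous_on_vector_derivative[OF p(1)], assumption) (rule continuous_on_vector_derivative[OF L(1)])
 have "continuous_on {0..T} (%t. p t \<bullet> x t)"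
  unfolding x_def by (intro continuous_intros contp continuous_on_matrix_inv[OF _ e Ec(1)]) (auto simp: E_def intro!: continuous_intros contp)
 then obtain s where s: "s : {0..T}" "!!t. t : {0..T} ==> p t \<bullet> x t <= p s \<bullet> x s"
  using continuous_attains_sup[of "{0..T}" "%t. p t \<bullet> x t"] t by auto
 have M: "p s \<bullet> x s <= (K + e) * (4 * G / c)^2"
 proof (cases "s = T")
  case True
  then show ?thesis using p(2) pos e by simp
 next
  case False
  let ?y = "x s" and ?D = "2 * (- (transpose (F s) *v p s + g s) \<bullet> x s) - x s \<bullet> (L' s *v x s)"
  have "((%t. \<Phi> t ?y) has_vector_derivative ?D) (at s within {0..T})"
   unfolding \<Phi>_def Ev inner_add_right
   by (auto intro!: derivative_eq_intros bounded_linear.has_vector_derivative[OF bounded_linear_inner_left]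
     bounded_linear.has_vector_derivative[OF bounded_linear_inner_right]
     bounded_linear.has_vector_derivative[OF bounded_bilinear.bounded_linear_left[OF bounded_bilinear_matrix_vector]] p(1)[OF s(1)] L(1)[OF s(1)])
  then have d: "((%t. \<Phi> t ?y) has_real_derivative ?D) (at s within {0..T})" by (simp add: has_real_derivative_iff_has_vector_derivative)
  have "?D <= 0"
  proof (rule ccontr)
   assume "\<not> ?D <= 0"
   then obtain h where h: "0 < h" "!!k. 0 < k ==> s + k : {0..T} ==> k < h ==> \<Phi> s ?y < \<Phi> (s + k) ?y"
    using has_real_derivative_pos_inc_right[OF d] by auto
   define k where "k = min (h / 2) (T - s)"
   have k: "0 < k" "s + k : {0..T}" "k < h" using h(1) s(1) False by (auto simp: k_def)
   have "\<Phi> (s + k) ?y <= p s \<bullet> x s" using le[OF k(2)] s(2)[OF k(2)] by (rule order_trans)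
   also have "... = \<Phi> s ?y" by (simp add: \<Phi>_def Ex[OF s(1)] inner_commute)
   finally show False using h(2)[OF k] by simp
  qed
  moreover have "(transpose (F s) *v p s) \<bullet> ?y = (F s *v ?y) \<bullet> (L s *v ?y) + e * ((F s *v ?y) \<bullet> ?y)"
   unfolding Ex[OF s(1), symmetric] Ev
   by (simp only: transpose_matrix_vector dot_lmul_matrix inner_add_left inner_scaleR_left) (simp add: inner_commute)
  ultimately have "- (?y \<bullet> (L' s *v ?y) + 2 * ((F s *v ?y) \<bullet> (L s *v ?y))) <= 2 * (e * ((F s *v ?y) \<bullet> ?y)) + 2 * (g s \<bullet> ?y)"
   by (simp add: inner_diff_left inner_add_left)
  then have "c * (norm ?y)^2 <= 2 * (e * ((F s *v ?y) \<bullet> ?y)) + 2 * (g s \<bullet> ?y)" using lyap[OF s(1), of ?y] by linarith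
  also have "... <= 2 * (e * (B * (norm ?y)^2)) + 2 * (G * norm ?y)"
  proof -
   have "(F s *v ?y) \<bullet> ?y <= B * norm ?y * norm ?y"
    by (rule order_trans[OF norm_cauchy_schwarz mult_right_mono[OF F[OF s(1)]]]) simp
   moreover have "g s \<bullet> ?y <= G * norm ?y"
    by (rule order_trans[OF norm_cauchy_schwarz mult_right_mono[OF g[OF s(1)]]]) simp
   ultimately show ?thesis using e by (intro add_mono mult_left_mono) (auto simp: power2_eq_square)
  qed
  also have "2 * (e * (B * (norm ?y)^2)) = c / 2 * (norm ?y)^2" using pos by (simp add: e_def)
  finally have "c / 2 * (norm ?y)^2 <= 2 * G * norm ?y" by (simp add: field_simps)
  then have y: "norm ?y <= 4 * G / c" using pos by (cases "norm ?y = 0") (auto simp: power2_eq_square field_simps)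
  have "p s \<bullet> ?y = ?y \<bullet> (E s *v ?y)" by (simp add: Ex[OF s(1)] inner_commute)
  also have "... <= (K + e) * (norm ?y)^2" by (rule Ec[OF s(1)])
  also have "... <= (K + e) * (4 * G / c)^2" using pos e y by (intro mult_left_mono power_mono) auto
  finally show ?thesis .
 qed
 \<comment> \<open>Every test vector bounds the maximum from below; the vector p / (K + e) makes
   this lower bound a multiple of the squared norm of \<open>p t\<close>.\<close>
 have "\<Phi> t ((1 / (K + e)) *\<^sub>R p t) <= (K + e) * (4 * G / c)^2"
  using le[OF t] s(2)[OF t] M by (meson order_trans)
 moreover have "(norm (p t))^2 / (K + e) <= \<Phi> t ((1 / (K + e)) *\<^sub>R p t)"
 proof -
  have "((1 / (K + e)) *\<^sub>R p t) \<bullet> (E t *v ((1 / (K + e)) *\<^sub>R p t)) <= (K + e) * (norm ((1 / (K + e)) *\<^sub>R p t))^2" by (rule Ec[OF t])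
  also have "... = (norm (p t))^2 / (K + e)"
  proof -
   have "a * (norm ((1 / a) *\<^sub>R p t))^2 = (norm (p t))^2 / a" if "0 < a" for a :: real
    using that by (simp add: power_divide power2_eq_square)
   then show ?thesis using pos e by (simp add: add_nonneg_pos)
  qed
  finally show ?thesis by (simp add: \<Phi>_def power2_norm_eq_inner)
 qed
 ultimately have "(norm (p t))^2 / (K + e) <= (K + e) * (4 * G / c)^2" by linarith
 then have "(norm (p t))^2 <= (K + e) * ((K + e) * (4 * G / c)^2)"
  using pos(4) e by (simp only: pos_divide_le_eq[OF add_nonneg_pos] mult.commute)
 then have "(norm (p t))^2 <= ((K + e) * (4 * G / c))^2"
  by (simp only: power_mult_distrib power2_eq_square[of "K + e"] mult.assoc)
 moreover have "0 <= K + e" "0 <= 4 * G / c" using pos e by simp_all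
 ultimately have "norm (p t) <= (K + e) * (4 * G / c)" by (metis power2_le_imp_le mult_nonneg_nonneg)
 then show ?thesis by (simp only: e_def)
qed

lemma (in brownian_space) solves_sde_L2_proc:
 assumes "solves_sde M Fl W J' T \<xi> \<beta> \<sigma> X" "0 <= T"
 shows "prog_measurable Fl T X" "L2_proc M T X"
 using assms prog_measurable_horizon[of T X] by (auto simp: solves_sde_def L2_proc_iff_energy)

text \<open>Along the process, the mean of the form of \<open>L\<close> decreases at a rate of at
  most C |X|^2 and ends at 0, so its initial value is at most C times the energy. For the value at
  time \<open>r\<close> the process, whose equation is autonomous, is run on [0, T - r] against the
  shifted function t \<mapsto> L (r + t).\<close>

lemma (in brownian_space) energy_bound_by_lyapunov:
 fixes L L' :: "real => real^'n^'n" and A :: "real^'n^'n"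
 assumes X: "!!T. 0 < T ==> solves_sde M Fl W J' T (%_. x) (%t w. A *v X t w) (%j t w. G j *v X t w) X"
  and J': "J' \<subseteq> J" and fin: "energy M {0..} X < \<infinity>"
  and L: "!!t. t : {0..T} ==> (L has_vector_derivative L' t) (at t within {0..T})" "continuous_on {0..T} L'" "L T = 0"
   "!!t. t : {0..T} ==> symmetric_matrix (L t)"
  and C: "0 <= C" "!!t y. t : {0..T} ==>
   - (y \<bullet> (L' t *v y) + 2 * ((A *v y) \<bullet> (L t *v y)) + (\<Sum>j\<in>J'. (G j *v y) \<bullet> (L t *v (G j *v y)))) <= C * (norm y)^2"
  and r: "r : {0..T}"
 shows "x \<bullet> (L r *v x) <= C * enn2real (energy M {0..} X)"
proof (cases "r = T")
 case True
 then show ?thesis using C L(3) by simp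
next
 case False
 define s where "s = T - r"
 have s: "0 < s" "s <= T" using False r by (auto simp: s_def)
 have fJ: "finite J'" using J' finite_J by (rule finite_subset)
 let ?\<sigma> = "%j. if j : J' then (%t w. G j *v X t w) else (%_ _. 0)"
 note XL = solves_sde_L2_proc[OF X[OF s(1)] less_imp_le[OF s(1)]]
 have ito: "ito_process s (%_. x) (%t w. A *v X t w) ?\<sigma> X"
  by (rule solves_sde_ito_process[OF X[OF s(1)] J'])
    (use s in \<open>auto intro!: prog_measurable_matrix L2_proc_matrix XL L2_fun_const finite_measure_axioms\<close>)
 have shift: "(%t. r + t) ` {0..s} = {r..T}" by (auto simp: s_def)
 have d: "((%t. L (r + t)) has_vector_derivative L' (r + t)) (at t within {0..s})" if "t : {0..s}" for t
 proof -
  have "((L \<circ> (%t. r + t)) has_vector_derivative 1 *\<^sub>R L' (r + t)) (at t within {0..s})"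
   by (rule vector_diff_chain_within)
     (use that r in \<open>auto simp: shift s_def intro!: derivative_eq_intros has_vector_derivative_within_subset[OF L(1)]\<close>)
  then show ?thesis by (simp add: o_def)
 qed
 have c: "continuous_on {0..s} (%t. L' (r + t))"
  by (rule continuous_on_compose2[OF L(2)]) (use r in \<open>auto intro!: continuous_intros simp: s_def\<close>)
 let ?I = "%(w, t). X t w \<bullet> (L' (r + t) *v X t w) + (A *v X t w) \<bullet> (L (r + t) *v X t w) + X t w \<bullet> (L (r + t) *v (A *v X t w))
    + (\<Sum>j\<in>J. ?\<sigma> j t w \<bullet> (L (r + t) *v ?\<sigma> j t w))"
 note q = ito_process_quadratic[OF ito ito less_imp_le[OF s(1)] d c]
 have "r + s = T" by (simp add: s_def)
 then have "0 = x \<bullet> (L r *v x) + integral\<^sup>L (horizon M s) ?I"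
  using q(2) L(3) by (simp add: prob_space)
 moreover have "(\<integral>z. - ?I z \<partial>horizon M s) <= (\<integral>z. C * (norm (X (snd z) (fst z)))^2 \<partial>horizon M s)"
 proof (rule integral_mono)
  show "integrable (horizon M s) (%z. - ?I z)" by (rule integrable_minus[OF q(1)])
  show "integrable (horizon M s) (%z. C * (norm (X (snd z) (fst z)))^2)"
   using L2_fun_integrable[OF XL(2)[unfolded L2_proc_def]] by (intro integrable_mult_right) (simp add: case_prod_beta')
  fix z assume "z : space (horizon M s)"
  then have z: "r + snd z : {0..T}" using r by (auto simp: horizon_def space_pair_measure space_restrict_space s_def)
  have "(\<Sum>j\<in>J. ?\<sigma> j (snd z) (fst z) \<bullet> (L (r + snd z) *v ?\<sigma> j (snd z) (fst z)))
    = (\<Sum>j\<in>J'. (G j *v X (snd z) (fst z)) \<bullet> (L (r + snd z) *v (G j *v X (snd z) (fst z))))"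
   using J' finite_J by (intro sum.mono_neutral_cong_right) auto
  then show "- ?I z <= C * (norm (X (snd z) (fst z)))^2"
   using C(2)[OF z, of "X (snd z) (fst z)"] symmetric_matrix_inner[OF L(4)[OF z], of "X (snd z) (fst z)" "A *v X (snd z) (fst z)"]
   by (simp add: case_prod_beta' inner_commute)
 qed
 moreover have "(\<integral>z. (norm (X (snd z) (fst z)))\<^sup>2 \<partial>horizon M s) <= enn2real (energy M {0..} X)"
 proof -
  have "ennreal (\<integral>z. (norm (X (snd z) (fst z)))\<^sup>2 \<partial>horizon M s) = energy M {0..s} X"
   using L2_fun_nn_integral[OF XL(2)[unfolded L2_proc_def]] XL(2) energy_horizon[of X M s]
   by (simp add: case_prod_beta' L2_proc_iff_energy)
  also have "... <= energy M {0..} X"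
   unfolding energy_def by (intro nn_integral_mono mult_left_mono) (auto simp: indicator_def)
  finally have "enn2real (ennreal (\<integral>z. (norm (X (snd z) (fst z)))\<^sup>2 \<partial>horizon M s)) <= enn2real (energy M {0..} X)"
   by (rule enn2real_mono) (use fin in simp)
  then show ?thesis by (simp add: enn2real_ennreal[OF Bochner_Integration.integral_nonneg])
 qed
 ultimately have "x \<bullet> (L r *v x) <= C * (\<integral>z. (norm (X (snd z) (fst z)))\<^sup>2 \<partial>horizon M s)"
   "C * (\<integral>z. (norm (X (snd z) (fst z)))\<^sup>2 \<partial>horizon M s) <= C * enn2real (energy M {0..} X)"
  by (simp_all only: Bochner_Integration.integral_minus integral_mult_right_zero mult_left_mono[OF _ C(1)])
 then show ?thesis by (rule order_trans)
qed

text \<open>A constant initial state generates only trivial events, all contained in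
  \<open>F0\<close>, so joint independence is inherited, also by fewer Brownian motions. This
  carries the stabilizability hypotheses over to the space on which the agents live.\<close>

lemma brownian_basis_trivial:
 assumes "brownian_basis M F0 W J" "J' \<subseteq> J"
 shows "brownian_basis M (vimage_algebra (space M) (%_. x :: 'a::topological_space) borel) W J'"
proof -
 let ?F = "vimage_algebra (space M) (%_. x) borel"
 have F: "sets ?F \<subseteq> {{}, space M}"
  by (auto simp: sets_vimage_algebra2)
 have b: "prob_space M" "subalgebra M F0" using assms(1) by (auto simp: brownian_basis_def)
 then have sub: "{{}, space M} \<subseteq> sets F0" using sets.top[of F0] by (auto simp: subalgebra_def)
 then have "subalgebra M ?F" using F b(2) by (auto simp: subalgebra_def)
 moreover have "prob_space.indep_sets M
    (case_option (sets ?F) (%j. sigma_sets (space M) (\<Union>t\<in>{0..}. sets (vimage_algebra (space M) (W j t) borel))))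
    (insert None (Some ` J'))"
  by (rule prob_space.indep_sets_mono[OF b(1), of "case_option (sets F0)
     (%j. sigma_sets (space M) (\<Union>t\<in>{0..}. sets (vimage_algebra (space M) (W j t) borel)))" "insert None (Some ` J)"])
    (use assms F sub in \<open>auto simp: brownian_basis_def split: option.splits\<close>)
 ultimately show ?thesis using assms by (auto simp: brownian_basis_def)
qed

lemma matrix_quadratic_bound:
 fixes M :: "real^'a^'a"
 obtains C where "0 <= C" "!!y. y \<bullet> (M *v y) <= C * (norm y)^2"
proof -
 have "y \<bullet> (M *v y) <= onorm ((*v) M) * (norm y)^2" for y
  using mult_left_mono[OF onorm[OF matrix_vector_mul_bounded_linear, of M y] norm_ge_zero[of y]] norm_cauchy_schwarz[of y "M *v y"]
  by (simp add: power2_eq_square mult_ac)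
 then show thesis by (rule that[OF onorm_pos_le[OF matrix_vector_mul_bounded_linear]])
qed

lemma feedback_cost_bound:
 fixes Q :: "real^'n^'n" and S :: "real^'n^'m" and R :: "real^'m^'m" and K :: "real^'n^'m"
 obtains C where "0 <= C" "!!y. y \<bullet> (Q *v y) + 2 * ((S *v y) \<bullet> (K *v y)) + (K *v y) \<bullet> (R *v (K *v y)) <= C * (norm y)^2"
proof -
 obtain C where "0 <= C" "!!y. y \<bullet> ((Q + 2 *\<^sub>R (transpose S ** K) + transpose K ** R ** K) *v y) <= C * (norm y)^2"
  using matrix_quadratic_bound[of "Q + 2 *\<^sub>R (transpose S ** K) + transpose K ** R ** K"] by blast
 then show thesis
  by (intro that[of C]) (simp_all add: matrix_vector_mult_add_rdistrib scaleR_matrix_vector_assoc[symmetric]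
    matrix_vector_mul_assoc[symmetric] inner_add_right inner_vector_matrix)
qed

lemma riccati_system_D:
 assumes "riccati_system d T P L p"
 shows "P T = 0" "L T = 0" "p T = 0"
  and "t : {0..T} ==> psd_matrix (P t)" "t : {0..T} ==> psd_matrix (L t)"
  and "t : {0..T} ==> (P has_vector_derivative riccati_rhs (decoupled d) (P t) (P t)) (at t within {0..T})"
  and "t : {0..T} ==> (L has_vector_derivative riccati_rhs d (P t) (L t)) (at t within {0..T})"
  and "t : {0..T} ==> (p has_vector_derivative costate_rhs d (P t) (L t) (p t)) (at t within {0..T})"
proof -
 note R = assms[unfolded riccati_system_def]
 show "P T = 0" "L T = 0" "p T = 0" using R by auto
 assume t: "t : {0..T}"
 then show "psd_matrix (P t)" "psd_matrix (L t)" using R by auto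
 have e1: "P' = riccati_rhs (decoupled d) (P t) (P t)"
  if "P' + opQ d (P t) - transpose (opS d (P t)) ** matrix_inv (opR d (P t)) ** opS d (P t) = 0" for P'
  using that by (simp add: riccati_rhs_def) (simp add: algebra_simps)
 have e2: "L' = riccati_rhs d (P t) (L t)"
  if "L' + op_hatQ d (P t) (L t) - transpose (op_hatS d (P t) (L t)) ** matrix_inv (opR d (P t)) ** op_hatS d (P t) (L t) = 0" for L'
  using that by (simp add: riccati_rhs_def) (simp add: algebra_simps)
 have e3: "p' = costate_rhs d (P t) (L t) (p t)"
  if "p' + transpose (hA d + mB d ** fb_Theta_bar d (P t) (L t)) *v p t
       + transpose (hC d + mD d ** fb_Theta_bar d (P t) (L t)) *v (P t *v vsig d)
       + transpose (fb_Theta_bar d (P t) (L t)) *v vr d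
       + L t *v vb d + transpose (hG d) *v (L t *v vgam d) + vq d = 0" for p'
  using that unfolding costate_rhs_def by (simp only: eq_neg_iff_add_eq_0 add.assoc)
 show "(P has_vector_derivative riccati_rhs (decoupled d) (P t) (P t)) (at t within {0..T})"
  "(L has_vector_derivative riccati_rhs d (P t) (L t)) (at t within {0..T})"
  "(p has_vector_derivative costate_rhs d (P t) (L t) (p t)) (at t within {0..T})"
  using R t e1 e2 e3 by blast+
qed

lemma riccati_system_continuous:
 assumes "riccati_system d T P L p"
 shows "continuous_on {0..T} P" "continuous_on {0..T} L" "continuous_on {0..T} p"
 by (rule continuous_on_vector_derivative[OF riccati_system_D(6)[OF assms]], assumption)
   (rule continuous_on_vector_derivative[OF riccati_system_D(7)[OF assms]], assumption,
   rule continuous_on_vector_derivative[OF riccati_system_D(8)[OF assms]], assumption)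

text \<open>The inequality says that along the linear system with drift \<open>A\<close> and noises
  \<open>G\<close> the mean of the form of \<open>L\<close> decreases at a rate of at most C |y|^2.
  As \<open>L\<close> vanishes at \<open>T\<close>, its form is then bounded by C times the energy
  of the system.\<close>

definition lyapunov_supersolution ::
 "real^'n^'n => (nat => real^'n^'n) => nat set => real => real => (real => real^'n^'n) => (real => real^'n^'n) => bool" where
 "lyapunov_supersolution A G J C T L L' \<longleftrightarrow> L T = 0 \<and> continuous_on {0..T} L' \<and>
   (\<forall>t\<in>{0..T}. psd_matrix (L t) \<and> (L has_vector_derivative L' t) (at t within {0..T}) \<and>
    (\<forall>y. - (y \<bullet> (L' t *v y) + 2 * ((A *v y) \<bullet> (L t *v y)) + (\<Sum>j\<in>J. (G j *v y) \<bullet> (L t *v (G j *v y)))) <= C * (norm y)^2))"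

text \<open>The energies over all nonnegative times of the solutions started at the unit vectors
  depend neither on \<open>T\<close> nor on \<open>L\<close>. These finitely many numbers bound the
  diagonal of every such \<open>L\<close>, and \<open>psd_norm_le\<close> does the rest.\<close>

lemma norm_bound_by_stability:
 fixes A :: "real^'n^'n" and M :: "'w measure" and W :: "nat => real => 'w => real"
 defines "Fx \<equiv> %x. usual_filtration M (vimage_algebra (space M) (%_. x :: real^'n) borel) W {0, 1}"
 assumes basis: "brownian_basis M F0 W {0..N}" "1 <= N" and J': "J' \<subseteq> {0, 1}" and C: "0 <= C"
  and fin: "!!x X. (\<forall>T>0. solves_sde M (Fx x) W J' T (%_. x) (%t w. A *v X t w) (%j t w. G j *v X t w) X) ==>
   energy M {0..} X < \<infinity>"
 obtains K where "0 <= K" "!!T L L' t. lyapunov_supersolution A G J' C T L L' ==> t : {0..T} ==> norm (L t) <= K"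
proof -
 have B: "brownian_space M (vimage_algebra (space M) (%_. x) borel) W {0, 1}" for x :: "real^'n"
  by (intro brownian_space.intro brownian_basis_trivial[OF basis(1)]) (use basis(2) in auto)
 have "\<exists>X. \<forall>T>0. solves_sde M (Fx x) W J' T (%_. x) (%t w. A *v X t w) (%j t w. G j *v X t w) X" for x :: "real^'n"
 proof -
  interpret brownian_space M "vimage_algebra (space M) (%_. x) borel" W "{0, 1}" by (rule B)
  show ?thesis unfolding Fx_def by (rule linear_sde_exists[OF _ L2_fun_const[OF finite_measure_axioms] J']) simp
 qed
 then obtain X where X: "!!x T. 0 < T ==> solves_sde M (Fx x) W J' T (%_. x) (%t w. A *v X x t w) (%j t w. G j *v X x t w) (X x)"
  by metis
 define e where "e i = enn2real (energy M {0..} (X (axis i 1)))" for i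
 have e: "C * e i <= C * (\<Sum>i\<in>UNIV. e i)" for i
  by (intro mult_left_mono member_le_sum C) (auto simp: e_def)
 show thesis
 proof (rule that[of "(real CARD('n))^2 * (C * (\<Sum>i\<in>UNIV. e i))"])
  show "0 <= (real CARD('n))^2 * (C * (\<Sum>i\<in>UNIV. e i))"
   by (intro mult_nonneg_nonneg C sum_nonneg) (auto simp: e_def)
  fix T L L' t assume L: "lyapunov_supersolution A G J' C T L L'" and t: "t : {0..T}"
  have LD: "!!t. t : {0..T} ==> (L has_vector_derivative L' t) (at t within {0..T})" "continuous_on {0..T} L'" "L T = 0"
   "!!t. t : {0..T} ==> psd_matrix (L t)"
   "!!t y. t : {0..T} ==>
    - (y \<bullet> (L' t *v y) + 2 * ((A *v y) \<bullet> (L t *v y)) + (\<Sum>j\<in>J'. (G j *v y) \<bullet> (L t *v (G j *v y)))) <= C * (norm y)^2"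
   using L unfolding lyapunov_supersolution_def by blast+
  show "norm (L t) <= (real CARD('n))^2 * (C * (\<Sum>i\<in>UNIV. e i))"
  proof (rule psd_norm_le)
   show "psd_matrix (L t)" using L t by (simp add: lyapunov_supersolution_def)
   fix i :: 'n
   interpret brownian_space M "vimage_algebra (space M) (%_. axis i 1 :: real^'n) borel" W "{0, 1}" by (rule B)
   have fX: "energy M {0..} (X (axis i 1)) < \<infinity>" by (rule fin) (use X in blast)
   have "axis i 1 \<bullet> (L t *v axis i 1) <= C * enn2real (energy M {0..} (X (axis i 1)))"
    by (rule energy_bound_by_lyapunov[OF X[unfolded Fx_def] J' fX LD(1,2,3) _ C LD(5) t]) (use X LD(4) in \<open>simp_all add: psd_matrix_def\<close>)
   then show "axis i 1 \<bullet> (L t *v axis i 1) <= C * (\<Sum>i\<in>UNIV. e i)" using e[of i] by (simp add: e_def)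
  qed
 qed
qed

section \<open>Bounds on the Riccati functions uniform in the horizon\<close>

locale mean_field_lq = bar: lq d + dev: lq "decoupled d" for d :: "('n::finite, 'm::finite) lq_data"
begin

text \<open>At the stabilizing feedback v = Theta y the completed square is nonnegative. Dropping it
  turns the Riccati equation of \<open>P\<close> into a Lyapunov inequality for the stabilized
  matrices, with the cost rate of that feedback on the right.\<close>

lemma riccati_solution_bound:
 fixes M :: "'w measure"
 assumes basis: "brownian_basis M F0 W {0..N}" "1 <= N"
  and st: "L2_stabilizable TYPE('w) (mA d) (mC d) (mG d) (mB d) (mD d)"
 obtains K where "0 <= K" "!!T P L p t. riccati_system d T P L p ==> t : {0..T} ==> norm (P t) <= K"
proof -
 obtain \<Theta> where \<Theta>: "!!x X. (\<forall>T>0. solves_sde M (usual_filtration M (vimage_algebra (space M) (%_. x) borel) W {0, 1}) W {0, 1} T (%_. x)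
   (%t w. (mA d + mB d ** \<Theta>) *v X t w) (%j t w. (if j = 0 then mG d else mC d + mD d ** \<Theta>) *v X t w) X) ==>
   energy M {0..} X < \<infinity>"
 proof -
  from st obtain \<Theta> where *: "!!\<xi> X. brownian_basis M (vimage_algebra (space M) \<xi> borel) W {0, 1} ==>
    (\<integral>\<^sup>+w. ennreal ((norm (\<xi> w)) ^ 4) \<partial>M) < \<infinity> ==>
    (\<forall>T>0. solves_sde M (usual_filtration M (vimage_algebra (space M) \<xi> borel) W {0, 1}) W {0, 1} T \<xi>
   (%t w. (mA d + mB d ** \<Theta>) *v X t w) (%j t w. (if j = 0 then mG d else mC d + mD d ** \<Theta>) *v X t w) X) ==>
   energy M {0..} X < \<infinity>"
   unfolding L2_stabilizable_def Let_def by blast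
  interpret M: prob_space M using basis by (simp add: brownian_basis_def)
  show thesis
  proof (rule that[of \<Theta>], rule *)
   fix x :: "real^'n"
   show "brownian_basis M (vimage_algebra (space M) (%_. x) borel) W {0, 1}"
    by (rule brownian_basis_trivial[OF basis(1)]) (use basis(2) in auto)
   show "(\<integral>\<^sup>+w. ennreal ((norm x) ^ 4) \<partial>M) < \<infinity>" by (simp add: M.emeasure_space_1)
  qed
 qed
 obtain C where C: "0 <= C"
  "!!y. y \<bullet> (mQ d *v y) + 2 * ((mS d *v y) \<bullet> (\<Theta> *v y)) + (\<Theta> *v y) \<bullet> (mR d *v (\<Theta> *v y)) <= C * (norm y)^2"
  using feedback_cost_bound[of "mQ d" "mS d" \<Theta> "mR d"] by blast
 obtain K where K: "0 <= K" "!!T L L' t. lyapunov_supersolution (mA d + mB d ** \<Theta>)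
   (%j. if j = 0 then mG d else mC d + mD d ** \<Theta>) {0, 1} C T L L' ==> t : {0..T} ==> norm (L t) <= K"
  by (rule norm_bound_by_stability[OF basis subset_refl C(1) \<Theta>], assumption) (rule that; blast)
 show thesis
 proof (rule that[OF K(1)])
  fix T P L p t assume R: "riccati_system d T P L p" and t: "t : {0..T}"
  note RD = riccati_system_D[OF R]
  show "norm (P t) <= K"
  proof (rule K(2)[OF _ t], unfold lyapunov_supersolution_def, intro conjI ballI allI)
   show "continuous_on {0..T} (%t. riccati_rhs (decoupled d) (P t) (P t))"
    by (rule dev.continuous_riccati_rhs[OF _ _ _ RD(4)]) (rule riccati_system_continuous[OF R])+
   fix s y assume s: "s : {0..T}"
   have sq: "0 <= z \<bullet> (opR d (P s) *v z)" for z
    using bar.opR_coercive[OF RD(4)[OF s], of z] bar.cR(1) by (smt (verit) mult_nonneg_nonneg zero_le_power2)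
   have "symmetric_matrix (P s)" using RD(4)[OF s] by (simp add: psd_matrix_def)
   from dev.riccati_square[OF RD(4)[OF s] this, of y "\<Theta> *v y"] sq[of "\<Theta> *v y - fb_Theta d (P s) *v y"] C(2)[of y]
   show "- (y \<bullet> (riccati_rhs (decoupled d) (P s) (P s) *v y) + 2 * (((mA d + mB d ** \<Theta>) *v y) \<bullet> (P s *v y))
    + (\<Sum>j\<in>{0::nat, 1}. ((if j = 0 then mG d else mC d + mD d ** \<Theta>) *v y) \<bullet> (P s *v ((if j = 0 then mG d else mC d + mD d ** \<Theta>) *v y))))
    <= C * (norm y)^2"
    by (simp add: matrix_vector_mult_add_rdistrib matrix_vector_mul_assoc[symmetric])
  qed (use RD in auto)
 qed
qed

text \<open>As for \<open>P\<close>, but the stabilized system of the mean carries the common noise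
  only. In the equation of \<open>L\<close> the own noise is weighted by \<open>P\<close>; as
  \<open>P\<close> is already bounded by \<open>KP\<close>, this term goes into the constant
  \<open>C\<close>.\<close>

lemma mean_riccati_solution_bound:
 fixes M :: "'w measure"
 assumes basis: "brownian_basis M F0 W {0..N}" "1 <= N"
  and st: "L2_stabilizable_common TYPE('w) (mA d + mAbar d) (mG d + mGbar d) (mB d)"
 obtains K where "0 <= K" "!!T P L p t. riccati_system d T P L p ==> (!!t. t : {0..T} ==> norm (P t) <= KP) ==> t : {0..T} ==> norm (L t) <= K"
\<comment> \<open>For negative \<open>KP\<close> the implication is empty: the time \<open>t\<close>
  itself would give a norm below \<open>KP\<close>.\<close>
proof (cases "0 <= KP")
 case KP: True
 obtain \<Theta> where \<Theta>: "!!x X. (\<forall>T>0. solves_sde M (usual_filtration M (vimage_algebra (space M) (%_. x) borel) W {0, 1}) W {0} T (%_. x)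
   (%t w. (hA d + mB d ** \<Theta>) *v X t w) (%j t w. hG d *v X t w) X) ==> energy M {0..} X < \<infinity>"
 proof -
  from st obtain \<Theta> where *: "!!x X. brownian_basis M (vimage_algebra (space M) (%_. x) borel) W {0, 1} ==>
    (\<forall>T>0. solves_sde M (usual_filtration M (vimage_algebra (space M) (%_. x) borel) W {0, 1}) W {0} T (%_. x)
   (%t w. (hA d + mB d ** \<Theta>) *v X t w) (%j t w. hG d *v X t w) X) ==> energy M {0..} X < \<infinity>"
   unfolding L2_stabilizable_common_def Let_def by blast
  show thesis
   by (rule that[of \<Theta>], rule *[OF brownian_basis_trivial[OF basis(1)]]) (use basis(2) in auto)
 qed
 obtain C1 where C1: "0 <= C1"
  "!!y. y \<bullet> (hQ d *v y) + 2 * ((mS d *v y) \<bullet> (\<Theta> *v y)) + (\<Theta> *v y) \<bullet> (mR d *v (\<Theta> *v y)) <= C1 * (norm y)^2"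
  using feedback_cost_bound[of "hQ d" "mS d" \<Theta> "mR d"] by blast
 obtain k where k: "!!a b. norm ((a::real^'n^'n) *v b) <= norm a * norm b * k" "0 <= k"
  using bounded_bilinear.nonneg_bounded[OF bounded_bilinear_matrix_vector] by metis
 define h where "h = norm (hC d + mD d ** \<Theta>) * k"
 define C where "C = C1 + KP * k * h\<^sup>2"
 have C0: "0 <= C" using C1(1) k(2) KP by (simp add: C_def)
 obtain K where K: "0 <= K" "!!T L L' t. lyapunov_supersolution (hA d + mB d ** \<Theta>) (%_. hG d) {0} C T L L' ==>
   t : {0..T} ==> norm (L t) <= K"
  by (rule norm_bound_by_stability[where J'="{0}" and G="%_. hG d", OF basis _ C0 \<Theta>], simp, assumption) (rule that; blast)
 show thesis
 proof (rule that[OF K(1)])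
  fix T P L p t assume R: "riccati_system d T P L p" and Pb: "!!t. t : {0..T} ==> norm (P t) <= KP" and t: "t : {0..T}"
  note RD = riccati_system_D[OF R]
  show "norm (L t) <= K"
  proof (rule K(2)[OF _ t], unfold lyapunov_supersolution_def, intro conjI ballI allI)
   show "continuous_on {0..T} (%t. riccati_rhs d (P t) (L t))"
    by (rule bar.continuous_riccati_rhs[OF _ _ _ RD(4)]) (rule riccati_system_continuous[OF R])+
   fix s y assume s: "s : {0..T}"
   have sq: "0 <= z \<bullet> (opR d (P s) *v z)" for z
    using bar.opR_coercive[OF RD(4)[OF s], of z] bar.cR(1) by (smt (verit) mult_nonneg_nonneg zero_le_power2)
   have sy: "symmetric_matrix (L s)" using RD(5)[OF s] by (simp add: psd_matrix_def)
   let ?z = "(hC d + mD d ** \<Theta>) *v y"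
   have zn: "norm ?z <= h * norm y" using k(1)[of "hC d + mD d ** \<Theta>" y] by (simp add: h_def mult_ac)
   have "?z \<bullet> (P s *v ?z) <= norm ?z * (norm (P s) * norm ?z * k)"
    by (rule order_trans[OF norm_cauchy_schwarz mult_left_mono[OF k(1)]]) simp
   also have "... = norm (P s) * k * (norm ?z)^2" by (simp add: power2_eq_square)
   also have "... <= KP * k * (h * norm y)^2"
    by (intro mult_mono power_mono Pb[OF s] zn mult_nonneg_nonneg KP k(2)) auto
   finally have "?z \<bullet> (P s *v ?z) <= KP * k * h\<^sup>2 * (norm y)^2" by (simp only: power_mult_distrib mult.assoc)
   with bar.riccati_square[OF RD(4)[OF s] sy, of y "\<Theta> *v y"] sq[of "\<Theta> *v y - fb_Theta_bar d (P s) (L s) *v y"] C1(2)[of y]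
   show "- (y \<bullet> (riccati_rhs d (P s) (L s) *v y) + 2 * (((hA d + mB d ** \<Theta>) *v y) \<bullet> (L s *v y))
    + (\<Sum>j\<in>{0::nat}. (hG d *v y) \<bullet> (L s *v (hG d *v y)))) <= C * (norm y)^2"
    unfolding C_def distrib_right matrix_vector_mult_add_rdistrib[of "hA d" "mB d ** \<Theta>"] matrix_vector_mult_add_rdistrib[of "hC d" "mD d ** \<Theta>"]
     matrix_vector_mul_assoc[symmetric] by simp
  qed (use RD in auto)
 qed
next
 case False
 show thesis
 proof (rule that[of 0])
  fix T P L p t assume "!!t. t : {0..T} ==> norm (P t :: real^'n^'n) <= KP" "t : {0..T}"
  from this(1)[OF this(2)] False show "norm (L t :: real^'n^'n) <= 0" using norm_ge_zero[of "P t"] by linarith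
 qed simp
qed

text \<open>At the optimal v = Theta_bar x the completed square vanishes, and the noise terms are
  nonnegative. With the coercivity of the running cost, the Riccati equation becomes the Lyapunov
  inequality for the closed-loop drift that \<open>costate_bound\<close> requires. The inhomogeneity
  \<open>g\<close> is minus the right-hand side at p = 0.\<close>

lemma costate_solution_bound:
 obtains Kp where "0 <= Kp" "!!T P L p t. riccati_system d T P L p ==>
  (!!t. t : {0..T} ==> norm (P t) <= K \<and> norm (L t) <= K) ==> t : {0..T} ==> norm (p t) <= Kp"
proof (cases "0 <= K")
 case K: True
 obtain k where k: "!!a b. norm ((a::real^'n^'n) *v b) <= norm a * norm b * k" "0 <= k"
  using bounded_bilinear.nonneg_bounded[OF bounded_bilinear_matrix_vector] by metis
 obtain c where c: "0 < c" "!!x v. c * ((norm x)^2 + (norm v)^2) <= x \<bullet> (hQ d *v x) + 2 * ((mS d *v x) \<bullet> v) + v \<bullet> (mR d *v v)"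
  using bar.cost_coercive by blast
 have z: "continuous_on S (%z. fst z)" "continuous_on S (%z. fst (snd z))" for S :: "((real^'n^'n) \<times> (real^'n^'n) \<times> (real^'n)) set"
  by (intro continuous_intros)+
 have "continuous_on {z :: (real^'n^'n) \<times> (real^'n^'n) \<times> (real^'n). psd_matrix (fst z)} (%z. hA d + mB d ** fb_Theta_bar d (fst z) (fst (snd z)))"
  by (intro continuous_intros bar.continuous_fb_Theta_bar z) auto
 then obtain B where B: "0 < B" "!!P L p. psd_matrix P ==> norm P <= K ==> norm L <= K ==> norm (p :: real^'n) <= K ==>
   norm (hA d + mB d ** fb_Theta_bar d P L) <= B"
  by (rule bounded_on_psd[where K=K]) (rule that, simp_all)
 have "continuous_on {z :: (real^'n^'n) \<times> (real^'n^'n) \<times> (real^'n). psd_matrix (fst z)} (%z. costate_rhs d (fst z) (fst (snd z)) 0)"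
  by (intro continuous_intros bar.continuous_costate_rhs z) auto
 then obtain G where G: "0 < G" "!!P L p. psd_matrix P ==> norm P <= K ==> norm L <= K ==> norm (p :: real^'n) <= K ==>
   norm (costate_rhs d P L 0) <= G"
  by (rule bounded_on_psd[where K=K]) (rule that, simp_all)
 show thesis
 \<comment> \<open>\<open>k\<close> converts norms of matrices into operator bounds; the summand 1
   makes the bound on the closed-loop drift positive even if \<open>k\<close> is 0.\<close>
 proof (rule that[of "(K * k + c / (4 * (B * k + 1))) * (4 * G / c)"])
  have Bk: "0 < B * k + 1" using B(1) k(2) by (simp add: add_nonneg_pos)
  then show "0 <= (K * k + c / (4 * (B * k + 1))) * (4 * G / c)" using K k(2) c(1) G(1) by simp
  fix T P L p t assume R: "riccati_system d T P L p" and PL: "!!t. t : {0..T} ==> norm (P t) <= K \<and> norm (L t) <= K" and t: "t : {0..T}"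
  note RD = riccati_system_D[OF R]
  let ?F = "%t. hA d + mB d ** fb_Theta_bar d (P t) (L t)" and ?g = "%t. - costate_rhs d (P t) (L t) 0"
  show "norm (p t) <= (K * k + c / (4 * (B * k + 1))) * (4 * G / c)"
  proof (rule costate_bound[where F="?F" and g="?g" and p=p and L=L and T=T and L'="%t. riccati_rhs d (P t) (L t)" and K="K * k", OF _ RD(3) RD(7) RD(5) _ _ _ _ c(1) Bk G(1) _ t])
   fix s assume s: "s : {0..T}"
   have "costate_rhs d (P s) (L s) (p s) = - (transpose (?F s) *v p s + ?g s)"
    by (simp add: costate_rhs_def)
   then show "(p has_vector_derivative - (transpose (?F s) *v p s + ?g s)) (at s within {0..T})" using RD(8)[OF s] by simp
   show "norm (?g s) <= G" using G(2)[OF RD(4)[OF s], of "L s" 0] PL[OF s] K by simp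
   fix x
   have n: "norm (E *v x) <= b * k * norm x" if "norm E <= b" for E :: "real^'n^'n" and b
    using k(1)[of E x] mult_right_mono[OF that, of "norm x * k"] k(2) by (simp add: mult_ac)
   show "norm (?F s *v x) <= (B * k + 1) * norm x"
    using n[OF B(2)[OF RD(4)[OF s], of "L s" 0]] PL[OF s] K norm_ge_zero[of x] by (simp add: distrib_right add_increasing2)
   have "x \<bullet> (L s *v x) <= norm x * (K * k * norm x)"
    by (rule order_trans[OF norm_cauchy_schwarz mult_left_mono[OF n]]) (use PL[OF s] in auto)
   then show "x \<bullet> (L s *v x) <= K * k * (norm x)^2" by (simp add: power2_eq_square mult_ac)
   have sy: "symmetric_matrix (L s)" using RD(5)[OF s] by (simp add: psd_matrix_def)
   let ?v = "fb_Theta_bar d (P s) (L s) *v x"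
   have "0 <= (hC d *v x + mD d *v ?v) \<bullet> (P s *v (hC d *v x + mD d *v ?v))" "0 <= (hG d *v x) \<bullet> (L s *v (hG d *v x))"
    using RD(4,5)[OF s] by (auto simp: psd_matrix_def)
   moreover have "c * (norm x)^2 <= c * ((norm x)^2 + (norm ?v)^2)" using c(1) by simp
   moreover have "?F s *v x = hA d *v x + mB d *v ?v" by (simp only: matrix_vector_mult_add_rdistrib[of "hA d"] matrix_vector_mul_assoc)
   ultimately show "x \<bullet> (riccati_rhs d (P s) (L s) *v x) + 2 * ((?F s *v x) \<bullet> (L s *v x)) <= - (c * (norm x)^2)"
    using bar.riccati_square[OF RD(4)[OF s] sy, of x ?v] c(2)[of x ?v] by simp
  qed (simp_all add: mult_nonneg_nonneg[OF K k(2)])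
 qed
next
 case False
 show thesis
 proof (rule that[of 0])
  fix T P L p t assume "!!t. t : {0..T} ==> norm (P t :: real^'n^'n) <= K \<and> norm (L t :: real^'n^'n) <= K" "t : {0..T}"
  from this(1)[OF this(2)] False show "norm (p t :: real^'n) <= 0" using norm_ge_zero[of "P t"] by linarith
 qed simp
qed

text \<open>Each bound feeds the next: that on \<open>P\<close> enters the equation of
  \<open>L\<close>, and both enter that of \<open>p\<close>. Compactness then bounds all right-hand
  sides, and these give the values at time 0 through \<open>norm_initial_le\<close>.\<close>

theorem riccati_uniform_bound:
 fixes M :: "'w measure"
 assumes "brownian_basis M F0 W {0..N}" "1 <= N"
  and "L2_stabilizable_common TYPE('w) (mA d + mAbar d) (mG d + mGbar d) (mB d)"
  and "L2_stabilizable TYPE('w) (mA d) (mC d) (mG d) (mB d) (mD d)"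
 obtains K where "0 < K"
  "!!T P L p t. riccati_system d T P L p ==> t : {0..T} ==>
   norm (P t) <= K \<and> norm (L t) <= K \<and> \<bar>running_offset d (P t) (L t) (p t)\<bar> <= K"
  "!!T P L p. riccati_system d T P L p ==> 0 <= T ==> norm (P 0) <= K * T \<and> norm (L 0) <= K * T \<and> norm (p 0) <= K * T"
proof -
 obtain KP where KP: "0 <= KP" "!!T P L p t. riccati_system d T P L p ==> t : {0..T} ==> norm (P t) <= KP"
  using riccati_solution_bound[OF assms(1,2,4)] by blast
 obtain KL where KL: "0 <= KL" "!!T P L p t. riccati_system d T P L p ==> (!!t. t : {0..T} ==> norm (P t) <= KP) ==> t : {0..T} ==> norm (L t) <= KL"
  by (rule mean_riccati_solution_bound[OF assms(1,2,3), of KP]) (rule that; blast)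
 obtain Kp where Kp: "0 <= Kp" "!!T P L p t. riccati_system d T P L p ==>
   (!!t. t : {0..T} ==> norm (P t) <= KP + KL \<and> norm (L t) <= KP + KL) ==> t : {0..T} ==> norm (p t) <= Kp"
  by (rule costate_solution_bound[of "KP + KL"]) (rule that; blast)
 let ?K = "KP + KL + Kp + 1"
 have b: "norm (P t) <= ?K" "norm (L t) <= ?K" "norm (p t) <= ?K" if R: "riccati_system d T P L p" and t: "t : {0..T}" for T P L p t
 proof -
  note 1 = KP(2)[OF R]
  have 2: "norm (L t) <= KL" if "t : {0..T}" for t by (rule KL(2)[OF R 1 that])
  have 3: "norm (P t) <= KP + KL \<and> norm (L t) <= KP + KL" if "t : {0..T}" for t
   using 1[OF that] 2[OF that] KP(1) KL(1) by auto
  show "norm (P t) <= ?K" "norm (L t) <= ?K" "norm (p t) <= ?K"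
   using 1[OF t] 2[OF t] Kp(2)[OF R 3 t] KP(1) KL(1) Kp(1) by linarith+
 qed
 let ?Z = "{z :: (real^'n^'n) \<times> (real^'n^'n) \<times> (real^'n). psd_matrix (fst z)}"
 have z: "continuous_on ?Z (%z. fst z)" "continuous_on ?Z (%z. fst (snd z))" "continuous_on ?Z (%z. snd (snd z))"
  by (intro continuous_intros)+
 \<comment> \<open>All three right-hand sides and the offset are packed into one function, so that a
   single compactness argument bounds them.\<close>
 let ?f = "%z. ((riccati_rhs (decoupled d) (fst z) (fst z), riccati_rhs d (fst z) (fst (snd z))),
  (costate_rhs d (fst z) (fst (snd z)) (snd (snd z)), running_offset d (fst z) (fst (snd z)) (snd (snd z))))"
 have "continuous_on ?Z ?f"
  by (intro continuous_on_Pair dev.continuous_riccati_rhs[OF z(1,1,3)] bar.continuous_riccati_rhs[OF z]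
    bar.continuous_costate_rhs[OF z] bar.continuous_running_offset[OF z]) auto
 then obtain B where B: "0 < B" "!!P L p. psd_matrix P ==> norm P <= ?K ==> norm L <= ?K ==> norm p <= ?K ==> norm (?f (P, L, p)) <= B"
  by (rule bounded_on_psd[where K="?K"]) (rule that, simp_all)
 have B': "norm (riccati_rhs (decoupled d) (P t) (P t)) <= B" "norm (riccati_rhs d (P t) (L t)) <= B"
   "norm (costate_rhs d (P t) (L t) (p t)) <= B" "\<bar>running_offset d (P t) (L t) (p t)\<bar> <= B"
  if R: "riccati_system d T P L p" and t: "t : {0..T}" for T P L p t
 proof -
  have n: "norm a <= norm ((a, b), (c, e))" "norm b <= norm ((a, b), (c, e))" "norm c <= norm ((a, b), (c, e))" "norm e <= norm ((a, b), (c, e))"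
   for a b :: "real^'n^'n" and c :: "real^'n" and e :: real
   by (meson norm_fst_le norm_snd_le order_trans)+
  note * = B(2)[OF riccati_system_D(4)[OF R t] b[OF R t], simplified]
  show "norm (riccati_rhs (decoupled d) (P t) (P t)) <= B" "norm (riccati_rhs d (P t) (L t)) <= B"
   "norm (costate_rhs d (P t) (L t) (p t)) <= B" "\<bar>running_offset d (P t) (L t) (p t)\<bar> <= B"
   using order_trans[OF n(1) *] order_trans[OF n(2) *] order_trans[OF n(3) *] order_trans[OF n(4) *] by auto
 qed
 show thesis
 proof (rule that[of "?K + B"])
  show "0 < ?K + B" using KP KL Kp B by linarith
  show "norm (P t) <= ?K + B \<and> norm (L t) <= ?K + B \<and> \<bar>running_offset d (P t) (L t) (p t)\<bar> <= ?K + B"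
   if "riccati_system d T P L p" "t : {0..T}" for T P L p t
   using b(1,2)[OF that] B'(4)[OF that] B(1) KP(1) KL(1) Kp(1) by auto
  show "norm (P 0) <= (?K + B) * T \<and> norm (L 0) <= (?K + B) * T \<and> norm (p 0) <= (?K + B) * T"
   if R: "riccati_system d T P L p" and T: "0 <= T" for T P L p
  proof -
   note RD = riccati_system_D[OF R]
   have "B * T <= (?K + B) * T" using KP(1) KL(1) Kp(1) T by (intro mult_right_mono) auto
   then show ?thesis
    using norm_initial_le[OF T RD(1) RD(6) B'(1)[OF R]] norm_initial_le[OF T RD(2) RD(7) B'(2)[OF R]]
     norm_initial_le[OF T RD(3) RD(8) B'(3)[OF R]] by linarith
  qed
 qed
qed

end

section \<open>The cost of the agents\<close>

definition avg :: "nat => (nat => 'a::real_vector) => 'a" where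
 "avg N f = (1 / real N) *\<^sub>R (\<Sum>i=1..N. f i)"

lemma agent_mean_avg: "agent_mean N X t \<omega> = avg N (%i. X i t \<omega>)"
 by (simp add: agent_mean_def avg_def)

lemma avg_add: "avg N (%i. f i + g i) = avg N f + avg N g"
 by (simp add: avg_def sum.distrib scaleR_right_distrib)

lemma avg_linear: "linear h ==> avg N (%i. h (f i)) = h (avg N f)"
 by (simp add: avg_def linear_scale linear_sum)

lemma avg_const: "0 < N ==> avg N (%_. c) = c"
 by (simp add: avg_def sum_constant_scaleR)

lemma avg_mult: "avg N (%i. c * f i) = c * avg N (f :: nat => real)"
 by (simp add: avg_def sum_distrib_left)

lemma avg_matrix: "avg N (%i. A *v x i) = A *v avg N (x :: nat => real^'a)"
 by (rule avg_linear) simp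

lemma avg_inner_left: "avg N (%i. x i \<bullet> a) = avg N x \<bullet> a" and avg_inner_right: "avg N (%i. a \<bullet> x i) = a \<bullet> avg N x"
 by (simp_all add: avg_def inner_sum_left inner_sum_right)

lemma avg_cong: "(!!i. i : {1..N} ==> f i = g i) ==> avg N f = avg N g"
 unfolding avg_def by (metis (mono_tags, lifting) sum.cong)

lemma avg_mono: "(!!i. i : {1..N} ==> f i <= g i) ==> avg N f <= avg N (g :: nat => real)"
 unfolding avg_def by (auto intro!: divide_right_mono sum_mono)

lemma avg_bilinear:
 "avg N (%i. avg N (%k. x i \<bullet> (A *v y k))) = avg N x \<bullet> (A *v avg N (y :: nat => real^'a))"
 unfolding avg_inner_right avg_matrix avg_inner_left ..

text \<open>The mixed terms drop out because the deviations average to zero: the decomposition of a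
  second moment into mean and variance, in polarized form.\<close>

lemma avg_inner_deviation:
 fixes y' :: "nat => real^'a" and y :: "nat => real^'b"
 assumes N: "0 < N" and z: "avg N y = 0" "avg N y' = 0"
  and e: "!!i. x i = a + y i" "!!i. x' i = b + y' i"
 shows "avg N (%i. x i \<bullet> (A *v x' i)) = a \<bullet> (A *v b) + avg N (%i. y i \<bullet> (A *v y' i))"
proof -
 have "avg N (%i. x i \<bullet> (A *v x' i))
   = avg N (%i. a \<bullet> (A *v b)) + avg N (%i. a \<bullet> (A *v y' i)) + avg N (%i. y i \<bullet> (A *v b)) + avg N (%i. y i \<bullet> (A *v y' i))"
  unfolding avg_add[symmetric] e by (rule avg_cong) (simp add: matrix_vector_right_distrib inner_add_left inner_add_right)
 then show ?thesis by (simp add: avg_const[OF N] avg_inner_left avg_inner_right avg_matrix z)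
qed

definition agent_drift :: "('n::finite, 'm::finite) lq_data => nat => (nat => real^'n) => (nat => real^'m) => nat => real^'n" where
 "agent_drift d N x v i = mA d *v x i + mAbar d *v avg N x + mB d *v v i + vb d"

definition own_noise :: "('n::finite, 'm::finite) lq_data => nat => (nat => real^'n) => (nat => real^'m) => nat => real^'n" where
 "own_noise d N x v i = mC d *v x i + mCbar d *v avg N x + mD d *v v i + vsig d"

definition common_noise :: "('n::finite, 'm::finite) lq_data => nat => (nat => real^'n) => nat => real^'n" where
 "common_noise d N x i = mG d *v x i + mGbar d *v avg N x + vgam d"

definition agent_noise :: "('n::finite, 'm::finite) lq_data => nat => (nat => real^'n) => (nat => real^'m) => nat => nat => real^'n" where
 "agent_noise d N x v i j = (if j : {0, i} then if j = 0 then common_noise d N x i else own_noise d N x v i else 0)"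

definition feedback_gap where
 "feedback_gap d N P L p x v i =
   v i - (fb_Theta d P *v x i + (fb_Theta_bar d P L - fb_Theta d P) *v avg N x + fb_theta d P p)"

text \<open>Two agents share the common noise \<open>W 0\<close>, while their own Brownian motions
  coincide only if the agents do.\<close>

lemma agent_noise_sum:
 fixes E :: "real^'n^'n"
 assumes i: "i : {1..N}" and k: "k : {1..N}"
 shows "(\<Sum>j\<in>{0..N}. agent_noise d N x v i j \<bullet> (E *v agent_noise d N x v k j))
  = common_noise d N x i \<bullet> (E *v common_noise d N x k) + (if i = k then own_noise d N x v i \<bullet> (E *v own_noise d N x v i) else 0)"
proof -
 have "(\<Sum>j\<in>{Suc 0..N}. agent_noise d N x v i j \<bullet> (E *v agent_noise d N x v k j))
   = (\<Sum>j\<in>{Suc 0..N}. if j = i then (if i = k then own_noise d N x v i \<bullet> (E *v own_noise d N x v i) else 0) else 0)"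
  by (rule sum.cong) (use i k in \<open>auto simp: agent_noise_def\<close>)
 also have "... = (if i = k then own_noise d N x v i \<bullet> (E *v own_noise d N x v i) else 0)"
  using i by (subst sum.delta) auto
 finally show ?thesis by (simp add: sum.atLeast_Suc_atMost[of 0 N] agent_noise_def)
qed

text \<open>The origin of the factor 1/N: a double average has N^2 pairs, of which N are
  diagonal.\<close>

lemma avg_avg_diagonal: "avg N (%i. avg N (%k. if i = k then f i else 0)) = (1 / real N) * avg N (f :: nat => real)"
proof -
 have "avg N (%i. avg N (%k. if i = k then f i else 0)) = avg N (%i. (1 / real N) * f i)"
  by (rule avg_cong) (auto simp: avg_def)
 then show ?thesis by (simp only: avg_mult)
qed

lemma avg_running_cost:
 assumes N: "0 < N" and z: "avg N y = 0" "avg N z = 0" and x: "!!i. x i = xb + y i" and v: "!!i. v i = vb' + z i"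
 shows "avg N (%i. running_cost d (x i) (avg N x) (v i)) = (xb \<bullet> (mQ d *v xb) + avg N (%i. y i \<bullet> (mQ d *v y i)))
   + 2 * (vb' \<bullet> (mS d *v xb) + avg N (%i. z i \<bullet> (mS d *v y i)))
   + (vb' \<bullet> (mR d *v vb') + avg N (%i. z i \<bullet> (mR d *v z i))) + 2 * (vq d \<bullet> xb) + 2 * (vr d \<bullet> vb') + xb \<bullet> (mQbar d *v xb)"
proof -
 note D = avg_inner_deviation[OF N]
 have m: "avg N x = xb" "avg N v = vb'" unfolding x v by (simp_all add: avg_add avg_const[OF N] z)
 have "avg N (%i. running_cost d (x i) (avg N x) (v i)) = avg N (%i. x i \<bullet> (mQ d *v x i)) + avg N (%i. 2 * (v i \<bullet> (mS d *v x i)))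
   + avg N (%i. v i \<bullet> (mR d *v v i)) + avg N (%i. 2 * (vq d \<bullet> x i)) + avg N (%i. 2 * (vr d \<bullet> v i)) + avg N (%i. xb \<bullet> (mQbar d *v xb))"
  unfolding avg_add[symmetric] running_cost_def m by (rule avg_cong) (simp add: inner_commute)
 then show ?thesis
  unfolding avg_mult avg_inner_right avg_const[OF N] D[OF z(1) z(1) x x] D[OF z(2) z(1) v x] D[OF z(2) z(2) v v] m .
qed

context mean_field_lq begin

text \<open>Only the deviations from the mean see \<open>P\<close> and only the mean sees \<open>L\<close>, except that the
 independent noises of the agents leave the term with \<open>1 / N\<close>.\<close>

lemma value_identity:
 fixes x :: "nat => real^'n" and v :: "nat => real^'m" and p :: "real^'n"
 assumes N: "0 < N" and P: "psd_matrix P" and L: "psd_matrix L"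
 defines "\<beta> \<equiv> agent_drift d N x v" and "\<sigma> \<equiv> agent_noise d N x v" and "w \<equiv> feedback_gap d N P L p x v"
  and "P' \<equiv> riccati_rhs (decoupled d) P P" and "L' \<equiv> riccati_rhs d P L"
 shows "avg N (%i. x i \<bullet> (P' *v x i) + \<beta> i \<bullet> (P *v x i) + x i \<bullet> (P *v \<beta> i) + (\<Sum>j\<in>{0..N}. \<sigma> i j \<bullet> (P *v \<sigma> i j)))
  + avg N (%i. avg N (%k. x i \<bullet> ((L' - P') *v x k) + \<beta> i \<bullet> ((L - P) *v x k) + x i \<bullet> ((L - P) *v \<beta> k)
    + (\<Sum>j\<in>{0..N}. \<sigma> i j \<bullet> ((L - P) *v \<sigma> k j))))
  + 2 * avg N (%i. costate_rhs d P L p \<bullet> x i + p \<bullet> \<beta> i) + avg N (%i. running_cost d (x i) (avg N x) (v i))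
  = avg N (%i. w i \<bullet> (opR d P *v w i)) + running_offset d P L p
   + (1 / real N) * avg N (%i. own_noise d N x v i \<bullet> ((L - P) *v own_noise d N x v i))"
proof -
 define xb vb' y z where "xb = avg N x" and "vb' = avg N v" and "y i = x i - xb" and "z i = v i - vb'" for i
 have y0: "avg N y = 0" "avg N z = 0"
  unfolding y_def z_def xb_def vb'_def diff_conv_add_uminus by (simp_all only: avg_add avg_const[OF N] right_minus)
 have x: "x i = xb + y i" and v: "v i = vb' + z i" for i by (simp_all add: y_def z_def)
 define g h where "g = common_noise d N x" and "h = own_noise d N x v"
 define gb hb bb wb where "gb = hG d *v xb + vgam d" and "hb = hC d *v xb + mD d *v vb' + vsig d"
  and "bb = hA d *v xb + mB d *v vb' + vb d" and "wb = vb' - fb_Theta_bar d P L *v xb - fb_theta d P p"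
 define g' h' b' w' where "g' i = mG d *v y i" and "h' i = mC d *v y i + mD d *v z i" and "b' i = mA d *v y i + mB d *v z i"
  and "w' i = z i - fb_Theta d P *v y i" for i

 have e: "g i = gb + g' i" "h i = hb + h' i" "\<beta> i = bb + b' i" "w i = wb + w' i" for i
  unfolding g_def h_def \<beta>_def w_def agent_drift_def own_noise_def common_noise_def feedback_gap_def xb_def[symmetric]
  by (simp_all add: x[of i] v[of i] gb_def g'_def hb_def h'_def bb_def b'_def wb_def w'_def algebra_simps
    matrix_vector_mult_diff_rdistrib)
 have z0: "avg N g' = 0" "avg N h' = 0" "avg N b' = 0" "avg N w' = 0"
  unfolding g'_def h'_def b'_def w'_def
  by (simp_all only: avg_add avg_matrix y0 matrix_vector_mult_0_right add_0 diff_conv_add_uminus avg_linear[OF linear_uminus] minus_zero)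
 have mean: "avg N x = xb" "avg N \<beta> = bb" "avg N g = gb"
  unfolding e(1,3) xb_def[symmetric] by (simp_all add: e avg_add avg_const[OF N] z0)
 have sP: "a \<bullet> (P *v b) = b \<bullet> (P *v a)" for a b using P symmetric_matrix_inner[of P a b] by (simp add: psd_matrix_def inner_commute)
 have sL: "a \<bullet> (L *v b) = b \<bullet> (L *v a)" for a b using L symmetric_matrix_inner[of L a b] by (simp add: psd_matrix_def inner_commute)
 have Py: "psd_matrix P" "symmetric_matrix P" "symmetric_matrix L" using P L by (auto simp: psd_matrix_def)
 note D = avg_inner_deviation[OF N]
 have "avg N (%i. x i \<bullet> (P' *v x i) + \<beta> i \<bullet> (P *v x i) + x i \<bullet> (P *v \<beta> i) + (\<Sum>j\<in>{0..N}. \<sigma> i j \<bullet> (P *v \<sigma> i j)))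
   = avg N (%i. x i \<bullet> (P' *v x i)) + avg N (%i. 2 * (\<beta> i \<bullet> (P *v x i))) + avg N (%i. g i \<bullet> (P *v g i)) + avg N (%i. h i \<bullet> (P *v h i))"
  unfolding avg_add[symmetric] \<sigma>_def by (rule avg_cong) (simp add: agent_noise_sum sP[of "x _"] g_def h_def)
 also have "... = (xb \<bullet> (P' *v xb) + avg N (%i. y i \<bullet> (P' *v y i))) + 2 * (bb \<bullet> (P *v xb) + avg N (%i. b' i \<bullet> (P *v y i)))
   + (gb \<bullet> (P *v gb) + avg N (%i. g' i \<bullet> (P *v g' i))) + (hb \<bullet> (P *v hb) + avg N (%i. h' i \<bullet> (P *v h' i)))"
  unfolding avg_mult D[OF y0(1) y0(1) x x] D[OF z0(3) y0(1) e(3) x] D[OF z0(1) z0(1) e(1) e(1)] D[OF z0(2) z0(2) e(2) e(2)] ..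
 finally have 1: "avg N (%i. x i \<bullet> (P' *v x i) + \<beta> i \<bullet> (P *v x i) + x i \<bullet> (P *v \<beta> i) + (\<Sum>j\<in>{0..N}. \<sigma> i j \<bullet> (P *v \<sigma> i j))) = ..." .
 have "avg N (%i. avg N (%k. x i \<bullet> ((L' - P') *v x k) + \<beta> i \<bullet> ((L - P) *v x k) + x i \<bullet> ((L - P) *v \<beta> k)
    + (\<Sum>j\<in>{0..N}. \<sigma> i j \<bullet> ((L - P) *v \<sigma> k j))))
   = avg N (%i. avg N (%k. x i \<bullet> ((L' - P') *v x k) + \<beta> i \<bullet> ((L - P) *v x k) + x i \<bullet> ((L - P) *v \<beta> k)
    + g i \<bullet> ((L - P) *v g k) + (if i = k then h i \<bullet> ((L - P) *v h i) else 0)))"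
  unfolding \<sigma>_def by (intro avg_cong) (simp add: agent_noise_sum g_def h_def)
 also have "... = xb \<bullet> ((L' - P') *v xb) + bb \<bullet> ((L - P) *v xb) + xb \<bullet> ((L - P) *v bb) + gb \<bullet> ((L - P) *v gb)
   + (1 / real N) * avg N (%i. h i \<bullet> ((L - P) *v h i))"
  unfolding avg_add avg_bilinear avg_avg_diagonal mean ..
 finally have 2: "avg N (%i. avg N (%k. x i \<bullet> ((L' - P') *v x k) + \<beta> i \<bullet> ((L - P) *v x k) + x i \<bullet> ((L - P) *v \<beta> k)
    + (\<Sum>j\<in>{0..N}. \<sigma> i j \<bullet> ((L - P) *v \<sigma> k j)))) = ..." .
 have 3: "avg N (%i. costate_rhs d P L p \<bullet> x i + p \<bullet> \<beta> i) = costate_rhs d P L p \<bullet> xb + p \<bullet> bb"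
  by (simp add: avg_add avg_inner_right mean)
 note 4 = avg_running_cost[OF N y0 x v]
 \<comment> \<open>The deviations obey the equations of \<open>decoupled d\<close> without
   inhomogeneity, so each agent contributes one completed square with weight
   \<open>P\<close>.\<close>
 have "avg N (%i. y i \<bullet> (P' *v y i)) + avg N (%i. 2 * (b' i \<bullet> (P *v y i))) + avg N (%i. h' i \<bullet> (P *v h' i)) + avg N (%i. g' i \<bullet> (P *v g' i))
   + avg N (%i. y i \<bullet> (mQ d *v y i)) + avg N (%i. 2 * (z i \<bullet> (mS d *v y i))) + avg N (%i. z i \<bullet> (mR d *v z i))
  = avg N (%i. w' i \<bullet> (opR d P *v w' i))"
  unfolding avg_add[symmetric]
 proof (rule avg_cong)
  fix i
  show "y i \<bullet> (P' *v y i) + 2 * (b' i \<bullet> (P *v y i)) + h' i \<bullet> (P *v h' i) + g' i \<bullet> (P *v g' i) + y i \<bullet> (mQ d *v y i)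
    + 2 * (z i \<bullet> (mS d *v y i)) + z i \<bullet> (mR d *v z i) = w' i \<bullet> (opR d P *v w' i)"
   using dev.riccati_square[OF Py(1,2), of "y i" "z i"]
   by (simp add: P'_def b'_def h'_def g'_def w'_def inner_commute[of _ "mS d *v y i"])
 qed
 then have 5: "avg N (%i. y i \<bullet> (P' *v y i)) + 2 * avg N (%i. b' i \<bullet> (P *v y i)) + avg N (%i. h' i \<bullet> (P *v h' i)) + avg N (%i. g' i \<bullet> (P *v g' i))
   + avg N (%i. y i \<bullet> (mQ d *v y i)) + 2 * avg N (%i. z i \<bullet> (mS d *v y i)) + avg N (%i. z i \<bullet> (mR d *v z i))
  = avg N (%i. w' i \<bullet> (opR d P *v w' i))" unfolding avg_mult .
 \<comment> \<open>In the mean the own noise \<open>hb\<close> is paired with \<open>P\<close>, not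
   with \<open>L\<close>: exactly this makes the Riccati equation of \<open>L\<close> fit, and the
   correction with L - P is the term of order 1/N.\<close>
 have 6: "xb \<bullet> (L' *v xb) + 2 * (bb \<bullet> (L *v xb)) + hb \<bullet> (P *v hb) + gb \<bullet> (L *v gb)
   + 2 * (costate_rhs d P L p \<bullet> xb + p \<bullet> bb) + (xb \<bullet> (hQ d *v xb) + 2 * (vb' \<bullet> (mS d *v xb)) + vb' \<bullet> (mR d *v vb'))
   + 2 * (vq d \<bullet> xb) + 2 * (vr d \<bullet> vb') = wb \<bullet> (opR d P *v wb) + running_offset d P L p"
  using bar.riccati_affine_square[OF Py(1,3), of xb vb' p]
  unfolding L'_def bb_def hb_def gb_def wb_def by (simp only: inner_commute[of vb'])
 have m: "a \<bullet> ((E - E') *v b) = a \<bullet> (E *v b) - a \<bullet> (E' *v b)" for a b :: "real^'n" and E E'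
  by (simp add: matrix_vector_mult_diff_rdistrib inner_diff_right)
 show ?thesis
  unfolding 1 2 3 4 D[OF z0(4) z0(4) e(4) e(4)] h_def[symmetric]
  using 5 6 unfolding m sP[of xb] sL[of xb] matrix_vector_mult_add_rdistrib[of "mQ d" "mQbar d"] inner_add_right by argo
qed

text \<open>Coercivity of the problem of the deviations (\<open>dev\<close>) and of the mean
  (\<open>bar\<close>) lets the running cost control all states and controls in mean square. Young's
  inequality absorbs the linear terms into half of the coercivity in the mean, at the price of a
  constant.\<close>

lemma own_noise_le_cost:
 obtains C1 C2 where "0 < C1" "0 <= C2"
  "!!N x v. 0 < N ==> avg N (%i. (norm (own_noise d N x v i))\<^sup>2) <= C1 * (avg N (%i. running_cost d (x i) (avg N x) (v i)) + C2)"
proof -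
 obtain c1 where c1: "0 < c1" "!!x v. c1 * ((norm x)^2 + (norm v)^2) <= x \<bullet> (mQ d *v x) + 2 * ((mS d *v x) \<bullet> v) + v \<bullet> (mR d *v v)"
  using dev.cost_coercive by auto
 obtain c2 where c2: "0 < c2" "!!x v. c2 * ((norm x)^2 + (norm v)^2) <= x \<bullet> (hQ d *v x) + 2 * ((mS d *v x) \<bullet> v) + v \<bullet> (mR d *v v)"
  using bar.cost_coercive by auto
 define c where "c = min c1 c2"
 have c: "0 < c" "c <= c1" "c <= c2" using c1(1) c2(1) by (auto simp: c_def)
 define q where "q = (onorm ((*v) (mC d)))^2 + (onorm ((*v) (hC d)))^2 + (onorm ((*v) (mD d)))^2 + 1"
 have q: "0 < q" unfolding q_def by (intro add_nonneg_pos add_nonneg_nonneg) auto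
 have qm: "(norm (E *v y))^2 <= q * (norm y)^2" if "(onorm ((*v) E))^2 <= q" for E :: "real^'k^'n" and y
  using power_mono[OF onorm[OF matrix_vector_mul_bounded_linear, of E y], of 2] mult_right_mono[OF that, of "(norm y)^2"]
  by (simp add: power_mult_distrib)
 have qb: "(norm (mC d *v y))^2 <= q * (norm y)^2" "(norm (hC d *v y))^2 <= q * (norm y)^2" "(norm (mD d *v w))^2 <= q * (norm w)^2" for y w
  by (rule qm, simp add: q_def)+
 define C0 where "C0 = (2 / c) * ((norm (vq d))^2 + (norm (vr d))^2)"
 have C0: "0 <= C0" using c by (simp add: C0_def)
 have young: "- (c / 2 * (norm y)^2) - 2 / c * (norm b)^2 <= 2 * (b \<bullet> y)" for b y :: "'v::real_inner"
 proof -
  have "0 <= (norm ((c / 2) *\<^sub>R y + b))^2 * (2 / c)" using c by simp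
  also have "... = ((c / 2)^2 * (norm y)^2 + c * (b \<bullet> y) + (norm b)^2) * (2 / c)"
   unfolding power2_norm_eq_inner by (simp add: inner_add_left inner_add_right inner_commute power2_eq_square algebra_simps)
  also have "... = c / 2 * (norm y)^2 + 2 * (b \<bullet> y) + 2 / c * (norm b)^2" using c by (simp add: field_simps power2_eq_square)
  finally show ?thesis by linarith
 qed
 show thesis
 \<comment> \<open>Repeated squares of sums put the factor 4 q on the deviations, 8 q on the mean
   and 4 on \<open>vsig\<close>. For the mean only c / 2 is left after Young, hence C1 = 16 q / c;
   the contribution of \<open>vsig\<close> is divided by C1 because C2 stands inside the
   bracket.\<close>
 proof (rule that[of "16 * q / c" "C0 + 4 * (norm (vsig d))^2 / (16 * q / c)"])
  show C1: "0 < 16 * q / c" using q c by simp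
  then show "0 <= C0 + 4 * (norm (vsig d))^2 / (16 * q / c)" using C0 by (intro add_nonneg_nonneg divide_nonneg_pos) auto
  fix N :: nat and x :: "nat => real^'n" and v :: "nat => real^'m" assume N: "0 < N"
  define xb w y z where "xb = avg N x" and "w = avg N v" and "y i = x i - xb" and "z i = v i - w" for i
  have y0: "avg N y = 0" "avg N z = 0"
   unfolding y_def z_def xb_def w_def diff_conv_add_uminus by (simp_all only: avg_add avg_const[OF N] right_minus)
  have x: "x i = xb + y i" and v: "v i = w + z i" for i by (simp_all add: y_def z_def)
  let ?s = "(norm xb)^2 + (norm w)^2" and ?a = "avg N (%i. (norm (y i))\<^sup>2 + (norm (z i))^2)"
  have "avg N (%i. c * ((norm (y i))^2 + (norm (z i))^2)) <= avg N (%i. y i \<bullet> (mQ d *v y i) + 2 * (z i \<bullet> (mS d *v y i)) + z i \<bullet> (mR d *v z i))"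
  proof (rule avg_mono)
   fix i
   have "c * ((norm (y i))^2 + (norm (z i))^2) <= c1 * ((norm (y i))^2 + (norm (z i))^2)" using c(2) by (intro mult_right_mono) auto
   then show "c * ((norm (y i))^2 + (norm (z i))^2) <= y i \<bullet> (mQ d *v y i) + 2 * (z i \<bullet> (mS d *v y i)) + z i \<bullet> (mR d *v z i)"
    using c1(2)[of "y i" "z i"] by (simp add: inner_commute[of "z i" "mS d *v y i"])
  qed
  moreover have "c * ?s <= c2 * ?s" using c(3) by (intro mult_right_mono) auto
  ultimately have "c * ?a + c / 2 * ?s <= avg N (%i. running_cost d (x i) (avg N x) (v i)) + C0"
   using c2(2)[of xb w] young[of xb "vq d"] young[of w "vr d"]
   unfolding avg_running_cost[OF N y0 x v] avg_mult avg_add matrix_vector_mult_add_rdistrib inner_add_right C0_def distrib_left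
   by (simp add: inner_commute[of w "mS d *v xb"])
  then have "16 * q / c * (c * ?a + c / 2 * ?s) <= 16 * q / c * (avg N (%i. running_cost d (x i) (avg N x) (v i)) + C0)"
   using C1 by (intro mult_left_mono) auto
  moreover have "16 * q / c * (c * ?a + c / 2 * ?s) = 16 * q * ?a + 8 * q * ?s" using c by (simp add: field_simps)
  moreover have "avg N (%i. (norm (own_noise d N x v i))\<^sup>2) <= avg N (%i. 4 * q * ((norm (y i))^2 + (norm (z i))^2) + (8 * q * ?s + 4 * (norm (vsig d))^2))"
  proof (rule avg_mono)
   fix i
   have e: "own_noise d N x v i = ((hC d *v xb + mD d *v w) + vsig d) + (mC d *v y i + mD d *v z i)"
    unfolding own_noise_def xb_def[symmetric] by (simp add: x[of i] v[of i] algebra_simps)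
   show "(norm (own_noise d N x v i))^2 <= 4 * q * ((norm (y i))^2 + (norm (z i))^2) + (8 * q * ?s + 4 * (norm (vsig d))^2)"
    unfolding e
    using norm_add_square_le[of "(hC d *v xb + mD d *v w) + vsig d" "mC d *v y i + mD d *v z i"] norm_add_square_le[of "hC d *v xb + mD d *v w" "vsig d"]
     norm_add_square_le[of "mC d *v y i" "mD d *v z i"] norm_add_square_le[of "hC d *v xb" "mD d *v w"]
     qb(1)[of "y i"] qb(2)[of xb] qb(3)[of "z i"] qb(3)[of w] by (simp add: distrib_left)
  qed
  moreover have "avg N (%i. 4 * q * ((norm (y i))^2 + (norm (z i))^2) + (8 * q * ?s + 4 * (norm (vsig d))^2)) = 4 * q * ?a + (8 * q * ?s + 4 * (norm (vsig d))^2)"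
   by (simp only: avg_add[of N "%i. 4 * q * ((norm (y i))^2 + (norm (z i))^2)"] avg_mult avg_const[OF N])
  moreover have "0 <= 12 * q * ?a" using q by (auto simp: avg_def intro!: mult_nonneg_nonneg divide_nonneg_nonneg sum_nonneg)
  moreover have "16 * q / c * (avg N (%i. running_cost d (x i) (avg N x) (v i)) + (C0 + 4 * (norm (vsig d))^2 / (16 * q / c)))
    = 16 * q / c * (avg N (%i. running_cost d (x i) (avg N x) (v i)) + C0) + 4 * (norm (vsig d))^2"
   using q c by (simp only: add.assoc[symmetric] distrib_left[of _ "_ + C0"]) simp
  ultimately show "avg N (%i. (norm (own_noise d N x v i))\<^sup>2)
    <= 16 * q / c * (avg N (%i. running_cost d (x i) (avg N x) (v i)) + (C0 + 4 * (norm (vsig d))^2 / (16 * q / c)))"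
   by linarith
 qed
qed

end

lemma integral_avg:
 fixes f :: "nat => 'a => real"
 assumes "!!i. i : {1..N} ==> integrable H (f i)"
 shows "integrable H (%z. avg N (%i. f i z))" "(\<integral>z. avg N (%i. f i z) \<partial>H) = avg N (%i. integral\<^sup>L H (f i))"
proof -
 show "integrable H (%z. avg N (%i. f i z))"
  unfolding avg_def real_scaleR_def by (intro integrable_mult_right Bochner_Integration.integrable_sum assms)
 have "(\<integral>z. (\<Sum>i=1..N. f i z) \<partial>H) = (\<Sum>i=1..N. integral\<^sup>L H (f i))"
  by (rule Bochner_Integration.integral_sum[OF assms])
 then show "(\<integral>z. avg N (%i. f i z) \<partial>H) = avg N (%i. integral\<^sup>L H (f i))" by (simp add: avg_def)
qed

section \<open>Cost of a control through the Riccati functions\<close>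

locale agent_system = mean_field_lq d + brownian_space M F0 W "{0..N}"
 for d :: "('n::finite, 'm::finite) lq_data" and M F0 :: "'w measure" and W N +
 fixes T :: real and P L :: "real => real^'n^'n" and p :: "real => real^'n" and \<xi> :: "nat => 'w => real^'n"
 assumes N: "0 < N" and T: "0 <= T" and R: "riccati_system d T P L p"
  and \<xi>: "!!i. i : {1..N} ==> \<xi> i : borel_measurable F0" "!!i. i : {1..N} ==> L2_fun M (\<xi> i)"
begin

text \<open>The expected value function at time 0, with the form in the mean of the agents expanded
  into an average over all pairs of agents.\<close>

definition initial_value :: real where
 "initial_value = avg N (%i. expectation (%w. \<xi> i w \<bullet> (P 0 *v \<xi> i w)))
   + avg N (%i. avg N (%k. expectation (%w. \<xi> i w \<bullet> ((L 0 - P 0) *v \<xi> k w))))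
   + 2 * avg N (%i. expectation (%w. p 0 \<bullet> \<xi> i w))"

definition offset_integral :: real where
 "offset_integral = (\<integral>z. running_offset d (P (snd z)) (L (snd z)) (p (snd z)) \<partial>horizon M T)"

lemmas RD = riccati_system_D[OF R]
lemmas RC = riccati_system_continuous[OF R]

lemma space_horizonD: "z : space (horizon M T) ==> snd z : {0..T}"
 by (auto simp: horizon_def space_pair_measure space_restrict_space)

lemma integrable_horizon_time:
 fixes f :: "real => real"
 assumes "continuous_on {0..T} f"
 shows "integrable (horizon M T) (%z. f (snd z))"
proof -
 interpret H: finite_measure "horizon M T" by (rule finite_measure_horizon)
 obtain B where B: "!!s. s : {0..T} ==> norm (f s) <= B" using continuous_on_Icc_bounded[OF assms] by blast
 have "AE z in horizon M T. norm (f (snd z)) <= B" by (rule AE_I2) (rule B[OF space_horizonD])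
 then show ?thesis
  using prog_measurable_horizon[OF prog_measurable_time[OF assms] T]
  by (intro H.integrable_const_bound[of _ B]) (simp_all add: case_prod_beta')
qed

lemma prog_measurable_avg:
 fixes Y :: "nat => real => 'w => 'v::euclidean_space"
 assumes "!!i. i : {1..N} ==> prog_measurable Fl T (Y i)" "!!i. i : {1..N} ==> L2_proc M T (Y i)"
 shows "prog_measurable Fl T (%s w. avg N (%i. Y i s w))" "L2_proc M T (%s w. avg N (%i. Y i s w))"
 unfolding avg_def
 by (rule prog_measurable_bounded_bilinear[OF bounded_bilinear_scaleR prog_measurable_const prog_measurable_sum[OF assms(1)]], assumption)
   (rule L2_proc_linear[OF bounded_linear_scaleR_right L2_proc_sum[OF assms(2)]], assumption)

context
 fixes u :: "nat => real => 'w => real^'m" and X :: "nat => real => 'w => real^'n"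
 assumes adm: "admissible M Fl T N u" and st: "state_system d M Fl W T N \<xi> u X"
begin

abbreviation "xz z \<equiv> (%i. X i (snd z) (fst z))"
abbreviation "uz z \<equiv> (%i. u i (snd z) (fst z))"

lemma control: "i : {1..N} ==> prog_measurable Fl T (u i)" "i : {1..N} ==> L2_proc M T (u i)"
 using adm prog_measurable_horizon[of T "u i"] T by (auto simp: admissible_def L2_proc_iff_energy)

lemma agent_sde:
 assumes "i : {1..N}"
 shows "solves_sde M Fl W {0, i} T (\<xi> i) (%s w. agent_drift d N (%i. X i s w) (%i. u i s w) i)
  (%j s w. if j = 0 then common_noise d N (%i. X i s w) i else own_noise d N (%i. X i s w) (%i. u i s w) i) (X i)"
 using st assms unfolding state_system_def agent_mean_avg agent_drift_def common_noise_def own_noise_def by blast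

lemma state: "i : {1..N} ==> prog_measurable Fl T (X i)" "i : {1..N} ==> L2_proc M T (X i)"
 using solves_sde_L2_proc[OF agent_sde T] by auto

lemmas mean_state = prog_measurable_avg[of X, OF state]

lemma agent_ito:
 assumes i: "i : {1..N}"
 shows "ito_process T (\<xi> i) (%s w. agent_drift d N (%i. X i s w) (%i. u i s w) i)
  (%j s w. agent_noise d N (%i. X i s w) (%i. u i s w) i j) (X i)"
proof -
 have "(%j s w. agent_noise d N (%i. X i s w) (%i. u i s w) i j) = (%j. if j : {0, i} then
   (%s w. if j = 0 then common_noise d N (%i. X i s w) i else own_noise d N (%i. X i s w) (%i. u i s w) i) else (%_ _. 0))"
  by (auto simp: agent_noise_def fun_eq_iff)
 moreover have "L2_proc M T (%s w. if j = 0 then common_noise d N (%i. X i s w) i else own_noise d N (%i. X i s w) (%i. u i s w) i)" for j :: nat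
  unfolding common_noise_def own_noise_def
  by (cases "j = 0") (use i in \<open>auto intro!: L2_proc_add L2_proc_matrix L2_proc_const state control mean_state\<close>)
 moreover have "prog_measurable Fl T (%s w. agent_drift d N (%i. X i s w) (%i. u i s w) i)"
  unfolding agent_drift_def by (intro prog_measurable_add prog_measurable_matrix prog_measurable_const state control i mean_state)
 moreover have "L2_proc M T (%s w. agent_drift d N (%i. X i s w) (%i. u i s w) i)"
  unfolding agent_drift_def by (intro L2_proc_add L2_proc_matrix L2_proc_const state control i mean_state)
 ultimately show ?thesis
  using solves_sde_ito_process[OF agent_sde[OF i] _ T] i \<xi>(2)[OF i] F0_measurable_usual[OF \<xi>(1)[OF i]] by simp
qed

lemma running_cost_integrable:
 assumes i: "i : {1..N}"
 shows "integrable (horizon M T) (%z. running_cost d (xz z i) (avg N (xz z)) (uz z i))"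
proof -
 have I: "integrable (horizon M T) (%z. f (snd z) (fst z) \<bullet> g (snd z) (fst z))" if "L2_proc M T f" "L2_proc M T g"
  for f g :: "real => 'w => 'v::euclidean_space"
  using horizon_inner_integrable[OF that] by (simp add: case_prod_beta')
 show ?thesis
  unfolding running_cost_def
  by (intro Bochner_Integration.integrable_add integrable_mult_right I L2_proc_matrix L2_proc_const state control i mean_state)
qed

lemma social_cost_horizon: "social_cost d M T N X u = (\<integral>z. avg N (%i. running_cost d (xz z i) (avg N (xz z)) (uz z i)) \<partial>horizon M T)"
proof -
 interpret R: pair_sigma_finite M "restrict_space lborel {0..T}" by (rule pair_sigma_finite_horizon)
 have "agent_cost d M T N X u i = (\<integral>z. running_cost d (xz z i) (avg N (xz z)) (uz z i) \<partial>horizon M T)" if i: "i : {1..N}" for i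
  unfolding agent_cost_def agent_mean_avg LINT_restrict
  using R.integral_fst'[OF running_cost_integrable[OF i, unfolded horizon_def]] by (simp add: horizon_def)
 then have "avg N (agent_cost d M T N X u) = avg N (%i. \<integral>z. running_cost d (xz z i) (avg N (xz z)) (uz z i) \<partial>horizon M T)"
  by (rule avg_cong)
 also have "... = (\<integral>z. avg N (%i. running_cost d (xz z i) (avg N (xz z)) (uz z i)) \<partial>horizon M T)"
  by (rule integral_avg(2)[OF running_cost_integrable, symmetric])
 finally show ?thesis by (simp add: social_cost_def avg_def[of N "agent_cost d M T N X u"])
qed

text \<open>The product formula is applied to each agent with weight \<open>P\<close>, to each pair
  of agents with weight L - P, and to each agent with the linear weight \<open>p\<close>. In this
  way the mean needs no stochastic equation of its own. The terminal weights vanish, and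
  \<open>value_identity\<close> rewrites the sum of the rates and the running cost.\<close>

lemma cost_formula:
 defines "I \<equiv> %z. avg N (%i. feedback_gap d N (P (snd z)) (L (snd z)) (p (snd z)) (xz z) (uz z) i \<bullet>
    (opR d (P (snd z)) *v feedback_gap d N (P (snd z)) (L (snd z)) (p (snd z)) (xz z) (uz z) i))
   + running_offset d (P (snd z)) (L (snd z)) (p (snd z))
   + (1 / real N) * avg N (%i. own_noise d N (xz z) (uz z) i \<bullet> ((L (snd z) - P (snd z)) *v own_noise d N (xz z) (uz z) i))"
 shows "integrable (horizon M T) I" "social_cost d M T N X u = initial_value + integral\<^sup>L (horizon M T) I"
proof -
 let ?\<beta> = "%z. agent_drift d N (xz z) (uz z)" and ?\<sigma> = "%z. agent_noise d N (xz z) (uz z)"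
 let ?P' = "%s. riccati_rhs (decoupled d) (P s) (P s)" and ?L' = "%s. riccati_rhs d (P s) (L s)"
 have cP: "continuous_on {0..T} ?P'" by (rule dev.continuous_riccati_rhs[OF RC(1,1,3) RD(4)])
 have cL: "continuous_on {0..T} ?L'" by (rule bar.continuous_riccati_rhs[OF RC RD(4)])
 have cp: "continuous_on {0..T} (%s. costate_rhs d (P s) (L s) (p s))" by (rule bar.continuous_costate_rhs[OF RC RD(4)])
 define A where "A i z = xz z i \<bullet> (?P' (snd z) *v xz z i) + ?\<beta> z i \<bullet> (P (snd z) *v xz z i) + xz z i \<bullet> (P (snd z) *v ?\<beta> z i)
   + (\<Sum>j\<in>{0..N}. ?\<sigma> z i j \<bullet> (P (snd z) *v ?\<sigma> z i j))" for i z
 define B where "B i k z = xz z i \<bullet> ((?L' (snd z) - ?P' (snd z)) *v xz z k) + ?\<beta> z i \<bullet> ((L (snd z) - P (snd z)) *v xz z k)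
   + xz z i \<bullet> ((L (snd z) - P (snd z)) *v ?\<beta> z k) + (\<Sum>j\<in>{0..N}. ?\<sigma> z i j \<bullet> ((L (snd z) - P (snd z)) *v ?\<sigma> z k j))" for i k z
 define C where "C i z = costate_rhs d (P (snd z)) (L (snd z)) (p (snd z)) \<bullet> xz z i + p (snd z) \<bullet> ?\<beta> z i" for i z
 define J where "J z = avg N (%i. running_cost d (xz z i) (avg N (xz z)) (uz z i))" for z
 have A: "integrable (horizon M T) (A i)" "expectation (%w. \<xi> i w \<bullet> (P 0 *v \<xi> i w)) + integral\<^sup>L (horizon M T) (A i) = 0" if i: "i : {1..N}" for i
  using ito_process_quadratic[OF agent_ito[OF i] agent_ito[OF i] T RD(6) cP]
  by (simp_all add: A_def[abs_def] case_prod_beta' RD(1))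
 have B: "integrable (horizon M T) (B i k)" "expectation (%w. \<xi> i w \<bullet> ((L 0 - P 0) *v \<xi> k w)) + integral\<^sup>L (horizon M T) (B i k) = 0"
  if i: "i : {1..N}" and k: "k : {1..N}" for i k
  using ito_process_quadratic[OF agent_ito[OF i] agent_ito[OF k] T has_vector_derivative_diff[OF RD(7) RD(6)] continuous_on_diff[OF cL cP]]
  by (simp_all add: B_def[abs_def] case_prod_beta' RD(1,2))
 have C: "integrable (horizon M T) (C i)" "expectation (%w. p 0 \<bullet> \<xi> i w) + integral\<^sup>L (horizon M T) (C i) = 0" if i: "i : {1..N}" for i
  using ito_process_affine[OF agent_ito[OF i] T RD(8) cp] by (simp_all add: C_def[abs_def] case_prod_beta' RD(3))
 let ?I = "%z. avg N (%i. A i z) + avg N (%i. avg N (%k. B i k z)) + 2 * avg N (%i. C i z) + J z"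
 have i4: "integrable (horizon M T) (%z. avg N (%i. A i z))" "integrable (horizon M T) (%z. avg N (%i. avg N (%k. B i k z)))"
   "integrable (horizon M T) (%z. 2 * avg N (%i. C i z))" "integrable (horizon M T) J"
  unfolding J_def by (intro integral_avg(1) A(1) B(1) C(1) integrable_mult_right running_cost_integrable; assumption)+
 have eq: "I z = ?I z" if z: "z : space (horizon M T)" for z
  unfolding I_def A_def B_def C_def J_def
  by (rule value_identity[OF N RD(4,5)[OF space_horizonD[OF z]], symmetric])
 have int: "integrable (horizon M T) ?I" by (intro Bochner_Integration.integrable_add i4)
 then show "integrable (horizon M T) I" by (subst Bochner_Integration.integrable_cong[OF refl eq])
 have "integral\<^sup>L (horizon M T) I = integral\<^sup>L (horizon M T) ?I" by (rule Bochner_Integration.integral_cong[OF refl eq])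
 also have "... = avg N (%i. integral\<^sup>L (horizon M T) (A i)) + avg N (%i. avg N (%k. integral\<^sup>L (horizon M T) (B i k)))
   + 2 * avg N (%i. integral\<^sup>L (horizon M T) (C i)) + integral\<^sup>L (horizon M T) J"
 proof -
  have "(\<integral>z. avg N (%i. avg N (%k. B i k z)) \<partial>horizon M T) = avg N (%i. \<integral>z. avg N (%k. B i k z) \<partial>horizon M T)"
   by (rule integral_avg(2)) (rule integral_avg(1)[OF B(1)])
  also have "... = avg N (%i. avg N (%k. integral\<^sup>L (horizon M T) (B i k)))"
   by (rule avg_cong) (rule integral_avg(2)[OF B(1)])
  finally have b: "(\<integral>z. avg N (%i. avg N (%k. B i k z)) \<partial>horizon M T) = ..." .
  have a: "(\<integral>z. avg N (%i. A i z) \<partial>horizon M T) = avg N (%i. integral\<^sup>L (horizon M T) (A i))"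
   and c: "(\<integral>z. avg N (%i. C i z) \<partial>horizon M T) = avg N (%i. integral\<^sup>L (horizon M T) (C i))"
   by (rule integral_avg(2)[OF A(1)], assumption) (rule integral_avg(2)[OF C(1)])
  note add = Bochner_Integration.integral_add Bochner_Integration.integrable_add
  show ?thesis
   unfolding add(1)[OF add(2)[OF add(2)[OF i4(1,2)] i4(3)] i4(4)] add(1)[OF add(2)[OF i4(1,2)] i4(3)] add(1)[OF i4(1,2)]
    a b integral_mult_right_zero c ..
 qed
 also have "avg N (%i. integral\<^sup>L (horizon M T) (A i)) = avg N (%i. - 1 * expectation (%w. \<xi> i w \<bullet> (P 0 *v \<xi> i w)))"
  by (rule avg_cong) (use A(2) in \<open>simp add: eq_neg_iff_add_eq_0 add.commute\<close>)
 also have "avg N (%i. integral\<^sup>L (horizon M T) (C i)) = avg N (%i. - 1 * expectation (%w. p 0 \<bullet> \<xi> i w))"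
  by (rule avg_cong) (use C(2) in \<open>simp add: eq_neg_iff_add_eq_0 add.commute\<close>)
 also have "avg N (%i. avg N (%k. integral\<^sup>L (horizon M T) (B i k)))
   = avg N (%i. avg N (%k. - 1 * expectation (%w. \<xi> i w \<bullet> ((L 0 - P 0) *v \<xi> k w))))"
  by (intro avg_cong) (use B(2) in \<open>simp add: eq_neg_iff_add_eq_0 add.commute\<close>)
 finally show "social_cost d M T N X u = initial_value + integral\<^sup>L (horizon M T) I"
  unfolding social_cost_horizon initial_value_def avg_mult J_def[symmetric] by simp
qed

end

end

section \<open>Comparison of the optimal control with the feedback\<close>

lemma abs_avg_le: "0 < N ==> (!!i. i : {1..N} ==> \<bar>f i\<bar> <= b) ==> \<bar>avg N f\<bar> <= (b :: real)"
 using avg_mono[of N f "%_. b"] avg_mono[of N "%_. - b" f] by (fastforce simp: avg_const abs_le_iff)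

lemma abs_inner_matrix_le:
 fixes A :: "real^'a^'b"
 assumes k: "!!(A :: real^'a^'b) y. norm (A *v y) <= norm A * norm y * k" "0 <= k" and A: "norm A <= a"
 shows "\<bar>x \<bullet> (A *v y)\<bar> <= a * k * (((norm x)^2 + (norm y)^2) / 2)"
proof -
 have "\<bar>x \<bullet> (A *v y)\<bar> <= norm x * (a * norm y * k)"
  using order_trans[OF Cauchy_Schwarz_ineq2 mult_left_mono[OF k(1) norm_ge_zero[of x]], of A y]
   mult_left_mono[OF mult_right_mono[OF mult_right_mono[OF A norm_ge_zero[of y]] k(2)] norm_ge_zero[of x]] by linarith
 also have "... = a * k * (norm x * norm y)" by simp
 also have "... <= a * k * (((norm x)^2 + (norm y)^2) / 2)"
  using sum_squares_bound[of "norm x" "norm y"] k(2) order_trans[OF norm_ge_zero A] by (intro mult_left_mono) auto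
 finally show ?thesis .
qed

context agent_system begin

lemma measure_horizon: "(\<integral>z. c \<partial>horizon M T) = T * c"
proof -
 let ?R = "restrict_space lborel {0..T}"
 interpret R: finite_measure ?R by (rule finite_measure_restrict_lborel)
 have "emeasure (M \<Otimes>\<^sub>M ?R) (space M \<times> {0..T}) = emeasure M (space M) * emeasure ?R {0..T}"
  by (rule R.emeasure_pair_measure_Times) (auto simp: sets_restrict_space)
 also have "... = ennreal T" using T by (simp add: emeasure_space_1 emeasure_restrict_space)
 finally show ?thesis using T by (simp add: horizon_def measure_def space_pair_measure space_restrict_space)
qed

text \<open>The estimate is linear in \<open>K\<close>, for which the O(T) bound on the Riccati
  functions at time 0 will be inserted. Only second moments of the initial states enter.\<close>

lemma initial_value_le:
 assumes k: "!!(A :: real^'n^'n) y. norm (A *v y) <= norm A * norm y * k" "0 <= k"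
  and K: "norm (P 0) <= K" "norm (L 0) <= K" "norm (p 0) <= K"
  and m: "!!i. i : {1..N} ==> expectation (%w. (norm (\<xi> i w))\<^sup>2) = m"
 shows "\<bar>initial_value\<bar> <= K * (3 * k * m + 2 + 2 * m)"
proof -
 have q: "\<bar>expectation (%w. \<xi> i w \<bullet> (A *v \<xi> j w))\<bar> <= a * k * m" if "i : {1..N}" "j : {1..N}" and A: "norm A <= a" for i j A a
 proof -
  have "\<bar>expectation (%w. \<xi> i w \<bullet> (A *v \<xi> j w))\<bar> <= expectation (%w. \<bar>\<xi> i w \<bullet> (A *v \<xi> j w)\<bar>)" by (rule integral_abs_bound)
  also have "... <= expectation (%w. a * k * (((norm (\<xi> i w))^2 + (norm (\<xi> j w))^2) / 2))"
   by (intro integral_mono integrable_abs L2_inner_integrable L2_fun_linear[OF matrix_vector_mul_bounded_linear] \<xi> that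
     integrable_mult_right integrable_divide Bochner_Integration.integrable_add L2_fun_integrable abs_inner_matrix_le k A)
  also have "... = a * k * m" using that by (simp add: m L2_fun_integrable[OF \<xi>(2)])
  finally show ?thesis .
 qed
 have l: "\<bar>expectation (%w. p 0 \<bullet> \<xi> i w)\<bar> <= K * (1 + m)" if i: "i : {1..N}" for i
 proof -
  have "\<bar>expectation (%w. p 0 \<bullet> \<xi> i w)\<bar> <= expectation (%w. \<bar>p 0 \<bullet> \<xi> i w\<bar>)" by (rule integral_abs_bound)
  also have "... <= expectation (%w. K * (1 + (norm (\<xi> i w))^2))"
  proof (rule integral_mono)
   show "integrable M (%w. \<bar>p 0 \<bullet> \<xi> i w\<bar>)"
    by (intro integrable_abs L2_inner_integrable L2_fun_const finite_measure_axioms \<xi> i)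
   show "integrable M (%w. K * (1 + (norm (\<xi> i w))^2))" using L2_fun_integrable[OF \<xi>(2)[OF i]] by simp
   fix w
   have "norm (\<xi> i w) <= 1 + (norm (\<xi> i w))^2" using sum_squares_bound[of 1 "norm (\<xi> i w)"] norm_ge_zero[of "\<xi> i w"] by (simp only: power_one)
   then show "\<bar>p 0 \<bullet> \<xi> i w\<bar> <= K * (1 + (norm (\<xi> i w))^2)"
    by (intro order_trans[OF Cauchy_Schwarz_ineq2] mult_mono K) (auto intro: order_trans[OF norm_ge_zero K(3)])
  qed
  also have "... = K * (1 + m)" using i by (simp add: m L2_fun_integrable[OF \<xi>(2)] prob_space)
  finally show ?thesis .
 qed
 have K2: "norm (L 0 - P 0) <= 2 * K" using norm_triangle_ineq4[of "L 0" "P 0"] K by linarith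
 have "\<bar>avg N (%i. expectation (%w. \<xi> i w \<bullet> (P 0 *v \<xi> i w)))\<bar> <= K * k * m"
  "\<bar>avg N (%i. avg N (%j. expectation (%w. \<xi> i w \<bullet> ((L 0 - P 0) *v \<xi> j w))))\<bar> <= 2 * K * k * m"
  "\<bar>avg N (%i. expectation (%w. p 0 \<bullet> \<xi> i w))\<bar> <= K * (1 + m)"
  by (intro abs_avg_le N q l K K2; assumption)+
 moreover have "K * k * m + 2 * K * k * m + 2 * (K * (1 + m)) = K * (3 * k * m + 2 + 2 * m)" by (simp add: algebra_simps)
 ultimately show ?thesis unfolding initial_value_def by linarith
qed

text \<open>Makes the feedback a competitor of the optimal control: its coefficients are continuous
  on [0, T], and its states belong to the square-integrable class built into
  \<open>solves_sde\<close>.\<close>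

lemma feedback_admissible:
 assumes st: "state_system d M Fl W T N \<xi> (mean_field_feedback d N P L p X) X"
 shows "admissible M Fl T N (mean_field_feedback d N P L p X)"
proof -
 have X: "prog_measurable Fl T (X i)" "L2_proc M T (X i)" if "i : {1..N}" for i
  using solves_sde_L2_proc[OF _ T] st that unfolding state_system_def by blast+
 have c: "continuous_on {0..T} (%t. fb_Theta d (P t))"
  using dev.continuous_fb_Theta_bar[OF RC(1,1,3) RD(4)] by simp
 have cb: "continuous_on {0..T} (%t. fb_Theta_bar d (P t) (L t) - fb_Theta d (P t))"
  by (rule continuous_on_diff[OF bar.continuous_fb_Theta_bar[OF RC RD(4)] c])
 have ct: "continuous_on {0..T} (%t. fb_theta d (P t) (p t))" by (rule bar.continuous_fb_theta[OF RC RD(4)])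
 note mX = prog_measurable_avg[of X, OF X]
 have "prog_measurable Fl T (mean_field_feedback d N P L p X i) \<and> L2_proc M T (mean_field_feedback d N P L p X i)" if i: "i : {1..N}" for i
 proof -
  note pm = prog_measurable_bounded_bilinear[OF bounded_bilinear_matrix_vector prog_measurable_time]
  have e: "mean_field_feedback d N P L p X i = (%t w. fb_Theta d (P t) *v X i t w
    + (fb_Theta_bar d (P t) (L t) - fb_Theta d (P t)) *v avg N (%i. X i t w) + fb_theta d (P t) (p t))"
   by (simp add: mean_field_feedback_def agent_mean_avg fun_eq_iff)
  have "L2_proc M T (%s _. fb_theta d (P s) (p s))"
  proof -
   obtain B where B: "!!s. s : {0..T} ==> norm (fb_theta d (P s) (p s)) <= B" using continuous_on_Icc_bounded[OF ct] by blast
   show ?thesis unfolding L2_proc_def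
    by (rule L2_fun_bounded[OF finite_measure_horizon prog_measurable_horizon[OF prog_measurable_time[OF ct] T]])
      (use B[OF space_horizonD] in \<open>simp add: case_prod_beta'\<close>)
  qed
  then show ?thesis unfolding e
   by (intro conjI prog_measurable_add pm[OF c X(1)[OF i]] pm[OF cb mX(1)] prog_measurable_time[OF ct]
     L2_proc_add L2_proc_time_matrix[OF c X[OF i] T] L2_proc_time_matrix[OF cb mX T]) (assumption | rule that)+
 qed
 then show ?thesis by (auto simp: admissible_def L2_proc_iff_energy)
qed

definition noise_energy :: "(nat => real => 'w => real^'n) => (nat => real => 'w => real^'m) => real" where
 "noise_energy X u = (\<integral>z. avg N (%i. (norm (own_noise d N (%i. X i (snd z) (fst z)) (%i. u i (snd z) (fst z)) i))\<^sup>2) \<partial>horizon M T)"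

context
 fixes u :: "nat => real => 'w => real^'m" and X :: "nat => real => 'w => real^'n"
 assumes adm: "admissible M Fl T N u" and st: "state_system d M Fl W T N \<xi> u X"
begin

lemma noise_integrable:
 "integrable (horizon M T) (%z. avg N (%i. (norm (own_noise d N (%i. X i (snd z) (fst z)) (%i. u i (snd z) (fst z)) i))\<^sup>2))"
proof (rule integral_avg(1))
 fix i assume i: "i : {1..N}"
 have "L2_proc M T (%s w. own_noise d N (%i. X i s w) (%i. u i s w) i)"
  unfolding own_noise_def
  by (intro L2_proc_add L2_proc_matrix L2_proc_const state[OF adm st] control[OF adm st] i mean_state[OF adm st])
 from L2_fun_integrable[OF this[unfolded L2_proc_def]]
 show "integrable (horizon M T) (%z. (norm (own_noise d N (%i. X i (snd z) (fst z)) (%i. u i (snd z) (fst z)) i))\<^sup>2)"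
  by (simp add: case_prod_beta')
qed

lemma noise_energy_le:
 assumes "!!x v. avg N (%i. (norm (own_noise d N x v i))\<^sup>2) <= C1 * (avg N (%i. running_cost d (x i) (avg N x) (v i)) + C2)"
 shows "0 <= noise_energy X u" "noise_energy X u <= C1 * (social_cost d M T N X u + T * C2)"
proof -
 interpret H: finite_measure "horizon M T" by (rule finite_measure_horizon)
 show "0 <= noise_energy X u"
  unfolding noise_energy_def by (rule Bochner_Integration.integral_nonneg) (simp add: avg_def sum_nonneg)
 have rc: "integrable (horizon M T) (%z. avg N (%i. running_cost d (X i (snd z) (fst z)) (avg N (%i. X i (snd z) (fst z))) (u i (snd z) (fst z))))"
  by (rule integral_avg(1)[OF running_cost_integrable[OF adm st]])
 have "noise_energy X u <= (\<integral>z. C1 * (avg N (%i. running_cost d (X i (snd z) (fst z)) (avg N (%i. X i (snd z) (fst z))) (u i (snd z) (fst z))) + C2) \<partial>horizon M T)"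
  unfolding noise_energy_def
  by (intro integral_mono noise_integrable assms integrable_mult_right Bochner_Integration.integrable_add rc H.integrable_const)
 also have "... = C1 * (social_cost d M T N X u + T * C2)"
  unfolding social_cost_horizon[OF adm st] integral_mult_right_zero Bochner_Integration.integral_add[OF rc H.integrable_const] measure_horizon ..
 finally show "noise_energy X u <= C1 * (social_cost d M T N X u + T * C2)" .
qed

text \<open>The square of the gap is nonnegative for every control and zero for the feedback, which
  gives one inequality each. What separates the cost from the common value is the 1/N term, bounded
  by the noise energy because L - P has norm at most 2 K.\<close>

lemma social_cost_bounds:
 assumes k: "!!(A :: real^'n^'n) y. norm (A *v y) <= norm A * norm y * k" "0 <= k"
  and K: "!!t. t : {0..T} ==> norm (P t) <= K \<and> norm (L t) <= K"
 shows "initial_value + offset_integral - 2 * K * k / real N * noise_energy X u <= social_cost d M T N X u"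
  and "u = mean_field_feedback d N P L p X ==>
   social_cost d M T N X u <= initial_value + offset_integral + 2 * K * k / real N * noise_energy X u"
proof -
 let ?x = "%z. (%i. X i (snd z) (fst z))" and ?v = "%z. (%i. u i (snd z) (fst z))"
 let ?w = "%z. feedback_gap d N (P (snd z)) (L (snd z)) (p (snd z)) (?x z) (?v z)"
 let ?h = "%z. own_noise d N (?x z) (?v z)"
 let ?o = "%z. running_offset d (P (snd z)) (L (snd z)) (p (snd z))" and ?e = "%z. avg N (%i. (norm (?h z i))\<^sup>2)"
 let ?n = "%z. (1 / real N) * avg N (%i. ?h z i \<bullet> ((L (snd z) - P (snd z)) *v ?h z i))"
 note F = cost_formula[OF adm st]
 have o: "integrable (horizon M T) ?o" by (rule integrable_horizon_time[OF bar.continuous_running_offset[OF RC RD(4)]])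
 have e: "integrable (horizon M T) (%z. 2 * K * k / real N * ?e z)" by (rule integrable_mult_right[OF noise_integrable])
 have ie: "(\<integral>z. 2 * K * k / real N * ?e z \<partial>horizon M T) = 2 * K * k / real N * noise_energy X u" unfolding noise_energy_def by simp
 have n: "\<bar>?n z\<bar> <= 2 * K * k / real N * ?e z" if z: "z : space (horizon M T)" for z
 proof -
  have K2: "norm (L (snd z) - P (snd z)) <= 2 * K"
   using norm_triangle_ineq4[of "L (snd z)" "P (snd z)"] K[OF space_horizonD[OF z]] by linarith
  have b: "\<bar>?h z i \<bullet> ((L (snd z) - P (snd z)) *v ?h z i)\<bar> <= 2 * K * k * (norm (?h z i))^2" for i
   using abs_inner_matrix_le[OF k K2, of "?h z i" "?h z i"] by simp
  have "avg N (%i. ?h z i \<bullet> ((L (snd z) - P (snd z)) *v ?h z i)) <= avg N (%i. 2 * K * k * (norm (?h z i))^2)"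
   by (rule avg_mono) (use b in \<open>auto simp: abs_le_iff\<close>)
  moreover have "avg N (%i. - (2 * K * k) * (norm (?h z i))^2) <= avg N (%i. ?h z i \<bullet> ((L (snd z) - P (snd z)) *v ?h z i))"
   by (rule avg_mono) (use b in \<open>auto simp: abs_le_iff algebra_simps\<close>)
  ultimately have "\<bar>avg N (%i. ?h z i \<bullet> ((L (snd z) - P (snd z)) *v ?h z i))\<bar> <= 2 * K * k * ?e z"
   unfolding avg_mult by (simp add: abs_le_iff)
  then have "(1 / real N) * \<bar>avg N (%i. ?h z i \<bullet> ((L (snd z) - P (snd z)) *v ?h z i))\<bar> <= (1 / real N) * (2 * K * k * ?e z)"
   by (intro mult_left_mono) auto
  then show ?thesis by (simp add: abs_mult)
 qed
 have "initial_value + offset_integral - 2 * K * k / real N * noise_energy X u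
   = initial_value + (\<integral>z. ?o z - 2 * K * k / real N * ?e z \<partial>horizon M T)"
  unfolding offset_integral_def Bochner_Integration.integral_diff[OF o e] ie by simp
 also have "... <= social_cost d M T N X u"
  unfolding F(2)
 proof (intro add_left_mono integral_mono F(1) Bochner_Integration.integrable_diff o e)
  fix z assume z: "z : space (horizon M T)"
  have "avg N (%_. 0) <= avg N (%i. ?w z i \<bullet> (opR d (P (snd z)) *v ?w z i))"
   by (intro avg_mono order_trans[OF _ bar.opR_coercive[OF RD(4)[OF space_horizonD[OF z]]]]) (simp add: less_imp_le[OF bar.cR(1)])
  then show "?o z - 2 * K * k / real N * ?e z <= avg N (%i. ?w z i \<bullet> (opR d (P (snd z)) *v ?w z i)) + ?o z + ?n z"
   using n[OF z] by (simp only: avg_const[OF N] abs_le_iff) linarith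
 qed
 finally show "initial_value + offset_integral - 2 * K * k / real N * noise_energy X u <= social_cost d M T N X u" .
 assume u: "u = mean_field_feedback d N P L p X"
 have "social_cost d M T N X u <= initial_value + (\<integral>z. ?o z + 2 * K * k / real N * ?e z \<partial>horizon M T)"
  unfolding F(2)
 proof (intro add_left_mono integral_mono F(1) Bochner_Integration.integrable_add o e)
  fix z assume z: "z : space (horizon M T)"
  have "?w z i = 0" for i by (simp add: feedback_gap_def u mean_field_feedback_def agent_mean_avg)
  then have "avg N (%i. ?w z i \<bullet> (opR d (P (snd z)) *v ?w z i)) = 0" by (simp add: avg_def)
  then show "avg N (%i. ?w z i \<bullet> (opR d (P (snd z)) *v ?w z i)) + ?o z + ?n z <= ?o z + 2 * K * k / real N * ?e z"
   using n[OF z] by (simp only: abs_le_iff) linarith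
 qed
 also have "... = initial_value + offset_integral + 2 * K * k / real N * noise_energy X u"
  unfolding offset_integral_def Bochner_Integration.integral_add[OF o e] ie by simp
 finally show "social_cost d M T N X u <= initial_value + offset_integral + 2 * K * k / real N * noise_energy X u" .
qed

end

end

theorem proposition7p5:
  fixes d :: "('n::finite, 'm::finite) lq_data"
    and \<mu>\<^sub>0 :: "(real^'n) measure"
  assumes "symmetric_matrix (mQ d)" and "symmetric_matrix (mQbar d)"
    and "pd_matrix (mR d)"
    and "pd_matrix (mQ d - transpose (mS d) ** matrix_inv (mR d) ** mS d)"
    and "pd_matrix (mQ d + mQbar d - transpose (mS d) ** matrix_inv (mR d) ** mS d)"
    and "L2_stabilizable_common TYPE('w) (mA d + mAbar d) (mG d + mGbar d) (mB d)"
    and "L2_stabilizable TYPE('w) (mA d) (mC d) (mG d) (mB d) (mD d)"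
    and "prob_space \<mu>\<^sub>0" and "sets \<mu>\<^sub>0 = sets borel"
    and "(\<integral>\<^sup>+x. ennreal ((norm x) ^ 4) \<partial>\<mu>\<^sub>0) < \<infinity>"
  shows "\<exists>(Nstar::nat) (K::real). 0 < Nstar \<and> 0 < K \<and>
    (\<forall>T>0. \<forall>N>Nstar.
      \<forall>(M :: 'w measure) F0 W \<xi> P \<Pi>b p u X Xt ut.
        agent_setup M F0 W N \<mu>\<^sub>0 \<xi> \<longrightarrow>
        riccati_system d T P \<Pi>b p \<longrightarrow>
        optimal_control d M (agent_filtration M F0 W N) W T N \<xi> u \<longrightarrow>
        state_system d M (agent_filtration M F0 W N) W T N \<xi> u X \<longrightarrow>
        ut = mean_field_feedback d N P \<Pi>b p Xt \<longrightarrow>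
        state_system d M (agent_filtration M F0 W N) W T N \<xi> ut Xt \<longrightarrow>
        \<bar>(1 / real N) * (\<Sum>i=1..N. agent_cost d M T N X u i)
          - (1 / real N) * (\<Sum>i=1..N. agent_cost d M T N Xt ut i)\<bar> \<le> K * T / real N)"
\<comment> \<open>The constants must be fixed before the probability space is given, whereas
  stabilizability is a statement about processes on spaces over the type \<open>'w\<close>. If no
  agent setup exists over this type, the claim is vacuous; otherwise any one of them supplies the
  Brownian motions from which the bounds are computed.\<close>
proof (cases "\<exists>N\<ge>1. \<exists>(M :: 'w measure) F0 W \<xi>. agent_setup M F0 W N \<mu>\<^sub>0 \<xi>")
 case False
 then show ?thesis by (intro exI[of _ 1]) auto
next
 case True
 then obtain N0 and M0 :: "'w measure" and F0' W0 where basis: "1 <= N0" "brownian_basis M0 F0' W0 {0..N0}"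
  unfolding agent_setup_def by blast
 have "mean_field_lq d"
  unfolding mean_field_lq_def lq_def using assms(1-5) by (simp add: symmetric_matrix_def transpose_add)
 then interpret mean_field_lq d .
 obtain K where K: "0 < K"
  "!!T P L p t. riccati_system d T P L p ==> t : {0..T} ==>
   norm (P t) <= K \<and> norm (L t) <= K \<and> \<bar>running_offset d (P t) (L t) (p t)\<bar> <= K"
  "!!T P L p. riccati_system d T P L p ==> 0 <= T ==> norm (P 0) <= K * T \<and> norm (L 0) <= K * T \<and> norm (p 0) <= K * T"
  by (rule riccati_uniform_bound[OF basis(2,1) assms(6,7)]) (rule that; blast)
 obtain C1 C2 where C: "0 < C1" "0 <= C2"
  "!!N x v. 0 < N ==> avg N (%i. (norm (own_noise d N x v i))\<^sup>2) <= C1 * (avg N (%i. running_cost d (x i) (avg N x) (v i)) + C2)"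
  by (rule own_noise_le_cost) (rule that; blast)
 obtain k where k: "!!(A :: real^'n^'n) y. norm (A *v y) <= norm A * norm y * k" "0 <= k"
  using bounded_bilinear.nonneg_bounded[OF bounded_bilinear_matrix_vector] by metis
 interpret \<mu>: prob_space \<mu>\<^sub>0 by fact
 define m where "m = (\<integral>x. (norm x)\<^sup>2 \<partial>\<mu>\<^sub>0)"
 have m: "0 <= m" unfolding m_def by (rule Bochner_Integration.integral_nonneg) simp
 have L2: "L2_fun \<mu>\<^sub>0 (%x. x)"
 proof -
  have "(\<integral>\<^sup>+x. ennreal ((norm x)^2) \<partial>\<mu>\<^sub>0) <= (\<integral>\<^sup>+x. 1 + ennreal ((norm x) ^ 4) \<partial>\<mu>\<^sub>0)"
  proof (rule nn_integral_mono)
   fix x :: "real^'n"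
   have "((norm x)^2)^2 = (norm x) ^ 4" by (simp flip: power_mult)
   moreover have "2 * 1 * (norm x)^2 <= 1\<^sup>2 + ((norm x)^2)^2" by (rule sum_squares_bound)
   ultimately have "(norm x)^2 <= 1 + (norm x) ^ 4" using zero_le_power2[of "norm x"] by (simp only: power_one)
   then have "ennreal ((norm x)^2) <= ennreal (1 + (norm x) ^ 4)" by (rule ennreal_leI)
   also have "... = 1 + ennreal ((norm x) ^ 4)" by (subst ennreal_plus) auto
   finally show "ennreal ((norm x)^2) <= 1 + ennreal ((norm x) ^ 4)" .
  qed
  also have "... = 1 + (\<integral>\<^sup>+x. ennreal ((norm x) ^ 4) \<partial>\<mu>\<^sub>0)"
   by (subst nn_integral_add) (auto simp: \<mu>.emeasure_space_1 cong: measurable_cong_sets[OF assms(9) refl])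
  also have "... < \<infinity>" using assms(10) by (simp add: less_top)
  finally show ?thesis unfolding L2_fun_iff by (simp add: measurable_cong_sets[OF assms(9) refl])
 qed
 \<comment> \<open>D / N is the weight with which the shifted cost bounds the noise terms: 2 K k
   from the norm of L - P, and C1 from coercivity. B * T collects the bounds on the initial value
   and on the offset integral, and the shift T * C2.\<close>
 define D B where "D = 2 * K * k * C1" and "B = K * (3 * k * m + 2 + 2 * m) + K + C2"
 have D: "0 <= D" using K(1) k(2) C(1) by (simp add: D_def)
 have B: "0 < B" unfolding B_def
  by (rule add_pos_nonneg[OF add_nonneg_pos[OF _ K(1)] C(2)]) (use K(1) k(2) m in simp)
 show ?thesis
 \<comment> \<open>The threshold ensures D / N \<le> 1 / 2; the summand 1 keeps the final constant
   positive when D is 0.\<close>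
 proof (rule exI[of _ "Suc (nat \<lceil>2 * D\<rceil>)"], rule exI[of _ "4 * D * B + 1"], intro conjI allI impI)
  show "0 < 4 * D * B + 1" using D B by (intro add_nonneg_pos) auto
  fix T :: real and N :: nat and M :: "'w measure" and F0 W \<xi> P L p u X Xt ut
  assume T: "0 < T" and N: "Suc (nat \<lceil>2 * D\<rceil>) < N" and S: "agent_setup M F0 W N \<mu>\<^sub>0 \<xi>" and R: "riccati_system d T P L p"
   and opt: "optimal_control d M (agent_filtration M F0 W N) W T N \<xi> u"
   and X: "state_system d M (agent_filtration M F0 W N) W T N \<xi> u X"
   and ut: "ut = mean_field_feedback d N P L p Xt" and Xt: "state_system d M (agent_filtration M F0 W N) W T N \<xi> ut Xt"
  have N0: "0 < N" and DN: "D / real N <= 1 / 2"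
  proof -
   have "2 * D <= real (nat \<lceil>2 * D\<rceil>)" by linarith
   also have "... <= real N" by (intro of_nat_mono) (use N in linarith)
   finally show "D / real N <= 1 / 2" using N by (simp add: field_simps)
  qed (use N in simp)
  interpret BS: brownian_space M F0 W "{0..N}"
   using S by (intro brownian_space.intro) (auto simp: agent_setup_def)
  have F0: "subalgebra M F0" using BS.basis by (simp add: brownian_basis_def)
  have xi: "\<xi> i : borel_measurable F0" "distr M borel (\<xi> i) = \<mu>\<^sub>0" if "i : {1..N}" for i
   using S that unfolding agent_setup_def by blast+
  note xi = xi measurable_from_subalg[OF F0 xi(1)]
  have xL2: "L2_fun M (\<xi> i)" "BS.expectation (%w. (norm (\<xi> i w))\<^sup>2) = m" if i: "i : {1..N}" for i
  proof -
   have "integrable (distr M borel (\<xi> i)) (%x. (norm x)\<^sup>2)" using L2_fun_integrable[OF L2] xi(2)[OF i] by simp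
   then show "L2_fun M (\<xi> i)" using xi(3)[OF i] by (simp add: L2_fun_def integrable_distr_eq)
   have "integral\<^sup>L (distr M borel (\<xi> i)) (%x. (norm x)\<^sup>2) = BS.expectation (%w. (norm (\<xi> i w))\<^sup>2)"
    using xi(3)[OF i] by (intro integral_distr) auto
   then show "BS.expectation (%w. (norm (\<xi> i w))\<^sup>2) = m" using xi(2)[OF i] by (simp add: m_def)
  qed
  interpret AS: agent_system d M F0 W N T P L p \<xi>
   by unfold_locales (use N0 T R xi(1) xL2(1) in auto)
  have adm: "admissible M (agent_filtration M F0 W N) T N u" using opt by (simp add: optimal_control_def)
  have admt: "admissible M (agent_filtration M F0 W N) T N ut" using AS.feedback_admissible Xt unfolding ut by blast
  let ?J = "social_cost d M T N X u" and ?Jt = "social_cost d M T N Xt ut"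
   and ?e = "AS.noise_energy X u" and ?et = "AS.noise_energy Xt ut"
  have JJ: "?J <= ?Jt" using opt X admt Xt by (simp add: optimal_control_def)
  have PL: "norm (P t) <= K \<and> norm (L t) <= K" if "t : {0..T}" for t using K(2)[OF R that] by blast
  have lower: "AS.initial_value + AS.offset_integral - 2 * K * k / real N * ?e <= ?J"
   by (rule AS.social_cost_bounds(1)[OF adm X k PL])
  have upper: "?Jt <= AS.initial_value + AS.offset_integral + 2 * K * k / real N * ?et"
   by (rule AS.social_cost_bounds(2)[OF admt Xt k PL ut])
  note e = AS.noise_energy_le[OF adm X C(3)[OF N0]] and et = AS.noise_energy_le[OF admt Xt C(3)[OF N0]]
  have iv: "\<bar>AS.initial_value\<bar> <= K * T * (3 * k * m + 2 + 2 * m)"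
   by (rule AS.initial_value_le[OF k]) (use K(3)[OF R] T xL2(2) in auto)
  have ov: "\<bar>AS.offset_integral\<bar> <= T * K"
  proof -
   interpret H: finite_measure "horizon M T" by (rule BS.finite_measure_horizon)
   have i: "integrable (horizon M T) (%z. running_offset d (P (snd z)) (L (snd z)) (p (snd z)))"
    by (rule AS.integrable_horizon_time[OF bar.continuous_running_offset[OF AS.RC AS.RD(4)]])
   have "\<bar>AS.offset_integral\<bar> <= (\<integral>z. \<bar>running_offset d (P (snd z)) (L (snd z)) (p (snd z))\<bar> \<partial>horizon M T)"
    unfolding AS.offset_integral_def by (rule integral_abs_bound)
   also have "... <= (\<integral>z. K \<partial>horizon M T)"
    by (intro integral_mono integrable_abs i H.integrable_const) (use K(2)[OF R AS.space_horizonD] in blast)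
   finally show ?thesis by (simp only: AS.measure_horizon)
  qed
  \<comment> \<open>The cost of the feedback, shifted so that C1 * Y dominates its noise energy and
    is thus nonnegative. By optimality the same multiple dominates the noise energy of the optimal
    control.\<close>
  define Y where "Y = ?Jt + T * C2"
  have g: "2 * K * k / real N * x <= D / real N * Y" "0 <= 2 * K * k / real N * x" if "0 <= x" "x <= C1 * Y" for x
  proof -
   have "2 * K * k / real N * x <= 2 * K * k / real N * (C1 * Y)" using K(1) k(2) that by (intro mult_left_mono) auto
   then show "2 * K * k / real N * x <= D / real N * Y" by (simp add: D_def mult_ac)
   show "0 <= 2 * K * k / real N * x" using K(1) k(2) that by simp
  qed
  have ety: "?et <= C1 * Y" using et(2) by (simp add: Y_def)
  have ey: "?e <= C1 * Y" by (rule order_trans[OF e(2)]) (use JJ C(1) in \<open>simp add: Y_def\<close>)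
  have Y0: "0 <= Y" using order_trans[OF et(1) ety] C(1) by (simp add: zero_le_mult_iff)
  have "D / real N * Y <= 1 / 2 * Y" by (rule mult_right_mono[OF DN Y0])
  moreover have "B * T = K * T * (3 * k * m + 2 + 2 * m) + T * K + T * C2" by (simp add: B_def algebra_simps)
  \<comment> \<open>Absorption: Y \<le> B T + (D / N) Y \<le> B T + Y / 2.\<close>
  ultimately have Y: "Y <= 2 * (B * T)"
   using upper g(1)[OF et(1) ety] abs_le_D1[OF iv] abs_le_D1[OF ov] Y_def by linarith
  have "?Jt - ?J <= 2 * (D / real N * Y)" using upper lower g(1)[OF et(1) ety] g(1)[OF e(1) ey] by linarith
  also have "... <= 2 * (D / real N * (2 * (B * T)))" using D by (intro mult_left_mono Y) auto
  also have "... <= (4 * D * B + 1) * T / real N" using T N0 by (simp add: field_simps)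
  finally show "\<bar>(1 / real N) * (\<Sum>i=1..N. agent_cost d M T N X u i)
    - (1 / real N) * (\<Sum>i=1..N. agent_cost d M T N Xt ut i)\<bar> <= (4 * D * B + 1) * T / real N"
   using JJ by (simp only: social_cost_def[symmetric])
 qed simp
qed

end
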